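(* Let $n\geq 3$ be an integer, $k\in\{1,\ldots,n\}$, and let $\alpha\geq n-3$ be real. Then $$ \mathbf J_{n,k}\Big(\frac{\alpha-n+1}{2}\Big)=\binom nk\int_{-\pi/2}^{\pi/2} c_{\frac{\alpha n}{2}}(\cos x)^{\alpha n+1}\Big(\frac12+ i\int_0^x c_{\frac{\alpha-1}{2}}(\cos y)^{-\alpha-1}\,dy\Big)^{n-k}dx . $$
   Context: For $d\in\mathbb N$ and $\beta>-1$ the $d$-dimensional beta distribution has Lebesgue density $f_{d,\beta}(x)=c_{d,\beta}(1-\|x\|^2)^\beta\mathbf 1_{\{\|x\|<1\}}$, $x\in\mathbb R^d$, with $c_{d,\beta}=\Gamma(\frac d2+\beta+1)/(\pi^{d/2}\Gamma(\beta+1))$; for $\beta=-1$ it is understood as the uniform distribution on the unit sphere $\mathbb S^{d-1}$. Write $c_\beta:=c_{1,\beta}=\Gamma(\beta+\frac32)/(\sqrt\pi\,\Gamma(\beta+1))$. For a $d$-dimensional simplex $T\subset\mathbb R^d$ and a face $F$ of $T$, the internal angle is $\beta(F,T)=\lim_{r\downarrow0}\mathrm{Vol}_d(B_r(z)\cap T)/\mathrm{Vol}_d(B_r(z))$, where $z$ is any point of the relative interior of $F$ (so the full angle equals $1$). For $n\ge 2$, $\beta\geq-1$, let $X_1,\ldots,X_n$ be i.i.d. in $\mathbb R^{n-1}$ with distribution $f_{n-1,\beta}$ and set $J_{n,k}(\beta)=\mathbb E\,\beta([X_1,\ldots,X_k],[X_1,\ldots,X_n])$ and $\mathbf J_{n,k}(\beta)=\binom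 nk J_{n,k}(\beta)$ for $k\in\{1,\ldots,n\}$ (the expected sum of internal angles at all $k$-vertex faces of the beta simplex). Here $i=\sqrt{-1}$. *)

theory Defs
  imports "HOL-Analysis.Analysis"
begin

definition beta_const :: "real \<Rightarrow> real \<Rightarrow> real" where
  "beta_const d \<beta> = Gamma (d / 2 + \<beta> + 1) / (pi powr (d / 2) * Gamma (\<beta> + 1))"

text \<open>Beta distribution on the space real^'d (dimension CARD('d)).
  For beta > -1: density c_{d,beta} (1 - |x|^2)^beta on the open unit ball.
  For beta = -1: uniform distribution on the unit sphere, realised as the
  image of the uniform distribution on the unit ball under x |-> x/|x|
  (this is the normalised surface measure on the sphere).\<close>
definition beta_distr :: "real \<Rightarrow> (real ^ ('d::finite)) measure" where
  "beta_distr \<beta> =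
    (if \<beta> > -1 then
       density lborel (\<lambda>x. ennreal (beta_const (real CARD('d)) \<beta>
                               * (1 - (norm x)\<^sup>2) powr \<beta> * indicator (ball 0 1) x))
     else distr (uniform_measure lborel (ball 0 1)) borel (\<lambda>x. x /\<^sub>R norm x))"

definition internal_angle :: "'a::euclidean_space set \<Rightarrow> 'a set \<Rightarrow> real" where
  "internal_angle F T =
    (let z = (SOME z. z \<in> rel_interior F) in
     Lim (at_right 0) (\<lambda>r. measure lebesgue (ball z r \<inter> T) / measure lebesgue (ball z r)))"

text \<open>bold J_{n,k}(beta) = (n choose k) * E beta([X_1..X_k],[X_1..X_n]) with
  X_1,...,X_n i.i.d. beta-distributed in real^'d (intended: CARD('d) = n - 1).
  Points are indexed 0..n-1.\<close>
definition bold_J :: "('d::finite) itself \<Rightarrow> nat \<Rightarrow> nat \<Rightarrow> real \<Rightarrow> real" where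
  "bold_J _ n k \<beta> = real (n choose k) *
     (\<integral>X. internal_angle (convex hull (X ` {..<k})) (convex hull (X ` {..<n}))
        \<partial>(PiM {..<n} (\<lambda>_. (beta_distr \<beta> :: (real ^ 'd) measure))))"

end

(* The expected angle is the probability that a fixed direction lies in the tangent cone of the
   random simplex at the face. Projecting the points to lower-dimensional coordinate subspaces turns
   this probability into a parametric linear program: its optimal bases correspond to lower facets,
   and counting them telescopes to  sum_m binom(N-k,m-k) I(N,m) J(m) = 1  for all k <= N <= n.  Here
   J(m) is the expected angle for m points and I(N,m) the probability that N-m further points lie
   above the hyperplane through m points; given the height of that hyperplane, the shape of the
   m points is independent of it, which gives the product form and a one-dimensional integral for
   I(N,m).  The right-hand side satisfies the same triangular system: the double integral that
   expresses this has a divergence as integrand, and the boundary terms over rectangles exhausting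
   the square, cut along the singular line x = 0, vanish in the limit. *)
theory Submission
 imports Defs "HOL-Probability.Probability"
begin

text \<open>Each linear program leaves two terms, feasibility in \<open>M\<close> columns and
  unboundedness of the cost column. They telescope because a ray of cost -1 means that minus the
  last unit vector of \<open>M + 1\<close> columns lies in the cone, and reflecting that coordinate,
  a symmetry of the law, removes the sign. Only laws of at most \<open>n - 2\<close> coordinates
  enter the height computation: for \<alpha> = n - 3 the points lie on a sphere and have no density
  in full dimension. The one remaining term, a single point against a facet, is 1/2 by symmetry. The
  field comes from the operator L = d/dt + i cos x d/dx. It maps \<open>pp\<close>,
  \<open>WW\<close> and \<open>DD\<close> itself to multiples of \<open>DD\<close>. With h a power
  of \<open>pp\<close> and V = WW^N - 1, the quotient L(hV) / DD is therefore free of singularities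
  and expands into the wanted products, and the equation for \<open>DD\<close> is exactly what makes
  this quotient a divergence. The 1 subtracted in V balances the zero of \<open>DD\<close> at the
  origin, where \<open>WW\<close> is 1, and is also the source of the right-hand side 1 of the
  system.\<close>

abbreviation (input) cr :: "real => complex" where "cr \<equiv> complex_of_real"

section \<open>Linear programs with generic rows and their optimal bases\<close>

text \<open>Rows with index below \<open>k\<close> stand for the vertices of the face: their weights
  are unrestricted. Cutting the matrix to its leading \<open>M\<close> columns corresponds to
  projecting the points to leading coordinates.\<close>

definition feas :: "nat set => nat => nat => (nat => nat => real) => (nat => real) => bool" where
 "feas I k M A w \<longleftrightarrow>
  (\<exists>l. (\<forall>i\<in>I. k \<le> i \<longrightarrow> 0 \<le> l i) \<and> (\<forall>j<M. (\<Sum>i\<in>I. l i * A i j) = w j))"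

text \<open>Column \<open>M\<close> is read as a height over the columns before it. When column 0 is
  constant, the linear function with coefficients \<open>b\<close> is affine in the point, and its
  graph is a hyperplane with all other points strictly above it.\<close>

definition lower_facet :: "nat set => nat set => nat => (nat => nat => real) => bool" where
 "lower_facet I G M A \<longleftrightarrow>
  (\<exists>b. (\<forall>i\<in>G. A i M = (\<Sum>j<M. b j * A i j)) \<and> (\<forall>i\<in>I - G. A i M > (\<Sum>j<M. b j * A i j)))"

definition indep_rows :: "nat set => nat => (nat => nat => real) => bool" where
 "indep_rows S M A \<longleftrightarrow>
  (\<forall>l. (\<forall>j<M. (\<Sum>i\<in>S. l i * A i j) = 0) \<longrightarrow> (\<forall>i\<in>S. l i = 0))"

text \<open>Nonvanishing of all square minors formed by leading columns, expressed without
  determinants.\<close>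

definition generic :: "nat => (nat => nat => real) => bool" where
 "generic n A \<longleftrightarrow> (\<forall>S. S \<subseteq> {..<n} \<longrightarrow> indep_rows S (card S) A)"

text \<open>The target of the program: the last axis. Its other entries vanish, and this is what
  makes basic solutions nondegenerate.\<close>

definition last_unit :: "nat => nat => real" where
 "last_unit M j = (if Suc j = M then 1 else 0)"

lemma sum_mult_swap:
 fixes l :: "'a => real"
 shows "(\<Sum>i\<in>S. l i * (\<Sum>j\<in>T. b j * A i j)) = (\<Sum>j\<in>T. b j * (\<Sum>i\<in>S. l i * A i j))"
 unfolding sum_distrib_left by (subst sum.swap) (simp add: mult.left_commute)

lemma indep_rowsD:
 "indep_rows S M A ==> (\<And>j. j < M ==> (\<Sum>i\<in>S. l i * A i j) = 0) ==> i \<in> S ==> l i = 0"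
 unfolding indep_rows_def by blast

lemma genericD: "generic n A ==> S \<subseteq> {..<n} ==> card S = M ==> indep_rows S M A"
 unfolding generic_def by blast

lemma generic_indep_mono:
 assumes "generic n A" "S \<subseteq> {..<n}" "card S \<le> M"
 shows "indep_rows S M A"
 using assms(3) genericD[OF assms(1,2) refl] unfolding indep_rows_def by (meson order_less_le_trans)

lemma generic_mono: "generic n A ==> m \<le> n ==> generic m A"
 unfolding generic_def by (meson lessThan_subset_iff order_trans)

text \<open>Bordering: a solution for the smaller square block is corrected by a multiple of the new
  row minus its representation \<open>q\<close> by the old rows. The pivot \<open>s\<close> is a
  Schur complement and nonzero by genericity.\<close>

lemma generic_rows_solve:
 assumes "generic n A" "S \<subseteq> {..<n}"
 shows "\<exists>l. \<forall>j<card S. (\<Sum>i\<in>S. l i * A i j) = w j"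
 using finite_subset[OF assms(2) finite_lessThan] assms(2)
proof (induction S arbitrary: w rule: finite_induct)
 case (insert g S)
 obtain l where l: "\<And>j. j < card S ==> (\<Sum>i\<in>S. l i * A i j) = w j"
  using insert.IH[of w] insert.prems by auto
 obtain q where q: "\<And>j. j < card S ==> (\<Sum>i\<in>S. q i * A i j) = A g j"
  using insert.IH[of "A g"] insert.prems by auto
 define s where "s = A g (card S) - (\<Sum>i\<in>S. q i * A i (card S))"
 have ins: "(\<Sum>i\<in>insert g S. f i) = f g + (\<Sum>i\<in>S. f i)" for f :: "nat => real"
  using insert.hyps by simp
 have cong: "(\<Sum>i\<in>S. (if i = g then c else f i) * h i) = (\<Sum>i\<in>S. f i * h i)"
  for c :: real and f h :: "nat => real"
  using insert.hyps by (intro sum.cong) auto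
 have "s \<noteq> 0"
 proof
  assume s0: "s = 0"
  define m where "m i = (if i = g then 1 else - q i)" for i
  have "(\<Sum>i\<in>insert g S. m i * A i j) = 0" if "j < card (insert g S)" for j
  proof (cases "j < card S")
   case True
   then show ?thesis using q[of j] unfolding ins m_def cong by (simp add: sum_negf)
  next
   case False
   then have "j = card S" using that insert.hyps by auto
   then show ?thesis using s0 unfolding ins m_def cong s_def by (simp add: sum_negf)
  qed
  from indep_rowsD[OF genericD[OF assms(1) insert.prems refl] this, of g]
  show False by (simp add: m_def)
 qed
 define r where "r = w (card S) - (\<Sum>i\<in>S. l i * A i (card S))"
 define m where "m i = (if i = g then r / s else l i - r / s * q i)" for i
 have "(\<Sum>i\<in>insert g S. m i * A i j) = w j" if "j < card (insert g S)" for j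
 proof -
  have *: "(\<Sum>i\<in>insert g S. m i * A i j)
   = (\<Sum>i\<in>S. l i * A i j) + r / s * (A g j - (\<Sum>i\<in>S. q i * A i j))"
   unfolding ins m_def cong
   by (simp add: algebra_simps sum.distrib sum_distrib_left sum_subtractf)
  show ?thesis
  proof (cases "j < card S")
   case True
   then show ?thesis unfolding * using l q by simp
  next
   case False
   then have "j = card S" using that insert.hyps by auto
   then show ?thesis unfolding * using \<open>s \<noteq> 0\<close> by (simp add: s_def[symmetric] r_def)
  qed
 qed
 then show ?case by blast
qed auto

text \<open>The same bordering for the transposed system: \<open>c\<close> writes the new column
  through the old ones on \<open>S\<close>, and the pivot is what remains of it on the new
  row.\<close>

lemma generic_cols_solve:
 assumes "generic n A" "S \<subseteq> {..<n}"
 shows "\<exists>b. \<forall>i\<in>S. (\<Sum>j<card S. b j * A i j) = t i"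
 using finite_subset[OF assms(2) finite_lessThan] assms(2)
proof (induction S arbitrary: t rule: finite_induct)
 case (insert g S)
 have cS: "card (insert g S) = Suc (card S)" using insert.hyps by simp
 obtain b where b: "\<And>i. i \<in> S ==> (\<Sum>j<card S. b j * A i j) = t i"
  using insert.IH[of t] insert.prems by auto
 obtain c where c: "\<And>i. i \<in> S ==> (\<Sum>j<card S. c j * A i j) = A i (card S)"
  using insert.IH[of "\<lambda>i. A i (card S)"] insert.prems by auto
 \<comment> \<open>If the pivot vanished, the row \<open>g\<close> would be the combination
   \<open>q\<close> of the rows of \<open>S\<close> in the new column as well, which contradicts
   genericity.\<close>
 obtain q where q: "\<And>j. j < card S ==> (\<Sum>i\<in>S. q i * A i j) = A g j"
  using generic_rows_solve[OF assms(1), of S "A g"] insert.prems by auto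
 define s where "s = A g (card S) - (\<Sum>j<card S. c j * A g j)"
 have "s \<noteq> 0"
 proof
  assume s0: "s = 0"
  define m where "m i = (if i = g then 1 else - q i)" for i
  have ins: "(\<Sum>i\<in>insert g S. m i * A i j) = A g j - (\<Sum>i\<in>S. q i * A i j)" for j
  proof -
   have "(\<Sum>i\<in>S. m i * A i j) = (\<Sum>i\<in>S. - q i * A i j)"
    using insert.hyps by (intro sum.cong) (auto simp: m_def)
   then show ?thesis using insert.hyps by (simp add: m_def sum_negf)
  qed
  have "(\<Sum>i\<in>insert g S. m i * A i j) = 0" if "j < card (insert g S)" for j
  proof (cases "j < card S")
   case True
   then show ?thesis using q[of j] unfolding ins by simp
  next
   case False
   then have j: "j = card S" using that insert.hyps by auto
   have "(\<Sum>i\<in>S. q i * A i j) = (\<Sum>i\<in>S. q i * (\<Sum>j<card S. c j * A i j))"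
    unfolding j using c by (intro sum.cong) auto
   also have "\<dots> = (\<Sum>j<card S. c j * A g j)"
    by (subst sum_mult_swap) (simp add: q)
   finally show ?thesis using s0 unfolding ins by (simp add: s_def j)
  qed
  from indep_rowsD[OF genericD[OF assms(1) insert.prems refl] this, of g]
  show False by (simp add: m_def)
 qed
 define r where "r = t g - (\<Sum>j<card S. b j * A g j)"
 define d where "d j = (if j = card S then r / s else b j - r / s * c j)" for j
 have *: "(\<Sum>j<card (insert g S). d j * A i j)
   = (\<Sum>j<card S. b j * A i j) + r / s * (A i (card S) - (\<Sum>j<card S. c j * A i j))" for i
  unfolding cS by (simp add: d_def algebra_simps sum.distrib sum_distrib_left sum_subtractf)
 have "(\<Sum>j<card (insert g S). d j * A i j) = t i" if "i \<in> insert g S" for i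
 proof (cases "i = g")
  case True
  then show ?thesis unfolding * using \<open>s \<noteq> 0\<close> by (simp add: s_def[symmetric] r_def)
 next
  case False
  then have "i \<in> S" using that by auto
  then show ?thesis unfolding * using b c by simp
 qed
 then show ?case by blast
qed auto

text \<open>Pairing both sides with the row combination \<open>l\<close> that isolates column
  \<open>j\<close> reads off the coefficient.\<close>

lemma generic_cols_unique:
 assumes "generic n A" "S \<subseteq> {..<n}" "\<And>i. i \<in> S ==> (\<Sum>j<card S. b j * A i j) = (\<Sum>j<card S. c j * A i j)"
  and j: "j < card S"
 shows "b j = c j"
proof -
 obtain l where l: "\<And>j'. j' < card S ==> (\<Sum>i\<in>S. l i * A i j') = (if j' = j then 1 else 0)"
  using generic_rows_solve[OF assms(1,2), of "\<lambda>j'. if j' = j then 1 else 0"] by auto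
 have *: "(\<Sum>i\<in>S. l i * (\<Sum>j'<card S. d j' * A i j')) = d j" for d :: "nat => real"
 proof -
  have "(\<Sum>i\<in>S. l i * (\<Sum>j'<card S. d j' * A i j')) = (\<Sum>j'<card S. d j' * (if j' = j then 1 else 0))"
   by (subst sum_mult_swap) (intro sum.cong refl, simp only: l lessThan_iff)
  also have "\<dots> = d j" using j by (simp add: if_distrib cong: if_cong)
  finally show ?thesis .
 qed
 have "(\<Sum>i\<in>S. l i * (\<Sum>j'<card S. b j' * A i j')) = (\<Sum>i\<in>S. l i * (\<Sum>j'<card S. c j' * A i j'))"
  using assms(3) by (intro sum.cong) auto
 then show ?thesis unfolding * .
qed

text \<open>Nondegeneracy. Dropping a row of weight zero leaves \<open>M - 1\<close> rows whose
  combination vanishes in the first \<open>M - 1\<close> columns; genericity kills all weights,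
  against the entry 1 in the last column.\<close>

lemma basic_solution_nonzero:
 assumes "generic n A" "G \<subseteq> {..<n}" "card G = M"
  and sol: "\<And>j. j < M ==> (\<Sum>i\<in>G. l i * A i j) = last_unit M j" and g: "g \<in> G"
 shows "l g \<noteq> 0"
proof
 assume 0: "l g = 0"
 have fin: "finite G" using assms(2) finite_subset by blast
 have M: "card (G - {g}) = M - 1" "0 < M" using g fin assms(3) by (auto simp: card_gt_0_iff)
 have eq: "(\<Sum>i\<in>G. l i * A i j) = (\<Sum>i\<in>G - {g}. l i * A i j)" for j
  using 0 g fin by (simp add: sum.remove)
 have "l i = 0" if "i \<in> G - {g}" for i
 proof (rule indep_rowsD[OF genericD[OF assms(1) _ M(1)] _ that])
  show "(\<Sum>i\<in>G - {g}. l i * A i j) = 0" if "j < M - 1" for j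
   using sol[of j] that unfolding eq by (simp add: last_unit_def)
 qed (use assms(2) in auto)
 then have "(\<Sum>i\<in>G. l i * A i (M - 1)) = 0" unfolding eq by (intro sum.neutral) auto
 then show False using sol[of "M - 1"] M(2) by (simp add: last_unit_def)
qed

lemma feas_mono_set:
 assumes "feas G k M A w" "G \<subseteq> I" "finite I"
 shows "feas I k M A w"
proof -
 obtain l where l: "\<forall>i\<in>G. k \<le> i \<longrightarrow> 0 \<le> l i" "\<forall>j<M. (\<Sum>i\<in>G. l i * A i j) = w j"
  using assms(1) unfolding feas_def by blast
 define l' where "l' i = (if i \<in> G then l i else 0)" for i
 have "(\<Sum>i\<in>I. l' i * A i j) = (\<Sum>i\<in>G. l i * A i j)" for j
  using assms(2,3) unfolding l'_def by (intro sum.mono_neutral_cong_right) auto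
 then show ?thesis using l unfolding feas_def by (intro exI[of _ l']) (auto simp: l'_def)
qed

text \<open>Weak duality together with complementary slackness.\<close>

lemma lower_facet_optimal:
 fixes A :: "nat => nat => real"
 assumes "finite I" "G \<subseteq> I"
  and b: "\<And>i. i \<in> G ==> A i M = (\<Sum>j<M. b j * A i j)"
   "\<And>i. i \<in> I - G ==> A i M > (\<Sum>j<M. b j * A i j)"
  and l: "\<And>i. i \<in> I - G ==> 0 \<le> l i" "\<And>j. j < M ==> (\<Sum>i\<in>I. l i * A i j) = w j"
 shows "(\<Sum>j<M. b j * w j) \<le> (\<Sum>i\<in>I. l i * A i M)"
  and "(\<Sum>i\<in>I. l i * A i M) \<le> (\<Sum>j<M. b j * w j) ==> i \<in> I - G ==> l i = 0"
proof -
 define s where "s i = A i M - (\<Sum>j<M. b j * A i j)" for i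
 have "(\<Sum>i\<in>I. l i * (\<Sum>j<M. b j * A i j)) = (\<Sum>j<M. b j * w j)"
  by (subst sum_mult_swap) (simp add: l(2))
 then have "(\<Sum>i\<in>I. l i * A i M) - (\<Sum>j<M. b j * w j) = (\<Sum>i\<in>I. l i * s i)"
  unfolding s_def by (simp add: right_diff_distrib sum_subtractf)
 also have "\<dots> = (\<Sum>i\<in>I - G. l i * s i)"
  using assms(1) b(1) by (intro sum.mono_neutral_right) (auto simp: s_def)
 finally have eq: "(\<Sum>i\<in>I. l i * A i M) - (\<Sum>j<M. b j * w j) = (\<Sum>i\<in>I - G. l i * s i)" .
 have nn: "0 \<le> l i * s i" if "i \<in> I - G" for i
  using b(2)[OF that] l(1)[OF that] by (simp add: s_def)
 have ge: "0 \<le> (\<Sum>i\<in>I - G. l i * s i)" using nn by (intro sum_nonneg)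
 show "(\<Sum>j<M. b j * w j) \<le> (\<Sum>i\<in>I. l i * A i M)" using eq ge by linarith
 assume "(\<Sum>i\<in>I. l i * A i M) \<le> (\<Sum>j<M. b j * w j)" and i: "i \<in> I - G"
 with eq ge have "(\<Sum>i\<in>I - G. l i * s i) = 0" by linarith
 then have "l i * s i = 0" using sum_nonneg_eq_0_iff[of "I - G" "\<lambda>i. l i * s i"] nn assms(1) i by auto
 then show "l i = 0" using b(2)[OF i] by (auto simp: s_def)
qed

text \<open>Only bases containing the free rows matter: a free weight has no sign constraint that
  could block a pivot, so these rows never have to leave.\<close>

definition bases :: "nat => nat => nat => nat set set" where
 "bases N k M = {G. {..<k} \<subseteq> G \<and> G \<subseteq> {..<N} \<and> card G = M}"

context
 fixes n N k M :: nat and A :: "nat => nat => real"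
 assumes gen: "generic n A" and N: "N \<le> n" and kM: "k \<le> M" and MN: "M < N" and M0: "0 < M"
begin

lemma finite_bases: "finite (bases N k M)"
 by (rule finite_subset[of _ "Pow {..<N}"]) (auto simp: bases_def)

lemma basesD:
 assumes "G \<in> bases N k M"
 shows "{..<k} \<subseteq> G" "G \<subseteq> {..<N}" "card G = M" "finite G" "G \<subseteq> {..<n}"
 using assms N finite_subset[of G "{..<N}"] by (auto simp: bases_def)

lemma basic_solution_pos:
 assumes "G \<in> bases N k M" "\<And>i. i \<in> G ==> k \<le> i ==> 0 \<le> l i"
  "\<And>j. j < M ==> (\<Sum>i\<in>G. l i * A i j) = last_unit M j" "i \<in> G" "k \<le> i"
 shows "0 < l i"
 using basic_solution_nonzero[OF gen basesD(5,3)[OF assms(1)] assms(3) assms(4)] assms(2)[OF assms(4,5)]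
 by simp

text \<open>Caratheodory's argument: among all solutions take one of least support and, if more than
  \<open>M\<close> rows occur, move along a linear dependence until a sign-constrained weight
  reaches zero.\<close>

lemma feasible_basic_exists:
 assumes "feas {..<N} k M A (last_unit M)"
 shows "\<exists>G\<in>bases N k M. feas G k M A (last_unit M)"
proof -
 define P where "P l \<longleftrightarrow> (\<forall>i<N. k \<le> i \<longrightarrow> 0 \<le> l i) \<and> (\<forall>j<M. (\<Sum>i<N. l i * A i j) = last_unit M j)"
  for l :: "nat => real"
 define supp where "supp l = {..<k} \<union> {i. i < N \<and> l i \<noteq> 0}" for l :: "nat => real"
 have fs: "finite (supp l)" "supp l \<subseteq> {..<N}" for l
  using kM MN by (auto simp: supp_def)
 have "\<exists>l. P l" using assms unfolding feas_def P_def by auto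
 then obtain l where l: "P l" "\<And>l'. P l' ==> card (supp l) \<le> card (supp l')"
  using ex_has_least_nat[of P _ "\<lambda>l. card (supp l)"] by blast
 have "card (supp l) \<le> M"
 proof (rule ccontr)
  assume "\<not> card (supp l) \<le> M"
  then obtain S where S: "{..<k} \<subseteq> S" "S \<subseteq> supp l" "card S = M"
   using exists_subset_between[of "{..<k}" M "supp l"] kM fs(1) by (auto simp: supp_def)
  then obtain g where g: "g \<in> supp l" "g \<notin> S"
   using \<open>\<not> card (supp l) \<le> M\<close> by (metis order_refl subset_antisym subsetI)
  have Sn: "S \<subseteq> {..<n}" using S(2) fs(2) N by fastforce
  obtain q where q: "\<And>j. j < M ==> (\<Sum>i\<in>S. q i * A i j) = A g j"
   using generic_rows_solve[OF gen Sn, of "A g"] S(3) by auto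
  have gk: "k \<le> g" "g < N" using g S(1) fs(2) by (auto simp: not_less[symmetric])
  have pos: "0 < l i" if "i \<in> supp l" "k \<le> i" for i
   using that l(1) by (auto simp: supp_def P_def order_less_le)
  have "S \<subseteq> {..<N}" using S fs(2) by blast
  have "finite S" using Sn finite_subset by blast
  \<comment> \<open>A dependence among \<open>g\<close> and the rows of \<open>S\<close>. The entry
    -1 at the constrained row \<open>g\<close> guarantees that some constrained weight
    decreases.\<close>
  define m where "m i = (if i = g then -1 else if i \<in> S then q i else 0)" for i
  have m0: "(\<Sum>i<N. m i * A i j) = 0" if "j < M" for j
  proof -
   have "(\<Sum>i<N. m i * A i j) = (\<Sum>i\<in>insert g S. m i * A i j)"
    using gk \<open>S \<subseteq> {..<N}\<close> by (intro sum.mono_neutral_right) (auto simp: m_def)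
   also have "\<dots> = - A g j + (\<Sum>i\<in>S. m i * A i j)"
    using g(2) \<open>finite S\<close> by (simp add: m_def)
   also have "(\<Sum>i\<in>S. m i * A i j) = (\<Sum>i\<in>S. q i * A i j)"
    using g(2) by (intro sum.cong) (auto simp: m_def)
   finally show ?thesis using q[OF that] by simp
  qed
  define B where "B = {i\<in>supp l. k \<le> i \<and> m i < 0}"
  have "g \<in> B" using g gk by (auto simp: B_def m_def)
  have "finite B" using fs by (auto simp: B_def)
  \<comment> \<open>Ratio test: the largest step that keeps every constrained weight
    nonnegative.\<close>
  define s where "s = Min ((\<lambda>i. l i / (- m i)) ` B)"
  have "s \<in> (\<lambda>i. l i / (- m i)) ` B" unfolding s_def
   using \<open>finite B\<close> \<open>g \<in> B\<close> by (intro Min_in) auto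
  then obtain h where h: "h \<in> B" "s = l h / (- m h)" by blast
  have smin: "s \<le> l i / (- m i)" if "i \<in> B" for i
   unfolding s_def using that \<open>finite B\<close> by (intro Min_le) auto
  have s0: "0 \<le> s" unfolding h(2) using h(1) pos[of h] by (intro divide_nonneg_nonneg) (auto simp: B_def less_imp_le)
  define l' where "l' i = l i + s * m i" for i
  have msupp: "m i = 0" if "i \<notin> supp l" for i
   using that g S(2) by (auto simp: m_def)
  have "P l'"
   unfolding P_def
  proof (intro conjI allI impI)
   fix i assume i: "i < N" "k \<le> i"
   show "0 \<le> l' i"
   proof (cases "i \<in> B")
    case True
    then show ?thesis using smin[OF True] by (simp add: l'_def B_def field_simps)
   next
    case False
    then have "0 \<le> m i" using i msupp[of i] by (force simp: B_def)
    then show ?thesis using l(1) i s0 by (simp add: P_def l'_def)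
   qed
  next
   fix j assume "j < M"
   then show "(\<Sum>i<N. l' i * A i j) = last_unit M j"
    using m0[of j] l(1) by (simp add: P_def l'_def distrib_right sum.distrib mult.assoc sum_distrib_left[symmetric])
  qed
  moreover have "supp l' \<subseteq> supp l - {h}"
  proof
   fix i assume i: "i \<in> supp l'"
   have "l' h = 0" using h by (simp add: l'_def B_def)
   then have "i \<noteq> h" using i h by (auto simp: supp_def B_def)
   moreover have "i \<in> supp l"
    using i msupp[of i] by (auto simp: supp_def l'_def)
   ultimately show "i \<in> supp l - {h}" by auto
  qed
  then have "card (supp l') \<le> card (supp l - {h})" using fs by (intro card_mono) auto
  then have "card (supp l') < card (supp l)"
   using h fs(1)[of l] by (metis (no_types, lifting) B_def card_Diff1_less mem_Collect_eq order_le_less_trans)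
  ultimately show False using l(2)[of l'] by simp
 qed
 then obtain G where G: "supp l \<subseteq> G" "G \<subseteq> {..<N}" "card G = M"
  using exists_subset_between[of "supp l" M "{..<N}"] fs(2)[of l] MN by auto
 have "(\<Sum>i<N. l i * A i j) = (\<Sum>i\<in>G. l i * A i j)" for j
  using G(1,2) by (intro sum.mono_neutral_right) (auto simp: supp_def)
 then have "feas G k M A (last_unit M)"
  using l(1) G(2) unfolding feas_def P_def by (intro exI[of _ l]) auto
 then show ?thesis using G by (auto simp: bases_def supp_def)
qed

text \<open>The support of the ray together with the free rows exceeds \<open>M\<close>, since
  otherwise genericity would make the ray zero. Solve for the target on \<open>M\<close> of these
  rows, and add a multiple of the ray large enough to repair all signs.\<close>

lemma unbounded_imp_feasible:
 assumes "feas {..<N} k (Suc M) A (\<lambda>j. - last_unit (Suc M) j)"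
 shows "feas {..<N} k M A (last_unit M)"
proof -
 obtain q where q: "\<And>i. i < N ==> k \<le> i ==> 0 \<le> q i"
  "\<And>j. j < Suc M ==> (\<Sum>i<N. q i * A i j) = - last_unit (Suc M) j"
  using assms unfolding feas_def by auto
 define S where "S = {..<k} \<union> {i. i < N \<and> q i \<noteq> 0}"
 have S: "S \<subseteq> {..<N}" "finite S" "{..<k} \<subseteq> S" using kM MN by (auto simp: S_def)
 have eq: "(\<Sum>i<N. q i * A i j) = (\<Sum>i\<in>S. q i * A i j)" for j
  using S by (intro sum.mono_neutral_right) (auto simp: S_def)
 have "\<not> card S \<le> M"
 proof
  assume "card S \<le> M"
  moreover have "S \<subseteq> {..<n}" using S(1) N by auto
  ultimately have ind: "indep_rows S M A" using generic_indep_mono[OF gen] by blast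
  have "q i = 0" if "i \<in> S" for i
   by (rule indep_rowsD[OF ind _ that])
    (use q(2) in \<open>auto simp: eq[symmetric] last_unit_def\<close>)
  then have "(\<Sum>i<N. q i * A i M) = 0" unfolding eq by (intro sum.neutral) auto
  then show False using q(2)[of M] by (simp add: last_unit_def)
 qed
 then obtain G where G: "{..<k} \<subseteq> G" "G \<subseteq> S" "card G = M"
  using exists_subset_between[of "{..<k}" M S] kM S by auto
 have "G \<subseteq> {..<n}" using G(2) S(1) N by fastforce
 then obtain l where l: "\<And>j. j < M ==> (\<Sum>i\<in>G. l i * A i j) = last_unit M j"
  using generic_rows_solve[OF gen, of G "last_unit M"] G(3) by auto
 \<comment> \<open>The sum dominates each single ratio, so one multiple of the ray serves all rows
   of \<open>G\<close>.\<close>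
 define s where "s = (\<Sum>i\<in>G - {..<k}. \<bar>l i\<bar> / q i)"
 define l' where "l' i = (if i \<in> G then l i else 0) + s * q i" for i
 have qpos: "0 < q i" if "i \<in> G - {..<k}" for i
  using that G(2) q(1)[of i] by (auto simp: S_def order_less_le)
 have finG: "finite G" using G(2) S(2) finite_subset by blast
 have s0: "0 \<le> s" unfolding s_def using qpos by (intro sum_nonneg) (auto intro!: divide_nonneg_pos)
 have "0 \<le> l' i" if "i < N" "k \<le> i" for i
 proof (cases "i \<in> G")
  case True
  then have i: "i \<in> G - {..<k}" using that by auto
  have "\<bar>l i\<bar> / q i \<le> s" unfolding s_def
   using finG i qpos by (intro member_le_sum) (auto intro!: divide_nonneg_pos)
  then have "\<bar>l i\<bar> \<le> s * q i" using qpos[OF i] by (simp add: field_simps)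
  then show ?thesis using True by (simp add: l'_def)
 next
  case False
  then show ?thesis using s0 q(1) that by (simp add: l'_def)
 qed
 moreover have "(\<Sum>i<N. l' i * A i j) = last_unit M j" if "j < M" for j
 proof -
  have "(\<Sum>i<N. (if i \<in> G then l i else 0) * A i j) = (\<Sum>i\<in>G. l i * A i j)"
   using G S by (intro sum.mono_neutral_cong_right) auto
  moreover have "(\<Sum>i<N. q i * A i j) = 0" using q(2)[of j] that by (simp add: last_unit_def)
  ultimately show ?thesis using l[OF that]
   by (simp add: l'_def distrib_right sum.distrib mult.assoc sum_distrib_left[symmetric])
 qed
 ultimately show ?thesis unfolding feas_def by (intro exI[of _ l']) auto
qed

text \<open>Weak duality with target 0: a ray costs at least 0, whereas an unbounded one would cost
  -1.\<close>

lemma optimal_basis_bounded: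
 assumes "G \<in> bases N k M" "lower_facet {..<N} G M A"
 shows "\<not> feas {..<N} k (Suc M) A (\<lambda>j. - last_unit (Suc M) j)"
proof
 assume "feas {..<N} k (Suc M) A (\<lambda>j. - last_unit (Suc M) j)"
 then obtain q where q: "\<And>i. i < N ==> k \<le> i ==> 0 \<le> q i"
  "\<And>j. j < Suc M ==> (\<Sum>i<N. q i * A i j) = - last_unit (Suc M) j"
  unfolding feas_def by auto
 obtain b where b: "\<And>i. i \<in> G ==> A i M = (\<Sum>j<M. b j * A i j)"
   "\<And>i. i \<in> {..<N} - G ==> A i M > (\<Sum>j<M. b j * A i j)"
  using assms(2) unfolding lower_facet_def by blast
 have "(\<Sum>j<M. b j * 0) \<le> (\<Sum>i<N. q i * A i M)"
 proof (rule lower_facet_optimal(1)[OF finite_lessThan basesD(2)[OF assms(1)] b])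
  show "0 \<le> q i" if "i \<in> {..<N} - G" for i
   using that q(1) basesD(1)[OF assms(1)] by (metis DiffD1 DiffD2 lessThan_iff not_less subsetD)
  show "(\<Sum>i<N. q i * A i j) = 0" if "j < M" for j
   using q(2)[of j] that by (simp add: last_unit_def)
 qed
 then show False using q(2)[of M] by (simp add: last_unit_def)
qed

text \<open>The solution on \<open>H\<close> is optimal too, so complementary slackness for
  \<open>G\<close> makes it vanish off \<open>G\<close>. By nondegeneracy it is nonzero on all of
  \<open>H\<close>, hence \<open>H\<close> lies in \<open>G\<close>.\<close>

lemma optimal_basis_unique:
 assumes "G \<in> bases N k M" "lower_facet {..<N} G M A" "feas G k M A (last_unit M)"
  and "H \<in> bases N k M" "lower_facet {..<N} H M A" "feas H k M A (last_unit M)"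
 shows "G = H"
proof -
 have sub: "H \<subseteq> G"
  if G: "G \<in> bases N k M" "lower_facet {..<N} G M A" "feas G k M A (last_unit M)"
  and H: "H \<in> bases N k M" "lower_facet {..<N} H M A" "feas H k M A (last_unit M)" for G H
 proof -
  have *: "\<exists>b l. (\<forall>i\<in>G. A i M = (\<Sum>j<M. b j * A i j)) \<and> (\<forall>i\<in>{..<N} - G. A i M > (\<Sum>j<M. b j * A i j))
    \<and> (\<forall>i<N. k \<le> i \<longrightarrow> 0 \<le> l i) \<and> (\<forall>j<M. (\<Sum>i<N. l i * A i j) = last_unit M j)
    \<and> (\<forall>j. (\<Sum>i<N. l i * A i j) = (\<Sum>i\<in>G. l i * A i j)) \<and> (\<forall>i. i \<notin> G \<longrightarrow> l i = 0)"
   if G: "G \<in> bases N k M" "lower_facet {..<N} G M A" "feas G k M A (last_unit M)" for G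
  proof -
   obtain l where l: "\<forall>i\<in>G. k \<le> i \<longrightarrow> 0 \<le> l i" "\<forall>j<M. (\<Sum>i\<in>G. l i * A i j) = last_unit M j"
    using G(3) unfolding feas_def by blast
   define l' where "l' i = (if i \<in> G then l i else 0)" for i
   have "(\<Sum>i<N. l' i * A i j) = (\<Sum>i\<in>G. l i * A i j)" for j
    using basesD(2)[OF G(1)] unfolding l'_def by (intro sum.mono_neutral_cong_right) auto
   moreover have "(\<Sum>i\<in>G. l' i * A i j) = (\<Sum>i\<in>G. l i * A i j)" for j
    unfolding l'_def by (intro sum.cong) auto
   ultimately show ?thesis using G(2) l unfolding lower_facet_def
    by (elim exE conjE) (rule exI, rule exI[of _ l'], auto simp: l'_def)
  qed
  obtain b l where b: "\<And>i. i \<in> G ==> A i M = (\<Sum>j<M. b j * A i j)"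
    "\<And>i. i \<in> {..<N} - G ==> A i M > (\<Sum>j<M. b j * A i j)"
   and l: "\<And>i. i < N ==> k \<le> i ==> 0 \<le> l i" "\<And>j. j < M ==> (\<Sum>i<N. l i * A i j) = last_unit M j"
    "\<And>i. i \<notin> G ==> l i = 0"
   using *[OF G] by blast
  obtain c m where c: "\<And>i. i \<in> H ==> A i M = (\<Sum>j<M. c j * A i j)"
    "\<And>i. i \<in> {..<N} - H ==> A i M > (\<Sum>j<M. c j * A i j)"
   and m: "\<And>i. i < N ==> k \<le> i ==> 0 \<le> m i" "\<And>j. j < M ==> (\<Sum>i<N. m i * A i j) = last_unit M j"
    "\<And>j. (\<Sum>i<N. m i * A i j) = (\<Sum>i\<in>H. m i * A i j)" "\<And>i. i \<notin> H ==> m i = 0"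
   using *[OF H] by blast
  have kk: "k \<le> i" if "i \<in> {..<N} - B" "B \<in> bases N k M" for i B
   using that basesD(1)[of B] by (metis DiffD2 lessThan_iff not_less subsetD)
  note optH = lower_facet_optimal[OF finite_lessThan basesD(2)[OF H(1)] c]
  have exact: "(\<Sum>i<N. f i * A i M) = (\<Sum>j<M. d j * last_unit M j)"
   if "\<And>i. i \<in> B ==> A i M = (\<Sum>j<M. d j * A i j)" "\<And>i. i \<notin> B ==> f i = 0"
    "\<And>j. j < M ==> (\<Sum>i<N. f i * A i j) = last_unit M j" for f d :: "nat => real" and B
  proof -
   have "(\<Sum>i<N. f i * A i M) = (\<Sum>i<N. f i * (\<Sum>j<M. d j * A i j))"
    using that(1,2) by (intro sum.cong refl) (metis mult_eq_0_iff)
   also have "\<dots> = (\<Sum>j<M. d j * last_unit M j)"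
    by (subst sum_mult_swap) (simp add: that(3))
   finally show ?thesis .
  qed
  have e1: "(\<Sum>i<N. l i * A i M) = (\<Sum>j<M. b j * last_unit M j)"
   by (rule exact[OF b(1) l(3) l(2)])
  have e2: "(\<Sum>i<N. m i * A i M) = (\<Sum>j<M. c j * last_unit M j)"
   by (rule exact[OF c(1) m(4) m(2)])
  have "(\<Sum>j<M. c j * last_unit M j) \<le> (\<Sum>i<N. l i * A i M)"
   by (rule optH(1)) (use l kk[OF _ H(1)] in auto)
  then have le: "(\<Sum>i<N. m i * A i M) \<le> (\<Sum>j<M. b j * last_unit M j)" using e1 e2 by simp
  have m0: "m i = 0" if "i \<in> {..<N} - G" for i
   by (rule lower_facet_optimal(2)[where b = b and w = "last_unit M" and G = G and I = "{..<N}" and A = A and M = M])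
    (use m kk[OF _ G(1)] le that b basesD(2)[OF G(1)] in auto)
  show "H \<subseteq> G"
  proof
   fix i assume i: "i \<in> H"
   have "m i \<noteq> 0"
    by (rule basic_solution_nonzero[OF gen basesD(5,3)[OF H(1)] _ i]) (use m in auto)
   then show "i \<in> G" using m0 basesD(2)[OF H(1)] i by blast
  qed
 qed
 show ?thesis using sub[OF assms] sub[OF assms(4-6) assms(1-3)] by auto
qed

text \<open>A feasible basis of least cost is dual feasible: an outside row that is not strictly
  above the graph would yield an unbounded ray or, by a pivot, a cheaper feasible basis.\<close>

lemma optimal_basis_exists:
 assumes fe: "feas {..<N} k M A (last_unit M)"
  and bd: "\<not> feas {..<N} k (Suc M) A (\<lambda>j. - last_unit (Suc M) j)"
 shows "\<exists>G\<in>bases N k M. feas G k M A (last_unit M) \<and> lower_facet {..<N} G M A"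
proof -
 define sol where "sol G l \<longleftrightarrow> (\<forall>i\<in>G. k \<le> i \<longrightarrow> 0 \<le> l i) \<and> (\<forall>j<M. (\<Sum>i\<in>G. l i * A i j) = last_unit M j)"
  for G l
 define fb where "fb = {G\<in>bases N k M. feas G k M A (last_unit M)}"
 define lam where "lam G = (SOME l. sol G l)" for G
 have lam: "sol G (lam G)" if "G \<in> fb" for G
  unfolding lam_def using that unfolding fb_def feas_def by (intro someI_ex[of "sol G"]) (auto simp: sol_def)
 define cost where "cost G = (\<Sum>i\<in>G. lam G i * A i M)" for G
 have "fb \<noteq> {}" "finite fb" using feasible_basic_exists[OF fe] finite_bases by (auto simp: fb_def)
 then obtain G where G: "G \<in> fb" "\<And>H. H \<in> fb ==> cost G \<le> cost H"
  using ex_min_if_finite[of "cost ` fb"] by (metis (no_types, lifting) arg_min_if_finite(1) arg_min_least)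
 have GB: "G \<in> bases N k M" using G(1) by (simp add: fb_def)
 note Gb = basesD[OF GB]
 let ?l = "lam G"
 obtain b where b: "\<And>i. i \<in> G ==> (\<Sum>j<M. b j * A i j) = A i M"
  using generic_cols_solve[OF gen Gb(5), of "\<lambda>i. A i M"] Gb(3) by auto
 have "A i M > (\<Sum>j<M. b j * A i j)" if i: "i \<in> {..<N} - G" for i
 proof (rule ccontr)
  assume "\<not> A i M > (\<Sum>j<M. b j * A i j)"
  then have le: "A i M \<le> (\<Sum>j<M. b j * A i j)" by simp
  have ik: "k \<le> i" "i < N" "i \<notin> G" using i Gb(1) by (auto simp: not_less[symmetric])
  obtain q where q: "\<And>j. j < M ==> (\<Sum>g\<in>G. q g * A g j) = A i j"
   using generic_rows_solve[OF gen Gb(5), of "A i"] Gb(3) by auto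
  have dual: "(\<Sum>g\<in>G. q g * A g M) = (\<Sum>j<M. b j * A i j)"
  proof -
   have "(\<Sum>g\<in>G. q g * A g M) = (\<Sum>g\<in>G. q g * (\<Sum>j<M. b j * A g j))"
    using b by (intro sum.cong) auto
   also have "\<dots> = (\<Sum>j<M. b j * A i j)"
    by (subst sum_mult_swap) (simp add: q)
   finally show ?thesis .
  qed
  \<comment> \<open>The gain in cost per unit of the entering row \<open>i\<close>. Zero is excluded
    because it would be a dependence of \<open>M + 1\<close> rows in \<open>M + 1\<close>
    columns.\<close>
  define d where "d = (\<Sum>g\<in>G. q g * A g M) - A i M"
  have d0: "0 \<le> d" using le dual by (simp add: d_def)
  have iG: "finite (insert i G)" "insert i G \<subseteq> {..<n}" "card (insert i G) = Suc M"
   using Gb ik N by auto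
  have "d \<noteq> 0"
  proof
   assume "d = 0"
   have "(\<Sum>g\<in>insert i G. (if g = i then - 1 else q g) * A g j) = 0" if "j < Suc M" for j
   proof -
    have "(\<Sum>g\<in>G. (if g = i then - 1 else q g) * A g j) = (\<Sum>g\<in>G. q g * A g j)"
     using ik by (intro sum.cong) auto
    then have "(\<Sum>g\<in>insert i G. (if g = i then - 1 else q g) * A g j) = - A i j + (\<Sum>g\<in>G. q g * A g j)"
     using ik Gb(4) by simp
    then show ?thesis using q[of j] \<open>d = 0\<close> that by (cases "j = M") (auto simp: d_def)
   qed
   from indep_rowsD[OF genericD[OF gen iG(2,3)] this, of i] show False by simp
  qed
  with d0 have d: "0 < d" by simp
  \<comment> \<open>Constrained rows whose weights fall as \<open>i\<close> enters. Without any, the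
    move never stops and is a ray of negative cost.\<close>
  define B where "B = {g\<in>G. k \<le> g \<and> 0 < q g}"
  have "B \<noteq> {}"
  proof
   assume B: "B = {}"
   define m where "m g = (if g = i then 1 / d else if g \<in> G then - q g / d else 0)" for g
   have sm: "(\<Sum>g<N. m g * A g j) = (A i j - (\<Sum>g\<in>G. q g * A g j)) / d" for j
   proof -
    have "(\<Sum>g<N. m g * A g j) = (\<Sum>g\<in>insert i G. m g * A g j)"
     using ik Gb(2) by (intro sum.mono_neutral_right) (auto simp: m_def)
    also have "\<dots> = A i j / d + (\<Sum>g\<in>G. m g * A g j)" using ik Gb(4) by (simp add: m_def)
    also have "(\<Sum>g\<in>G. m g * A g j) = (\<Sum>g\<in>G. - (q g * A g j) / d)"
     using ik by (intro sum.cong) (auto simp: m_def)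
    finally show ?thesis by (simp add: sum_negf diff_divide_distrib sum_divide_distrib)
   qed
   have "feas {..<N} k (Suc M) A (\<lambda>j. - last_unit (Suc M) j)"
    unfolding feas_def
   proof (intro exI[of _ m] conjI ballI allI impI)
    show "0 \<le> m g" if "g \<in> {..<N}" "k \<le> g" for g
     using that d B by (force simp: m_def B_def divide_le_0_iff)
    show "(\<Sum>g<N. m g * A g j) = - last_unit (Suc M) j" if "j < Suc M" for j
     unfolding sm using that q[of j] d by (cases "j = M") (auto simp: last_unit_def d_def field_simps)
   qed
   then show False using bd by blast
  qed
  have finB: "finite B" using Gb by (auto simp: B_def)
  define s where "s = Min ((\<lambda>g. ?l g / q g) ` B)"
  have "s \<in> (\<lambda>g. ?l g / q g) ` B" unfolding s_def using finB \<open>B \<noteq> {}\<close> by (intro Min_in) auto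
  then obtain h where h: "h \<in> B" "s = ?l h / q h" by blast
  have smin: "s \<le> ?l g / q g" if "g \<in> B" for g
   unfolding s_def using that finB by (intro Min_le) auto
  have solG: "sol G ?l" using lam[OF G(1)] .
  have pos: "0 < ?l g" if "g \<in> G" "k \<le> g" for g
   using basic_solution_pos[OF GB _ _ that, of ?l] solG by (auto simp: sol_def)
  \<comment> \<open>Nondegeneracy makes the step strictly positive, so the pivot strictly lowers the
    cost.\<close>
  have s0: "0 < s" using h pos by (auto simp: B_def)
  define H where "H = insert i (G - {h})"
  have hG: "h \<in> G" "k \<le> h" "0 < q h" using h by (auto simp: B_def)
  define m where "m g = (if g = i then s else ?l g - s * q g)" for g
  have sm: "(\<Sum>g\<in>H. m g * A g j) = (\<Sum>g\<in>G. ?l g * A g j) + s * (A i j - (\<Sum>g\<in>G. q g * A g j))" for j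
  proof -
   have "(\<Sum>g\<in>H. m g * A g j) = s * A i j + (\<Sum>g\<in>G - {h}. m g * A g j)"
    unfolding H_def using ik Gb(4) by (simp add: m_def)
   also have "(\<Sum>g\<in>G - {h}. m g * A g j) = (\<Sum>g\<in>G - {h}. (?l g - s * q g) * A g j)"
    using ik by (intro sum.cong) (auto simp: m_def)
   also have "\<dots> = (\<Sum>g\<in>G. (?l g - s * q g) * A g j)"
    using hG h(2) Gb(4) by (intro sum.mono_neutral_left) auto
   finally show ?thesis by (simp add: algebra_simps sum_subtractf sum_distrib_left)
  qed
  have HB: "H \<in> bases N k M"
  proof -
   have "card H = M" using Gb(3,4) hG ik M0 unfolding H_def
    by (simp add: card_Diff_singleton)
   then show ?thesis using Gb hG ik by (auto simp: bases_def H_def)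
  qed
  have solH: "sol H m"
   unfolding sol_def
  proof (intro conjI ballI allI impI)
   fix g assume g: "g \<in> H" "k \<le> g"
   show "0 \<le> m g"
   proof (cases "g = i")
    case True then show ?thesis using s0 by (simp add: m_def)
   next
    case False
    then have gG: "g \<in> G" using g by (auto simp: H_def)
    show ?thesis
    proof (cases "0 < q g")
     case True
     then have "g \<in> B" using gG g by (auto simp: B_def)
     then show ?thesis using smin[of g] True False by (simp add: m_def field_simps)
    next
     case q: False
     then have "s * q g \<le> 0" using s0 by (simp add: mult_nonneg_nonpos)
     then show ?thesis using pos[OF gG g(2)] False by (simp add: m_def)
    qed
   qed
  next
   fix j assume "j < M"
   then show "(\<Sum>g\<in>H. m g * A g j) = last_unit M j"
    unfolding sm using q[of j] solG by (simp add: sol_def)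
  qed
  then have Hfb: "H \<in> fb" using HB by (auto simp: fb_def feas_def sol_def)
  have eqm: "lam H g = m g" if "g \<in> H" for g
  proof -
   have "lam H g - m g = 0"
    by (rule indep_rowsD[OF genericD[OF gen basesD(5,3)[OF HB]] _ that])
     (use lam[OF Hfb] solH in \<open>auto simp: sol_def left_diff_distrib sum_subtractf\<close>)
   then show ?thesis by simp
  qed
  have "cost H = (\<Sum>g\<in>H. m g * A g M)" unfolding cost_def using eqm by (intro sum.cong) auto
  also have "\<dots> = cost G - s * d" unfolding sm cost_def d_def by (simp add: algebra_simps)
  finally have "cost H < cost G" using s0 d by simp
  then show False using G(2)[OF Hfb] by simp
 qed
 then have "lower_facet {..<N} G M A" unfolding lower_facet_def using b by (intro exI[of _ b]) auto
 then show ?thesis using G(1) by (auto simp: fb_def)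
qed

text \<open>There is exactly one optimal basis if the program is feasible and bounded, and none
  otherwise. As unboundedness implies feasibility, this indicator is a difference of two
  indicators.\<close>

lemma optimal_bases_count:
 "(\<Sum>G\<in>bases N k M. of_bool (feas G k M A (last_unit M) \<and> lower_facet {..<N} G M A) :: real) =
  of_bool (feas {..<N} k M A (last_unit M)) -
  of_bool (feas {..<N} k (Suc M) A (\<lambda>j. - last_unit (Suc M) j))"
proof (cases "\<exists>G\<in>bases N k M. feas G k M A (last_unit M) \<and> lower_facet {..<N} G M A")
 case True
 then obtain G where G: "G \<in> bases N k M" "feas G k M A (last_unit M)" "lower_facet {..<N} G M A" by blast
 have "feas H k M A (last_unit M) \<and> lower_facet {..<N} H M A \<longleftrightarrow> H = G" if "H \<in> bases N k M" for H
  using optimal_basis_unique[OF G(1,3,2) that] G by blast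
 then have "(\<Sum>H\<in>bases N k M. of_bool (feas H k M A (last_unit M) \<and> lower_facet {..<N} H M A) :: real)
  = (\<Sum>H\<in>bases N k M. if H = G then 1 else 0)"
  by (intro sum.cong refl) simp
 also have "\<dots> = 1" using G(1) finite_bases by simp
 finally show ?thesis
  using optimal_basis_bounded[OF G(1,3)] feas_mono_set[OF G(2) basesD(2)[OF G(1)]] by simp
next
 case False
 then have "(\<Sum>H\<in>bases N k M. of_bool (feas H k M A (last_unit M) \<and> lower_facet {..<N} H M A) :: real) = 0"
  by (intro sum.neutral) auto
 then show ?thesis using False optimal_basis_exists unbounded_imp_feasible by auto
qed

end

lemma feas_cong:
 assumes "\<And>i j. i \<in> I ==> j < M ==> A i j = B i j" "\<And>j. j < M ==> w j = w' j"
 shows "feas I k M A w \<longleftrightarrow> feas I k M B w'"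
proof -
 have "(\<Sum>i\<in>I. l i * A i j) = (\<Sum>i\<in>I. l i * B i j)" if "j < M" for l :: "nat => real" and j
  using assms(1) that by (intro sum.cong) auto
 then show ?thesis unfolding feas_def using assms(2) by auto
qed

lemma generic_cong:
 assumes "\<And>i j. i < n ==> j < n ==> A i j = B i j"
 shows "generic n A \<longleftrightarrow> generic n B"
proof -
 have "indep_rows S (card S) A \<longleftrightarrow> indep_rows S (card S) B" if "S \<subseteq> {..<n}" for S
 proof -
  have "card S \<le> n" using card_mono[OF finite_lessThan that] by simp
  then have "(\<Sum>i\<in>S. l i * A i j) = (\<Sum>i\<in>S. l i * B i j)" if "j < card S" for l :: "nat => real" and j
   using assms that \<open>S \<subseteq> {..<n}\<close> by (intro sum.cong) auto
  then show ?thesis unfolding indep_rows_def by simp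
 qed
 then show ?thesis unfolding generic_def by auto
qed

lemma lower_facet_cong:
 assumes "\<And>i j. i \<in> I \<union> G ==> j \<le> M ==> A i j = B i j"
 shows "lower_facet I G M A \<longleftrightarrow> lower_facet I G M B"
proof -
 have 1: "(\<Sum>j<M. b j * A i j) = (\<Sum>j<M. b j * B i j)" if "i \<in> I \<union> G" for b :: "nat => real" and i
  using assms that by (intro sum.cong) auto
 have 2: "A i M = B i M" if "i \<in> I \<union> G" for i using assms that by auto
 show ?thesis unfolding lower_facet_def
  by (intro arg_cong[where f=Ex] ext arg_cong2[where f="(\<and>)"] ball_cong refl) (use 1 2 in auto)
qed

subsection \<open>Measurability\<close>

text \<open>Tychonoff. Multipliers are functions on all of nat, so a bound in every coordinate
  already gives compactness in the product topology.\<close>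

lemma compact_box: "compact {l :: nat => real. \<forall>i. \<bar>l i\<bar> \<le> R}"
proof -
 have "{l :: nat => real. \<forall>i. \<bar>l i\<bar> \<le> R} = PiE UNIV (\<lambda>_. {- R..R})"
  by (auto simp: PiE_def Pi_def abs_le_iff minus_le_iff; metis minus_le_iff)
 then show ?thesis
  using compactin_PiE[of "\<lambda>_::nat. euclidean :: real topology" UNIV "\<lambda>_. {- R..R}"]
  by (simp add: euclidean_product_topology)
qed

text \<open>Tube lemma. It turns the existence of bounded multipliers into a closed condition on the
  matrix.\<close>

lemma closed_ex_compact:
 fixes K :: "'a::topological_space set" and C :: "('a \<times> 'b::topological_space) set"
 assumes "compact K" "closed C"
 shows "closed {y. \<exists>x\<in>K. (x, y) \<in> C}"
proof -
 have "open {y. \<not> (\<exists>x\<in>K. (x, y) \<in> C)}"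
 proof (subst open_subopen, safe)
  fix y assume y: "\<not> (\<exists>x\<in>K. (x, y) \<in> C)"
  have op: "open (prod.swap -` (- C) :: ('b \<times> 'a) set)"
   using assms(2) by (intro open_vimage) (auto intro!: continuous_intros simp: prod.swap_def)
  have sub: "{y} \<times> K \<subseteq> prod.swap -` (- C)" using y by auto
  from Elementary_Topology.tube_lemma[OF assms(1) op sub]
  obtain U where "y \<in> U" "open U" "U \<times> K \<subseteq> prod.swap -` (- C)" by (elim exE conjE)
  then show "\<exists>T. open T \<and> y \<in> T \<and> T \<subseteq> {y. \<not> (\<exists>x\<in>K. (x, y) \<in> C)}"
   by (intro exI[of _ U]) auto
 qed
 then show ?thesis unfolding closed_def Collect_neg_eq[symmetric] .
qed

lemma continuous_on_fst_apply:
 "continuous_on UNIV (\<lambda>z :: (nat => real) \<times> (nat => nat => real). fst z i)"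
 by (rule continuous_on_product_then_coordinatewise) (intro continuous_intros)

lemma continuous_on_snd_apply:
 "continuous_on UNIV (\<lambda>z :: (nat => real) \<times> (nat => nat => real). snd z i j)"
 by (rule continuous_on_product_then_coordinatewise, rule continuous_on_product_then_coordinatewise)
  (intro continuous_intros)

lemmas closed_matrix_intros =
 closed_Collect_conj closed_Collect_all closed_Collect_imp open_Collect_const closed_Collect_le
 closed_Collect_eq continuous_on_const continuous_on_sum continuous_on_mult continuous_on_add
 continuous_on_rabs continuous_on_fst_apply continuous_on_snd_apply

lemma closed_ex_box:
 fixes P :: "(nat => real) => 'b::topological_space => bool"
 assumes "closed {z. P (fst z) (snd z)}"
 shows "closed {A. \<exists>l. (\<forall>i. \<bar>l i\<bar> \<le> R) \<and> P l A}"
 using closed_ex_compact[OF compact_box[of R] assms] by simp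

lemma measurable_entry: "(\<lambda>A :: nat => nat => real. A i j) \<in> borel_measurable borel"
 by (intro borel_measurable_continuous_onI)
  (rule continuous_on_product_then_coordinatewise[OF continuous_on_product_coordinates])

lemma measurable_matrix:
 fixes A :: "'a => nat => nat => real"
 assumes "\<And>i j. (\<lambda>w. A w i j) \<in> borel_measurable M"
 shows "A \<in> borel_measurable M"
 by (intro measurable_coordinatewise_then_product assms)

text \<open>The multipliers bounded by \<open>R\<close> give a closed set of matrices, and the union
  over \<open>R\<close> is countable. The target is itself a row of the matrix, so that it may vary
  together with it.\<close>

lemma borel_feas_row:
 assumes "finite I"
 shows "Measurable.pred borel (\<lambda>A. feas I k M A (A r))"
proof -
 define C where "C R = {A. \<exists>l. (\<forall>i. \<bar>l i\<bar> \<le> real R) \<and>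
  ((\<forall>i\<in>I. k \<le> i \<longrightarrow> 0 \<le> l i) \<and> (\<forall>j<M. (\<Sum>i\<in>I. l i * A i j) = A r j))}" for R :: nat
 have "closed (C R)" for R unfolding C_def
  by (rule closed_ex_box) (unfold Ball_def, intro closed_matrix_intros)
 moreover have "{A. feas I k M A (A r)} = (\<Union>R. C R)"
 proof (intro set_eqI iffI)
  fix A assume "A \<in> {A. feas I k M A (A r)}"
  then obtain l where l: "\<forall>i\<in>I. k \<le> i \<longrightarrow> 0 \<le> l i" "\<forall>j<M. (\<Sum>i\<in>I. l i * A i j) = A r j"
   unfolding feas_def by auto
  define l' where "l' i = (if i \<in> I then l i else 0)" for i
  obtain R :: nat where R: "(\<Sum>i\<in>I. \<bar>l i\<bar>) \<le> real R" using real_arch_simple by blast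
  have "\<bar>l' i\<bar> \<le> real R" for i
  proof (cases "i \<in> I")
   case True
   then have "\<bar>l i\<bar> \<le> (\<Sum>i\<in>I. \<bar>l i\<bar>)" using assms by (intro member_le_sum) auto
   then show ?thesis using True R by (simp add: l'_def)
  qed (simp add: l'_def)
  moreover have "(\<Sum>i\<in>I. l' i * A i j) = (\<Sum>i\<in>I. l i * A i j)" for j
   by (intro sum.cong) (auto simp: l'_def)
  ultimately have "A \<in> C R" using l unfolding C_def by (auto intro!: exI[of _ l'] simp: l'_def)
  then show "A \<in> (\<Union>R. C R)" by blast
 next
  fix A assume "A \<in> (\<Union>R. C R)"
  then show "A \<in> {A. feas I k M A (A r)}" unfolding C_def feas_def by auto
 qed
 ultimately show ?thesis unfolding pred_def by auto
qed

text \<open>A fixed target is written into some row outside the finite set \<open>I\<close>.\<close>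

lemma borel_feas [measurable]:
 assumes "finite I"
 shows "Measurable.pred borel (\<lambda>A. feas I k M A w)"
proof -
 obtain r where r: "r \<notin> I" using ex_new_if_finite[OF infinite_UNIV_nat assms] by blast
 have u: "(\<lambda>A :: nat => nat => real. A(r := w)) \<in> borel \<rightarrow>\<^sub>M borel"
 proof (rule measurable_matrix)
  show "(\<lambda>A. (A(r := w)) i j) \<in> borel_measurable borel" for i j
   using measurable_entry[of i j] by (cases "i = r") simp_all
 qed
 have "feas I k M A w \<longleftrightarrow> feas I k M (A(r := w)) ((A(r := w)) r)" for A
  by (rule feas_cong) (use r in auto)
 then show ?thesis using measurable_compose[OF u borel_feas_row[OF assms, of k M r]] by simp
qed

text \<open>Strict inequalities are exhausted by closed ones with gap 1 / (R + 1); finitely many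
  rows leave a positive common gap.\<close>

lemma borel_lower_facet [measurable]:
 assumes "finite I" "finite G"
 shows "Measurable.pred borel (\<lambda>A. lower_facet I G M A)"
proof -
 define C where "C R = {A. \<exists>b. (\<forall>i. \<bar>b i\<bar> \<le> real R) \<and>
  ((\<forall>i\<in>G. A i M = (\<Sum>j<M. b j * A i j)) \<and> (\<forall>i\<in>I - G. (\<Sum>j<M. b j * A i j) + 1 / real (Suc R) \<le> A i M))}"
  for R :: nat
 have "closed (C R)" for R unfolding C_def
  by (rule closed_ex_box) (unfold Ball_def, intro closed_matrix_intros)
 moreover have "{A. lower_facet I G M A} = (\<Union>R. C R)"
 proof (intro set_eqI iffI)
  fix A assume "A \<in> {A. lower_facet I G M A}"
  then obtain b where b: "\<forall>i\<in>G. A i M = (\<Sum>j<M. b j * A i j)"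
    "\<forall>i\<in>I - G. A i M > (\<Sum>j<M. b j * A i j)"
   unfolding lower_facet_def by blast
  define b' where "b' j = (if j < M then b j else 0)" for j
  define e where "e i = 1 / (A i M - (\<Sum>j<M. b j * A i j))" for i
  obtain R :: nat where R: "(\<Sum>j<M. \<bar>b j\<bar>) + (\<Sum>i\<in>I - G. e i) \<le> real R" using real_arch_simple by blast
  have e0: "0 < e i" if "i \<in> I - G" for i using b(2) that by (simp add: e_def)
  have le: "\<bar>b j\<bar> \<le> real R" if "j < M" for j
  proof -
   have "\<bar>b j\<bar> \<le> (\<Sum>j<M. \<bar>b j\<bar>)" using that by (intro member_le_sum) auto
   moreover have "0 \<le> (\<Sum>i\<in>I - G. e i)" using e0 by (intro sum_nonneg) (auto intro: less_imp_le)
   ultimately show ?thesis using R by linarith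
  qed
  have "(\<Sum>j<M. b j * A i j) + 1 / real (Suc R) \<le> A i M" if "i \<in> I - G" for i
  proof -
   have "e i \<le> (\<Sum>i\<in>I - G. e i)" using that assms e0 by (intro member_le_sum) (auto intro: less_imp_le)
   moreover have "0 \<le> (\<Sum>j<M. \<bar>b j\<bar>)" by (intro sum_nonneg) auto
   ultimately have "e i \<le> real R" using R by linarith
   then have "e i \<le> real (Suc R)" by simp
   then have "1 / real (Suc R) \<le> 1 / e i" using e0[OF that] by (intro divide_left_mono) auto
   also have "1 / e i = A i M - (\<Sum>j<M. b j * A i j)" by (simp add: e_def)
   finally show ?thesis by simp
  qed
  moreover have "(\<Sum>j<M. b' j * A i j) = (\<Sum>j<M. b j * A i j)" for i
   by (intro sum.cong) (auto simp: b'_def)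
  ultimately have "A \<in> C R" using b le unfolding C_def by (auto intro!: exI[of _ b'] simp: b'_def)
  then show "A \<in> (\<Union>R. C R)" by blast
 next
  fix A assume "A \<in> (\<Union>R. C R)"
  then obtain R b where b: "\<forall>i\<in>G. A i M = (\<Sum>j<M. b j * A i j)"
    "\<forall>i\<in>I - G. (\<Sum>j<M. b j * A i j) + 1 / real (Suc R) \<le> A i M"
   unfolding C_def by blast
  have "(\<Sum>j<M. b j * A i j) < A i M" if "i \<in> I - G" for i
  proof -
   have "(0::real) < 1 / real (Suc R)" by simp
   then show ?thesis using b(2)[rule_format, OF that] by linarith
  qed
  then show "A \<in> {A. lower_facet I G M A}" using b(1) unfolding lower_facet_def by blast
 qed
 ultimately show ?thesis unfolding pred_def by auto
qed

text \<open>The complement is a finite union of closed sets: a nontrivial dependence can be scaled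
  to maximum norm 1 and then lies in a compact box.\<close>

lemma borel_generic [measurable]: "Measurable.pred borel (\<lambda>A. generic n A)"
proof -
 define D where "D S = {A. \<exists>l. (\<forall>i. \<bar>l i\<bar> \<le> (1::real)) \<and>
   ((\<exists>i\<in>S. \<bar>l i\<bar> = 1) \<and> (\<forall>j<card S. (\<Sum>i\<in>S. l i * A i j) = 0))}" for S :: "nat set"
 have D: "closed (D S)" if "finite S" for S
  unfolding D_def
 proof (rule closed_ex_box)
  have "{z :: (nat => real) \<times> (nat => nat => real). \<exists>i\<in>S. \<bar>fst z i\<bar> = 1} = (\<Union>i\<in>S. {z. \<bar>fst z i\<bar> = 1})" by auto
  moreover have "closed (\<Union>i\<in>S. {z :: (nat => real) \<times> (nat => nat => real). \<bar>fst z i\<bar> = 1})"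
   using that by (intro closed_UN ballI closed_matrix_intros) auto
  ultimately have 1: "closed {z :: (nat => real) \<times> (nat => nat => real). \<exists>i\<in>S. \<bar>fst z i\<bar> = 1}" by simp
  show "closed {z. (\<exists>i\<in>S. \<bar>fst z i\<bar> = 1) \<and> (\<forall>j<card S. (\<Sum>i\<in>S. fst z i * snd z i j) = (0::real))}"
   by (intro closed_Collect_conj 1 closed_matrix_intros)
 qed
 have eq: "{A. generic n A} = - (\<Union>S\<in>Pow {..<n}. D S)"
 proof (intro set_eqI iffI)
  fix A assume A: "A \<in> {A. generic n A}"
  show "A \<in> - (\<Union>S\<in>Pow {..<n}. D S)"
  proof
   assume "A \<in> (\<Union>S\<in>Pow {..<n}. D S)"
   then obtain S l i where S: "S \<subseteq> {..<n}" and l: "i \<in> S" "\<bar>l i\<bar> = (1::real)" "\<forall>j<card S. (\<Sum>i\<in>S. l i * A i j) = 0"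
    unfolding D_def by blast
   have "l i = 0"
    by (rule indep_rowsD[of S "card S" A l i]) (use A S l in \<open>auto simp: generic_def\<close>)
   then show False using l by simp
  qed
 next
  fix A assume A: "A \<in> - (\<Union>S\<in>Pow {..<n}. D S)"
  have "l i = 0" if S: "S \<subseteq> {..<n}" and l: "\<forall>j<card S. (\<Sum>i\<in>S. l i * A i j) = 0" and i: "i \<in> S" for S i and l :: "nat => real"
  proof (rule ccontr)
   assume "l i \<noteq> 0"
   have fin: "finite S" using S finite_subset by blast
   define m where "m = Max ((\<lambda>i. \<bar>l i\<bar>) ` S)"
   have mge: "\<bar>l i\<bar> \<le> m" if "i \<in> S" for i unfolding m_def using fin that by (intro Max_ge) auto
   have m0: "0 < m" using mge[OF i] \<open>l i \<noteq> 0\<close> by linarith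
   have "m \<in> (\<lambda>i. \<bar>l i\<bar>) ` S" unfolding m_def using fin i by (intro Max_in) auto
   then obtain g where g: "g \<in> S" "m = \<bar>l g\<bar>" by blast
   define l' where "l' i = (if i \<in> S then l i / m else 0)" for i
   have "(\<Sum>i\<in>S. l' i * A i j) = (\<Sum>i\<in>S. l i * A i j) / m" for j
    unfolding sum_divide_distrib by (intro sum.cong) (auto simp: l'_def)
   moreover have "\<bar>l' i\<bar> \<le> 1" for i using mge[of i] m0 by (auto simp: l'_def)
   moreover have "\<bar>l' g\<bar> = 1" using g m0 by (simp add: l'_def)
   ultimately have "A \<in> D S" using l g(1) unfolding D_def by (intro CollectI exI[of _ l']) auto
   then show False using A S by blast
  qed
  then show "A \<in> {A. generic n A}" unfolding generic_def indep_rows_def by blast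
 qed
 have "{A. generic n A} \<in> sets borel" unfolding eq
  by (intro borel_comp sets.finite_UN borel_closed D) (auto intro: finite_subset)
 then show ?thesis unfolding pred_def by simp
qed

subsection \<open>Almost sure general position\<close>

definition rows :: "nat => ('a => nat => real) => (nat => 'a) => nat => nat => real" where
 "rows N v X i j = (if i < N then v (X i) j else 0)"

lemma measurable_rows:
 assumes [measurable]: "\<And>j. (\<lambda>x. v x j) \<in> borel_measurable M" and "{..<N} \<subseteq> I"
 shows "rows N v \<in> borel_measurable (PiM I (\<lambda>_. M))"
proof (rule measurable_matrix)
 fix i j
 show "(\<lambda>X. rows N v X i j) \<in> borel_measurable (PiM I (\<lambda>_. M))"
 proof (cases "i < N")
  case True
  then have "i \<in> I" using assms(2) by auto
  then have [measurable]: "(\<lambda>X. X i) \<in> measurable (PiM I (\<lambda>_. M)) M" by simp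
  show ?thesis using True by (simp add: rows_def)
 qed (simp add: rows_def)
qed

text \<open>\<open>b S\<close> describes the hyperplane spanned by the rows of \<open>S\<close> in
  the leading \<open>card S + 1\<close> columns. A new row off all these hyperplanes admits no new
  dependence.\<close>

lemma generic_Suc:
 assumes "generic N A" "\<And>S i. S \<subseteq> {..<N} ==> i \<in> S ==> (\<Sum>j<card S. b S j * A i j) = A i (card S)"
  and "\<And>S. S \<subseteq> {..<N} ==> A N (card S) \<noteq> (\<Sum>j<card S. b S j * A N j)"
 shows "generic (Suc N) A"
 unfolding generic_def
proof (intro allI impI)
 fix S assume S: "S \<subseteq> {..<Suc N}"
 show "indep_rows S (card S) A"
 proof (cases "N \<in> S")
  case False
  then have "S \<subseteq> {..<N}" using S by (auto simp: less_Suc_eq)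
  then show ?thesis using genericD[OF assms(1)] by blast
 next
  case True
  define T where "T = S - {N}"
  have T: "T \<subseteq> {..<N}" "S = insert N T" "N \<notin> T" "finite T"
   using S True finite_subset[of T "{..<Suc N}"] by (auto simp: T_def less_Suc_eq)
  then have cS: "card S = Suc (card T)" by simp
  show ?thesis unfolding indep_rows_def
  proof (intro allI impI)
   fix l :: "nat => real" assume l: "\<forall>j<card S. (\<Sum>i\<in>S. l i * A i j) = 0"
   have l0: "l N * A N j + (\<Sum>i\<in>T. l i * A i j) = 0" if "j \<le> card T" for j
    using l that unfolding cS T(2) using T(3,4) by simp
   have l1: "(\<Sum>i\<in>T. l i * A i j) = - (l N * A N j)" if "j \<le> card T" for j
    using l0[OF that] by linarith
   have "(\<Sum>i\<in>T. l i * A i (card T)) = (\<Sum>i\<in>T. l i * (\<Sum>j<card T. b T j * A i j))"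
    using assms(2)[OF T(1)] by (intro sum.cong) auto
   also have "\<dots> = (\<Sum>j<card T. b T j * (\<Sum>i\<in>T. l i * A i j))" by (rule sum_mult_swap)
   also have "\<dots> = (\<Sum>j<card T. b T j * (- (l N * A N j)))"
    by (simp add: l1)
   also have "\<dots> = - l N * (\<Sum>j<card T. b T j * A N j)"
    by (simp add: sum_distrib_left sum_negf mult.left_commute)
   finally have "l N * (A N (card T) - (\<Sum>j<card T. b T j * A N j)) = 0"
    using l0[of "card T"] by (simp add: algebra_simps)
   then have N0: "l N = 0" using assms(3)[OF T(1)] by simp
   have "l i = 0" if "i \<in> T" for i
    by (rule indep_rowsD[OF genericD[OF assms(1) T(1) refl] _ that])
     (use l0 N0 in \<open>metis add_0 less_imp_le mult_zero_left\<close>)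
   then show "\<forall>i\<in>S. l i = 0" using N0 T(2) by auto
  qed
 qed
qed

text \<open>Points are added one at a time: by Fubini, for fixed generic earlier points the new one
  has to avoid only finitely many hyperplanes.\<close>

lemma AE_generic:
 assumes M: "sigma_finite_measure M"
  and v: "\<And>j. (\<lambda>x. v x j) \<in> borel_measurable M"
  and hyp: "\<And>b m. m < n ==> AE x in M. v x m \<noteq> (\<Sum>j<m. b j * v x j)"
  and "N \<le> n"
 shows "AE X in PiM {..<N} (\<lambda>_. M). generic N (rows N v X)"
 using \<open>N \<le> n\<close>
proof (induction N)
 case 0
 show ?case by (simp add: generic_def indep_rows_def)
next
 case (Suc N)
 interpret sigma_finite_measure M by fact
 interpret product_sigma_finite "\<lambda>_::nat. M" by standard
 note [measurable] = measurable_rows[OF v, of N "{..<N}"] measurable_rows[OF v, of "Suc N" "{..<Suc N}"]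
 have eq: "{..<Suc N} = insert N {..<N}" by auto
 have meas: "(\<lambda>X. indicator {A. \<not> generic (Suc N) A} (rows (Suc N) v X) :: ennreal)
   \<in> borel_measurable (PiM (insert N {..<N}) (\<lambda>_. M))"
  unfolding eq[symmetric] by measurable
 have inner: "(\<integral>\<^sup>+ x. indicator {A. \<not> generic (Suc N) A} (rows (Suc N) v (X(N := x))) \<partial>M) = 0"
  if g: "generic N (rows N v X)" for X
 proof -
  let ?A = "rows N v X"
  have "\<forall>S. \<exists>b. S \<subseteq> {..<N} \<longrightarrow> (\<forall>i\<in>S. (\<Sum>j<card S. b j * ?A i j) = ?A i (card S))"
  proof
   fix S
   show "\<exists>b. S \<subseteq> {..<N} \<longrightarrow> (\<forall>i\<in>S. (\<Sum>j<card S. b j * ?A i j) = ?A i (card S))"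
   proof (cases "S \<subseteq> {..<N}")
    case True
    then show ?thesis using generic_cols_solve[OF g True, of "\<lambda>i. ?A i (card S)"] by auto
   qed auto
  qed
  then obtain b where b: "\<And>S i. S \<subseteq> {..<N} ==> i \<in> S ==> (\<Sum>j<card S. b S j * ?A i j) = ?A i (card S)"
   by metis
  have "AE x in M. \<forall>S\<in>Pow {..<N}. v x (card S) \<noteq> (\<Sum>j<card S. b S j * v x j)"
  proof (rule AE_finite_allI)
   fix S assume "S \<in> Pow {..<N}"
   then have "card S \<le> N" using card_mono[of "{..<N}" S] by auto
   then show "AE x in M. v x (card S) \<noteq> (\<Sum>j<card S. b S j * v x j)"
    using Suc.prems by (intro hyp) auto
  qed simp
  then have "AE x in M. indicator {A. \<not> generic (Suc N) A} (rows (Suc N) v (X(N := x))) = (0::ennreal)"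
  proof eventually_elim
   case (elim x)
   let ?B = "rows (Suc N) v (X(N := x))"
   have "generic (Suc N) ?B"
   proof (rule generic_Suc[where b = b])
    show "generic N ?B" using g by (subst generic_cong[of N _ ?A]) (auto simp: rows_def)
    fix S assume S: "S \<subseteq> {..<N}"
    show "?B N (card S) \<noteq> (\<Sum>j<card S. b S j * ?B N j)"
     using elim S by (simp add: rows_def)
    fix i assume "i \<in> S"
    then have "i < N" using S by auto
    then show "(\<Sum>j<card S. b S j * ?B i j) = ?B i (card S)"
     using b[OF S \<open>i \<in> S\<close>] by (simp add: rows_def)
   qed
   then show ?case by simp
  qed
  then have "(\<integral>\<^sup>+ x. indicator {A. \<not> generic (Suc N) A} (rows (Suc N) v (X(N := x))) \<partial>M) = (\<integral>\<^sup>+ x. 0 \<partial>M)"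
   by (rule nn_integral_cong_AE)
  then show ?thesis by simp
 qed
 have "(\<integral>\<^sup>+ X. indicator {A. \<not> generic (Suc N) A} (rows (Suc N) v X) \<partial>PiM {..<Suc N} (\<lambda>_. M)) =
  (\<integral>\<^sup>+ X. \<integral>\<^sup>+ x. indicator {A. \<not> generic (Suc N) A} (rows (Suc N) v (X(N := x))) \<partial>M \<partial>PiM {..<N} (\<lambda>_. M))"
  unfolding eq by (rule product_nn_integral_insert[OF _ _ meas]) auto
 also have "\<dots> = (\<integral>\<^sup>+ X. 0 \<partial>PiM {..<N} (\<lambda>_. M))"
  using Suc inner by (intro nn_integral_cong_AE) (auto elim!: AE_mp)
 finally have "(\<integral>\<^sup>+ X. indicator {A. \<not> generic (Suc N) A} (rows (Suc N) v X) \<partial>PiM {..<Suc N} (\<lambda>_. M)) = 0"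
  by simp
 then have "AE X in PiM {..<Suc N} (\<lambda>_. M). indicator {A. \<not> generic (Suc N) A} (rows (Suc N) v X) = (0::ennreal)"
  by (subst (asm) nn_integral_0_iff_AE) (use meas in \<open>auto simp: eq\<close>)
 then show ?case by eventually_elim (auto simp: indicator_def split: if_splits)
qed

section \<open>Changes of variables for product Lebesgue measure\<close>

abbreviation leb :: "nat set => (nat => real) measure" where
 "leb I \<equiv> PiM I (\<lambda>_. lborel)"

interpretation lebP: product_sigma_finite "\<lambda>_::nat. lborel :: real measure"
 by standard

lemma sigma_finite_leb: "finite I ==> sigma_finite_measure (leb I)"
 by (rule lebP.sigma_finite)

lemma leb_component: "i \<in> I ==> (\<lambda>t. t i) \<in> borel_measurable (leb I)"
 using measurable_component_singleton[of i I "\<lambda>_. lborel :: real measure"] by simp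

text \<open>\<open>D\<close> is the absolute Jacobian. The substitution rule itself is the
  definition, so that composition is immediate and triangular maps can be built coordinate by
  coordinate without determinants.\<close>

definition scales :: "nat set => ((nat => real) => (nat => real)) => real => bool" where
 "scales I \<phi> D \<longleftrightarrow> \<phi> \<in> leb I \<rightarrow>\<^sub>M leb I \<and> 0 < D \<and>
  (\<forall>F\<in>borel_measurable (leb I). (\<integral>\<^sup>+ y. F y \<partial>leb I) = ennreal D * (\<integral>\<^sup>+ z. F (\<phi> z) \<partial>leb I))"

lemma scalesD:
 assumes "scales I \<phi> D"
 shows "\<phi> \<in> leb I \<rightarrow>\<^sub>M leb I" "0 < D"
  "F \<in> borel_measurable (leb I) ==> (\<integral>\<^sup>+ y. F y \<partial>leb I) = ennreal D * (\<integral>\<^sup>+ z. F (\<phi> z) \<partial>leb I)"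
 using assms unfolding scales_def by auto

lemma scales_cong:
 assumes "scales I \<phi> D" "\<And>z. z \<in> space (leb I) ==> \<phi> z = \<psi> z" "D = E"
 shows "scales I \<psi> E"
proof -
 have "\<psi> \<in> leb I \<rightarrow>\<^sub>M leb I" using scalesD(1)[OF assms(1)] assms(2) by (subst measurable_cong[of _ \<psi> \<phi>]) auto
 moreover have "(\<integral>\<^sup>+ z. F (\<psi> z) \<partial>leb I) = (\<integral>\<^sup>+ z. F (\<phi> z) \<partial>leb I)" for F :: "_ => ennreal"
  using assms(2) by (intro nn_integral_cong) auto
 ultimately show ?thesis using assms unfolding scales_def by auto
qed

lemma scales_comp:
 assumes "scales I \<phi> D" "scales I \<psi> E"
 shows "scales I (\<lambda>z. \<psi> (\<phi> z)) (E * D)"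
 unfolding scales_def
proof (intro conjI ballI)
 note [measurable] = scalesD(1)[OF assms(1)] scalesD(1)[OF assms(2)]
 show "(\<lambda>z. \<psi> (\<phi> z)) \<in> leb I \<rightarrow>\<^sub>M leb I" by measurable
 show "0 < E * D" using scalesD(2)[OF assms(1)] scalesD(2)[OF assms(2)] by simp
 fix F :: "(nat => real) => ennreal" assume [measurable]: "F \<in> borel_measurable (leb I)"
 have "(\<lambda>z. F (\<psi> z)) \<in> borel_measurable (leb I)" by measurable
 from scalesD(3)[OF assms(1) this] scalesD(3)[OF assms(2), of F]
 show "(\<integral>\<^sup>+ y. F y \<partial>leb I) = ennreal (E * D) * (\<integral>\<^sup>+ z. F (\<psi> (\<phi> z)) \<partial>leb I)"
  using scalesD(2)[OF assms(1)] scalesD(2)[OF assms(2)]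
  by (simp add: ennreal_mult' mult.assoc)
qed

lemma restrict_fun_upd_leb: "z \<in> space (leb I) ==> j \<notin> I ==> restrict (z(j := t)) I = z"
 by (auto simp: space_PiM PiE_def extensional_def restrict_def fun_eq_iff)

text \<open>Fubini in coordinate \<open>j\<close>: for fixed other coordinates the map is affine
  with slope \<open>c\<close>, and the shift \<open>l\<close> depends only on those
  coordinates.\<close>

lemma scales_insert:
 assumes I: "finite I" "j \<notin> I" and s: "scales I \<phi> D" "c \<noteq> 0"
  and l[measurable]: "l \<in> borel_measurable (leb I)"
 shows "scales (insert j I) (\<lambda>z. (\<phi> (restrict z I))(j := c * z j + l (restrict z I))) (D * \<bar>c\<bar>)"
 unfolding scales_def
proof (intro conjI ballI)
 note [measurable] = scalesD(1)[OF s(1)]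
 have [measurable]: "(\<lambda>z. restrict z I) \<in> leb (insert j I) \<rightarrow>\<^sub>M leb I"
  by (rule measurable_restrict_subset) auto
 have "(\<lambda>z. (\<phi> (restrict z I), c * z j + l (restrict z I))) \<in> leb (insert j I) \<rightarrow>\<^sub>M leb I \<Otimes>\<^sub>M lborel"
  by measurable
 from measurable_comp[OF this measurable_add_dim[of j I "\<lambda>_. lborel"]]
 show "(\<lambda>z. (\<phi> (restrict z I))(j := c * z j + l (restrict z I))) \<in> leb (insert j I) \<rightarrow>\<^sub>M leb (insert j I)"
  by (simp add: comp_def)
 then have mm: "(\<lambda>z. F ((\<phi> (restrict z I))(j := c * z j + l (restrict z I)))) \<in> borel_measurable (leb (insert j I))"
  if "F \<in> borel_measurable (leb (insert j I))" for F :: "(nat => real) => ennreal"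
  using that by (rule measurable_compose)
 show "0 < D * \<bar>c\<bar>" using s scalesD(2) by simp
 fix F :: "(nat => real) => ennreal" assume F[measurable]: "F \<in> borel_measurable (leb (insert j I))"
 have [measurable]: "(\<lambda>(y, t). F (y(j := t))) \<in> borel_measurable (leb I \<Otimes>\<^sub>M lborel)"
  using measurable_comp[OF measurable_add_dim[of j I "\<lambda>_. lborel"] F] by (simp add: comp_def case_prod_beta)
 have "(\<integral>\<^sup>+ y. F y \<partial>leb (insert j I)) = (\<integral>\<^sup>+ y. \<integral>\<^sup>+ t. F (y(j := t)) \<partial>lborel \<partial>leb I)"
  by (rule lebP.product_nn_integral_insert[OF I F])
 also have "\<dots> = ennreal D * (\<integral>\<^sup>+ z. \<integral>\<^sup>+ t. F ((\<phi> z)(j := t)) \<partial>lborel \<partial>leb I)"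
  by (rule scalesD(3)[OF s(1)]) measurable
 also have "(\<integral>\<^sup>+ z. \<integral>\<^sup>+ t. F ((\<phi> z)(j := t)) \<partial>lborel \<partial>leb I) =
  (\<integral>\<^sup>+ z. ennreal \<bar>c\<bar> * (\<integral>\<^sup>+ t. F ((\<phi> z)(j := l z + c * t)) \<partial>lborel) \<partial>leb I)"
 proof (intro nn_integral_cong nn_integral_real_affine s(2))
  fix z assume "z \<in> space (leb I)"
  then have "\<phi> z \<in> space (leb I)" using scalesD(1)[OF s(1)] by (rule measurable_space[rotated])
  then have "(\<lambda>t. F ((\<phi> z)(j := t))) \<in> borel_measurable lborel"
   using measurable_comp[OF measurable_component_update[of "\<phi> z" I "\<lambda>_. lborel" j] F] I by (simp add: comp_def)
  then show "(\<lambda>t. F ((\<phi> z)(j := t))) \<in> borel_measurable borel" by simp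
 qed
 also have "\<dots> = ennreal \<bar>c\<bar> * (\<integral>\<^sup>+ z. (\<integral>\<^sup>+ t. F ((\<phi> z)(j := l z + c * t)) \<partial>lborel) \<partial>leb I)"
  by (rule nn_integral_cmult) measurable
 also have "(\<integral>\<^sup>+ z. (\<integral>\<^sup>+ t. F ((\<phi> z)(j := l z + c * t)) \<partial>lborel) \<partial>leb I) =
  (\<integral>\<^sup>+ z. (\<integral>\<^sup>+ t. F ((\<phi> (restrict (z(j := t)) I))(j := c * (z(j := t)) j + l (restrict (z(j := t)) I))) \<partial>lborel) \<partial>leb I)"
  by (intro nn_integral_cong) (simp only: restrict_fun_upd_leb[OF _ I(2)] fun_upd_same add.commute)
 also have "\<dots> = (\<integral>\<^sup>+ z. F ((\<phi> (restrict z I))(j := c * z j + l (restrict z I))) \<partial>leb (insert j I))"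
  by (rule lebP.product_nn_integral_insert[OF I mm[OF F], symmetric])
 finally show "(\<integral>\<^sup>+ y. F y \<partial>leb (insert j I)) =
   ennreal (D * \<bar>c\<bar>) * (\<integral>\<^sup>+ z. F ((\<phi> (restrict z I))(j := c * z j + l (restrict z I))) \<partial>leb (insert j I))"
  using scalesD(2)[OF s(1)] by (simp add: ennreal_mult mult.assoc)
qed

lemma scales_empty: "scales {} (\<lambda>z. \<lambda>j\<in>{}. f z j) 1"
proof -
 have "(\<lambda>z. \<lambda>j\<in>{}. f z j) \<in> leb {} \<rightarrow>\<^sub>M leb {}" by (rule measurable_restrict) auto
 moreover have "F (\<lambda>j\<in>{}. f z j) = F z" if "z \<in> space (leb {})" for F :: "(nat => real) => ennreal" and z
  using that by (intro arg_cong[where f=F]) (auto simp: space_PiM fun_eq_iff)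
 then have "(\<integral>\<^sup>+ z. F (\<lambda>j\<in>{}. f z j) \<partial>leb {}) = (\<integral>\<^sup>+ z. F z \<partial>leb {})" for F :: "_ => ennreal"
  by (intro nn_integral_cong) auto
 ultimately show ?thesis unfolding scales_def by simp
qed

lemma scales_lower_triangular:
 assumes "\<And>j. j < p ==> s j \<noteq> 0"
 shows "scales {..<p} (\<lambda>z. \<lambda>j\<in>{..<p}. s j * z j + ((\<Sum>l<j. T j l * z l) + c j)) (\<Prod>j<p. \<bar>s j\<bar>)"
 using assms
proof (induction p)
 case 0
 show ?case unfolding lessThan_0 prod.empty by (rule scales_empty)
next
 case (Suc p)
 have "scales (insert p {..<p}) (\<lambda>z. ((\<lambda>z. \<lambda>j\<in>{..<p}. s j * z j + ((\<Sum>l<j. T j l * z l) + c j)) (restrict z {..<p}))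
   (p := s p * z p + (\<lambda>z. (\<Sum>l<p. T p l * z l) + c p) (restrict z {..<p}))) ((\<Prod>j<p. \<bar>s j\<bar>) * \<bar>s p\<bar>)"
  by (rule scales_insert) (use Suc in auto)
 then have "scales {..<Suc p} (\<lambda>z. ((\<lambda>z. \<lambda>j\<in>{..<p}. s j * z j + ((\<Sum>l<j. T j l * z l) + c j)) (restrict z {..<p}))
   (p := s p * z p + (\<lambda>z. (\<Sum>l<p. T p l * z l) + c p) (restrict z {..<p}))) ((\<Prod>j<p. \<bar>s j\<bar>) * \<bar>s p\<bar>)"
  by (simp add: lessThan_Suc)
 then show ?case
 proof (rule scales_cong)
  fix z assume "z \<in> space (leb {..<Suc p})"
  show "((\<lambda>z. \<lambda>j\<in>{..<p}. s j * z j + ((\<Sum>l<j. T j l * z l) + c j)) (restrict z {..<p}))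
   (p := s p * z p + (\<lambda>z. (\<Sum>l<p. T p l * z l) + c p) (restrict z {..<p}))
   = (\<lambda>j\<in>{..<Suc p}. s j * z j + ((\<Sum>l<j. T j l * z l) + c j))" (is "?l = ?r")
  proof
   fix j
   have "(\<Sum>l<i. T j l * restrict z {..<p} l) = (\<Sum>l<i. T j l * z l)" if "i \<le> p" for i
    using that by (intro sum.cong) auto
   then show "?l j = ?r j" by (auto simp: less_Suc_eq)
  qed
 qed simp
qed

lemma scales_upper_triangular:
 assumes "\<And>j. j < p ==> s j \<noteq> 0"
 shows "scales {..<p} (\<lambda>z. \<lambda>j\<in>{..<p}. s j * z j + (\<Sum>l\<in>{j<..<p}. T j l * z l)) (\<Prod>j<p. \<bar>s j\<bar>)"
proof -
 \<comment> \<open>Coordinates are inserted from the top down, each depending only on those already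
   present.\<close>
 have "scales {p - d..<p} (\<lambda>z. \<lambda>j\<in>{p - d..<p}. s j * z j + (\<Sum>l\<in>{j<..<p}. T j l * z l)) (\<Prod>j\<in>{p - d..<p}. \<bar>s j\<bar>)"
  if "d \<le> p" for d
  using that
 proof (induction d)
  case 0
  show ?case by (simp only: diff_zero atLeastLessThan_empty[OF order_refl] prod.empty scales_empty)
 next
  case (Suc d)
  define q where "q = p - Suc d"
  have q: "p - d = Suc q" "q < p" using Suc.prems by (auto simp: q_def)
  have ins: "{q..<p} = insert q {Suc q..<p}" using q by auto
  have "scales (insert q {Suc q..<p}) (\<lambda>z. ((\<lambda>z. \<lambda>j\<in>{Suc q..<p}. s j * z j + (\<Sum>l\<in>{j<..<p}. T j l * z l)) (restrict z {Suc q..<p}))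
   (q := s q * z q + (\<lambda>z. (\<Sum>l\<in>{q<..<p}. T q l * z l)) (restrict z {Suc q..<p}))) ((\<Prod>j\<in>{Suc q..<p}. \<bar>s j\<bar>) * \<bar>s q\<bar>)"
  proof (rule scales_insert)
   show "(\<lambda>z. \<Sum>l\<in>{q<..<p}. T q l * z l) \<in> borel_measurable (leb {Suc q..<p})"
    by (intro borel_measurable_sum borel_measurable_times borel_measurable_const) auto
  qed (use Suc q assms in auto)
  then have "scales {q..<p} (\<lambda>z. ((\<lambda>z. \<lambda>j\<in>{Suc q..<p}. s j * z j + (\<Sum>l\<in>{j<..<p}. T j l * z l)) (restrict z {Suc q..<p}))
   (q := s q * z q + (\<lambda>z. (\<Sum>l\<in>{q<..<p}. T q l * z l)) (restrict z {Suc q..<p}))) ((\<Prod>j\<in>{Suc q..<p}. \<bar>s j\<bar>) * \<bar>s q\<bar>)"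
   by (simp add: ins)
  then have "scales {q..<p} (\<lambda>z. \<lambda>j\<in>{q..<p}. s j * z j + (\<Sum>l\<in>{j<..<p}. T j l * z l)) (\<Prod>j\<in>{q..<p}. \<bar>s j\<bar>)"
  proof (rule scales_cong)
   fix z assume "z \<in> space (leb {q..<p})"
   show "((\<lambda>z. \<lambda>j\<in>{Suc q..<p}. s j * z j + (\<Sum>l\<in>{j<..<p}. T j l * z l)) (restrict z {Suc q..<p}))
    (q := s q * z q + (\<lambda>z. (\<Sum>l\<in>{q<..<p}. T q l * z l)) (restrict z {Suc q..<p}))
    = (\<lambda>j\<in>{q..<p}. s j * z j + (\<Sum>l\<in>{j<..<p}. T j l * z l))" (is "?l = ?r")
   proof
    fix j
    have "(\<Sum>l\<in>{i<..<p}. T j l * restrict z {Suc q..<p} l) = (\<Sum>l\<in>{i<..<p}. T j l * z l)" if "q \<le> i" for i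
     using that by (intro sum.cong) auto
    then show "?l j = ?r j" using q by auto
   qed
  qed (simp add: ins mult.commute)
  then show ?case unfolding q_def .
 qed
 from this[of p] show ?thesis by (simp add: lessThan_atLeast0)
qed

text \<open>Elimination: a shear by the coefficients \<open>c\<close> that express column
  \<open>N\<close> through the earlier columns, followed by the smaller matrix and a last coordinate
  scaled by the Schur complement \<open>s\<close>.\<close>

lemma scales_generic_matrix:
 assumes "generic m A" "N \<le> m"
 shows "\<exists>D. scales {..<N} (\<lambda>b. \<lambda>i\<in>{..<N}. \<Sum>j<N. b j * A i j) D"
 using assms(2)
proof (induction N)
 case 0
 show ?case unfolding lessThan_0 by (rule exI, rule scales_empty)
next
 case (Suc N)
 from Suc.IH[OF Suc_leD[OF Suc.prems]]
 obtain D where D: "scales {..<N} (\<lambda>b. \<lambda>i\<in>{..<N}. \<Sum>j<N. b j * A i j) D" ..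
 have gen: "generic (Suc N) A" using generic_mono[OF assms(1) Suc.prems] .
 obtain c where c: "\<And>i. i < N ==> (\<Sum>j<N. c j * A i j) = A i N"
  using generic_cols_solve[OF gen, of "{..<N}" "\<lambda>i. A i N"] by auto
 define s where "s = A N N - (\<Sum>j<N. c j * A N j)"
 have "s \<noteq> 0"
 proof
  assume s0: "s = 0"
  define d where "d j = (if j = N then -1 else c j)" for j
  have "d N = (\<lambda>_. 0) N"
  proof (rule generic_cols_unique[OF gen order_refl, of d "\<lambda>_. 0"])
   fix i assume "i \<in> {..<Suc N}"
   moreover have "(\<Sum>j<Suc N. d j * A i j) = (\<Sum>j<N. c j * A i j) - A i N"
    by (simp add: d_def)
   ultimately show "(\<Sum>j<card {..<Suc N}. d j * A i j) = (\<Sum>j<card {..<Suc N}. 0 * A i j)"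
    using c s0 by (cases "i = N") (auto simp: s_def less_Suc_eq)
  qed auto
  then show False by (simp add: d_def)
 qed
 have 1: "scales (insert N {..<N}) (\<lambda>b. ((\<lambda>b. \<lambda>i\<in>{..<N}. \<Sum>j<N. b j * A i j) (restrict b {..<N}))
   (N := s * b N + (\<lambda>b. \<Sum>j<N. b j * A N j) (restrict b {..<N}))) (D * \<bar>s\<bar>)"
 proof (rule scales_insert[OF _ _ D \<open>s \<noteq> 0\<close>])
  show "(\<lambda>b. \<Sum>j<N. b j * A N j) \<in> borel_measurable (leb {..<N})"
   by (intro borel_measurable_sum borel_measurable_times borel_measurable_const) auto
 qed auto
 have 2: "scales {..<Suc N} (\<lambda>b. \<lambda>j\<in>{..<Suc N}. 1 * b j + (\<Sum>l\<in>{j<..<Suc N}. (if l = N then c j else 0) * b l)) (\<Prod>j<Suc N. \<bar>1\<bar>)"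
  by (rule scales_upper_triangular) auto
 have "scales {..<Suc N} (\<lambda>b. \<lambda>i\<in>{..<Suc N}. \<Sum>j<Suc N. b j * A i j) ((D * \<bar>s\<bar>) * (\<Prod>j<Suc N. \<bar>1\<bar>))"
 proof (rule scales_cong[OF scales_comp[OF 2 1[folded lessThan_Suc]]])
  fix b assume "b \<in> space (leb {..<Suc N})"
  define e where "e = (\<lambda>j\<in>{..<Suc N}. 1 * b j + (\<Sum>l\<in>{j<..<Suc N}. (if l = N then c j else 0) * b l))"
  have "{N<..<Suc N} = {}" by auto
  then have eN: "e N = b N" by (simp add: e_def)
  have ej: "e j = b j + c j * b N" if "j < N" for j
  proof -
   have "(\<Sum>l\<in>{j<..<Suc N}. (if l = N then c j else 0) * b l) = (\<Sum>l\<in>{j<..<Suc N}. if l = N then c j * b l else 0)"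
    by (intro sum.cong) auto
   then show ?thesis using that by (simp add: e_def)
  qed
  have se: "(\<Sum>j<N. e j * A i j) = (\<Sum>j<N. b j * A i j) + b N * (\<Sum>j<N. c j * A i j)" for i
  proof -
   have "(\<Sum>j<N. e j * A i j) = (\<Sum>j<N. b j * A i j + b N * (c j * A i j))"
    using ej by (intro sum.cong) (auto simp: algebra_simps)
   then show ?thesis by (simp add: sum.distrib sum_distrib_left)
  qed
  show "((\<lambda>b. \<lambda>i\<in>{..<N}. \<Sum>j<N. b j * A i j) (restrict e {..<N}))
   (N := s * e N + (\<lambda>b. \<Sum>j<N. b j * A N j) (restrict e {..<N}))
   = (\<lambda>i\<in>{..<Suc N}. \<Sum>j<Suc N. b j * A i j)" (is "?l = ?r")
  proof
   fix i
   show "?l i = ?r i"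
   proof (cases "i < N")
    case True
    then show ?thesis using c[OF True] by (simp add: se)
   next
    case False
    then show ?thesis by (cases "i = N") (auto simp: se eN s_def algebra_simps)
   qed
  qed
 qed simp
 then show ?case by blast
qed

interpretation lebPP: product_sigma_finite "\<lambda>_::nat. leb {..<p}" for p
 by (intro product_sigma_finite.intro sigma_finite_leb) simp

text \<open>Fubini over the points, each contributing one Jacobian factor.\<close>

lemma nn_integral_scales_points:
 fixes K :: "nat set"
 assumes s: "scales {..<p} \<phi> D" and K: "finite K"
  and F: "F \<in> borel_measurable (PiM K (\<lambda>_. leb {..<p}))"
 shows "(\<integral>\<^sup>+ Y. F Y \<partial>PiM K (\<lambda>_. leb {..<p})) =
  ennreal (D ^ card K) * (\<integral>\<^sup>+ Z. F (\<lambda>i\<in>K. \<phi> (Z i)) \<partial>PiM K (\<lambda>_. leb {..<p}))"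
 using K F
proof (induction K arbitrary: F rule: finite_induct)
 case empty
 have "(\<lambda>i\<in>{}. \<phi> (Z i)) = Z" if "Z \<in> space (PiM {} (\<lambda>_. leb {..<p}))" for Z
  using that by (auto simp: space_PiM fun_eq_iff)
 then have "(\<integral>\<^sup>+ Z. F (\<lambda>i\<in>{}. \<phi> (Z i)) \<partial>PiM {} (\<lambda>_. leb {..<p})) = (\<integral>\<^sup>+ Z. F Z \<partial>PiM {} (\<lambda>_. leb {..<p}))"
  by (intro nn_integral_cong arg_cong[where f=F])
 then show ?case by (simp only: card.empty power_0 ennreal_1 mult_1)
next
 case (insert k K)
 let ?M = "\<lambda>_::nat. leb {..<p}"
 note [measurable] = scalesD(1)[OF s] insert.prems
 have D0: "0 \<le> D" using scalesD(2)[OF s] by simp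
 have F2: "(\<lambda>(Y, y). F (Y(k := y))) \<in> borel_measurable (PiM K ?M \<Otimes>\<^sub>M leb {..<p})"
  using measurable_comp[OF measurable_add_dim[of k K ?M] insert.prems] by (simp add: comp_def case_prod_beta)
 have F3: "(\<lambda>(Y, z). F (Y(k := \<phi> z))) \<in> borel_measurable (PiM K ?M \<Otimes>\<^sub>M leb {..<p})"
 proof -
  have "(\<lambda>x. (fst x, \<phi> (snd x))) \<in> PiM K ?M \<Otimes>\<^sub>M leb {..<p} \<rightarrow>\<^sub>M PiM K ?M \<Otimes>\<^sub>M leb {..<p}" by measurable
  from measurable_comp[OF this F2] show ?thesis by (simp add: comp_def case_prod_beta)
 qed
 interpret lp: sigma_finite_measure "leb {..<p}" by (simp add: sigma_finite_leb)
 have mF4: "(\<lambda>Z. F (\<lambda>i\<in>insert k K. \<phi> (Z i))) \<in> borel_measurable (PiM (insert k K) ?M)"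
  by (rule measurable_compose[OF measurable_restrict insert.prems]) measurable
 have "(\<integral>\<^sup>+ Y. F Y \<partial>PiM (insert k K) ?M) = (\<integral>\<^sup>+ Y. \<integral>\<^sup>+ y. F (Y(k := y)) \<partial>leb {..<p} \<partial>PiM K ?M)"
  by (rule lebPP.product_nn_integral_insert[OF insert.hyps insert.prems])
 also have "\<dots> = (\<integral>\<^sup>+ Y. ennreal D * (\<integral>\<^sup>+ z. F (Y(k := \<phi> z)) \<partial>leb {..<p}) \<partial>PiM K ?M)"
 proof (intro nn_integral_cong scalesD(3)[OF s])
  fix Y assume "Y \<in> space (PiM K ?M)"
  from measurable_comp[OF measurable_component_update[OF this insert.hyps(2)] insert.prems]
  show "(\<lambda>y. F (Y(k := y))) \<in> borel_measurable (leb {..<p})" by (simp add: comp_def)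
 qed
 also have "\<dots> = ennreal D * (\<integral>\<^sup>+ Y. (\<integral>\<^sup>+ z. F (Y(k := \<phi> z)) \<partial>leb {..<p}) \<partial>PiM K ?M)"
  using F3 by (intro nn_integral_cmult sigma_finite_measure.borel_measurable_nn_integral[OF sigma_finite_leb] finite_lessThan)
 also have "(\<integral>\<^sup>+ Y. (\<integral>\<^sup>+ z. F (Y(k := \<phi> z)) \<partial>leb {..<p}) \<partial>PiM K ?M) =
  ennreal (D ^ card K) * (\<integral>\<^sup>+ Z. (\<integral>\<^sup>+ z. F ((\<lambda>i\<in>K. \<phi> (Z i))(k := \<phi> z)) \<partial>leb {..<p}) \<partial>PiM K ?M)"
  using F3 by (intro insert.IH sigma_finite_measure.borel_measurable_nn_integral[OF sigma_finite_leb] finite_lessThan)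
 also have "(\<integral>\<^sup>+ Z. (\<integral>\<^sup>+ z. F ((\<lambda>i\<in>K. \<phi> (Z i))(k := \<phi> z)) \<partial>leb {..<p}) \<partial>PiM K ?M) =
  (\<integral>\<^sup>+ Z. (\<integral>\<^sup>+ z. F (\<lambda>i\<in>insert k K. \<phi> ((Z(k := z)) i)) \<partial>leb {..<p}) \<partial>PiM K ?M)"
  using insert.hyps by (intro nn_integral_cong arg_cong[where f=F]) (auto simp: fun_eq_iff)
 also have "\<dots> = (\<integral>\<^sup>+ Z. F (\<lambda>i\<in>insert k K. \<phi> (Z i)) \<partial>PiM (insert k K) ?M)"
  by (rule lebPP.product_nn_integral_insert[OF insert.hyps mF4, symmetric])
 finally show ?case unfolding card_insert_disjoint[OF insert.hyps] using D0
  by (simp only: power_Suc ennreal_mult zero_le_power mult.assoc)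
qed

text \<open>Separates the last coordinates of all points, so that these heights can be exchanged for
  the coefficients of a hyperplane while the projected points stay fixed.\<close>

lemma nn_integral_split_points:
 assumes K: "finite K" and F: "F \<in> borel_measurable (PiM K (\<lambda>_. leb {..<Suc p}))"
 shows "(\<integral>\<^sup>+ X. F X \<partial>PiM K (\<lambda>_. leb {..<Suc p})) =
  (\<integral>\<^sup>+ Y. \<integral>\<^sup>+ t. F (\<lambda>i\<in>K. (Y i)(p := t i)) \<partial>leb K \<partial>PiM K (\<lambda>_. leb {..<p}))"
 using K F
proof (induction K arbitrary: F rule: finite_induct)
 case empty
 have "(\<lambda>i\<in>{}. (Y i)(p := t i)) = (\<lambda>_. undefined)" for Y :: "nat => nat => real" and t by (auto simp: fun_eq_iff)
 then show ?case by (simp add: PiM_empty nn_integral_count_space_finite)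
next
 case (insert k K)
 let ?M = "\<lambda>_::nat. leb {..<p}" and ?S = "\<lambda>_::nat. leb {..<Suc p}"
 interpret lp: sigma_finite_measure "leb {..<p}" by (simp add: sigma_finite_leb)
 interpret ls: sigma_finite_measure "leb {..<Suc p}" by (simp add: sigma_finite_leb)
 interpret lk: sigma_finite_measure "leb K" using insert.hyps by (simp add: sigma_finite_leb)
 have F2: "(\<lambda>(X, x). F (X(k := x))) \<in> borel_measurable (PiM K ?S \<Otimes>\<^sub>M leb {..<Suc p})"
  using measurable_comp[OF measurable_add_dim[of k K ?S] insert.prems] by (simp add: comp_def case_prod_beta)
 have ad: "(\<lambda>(y, t). y(p := t)) \<in> leb {..<p} \<Otimes>\<^sub>M lborel \<rightarrow>\<^sub>M leb {..<Suc p}"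
  using measurable_add_dim[of p "{..<p}" "\<lambda>_. lborel"] by (simp add: lessThan_Suc)
 have upd: "(\<lambda>z. (f z)(p := g z)) \<in> N \<rightarrow>\<^sub>M leb {..<Suc p}"
  if "f \<in> N \<rightarrow>\<^sub>M leb {..<p}" "g \<in> borel_measurable N" for f g and N :: "'z measure"
 proof -
  have "(\<lambda>z. (f z, g z)) \<in> N \<rightarrow>\<^sub>M leb {..<p} \<Otimes>\<^sub>M lborel" using that by measurable
  from measurable_comp[OF this ad] show ?thesis by (simp add: comp_def)
 qed
 let ?W = "\<lambda>(Y::nat => nat => real) (t::nat => real). \<lambda>i\<in>K. (Y i)(p := t i)"
 have W: "(\<lambda>z. ?W (f z) (g z)) \<in> N \<rightarrow>\<^sub>M PiM K ?S"
  if "f \<in> N \<rightarrow>\<^sub>M PiM K ?M" "g \<in> N \<rightarrow>\<^sub>M leb K" for f g and N :: "'z measure"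
  by (intro measurable_restrict upd measurable_compose[OF that(1) measurable_component_singleton]
    measurable_compose[OF that(2) leb_component])
 have F4: "(\<lambda>z. F ((?W (f z) (g z))(k := (h z)(p := e z)))) \<in> borel_measurable N"
  if [measurable]: "f \<in> N \<rightarrow>\<^sub>M PiM K ?M" "g \<in> N \<rightarrow>\<^sub>M leb K" "h \<in> N \<rightarrow>\<^sub>M leb {..<p}" "e \<in> borel_measurable N"
  for f g h e and N :: "'z measure"
 proof -
  have "(\<lambda>z. (?W (f z) (g z), (h z)(p := e z))) \<in> N \<rightarrow>\<^sub>M PiM K ?S \<Otimes>\<^sub>M leb {..<Suc p}"
   using W[OF that(1,2)] upd[OF that(3,4)] by measurable
  from measurable_comp[OF this F2] show ?thesis by (simp add: comp_def)
 qed
 have mS: "(\<lambda>X. \<integral>\<^sup>+ x. F (X(k := x)) \<partial>leb {..<Suc p}) \<in> borel_measurable (PiM K ?S)"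
  using F2 by (intro sigma_finite_measure.borel_measurable_nn_integral[OF sigma_finite_leb] finite_lessThan)
 have "(\<integral>\<^sup>+ X. F X \<partial>PiM (insert k K) ?S) = (\<integral>\<^sup>+ X. \<integral>\<^sup>+ x. F (X(k := x)) \<partial>leb {..<Suc p} \<partial>PiM K ?S)"
  by (rule lebPP.product_nn_integral_insert[OF insert.hyps insert.prems])
 also have "\<dots> = (\<integral>\<^sup>+ Y. \<integral>\<^sup>+ t. \<integral>\<^sup>+ x. F ((?W Y t)(k := x)) \<partial>leb {..<Suc p} \<partial>leb K \<partial>PiM K ?M)"
  by (rule insert.IH[OF mS])
 also have "\<dots> = (\<integral>\<^sup>+ Y. \<integral>\<^sup>+ t. \<integral>\<^sup>+ y. \<integral>\<^sup>+ u. F ((?W Y t)(k := y(p := u))) \<partial>lborel \<partial>leb {..<p} \<partial>leb K \<partial>PiM K ?M)"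
 proof (intro nn_integral_cong)
  fix Y t assume Y: "Y \<in> space (PiM K ?M)" and t: "t \<in> space (leb K)"
  have "?W Y t \<in> space (PiM K ?S)"
   using Y t by (auto simp: space_PiM PiE_def Pi_def extensional_def)
  from measurable_comp[OF measurable_component_update[OF this insert.hyps(2)] insert.prems]
  have "(\<lambda>x. F ((?W Y t)(k := x))) \<in> borel_measurable (leb (insert p {..<p}))"
   by (simp add: comp_def lessThan_Suc)
  from lebP.product_nn_integral_insert[OF _ _ this]
  show "(\<integral>\<^sup>+ x. F ((?W Y t)(k := x)) \<partial>leb {..<Suc p}) =
   (\<integral>\<^sup>+ y. \<integral>\<^sup>+ u. F ((?W Y t)(k := y(p := u))) \<partial>lborel \<partial>leb {..<p})" by (simp add: lessThan_Suc)
 qed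
 \<comment> \<open>The projection of the new point is moved in front of the old heights, so that it
   joins the outer product.\<close>
 also have "\<dots> = (\<integral>\<^sup>+ Y. \<integral>\<^sup>+ y. \<integral>\<^sup>+ t. \<integral>\<^sup>+ u. F ((?W Y t)(k := y(p := u))) \<partial>lborel \<partial>leb K \<partial>leb {..<p} \<partial>PiM K ?M)"
 proof (rule nn_integral_cong)
  fix Y assume Y: "Y \<in> space (PiM K ?M)"
  interpret pair_sigma_finite "leb {..<p}" "leb K" by standard
  show "(\<integral>\<^sup>+ t. \<integral>\<^sup>+ y. \<integral>\<^sup>+ u. F ((?W Y t)(k := y(p := u))) \<partial>lborel \<partial>leb {..<p} \<partial>leb K) =
   (\<integral>\<^sup>+ y. \<integral>\<^sup>+ t. \<integral>\<^sup>+ u. F ((?W Y t)(k := y(p := u))) \<partial>lborel \<partial>leb K \<partial>leb {..<p})"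
  proof (rule Fubini')
   have "(\<lambda>w. F ((?W Y (snd (fst w)))(k := (fst (fst w))(p := snd w)))) \<in> borel_measurable ((leb {..<p} \<Otimes>\<^sub>M leb K) \<Otimes>\<^sub>M lborel)"
    using Y by (intro F4) measurable
   then have "(\<lambda>z. \<integral>\<^sup>+ u. F ((?W Y (snd z))(k := (fst z)(p := u))) \<partial>lborel) \<in> borel_measurable (leb {..<p} \<Otimes>\<^sub>M leb K)"
    by (intro lborel.borel_measurable_nn_integral) (simp add: case_prod_beta)
   then show "(\<lambda>(y, t). \<integral>\<^sup>+ u. F ((?W Y t)(k := y(p := u))) \<partial>lborel) \<in> borel_measurable (leb {..<p} \<Otimes>\<^sub>M leb K)"
    by (simp add: case_prod_beta)
  qed
 qed
 also have "\<dots> = (\<integral>\<^sup>+ Y. \<integral>\<^sup>+ y. \<integral>\<^sup>+ t. F (\<lambda>i\<in>insert k K. ((Y(k := y)) i)(p := t i)) \<partial>leb (insert k K) \<partial>leb {..<p} \<partial>PiM K ?M)"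
 proof (intro nn_integral_cong)
  fix Y y assume Y: "Y \<in> space (PiM K ?M)" and y: "y \<in> space (leb {..<p})"
  have eq: "(\<lambda>i\<in>insert k K. ((Y(k := y)) i)(p := (t(k := u)) i)) = (?W Y t)(k := y(p := u))" for t u
   using insert.hyps by (auto simp: fun_eq_iff)
  have "(\<lambda>t. \<lambda>i\<in>insert k K. ((Y(k := y)) i)(p := t i)) \<in> leb (insert k K) \<rightarrow>\<^sub>M PiM (insert k K) ?S"
  proof (intro measurable_restrict upd measurable_const leb_component)
   fix i assume "i \<in> insert k K"
   then show "(Y(k := y)) i \<in> space (leb {..<p})" using Y y by (auto simp: space_PiM PiE_def Pi_def)
  qed
  from measurable_comp[OF this insert.prems]
  have "(\<lambda>t. F (\<lambda>i\<in>insert k K. ((Y(k := y)) i)(p := t i))) \<in> borel_measurable (leb (insert k K))" by (simp add: comp_def)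
  from lebP.product_nn_integral_insert[OF insert.hyps this]
  show "(\<integral>\<^sup>+ t. \<integral>\<^sup>+ u. F ((?W Y t)(k := y(p := u))) \<partial>lborel \<partial>leb K) =
   (\<integral>\<^sup>+ t. F (\<lambda>i\<in>insert k K. ((Y(k := y)) i)(p := t i)) \<partial>leb (insert k K))"
   unfolding eq by simp
 qed
 also have "\<dots> = (\<integral>\<^sup>+ Y. \<integral>\<^sup>+ t. F (\<lambda>i\<in>insert k K. (Y i)(p := t i)) \<partial>leb (insert k K) \<partial>PiM (insert k K) ?M)"
 proof (rule lebPP.product_nn_integral_insert[OF insert.hyps, symmetric])
  interpret lkk: sigma_finite_measure "leb (insert k K)" using insert.hyps by (simp add: sigma_finite_leb)
  have "(\<lambda>z. \<lambda>i\<in>insert k K. (fst z i)(p := snd z i)) \<in> PiM (insert k K) ?M \<Otimes>\<^sub>M leb (insert k K) \<rightarrow>\<^sub>M PiM (insert k K) ?S"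
   by (intro measurable_restrict upd) measurable
  from measurable_comp[OF this insert.prems]
  show "(\<lambda>Y. \<integral>\<^sup>+ t. F (\<lambda>i\<in>insert k K. (Y i)(p := t i)) \<partial>leb (insert k K)) \<in> borel_measurable (PiM (insert k K) ?M)"
   using insert.hyps
   by (intro sigma_finite_measure.borel_measurable_nn_integral[OF sigma_finite_leb]) (simp_all add: comp_def case_prod_beta)
 qed
 finally show ?case .
qed

subsection \<open>Beta densities\<close>

text \<open>The Beta integral after substituting a square, which gives half of the symmetric
  integral; reflection supplies the other half.\<close>

lemma nn_integral_beta_unit:
 fixes g :: real
 assumes g: "g > -1"
 shows "(\<integral>\<^sup>+ t. ennreal (if t\<^sup>2 < 1 then (1 - t\<^sup>2) powr g else 0) \<partial>lborel) = ennreal (Beta (1 / 2) (g + 1))"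
proof -
 have "((\<lambda>t. t powr (-1 / 2) * (1 - t) powr g) has_integral Beta (1 / 2) (g + 1)) {0..1}"
  using has_integral_Beta_real[of "1/2" "g + 1"] g by simp
 from nn_integral_has_integral_lebesgue[OF _ this] have
   "ennreal (Beta (1 / 2) (g + 1)) =
    nn_integral lborel (\<lambda>t. ennreal (t powr (-1 / 2) * (1 - t) powr g * indicator {0^2..1^2} t))"
  by (simp add: mult_ac ennreal_mult' ennreal_indicator)
 also have "\<dots> = (\<integral>\<^sup>+ x. ennreal (x\<^sup>2 powr - (1 / 2) * (1 - x\<^sup>2) powr g * (2 * x) * indicator {0..1} x) \<partial>lborel)"
  by (subst nn_integral_substitution[where g = "\<lambda>x. x ^ 2" and g' = "\<lambda>x. 2 * x"])
    (auto intro!: derivative_eq_intros continuous_intros simp: set_borel_measurable_def)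
 also have "\<dots> = (\<integral>\<^sup>+ x. 2 * ennreal ((1 - x\<^sup>2) powr g * indicator {0..1} x) \<partial>lborel)"
  by (intro nn_integral_cong_AE AE_I[of _ _ "{0}"])
    (auto simp: indicator_def powr_minus powr_half_sqrt field_split_simps ennreal_mult')
 also have "\<dots> = (\<integral>\<^sup>+ x. ennreal ((1 - x\<^sup>2) powr g * indicator {0..1} x) \<partial>lborel) +
          (\<integral>\<^sup>+ x. ennreal ((1 - x\<^sup>2) powr g * indicator {0..1} x) \<partial>lborel)"
  (is "_ = ?I + _") by (simp add: mult_2 nn_integral_add)
 also have "?I = (\<integral>\<^sup>+ x. ennreal ((1 - x\<^sup>2) powr g * indicator {-1..0} x) \<partial>lborel)"
  by (subst nn_integral_real_affine[of _ "-1" 0])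
    (auto simp: indicator_def intro!: nn_integral_cong)
 hence "?I + ?I = \<dots> + ?I" by simp
 also have "\<dots> = (\<integral>\<^sup>+ x. ennreal ((1 - x\<^sup>2) powr g * (indicator {-1..0} x + indicator{0..1} x)) \<partial>lborel)"
  by (subst nn_integral_add [symmetric]) (auto simp: algebra_simps)
 also have "\<dots> = (\<integral>\<^sup>+ t. ennreal (if t\<^sup>2 < 1 then (1 - t\<^sup>2) powr g else 0) \<partial>lborel)"
 proof (intro nn_integral_cong_AE AE_I[of _ _ "{0, 1, -1}"])
  have k: "(1 - x\<^sup>2) powr g * (indicator {-1..0} x + indicator{0..1} x) = (if x\<^sup>2 < 1 then (1 - x\<^sup>2) powr g else 0)"
   if "x \<noteq> 0" "x \<noteq> 1" "x \<noteq> - 1" for x :: real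
  proof (cases "x\<^sup>2 < 1")
   case True
   then have "\<bar>x\<bar> < 1" by (simp add: abs_square_less_1)
   then show ?thesis using True that by (auto simp: indicator_def)
  next
   case False
   then have "\<not> \<bar>x\<bar> < 1" by (simp add: abs_square_less_1)
   then show ?thesis using False that by (auto simp: indicator_def)
  qed
  show "{x \<in> space lborel. ennreal ((1 - x\<^sup>2) powr g * (indicator {-1..0} x + indicator{0..1} x)) \<noteq>
   ennreal (if x\<^sup>2 < 1 then (1 - x\<^sup>2) powr g else 0)} \<subseteq> {0, 1, -1}" (is "?S \<subseteq> _")
  proof
   fix x assume x: "x \<in> ?S"
   show "x \<in> {0, 1, -1}"
   proof (rule ccontr)
    assume "x \<notin> {0, 1, -1}"
    then show False using k[of x] x by simp
   qed
  qed
 qed (auto simp: emeasure_lborel_countable)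
 finally show ?thesis ..
qed

lemma nn_integral_beta_scaled:
 fixes g q :: real
 assumes g: "g > -1" and q: "q > 0"
 shows "(\<integral>\<^sup>+ t. ennreal (if t\<^sup>2 < q then (q - t\<^sup>2) powr g else 0) \<partial>lborel)
  = ennreal (Beta (1 / 2) (g + 1) * q powr (g + 1 / 2))"
proof -
 have "(\<integral>\<^sup>+ t. ennreal (if t\<^sup>2 < q then (q - t\<^sup>2) powr g else 0) \<partial>lborel) =
  ennreal \<bar>sqrt q\<bar> * (\<integral>\<^sup>+ t. ennreal (if (0 + sqrt q * t)\<^sup>2 < q then (q - (0 + sqrt q * t)\<^sup>2) powr g else 0) \<partial>lborel)"
  using q by (intro nn_integral_real_affine) auto
 also have "(\<integral>\<^sup>+ t. ennreal (if (0 + sqrt q * t)\<^sup>2 < q then (q - (0 + sqrt q * t)\<^sup>2) powr g else 0) \<partial>lborel) =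
  (\<integral>\<^sup>+ t. ennreal (q powr g) * ennreal (if t\<^sup>2 < 1 then (1 - t\<^sup>2) powr g else 0) \<partial>lborel)"
 proof (intro nn_integral_cong)
  fix t :: real
  have "(0 + sqrt q * t)\<^sup>2 = q * t\<^sup>2" using q by (simp add: power_mult_distrib)
  moreover have "q * t\<^sup>2 < q \<longleftrightarrow> t\<^sup>2 < 1" using q by simp
  moreover have "(q - q * t\<^sup>2) powr g = q powr g * (1 - t\<^sup>2) powr g" if "t\<^sup>2 < 1"
   using q that powr_mult[of q "1 - t\<^sup>2" g] by (simp add: algebra_simps)
  ultimately show "ennreal (if (0 + sqrt q * t)\<^sup>2 < q then (q - (0 + sqrt q * t)\<^sup>2) powr g else 0)
   = ennreal (q powr g) * ennreal (if t\<^sup>2 < 1 then (1 - t\<^sup>2) powr g else 0)"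
   by (simp add: ennreal_mult)
 qed
 also have "\<dots> = ennreal (q powr g) * ennreal (Beta (1 / 2) (g + 1))"
  by (subst nn_integral_cmult) (auto simp: nn_integral_beta_unit[OF g])
 also have "ennreal \<bar>sqrt q\<bar> * \<dots> = ennreal (Beta (1 / 2) (g + 1) * q powr (g + 1 / 2))"
 proof -
  have "sqrt q * q powr g = q powr (g + 1 / 2)"
   using q by (simp add: powr_add powr_half_sqrt)
  moreover have "0 < Beta (1 / 2) (g + 1)"
   using g by (simp add: Beta_def Gamma_real_pos)
  ultimately show ?thesis using q
   by (simp add: ennreal_mult'[symmetric] ac_simps)
 qed
 finally show ?thesis .
qed

lemma beta_const_pos: "0 \<le> m ==> g > -1 ==> 0 < beta_const m g"
 unfolding beta_const_def by (intro divide_pos_pos mult_pos_pos Gamma_real_pos) auto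

text \<open>The factor that arises when one coordinate is integrated out, so the normalising
  constants are consistent under marginals.\<close>

lemma beta_const_Suc:
 assumes "g > -1"
 shows "beta_const (real (Suc m)) g * Beta (1 / 2) (g + 1) = beta_const (real m) (g + 1 / 2)"
proof -
 have "0 < Gamma (g + 1)" using assms by (intro Gamma_real_pos) auto
 moreover have "pi powr (real (Suc m) / 2) = pi powr (real m / 2) * sqrt pi"
  by (simp add: add_divide_distrib powr_add powr_half_sqrt)
 moreover have "Gamma (1 / 2) = sqrt pi" by (rule Gamma_one_half_real)
 ultimately show ?thesis unfolding beta_const_def Beta_def
  by (simp add: field_simps)
qed

lemma beta_const_1:
 assumes "s > -1"
 shows "beta_const 1 s * Beta (1 / 2) (s + 1) = 1"
proof -
 have "0 < Gamma (3 / 2 + s)" using assms by (intro Gamma_real_pos) auto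
 moreover have "0 < Beta (1 / 2) (s + 1)" using assms by (simp add: Beta_def Gamma_real_pos)
 ultimately show ?thesis using beta_const_Suc[OF assms, of 0] by (simp add: beta_const_def)
qed

text \<open>The beta density on functions instead of vectors: the dimension \<open>m\<close> becomes
  an ordinary number and can be lowered.\<close>

definition bdens :: "nat => real => (nat => real) => real" where
 "bdens m g y = (if (\<Sum>j<m. (y j)\<^sup>2) < 1 then beta_const (real m) g * (1 - (\<Sum>j<m. (y j)\<^sup>2)) powr g else 0)"

definition bdist :: "nat => real => (nat => real) measure" where
 "bdist m g = density (leb {..<m}) (\<lambda>y. ennreal (bdens m g y))"

lemma bdens_nonneg: "g > -1 ==> 0 \<le> bdens m g y"
 using beta_const_pos[of "real m" g] by (simp add: bdens_def)

lemma bdens_measurable [measurable]: "bdens m g \<in> borel_measurable (leb {..<m})"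
proof -
 have [measurable]: "(\<lambda>y. \<Sum>j<m. (y j)\<^sup>2) \<in> borel_measurable (leb {..<m})"
  by (intro borel_measurable_sum borel_measurable_power leb_component)
 show ?thesis unfolding bdens_def[abs_def] by measurable
qed

lemma space_bdist [simp]: "space (bdist m g) = space (leb {..<m})"
 and sets_bdist [simp, measurable_cong]: "sets (bdist m g) = sets (leb {..<m})"
 by (simp_all add: bdist_def)

text \<open>For fixed earlier coordinates the last one runs over an interval of half-length sqrt q,
  and the scaled Beta integral produces the power g + 1/2 of q.\<close>

lemma bdens_integrate_last:
 assumes "g > -1"
 shows "(\<integral>\<^sup>+ t. ennreal (bdens (Suc m) g (y(m := t))) \<partial>lborel) = ennreal (bdens m (g + 1 / 2) y)"
proof -
 define q where "q = 1 - (\<Sum>j<m. (y j)\<^sup>2)"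
 have s: "(\<Sum>j<Suc m. ((y(m := t)) j)\<^sup>2) = 1 - q + t\<^sup>2" for t by (simp add: q_def)
 have c: "0 < beta_const (real (Suc m)) g" using assms by (intro beta_const_pos) auto
 have e: "bdens (Suc m) g (y(m := t)) = beta_const (real (Suc m)) g * (if t\<^sup>2 < q then (q - t\<^sup>2) powr g else 0)" for t
  unfolding bdens_def s by (simp add: algebra_simps)
 have "(\<integral>\<^sup>+ t. ennreal (bdens (Suc m) g (y(m := t))) \<partial>lborel) =
  ennreal (beta_const (real (Suc m)) g) * (\<integral>\<^sup>+ t. ennreal (if t\<^sup>2 < q then (q - t\<^sup>2) powr g else 0) \<partial>lborel)"
  unfolding e using c by (simp add: ennreal_mult nn_integral_cmult)
 also have "\<dots> = ennreal (bdens m (g + 1 / 2) y)"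
 proof (cases "0 < q")
  case True
  have "Beta (1 / 2) (g + 1) \<ge> 0" using assms by (simp add: Beta_def Gamma_real_pos less_imp_le)
  then show ?thesis unfolding nn_integral_beta_scaled[OF assms True]
   using c True beta_const_Suc[OF assms, of m]
   by (simp add: bdens_def ennreal_mult'[symmetric] q_def mult.assoc[symmetric])
 next
  case False
  then have "\<not> t\<^sup>2 < q" for t by (smt (verit) zero_le_power2)
  then show ?thesis using False by (simp add: bdens_def q_def)
 qed
 finally show ?thesis .
qed

lemma nn_integral_bdens_drop:
 assumes g: "g > -1" and F: "F \<in> borel_measurable (leb {..<m})"
 shows "(\<integral>\<^sup>+ y. ennreal (bdens (Suc m) g y) * F (restrict y {..<m}) \<partial>leb {..<Suc m}) =
  (\<integral>\<^sup>+ y. ennreal (bdens m (g + 1 / 2) y) * F y \<partial>leb {..<m})"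
proof -
 have r[measurable]: "(\<lambda>y. restrict y {..<m}) \<in> leb {..<Suc m} \<rightarrow>\<^sub>M leb {..<m}"
  by (rule measurable_restrict_subset) auto
 note [measurable] = F measurable_compose[OF r F]
 have "(\<lambda>y. ennreal (bdens (Suc m) g y) * F (restrict y {..<m})) \<in> borel_measurable (leb {..<Suc m})"
  by measurable
 then have "(\<integral>\<^sup>+ y. ennreal (bdens (Suc m) g y) * F (restrict y {..<m}) \<partial>leb {..<Suc m}) =
  (\<integral>\<^sup>+ y. \<integral>\<^sup>+ t. ennreal (bdens (Suc m) g (y(m := t))) * F (restrict (y(m := t)) {..<m}) \<partial>lborel \<partial>leb {..<m})"
  unfolding lessThan_Suc by (intro lebP.product_nn_integral_insert) auto
 also have "\<dots> = (\<integral>\<^sup>+ y. (\<integral>\<^sup>+ t. ennreal (bdens (Suc m) g (y(m := t))) \<partial>lborel) * F y \<partial>leb {..<m})"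
 proof (intro nn_integral_cong)
  fix y assume y: "y \<in> space (leb {..<m})"
  have "(\<lambda>t. y(m := t)) \<in> lborel \<rightarrow>\<^sub>M leb {..<Suc m}"
   unfolding lessThan_Suc by (rule measurable_component_update[OF y]) auto
  from measurable_compose[OF this bdens_measurable]
  have [measurable]: "(\<lambda>t. bdens (Suc m) g (y(m := t))) \<in> borel_measurable lborel" .
  have "restrict (y(m := t)) {..<m} = y" for t by (rule restrict_fun_upd_leb[OF y]) auto
  then show "(\<integral>\<^sup>+ t. ennreal (bdens (Suc m) g (y(m := t))) * F (restrict (y(m := t)) {..<m}) \<partial>lborel) =
   (\<integral>\<^sup>+ t. ennreal (bdens (Suc m) g (y(m := t))) \<partial>lborel) * F y"
   by (simp only:) (rule nn_integral_multc, measurable)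
 qed
 also have "\<dots> = (\<integral>\<^sup>+ y. ennreal (bdens m (g + 1 / 2) y) * F y \<partial>leb {..<m})"
  by (simp only: bdens_integrate_last[OF g])
 finally show ?thesis .
qed

lemma nn_integral_bdens: "g > -1 ==> (\<integral>\<^sup>+ y. ennreal (bdens m g y) \<partial>leb {..<m}) = 1"
proof (induction m arbitrary: g)
 case 0
 then have "0 < Gamma (g + 1)" by (intro Gamma_real_pos) auto
 then show ?case by (simp add: PiM_empty nn_integral_count_space_finite bdens_def beta_const_def)
next
 case (Suc m)
 have "(\<integral>\<^sup>+ y. ennreal (bdens (Suc m) g y) \<partial>leb {..<Suc m}) = (\<integral>\<^sup>+ y. ennreal (bdens m (g + 1 / 2) y) \<partial>leb {..<m})"
  using nn_integral_bdens_drop[OF Suc.prems, of "\<lambda>_. 1" m] by simp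
 then show ?case using Suc.IH[of "g + 1 / 2"] Suc.prems by simp
qed

lemma prob_space_bdist:
 assumes "g > -1"
 shows "prob_space (bdist m g)"
proof (rule prob_spaceI)
 have "emeasure (bdist m g) (space (bdist m g)) =
  (\<integral>\<^sup>+ y. ennreal (bdens m g y) * indicator (space (leb {..<m})) y \<partial>leb {..<m})"
  unfolding space_bdist unfolding bdist_def by (rule emeasure_density) auto
 also have "\<dots> = (\<integral>\<^sup>+ y. ennreal (bdens m g y) \<partial>leb {..<m})"
  by (intro nn_integral_cong) simp
 finally show "emeasure (bdist m g) (space (bdist m g)) = 1"
  by (simp add: nn_integral_bdens[OF assms])
qed

lemma bdist_marginal:
 assumes g: "g > -1"
 shows "distr (bdist (Suc m) g) (leb {..<m}) (\<lambda>y. restrict y {..<m}) = bdist m (g + 1 / 2)"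
proof (rule measure_eqI)
 have r[measurable]: "(\<lambda>y. restrict y {..<m}) \<in> leb {..<Suc m} \<rightarrow>\<^sub>M leb {..<m}"
  by (rule measurable_restrict_subset) auto
 fix A assume "A \<in> sets (distr (bdist (Suc m) g) (leb {..<m}) (\<lambda>y. restrict y {..<m}))"
 then have A[measurable]: "A \<in> sets (leb {..<m})" by simp
 have "emeasure (distr (bdist (Suc m) g) (leb {..<m}) (\<lambda>y. restrict y {..<m})) A =
  (\<integral>\<^sup>+ y. indicator A y \<partial>distr (bdist (Suc m) g) (leb {..<m}) (\<lambda>y. restrict y {..<m}))"
  by simp
 also have "\<dots> = (\<integral>\<^sup>+ y. indicator A (restrict y {..<m}) \<partial>bdist (Suc m) g)"
  by (rule nn_integral_distr) measurable
 also have "\<dots> = (\<integral>\<^sup>+ y. ennreal (bdens (Suc m) g y) * indicator A (restrict y {..<m}) \<partial>leb {..<Suc m})"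
  unfolding bdist_def by (rule nn_integral_density) measurable
 also have "\<dots> = (\<integral>\<^sup>+ y. ennreal (bdens m (g + 1 / 2) y) * indicator A y \<partial>leb {..<m})"
  by (rule nn_integral_bdens_drop[OF g]) measurable
 also have "\<dots> = emeasure (bdist m (g + 1 / 2)) A"
  unfolding bdist_def by (rule emeasure_density[symmetric]) measurable
 finally show "emeasure (distr (bdist (Suc m) g) (leb {..<m}) (\<lambda>y. restrict y {..<m})) A = emeasure (bdist m (g + 1 / 2)) A" .
qed simp

lemma nn_integral_PiM_bdist:
 assumes g: "g > -1" and K: "finite K" and F[measurable]: "F \<in> borel_measurable (PiM K (\<lambda>_. leb {..<m}))"
 shows "(\<integral>\<^sup>+ X. F X \<partial>PiM K (\<lambda>_::nat. bdist m g)) =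
  (\<integral>\<^sup>+ X. (\<Prod>i\<in>K. ennreal (bdens m g (X i))) * F X \<partial>PiM K (\<lambda>_. leb {..<m}))"
proof -
 let ?L = "PiM K (\<lambda>_::nat. leb {..<m})"
 have mp[measurable]: "(\<lambda>X. \<Prod>i\<in>K. ennreal (bdens m g (X i))) \<in> borel_measurable ?L"
  by measurable
 interpret bd: product_sigma_finite "\<lambda>_::nat. bdist m g"
  using prob_space_bdist[OF g] by (intro product_sigma_finite.intro prob_space_imp_sigma_finite)
 have "density ?L (\<lambda>X. \<Prod>i\<in>K. ennreal (bdens m g (X i))) = PiM K (\<lambda>_. bdist m g)"
 proof (rule bd.PiM_eqI[OF K])
  show "sets (density ?L (\<lambda>X. \<Prod>i\<in>K. ennreal (bdens m g (X i)))) = sets (PiM K (\<lambda>_. bdist m g))"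
   unfolding sets_density by (intro sets_PiM_cong) auto
  fix A assume "\<And>i. i \<in> K ==> A i \<in> sets (bdist m g)"
  then have A[measurable]: "\<And>i. i \<in> K ==> A i \<in> sets (leb {..<m})" by simp
  have B: "PiE K A \<in> sets ?L" using A K by (intro sets_PiM_I_finite) auto
  have "emeasure (density ?L (\<lambda>X. \<Prod>i\<in>K. ennreal (bdens m g (X i)))) (PiE K A) =
   (\<integral>\<^sup>+ X. (\<Prod>i\<in>K. ennreal (bdens m g (X i))) * indicator (PiE K A) X \<partial>?L)"
   by (rule emeasure_density[OF mp B])
  also have "\<dots> = (\<integral>\<^sup>+ X. (\<Prod>i\<in>K. ennreal (bdens m g (X i)) * indicator (A i) (X i)) \<partial>?L)"
  proof (intro nn_integral_cong)
   fix X assume X: "X \<in> space ?L"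
   have "indicator (PiE K A) X = (\<Prod>i\<in>K. indicator (A i) (X i) :: ennreal)"
   proof (cases "X \<in> PiE K A")
    case True
    then show ?thesis by (auto simp: PiE_def Pi_def intro!: prod.neutral[symmetric])
   next
    case False
    then obtain i where "i \<in> K" "X i \<notin> A i" using X by (auto simp: space_PiM PiE_def)
    then show ?thesis using False K by (auto intro!: prod_zero[symmetric] bexI[of _ i])
   qed
   then show "(\<Prod>i\<in>K. ennreal (bdens m g (X i))) * indicator (PiE K A) X =
    (\<Prod>i\<in>K. ennreal (bdens m g (X i)) * indicator (A i) (X i))" by (simp add: prod.distrib)
  qed
  also have "\<dots> = (\<Prod>i\<in>K. \<integral>\<^sup>+ x. ennreal (bdens m g x) * indicator (A i) x \<partial>leb {..<m})"
   by (rule lebPP.product_nn_integral_prod[OF K]) measurable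
  also have "\<dots> = (\<Prod>i\<in>K. emeasure (bdist m g) (A i))"
   unfolding bdist_def using A by (intro prod.cong emeasure_density[symmetric]) auto
  finally show "emeasure (density ?L (\<lambda>X. \<Prod>i\<in>K. ennreal (bdens m g (X i)))) (PiE K A)
   = (\<Prod>i\<in>K. emeasure (bdist m g) (A i))" .
 qed
 then have "(\<integral>\<^sup>+ X. F X \<partial>PiM K (\<lambda>_. bdist m g)) = (\<integral>\<^sup>+ X. F X \<partial>density ?L (\<lambda>X. \<Prod>i\<in>K. ennreal (bdens m g (X i))))"
  by simp
 also have "\<dots> = (\<integral>\<^sup>+ X. (\<Prod>i\<in>K. ennreal (bdens m g (X i))) * F X \<partial>?L)"
  by (rule nn_integral_density) measurable
 finally show ?thesis .
qed

subsection \<open>The hyperplane through the vertices\<close>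

text \<open>Homogeneous coordinates: affine functions of a point are linear in
  \<open>hv\<close>.\<close>

definition hv :: "nat => (nat => real) => nat => real" where
 "hv p x j = (case j of 0 => 1 | Suc i => if i < p then x i else 0)"

lemma hv_simps [simp]: "hv p x 0 = 1" "i < p ==> hv p x (Suc i) = x i" "\<not> i < p ==> hv p x (Suc i) = 0"
 by (simp_all add: hv_def)

lemma measurable_hv [measurable]: "(\<lambda>x. hv p x j) \<in> borel_measurable (leb {..<p})"
proof (cases j)
 case (Suc i)
 then show ?thesis by (cases "i < p") (auto intro: leb_component)
qed simp

text \<open>Fubini in the coordinate \<open>m - 1\<close>, which enters only the entry with index
  \<open>m\<close>: for fixed other coordinates it has to avoid one value.\<close>

lemma hv_generic_AE:
 assumes "m \<le> p"
 shows "AE x in leb {..<p}. hv p x m \<noteq> (\<Sum>j<m. b j * hv p x j)"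
proof (cases m)
 case 0
 then show ?thesis by simp
next
 case (Suc i)
 then have i: "i < p" using assms by simp
 have ins: "{..<p} = insert i ({..<p} - {i})" using i by auto
 let ?F = "\<lambda>x. indicator {0::real} (hv p x m - (\<Sum>j<m. b j * hv p x j)) :: ennreal"
 have F: "?F \<in> borel_measurable (leb {..<p})"
  by (intro measurable_compose[OF _ borel_measurable_indicator[of "{0}" borel]]) auto
 then have "(\<integral>\<^sup>+ x. ?F x \<partial>leb (insert i ({..<p} - {i}))) = (\<integral>\<^sup>+ x. \<integral>\<^sup>+ t. ?F (x(i := t)) \<partial>lborel \<partial>leb ({..<p} - {i}))"
  by (intro lebP.product_nn_integral_insert) (simp_all only: ins[symmetric], auto)
 then have "(\<integral>\<^sup>+ x. ?F x \<partial>leb {..<p}) = (\<integral>\<^sup>+ x. \<integral>\<^sup>+ t. ?F (x(i := t)) \<partial>lborel \<partial>leb ({..<p} - {i}))"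
  by (simp only: ins[symmetric])
 also have "\<dots> = (\<integral>\<^sup>+ x. 0 \<partial>leb ({..<p} - {i}))"
 proof (rule nn_integral_cong)
  fix x
  have "hv p (x(i := t)) j = hv p x j" if "j < m" for j t
   using that Suc by (cases j) (auto simp: hv_def)
  then have "(\<Sum>j<m. b j * hv p (x(i := t)) j) = (\<Sum>j<m. b j * hv p x j)" for t by simp
  moreover have "hv p (x(i := t)) m = t" for t using i by (simp add: Suc)
  ultimately have "?F (x(i := t)) = indicator {\<Sum>j<m. b j * hv p x j} t" for t
   by (auto simp: indicator_def)
  then show "(\<integral>\<^sup>+ t. ?F (x(i := t)) \<partial>lborel) = 0" by simp
 qed
 finally have "(\<integral>\<^sup>+ x. ?F x \<partial>leb {..<p}) = 0" by simp
 then have "AE x in leb {..<p}. ?F x = 0" by (subst (asm) nn_integral_0_iff_AE) auto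
 then show ?thesis by eventually_elim (auto simp: indicator_def split: if_splits)
qed

lemma AE_generic_leb: "AE Y in PiM {..<Suc p} (\<lambda>_. leb {..<p}). generic (Suc p) (rows (Suc p) (hv p) Y)"
 by (rule AE_generic[where n = "Suc p"]) (auto intro: sigma_finite_leb hv_generic_AE)

text \<open>The volume of the preimage of the unit cube, hence 1 / |det A| for nonsingular
  \<open>A\<close>: a stand-in for the determinant that is visibly measurable in
  \<open>A\<close>.\<close>

definition boxvol :: "nat => (nat => nat => real) => ennreal" where
 "boxvol m A = (\<integral>\<^sup>+ b. (\<Prod>i<m. indicator {0..1} (\<Sum>j<m. b j * A i j)) \<partial>leb {..<m})"

lemma measurable_boxvol [measurable]: "boxvol m \<in> borel_measurable borel"
proof -
 have "(\<lambda>z. \<Sum>j<m. snd z j * fst z i j) \<in> borel_measurable ((borel :: (nat => nat => real) measure) \<Otimes>\<^sub>M leb {..<m})" for i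
 proof (intro borel_measurable_sum borel_measurable_times)
  fix j assume "j \<in> {..<m}"
  then show "(\<lambda>z. snd z j) \<in> borel_measurable ((borel :: (nat => nat => real) measure) \<Otimes>\<^sub>M leb {..<m})"
   by (intro measurable_compose[OF measurable_snd leb_component])
  show "(\<lambda>z. fst z i j) \<in> borel_measurable ((borel :: (nat => nat => real) measure) \<Otimes>\<^sub>M leb {..<m})"
   by (rule measurable_compose[OF measurable_fst measurable_entry])
 qed
 then have "(\<lambda>z. \<Prod>i<m. indicator {0..1} (\<Sum>j<m. snd z j * fst z i j) :: ennreal)
  \<in> borel_measurable ((borel :: (nat => nat => real) measure) \<Otimes>\<^sub>M leb {..<m})"
  by (intro borel_measurable_prod_ennreal) (auto intro: measurable_compose[OF _ borel_measurable_indicator])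
 then show ?thesis unfolding boxvol_def[abs_def]
  by (intro sigma_finite_measure.borel_measurable_nn_integral[OF sigma_finite_leb]) (auto simp: case_prod_beta)
qed

lemma nn_integral_prod_indicator_box:
 "(\<integral>\<^sup>+ t. (\<Prod>i<m. indicator {0..1} (t i)) \<partial>leb {..<m}) = (1::ennreal)"
 by (subst lebP.product_nn_integral_prod) auto

lemma prod_indicator_box_measurable:
 "(\<lambda>t. \<Prod>i<m. indicator {0..1::real} (t i) :: ennreal) \<in> borel_measurable (leb {..<m})"
 by (intro borel_measurable_prod_ennreal)
  (auto intro!: measurable_compose[OF leb_component borel_measurable_indicator])

text \<open>The heights of \<open>m\<close> generic points are exchanged for the coefficients of the
  hyperplane through them. Testing the substitution rule on the unit cube identifies the
  Jacobian.\<close>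

lemma nn_integral_generic_matrix:
 assumes gen: "generic m A" and F: "F \<in> borel_measurable (leb {..<m})"
 shows "(\<integral>\<^sup>+ t. F t \<partial>leb {..<m}) =
  inverse (boxvol m A) * (\<integral>\<^sup>+ b. F (\<lambda>i\<in>{..<m}. \<Sum>j<m. b j * A i j) \<partial>leb {..<m})"
proof -
 obtain D where D: "scales {..<m} (\<lambda>b. \<lambda>i\<in>{..<m}. \<Sum>j<m. b j * A i j) D"
  using scales_generic_matrix[OF gen order_refl] by blast
 have D0: "0 < D" using scalesD(2)[OF D] .
 have *: "(\<Prod>i<m. indicator {0..1} ((\<lambda>i\<in>{..<m}. \<Sum>j<m. b j * A i j) i) :: ennreal) =
  (\<Prod>i<m. indicator {0..1} (\<Sum>j<m. b j * A i j))" for b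
  by (intro prod.cong) auto
 have 1: "ennreal D * boxvol m A = 1"
  using scalesD(3)[OF D prod_indicator_box_measurable]
  unfolding nn_integral_prod_indicator_box * boxvol_def[symmetric] by (rule sym)
 have "boxvol m A = ennreal (1 / D) * (ennreal D * boxvol m A)"
  using D0 by (simp add: mult.assoc[symmetric] ennreal_mult'[symmetric])
 then have "boxvol m A = ennreal (1 / D)" unfolding 1 by simp
 then have "inverse (boxvol m A) = ennreal D" using D0 by (simp add: inverse_ennreal)
 then show ?thesis using scalesD(3)[OF D F] by simp
qed

section \<open>The section of the unit ball by a hyperplane\<close>

definition rad :: "nat => (nat => real) => nat => real" where
 "rad p b q = sqrt (1 + (\<Sum>j\<in>{q..<p}. (b (Suc j))\<^sup>2))"

text \<open>The signed distance from the origin of the hyperplane on which the last coordinate is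
  b_0 plus the sum of b_(j+1) times the j-th coordinate: \<open>rad p b 0\<close> is the length of
  its normal vector, and the later values of \<open>rad\<close> are the pivots met when squares are
  completed.\<close>

definition ht :: "nat => (nat => real) => real" where
 "ht p b = b 0 / rad p b 0"

text \<open>Diagonal of the triangular parametrisation: the square root is the radius of the
  section, and the quotients of \<open>rad\<close> telescope in the product.\<close>

definition scf :: "nat => (nat => real) => nat => real" where
 "scf p b j = sqrt (1 - (ht p b)\<^sup>2) * rad p b (Suc j) / rad p b j"

definition shearT :: "nat => (nat => real) => nat => nat => real" where
 "shearT p b j l = - (b (Suc j) * b (Suc l) * scf p b l / (rad p b (Suc l))\<^sup>2)"

text \<open>The affine parametrisation of the section of the unit ball by the hyperplane
 with coefficients \<open>b\<close> that arises from completing squares one coordinate at a time;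
 being triangular, it preserves the direction of the last coordinate axis.\<close>

definition aff :: "nat => (nat => real) => (nat => real) => nat => real" where
 "aff p b z = (\<lambda>j\<in>{..<p}. scf p b j * z j +
   ((\<Sum>l<j. shearT p b j l * z l) + - (b (Suc j) * b 0 / (rad p b 0)\<^sup>2)))"

lemma rad_pos: "0 < rad p b q"
 unfolding rad_def by (intro real_sqrt_gt_zero add_pos_nonneg sum_nonneg) auto

lemma rad_sq: "(rad p b q)\<^sup>2 = 1 + (\<Sum>j\<in>{q..<p}. (b (Suc j))\<^sup>2)"
 unfolding rad_def by (intro real_sqrt_pow2 add_nonneg_nonneg sum_nonneg) auto

lemma rad_Suc: "q < p ==> (rad p b q)\<^sup>2 = (rad p b (Suc q))\<^sup>2 + (b (Suc q))\<^sup>2"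
 unfolding rad_sq by (subst sum.atLeast_Suc_lessThan) auto

lemma rad_last: "rad p b p = 1"
 by (simp add: rad_def)

lemma scf_prod:
 "q \<le> p ==> (\<Prod>j<q. scf p b j) = sqrt (1 - (ht p b)\<^sup>2) ^ q * rad p b q / rad p b 0"
proof (induction q)
 case 0
 then show ?case using rad_pos[of p b 0] by simp
next
 case (Suc q)
 then show ?case using rad_pos[of p b q] by (simp add: scf_def)
qed

text \<open>The partial height divided by the squared pivot is a running sum in \<open>z\<close>.
  Thus each new coordinate depends on the earlier ones only through this single number.\<close>

lemma aff_partial:
 assumes "q \<le> p"
 shows "(b 0 + (\<Sum>j<q. b (Suc j) * aff p b z j)) / (rad p b q)\<^sup>2 =
  b 0 / (rad p b 0)\<^sup>2 + (\<Sum>l<q. b (Suc l) * scf p b l * z l / (rad p b (Suc l))\<^sup>2)"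
  (is "?S q / _ = ?T q")
  and "q < p ==> aff p b z q = scf p b q * z q - b (Suc q) * ((b 0 + (\<Sum>j<q. b (Suc j) * aff p b z j)) / (rad p b q)\<^sup>2)"
proof -
 have aff: "aff p b z q = scf p b q * z q - b (Suc q) * ?T q" if "q < p" for q
  using that by (simp add: aff_def shearT_def sum_negf sum_distrib_left algebra_simps)
 have *: "?S q / (rad p b q)\<^sup>2 = ?T q" if "q \<le> p" for q
  using that
 proof (induction q)
  case 0
  then show ?case by simp
 next
  case (Suc q)
  define r r' S T y s \<beta> where "r = rad p b q" "r' = rad p b (Suc q)" "S = ?S q" "T = ?T q"
   "y = aff p b z q" "s = scf p b q * z q" "\<beta> = b (Suc q)"
  have r: "0 < r" "0 < r'" "r\<^sup>2 = r'\<^sup>2 + \<beta>\<^sup>2"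
   using rad_pos rad_Suc[of q p b] Suc.prems by (auto simp: r_r'_S_T_y_s_\<beta>_def)
  have S: "S = r\<^sup>2 * T" using Suc r by (simp add: r_r'_S_T_y_s_\<beta>_def field_simps)
  have y: "y = s - \<beta> * T" using aff[of q] Suc.prems by (simp add: r_r'_S_T_y_s_\<beta>_def)
  have "?S (Suc q) = S + \<beta> * y" by (simp add: r_r'_S_T_y_s_\<beta>_def)
  also have "\<dots> = r'\<^sup>2 * (T + \<beta> * s / r'\<^sup>2)"
   using r by (simp add: S y power2_eq_square algebra_simps)
  finally have "?S (Suc q) / r'\<^sup>2 = T + \<beta> * s / r'\<^sup>2" using r by simp
  then show ?case by (simp add: r_r'_S_T_y_s_\<beta>_def mult.assoc)
 qed
 from *[OF assms] show "?S q / (rad p b q)\<^sup>2 = ?T q" .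
 then show "q < p ==> aff p b z q = scf p b q * z q - b (Suc q) * (?S q / (rad p b q)\<^sup>2)"
  using aff by simp
qed

text \<open>The left-hand side is the squared norm of the point of the hyperplane above
  \<open>aff p b z\<close>, so the unit ball in \<open>z\<close> parametrises the section.\<close>

lemma aff_quadratic:
 assumes "(ht p b)\<^sup>2 \<le> 1"
 shows "(\<Sum>j<p. (aff p b z j)\<^sup>2) + (b 0 + (\<Sum>j<p. b (Suc j) * aff p b z j))\<^sup>2 =
  (ht p b)\<^sup>2 + (1 - (ht p b)\<^sup>2) * (\<Sum>j<p. (z j)\<^sup>2)"
proof -
 let ?S = "\<lambda>q. b 0 + (\<Sum>j<q. b (Suc j) * aff p b z j)"
 \<comment> \<open>Invariant after \<open>q\<close> coordinates: the squared partial height enters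
   divided by the squared pivot, and the pivot is 1 at \<open>q = p\<close>.\<close>
 have "(\<Sum>j<q. (aff p b z j)\<^sup>2) + (?S q)\<^sup>2 / (rad p b q)\<^sup>2 =
  (ht p b)\<^sup>2 + (1 - (ht p b)\<^sup>2) * (\<Sum>j<q. (z j)\<^sup>2)" if "q \<le> p" for q
  using that
 proof (induction q)
  case 0
  then show ?case by (simp add: ht_def power_divide)
 next
  case (Suc q)
  define r r' S y w \<beta> x where "r = rad p b q" "r' = rad p b (Suc q)" "S = ?S q"
   "y = aff p b z q" "w = sqrt (1 - (ht p b)\<^sup>2)" "\<beta> = b (Suc q)" "x = z q"
  note d = r_r'_S_y_w_\<beta>_x_def
  have r: "0 < r" "0 < r'" "r\<^sup>2 = r'\<^sup>2 + \<beta>\<^sup>2"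
   using rad_pos rad_Suc[of q p b] Suc.prems by (auto simp: d)
  have w2: "w\<^sup>2 = 1 - (ht p b)\<^sup>2" using assms by (simp add: d)
  have y: "y = w * r' / r * x - \<beta> * (S / r\<^sup>2)"
   using aff_partial(2)[of q p b z] Suc.prems by (simp add: d scf_def)
  have SS: "?S (Suc q) = S + \<beta> * y" by (simp add: d)
  define u v where "u = w * x / r" "v = S / r\<^sup>2"
  have S: "S = r\<^sup>2 * v" using r by (simp add: u_v_def)
  have wx: "w * x = r * u" using r by (simp add: u_v_def)
  have y': "y = r' * u - \<beta> * v" using y by (simp add: u_v_def mult.commute mult.left_commute)
  have "S + \<beta> * y = r' * (r' * v + \<beta> * u)"
   unfolding S y' r(3) by (simp add: algebra_simps power2_eq_square)
  then have "(S + \<beta> * y)\<^sup>2 / r'\<^sup>2 = (r' * v + \<beta> * u)\<^sup>2"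
   using r by (simp add: power_mult_distrib)
  then have "y\<^sup>2 + (S + \<beta> * y)\<^sup>2 / r'\<^sup>2 = (r' * u - \<beta> * v)\<^sup>2 + (r' * v + \<beta> * u)\<^sup>2"
   by (simp add: y')
  also have "\<dots> = r\<^sup>2 * u\<^sup>2 + r\<^sup>2 * v\<^sup>2"
   unfolding r(3) by (simp add: algebra_simps power2_eq_square)
  also have "r\<^sup>2 * u\<^sup>2 = w\<^sup>2 * x\<^sup>2" using wx by (metis power_mult_distrib)
  also have "r\<^sup>2 * v\<^sup>2 = S\<^sup>2 / r\<^sup>2" using r by (simp add: S power2_eq_square)
  finally have "y\<^sup>2 + (S + \<beta> * y)\<^sup>2 / r'\<^sup>2 = w\<^sup>2 * x\<^sup>2 + S\<^sup>2 / r\<^sup>2" .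
  then have "(aff p b z q)\<^sup>2 + (?S (Suc q))\<^sup>2 / (rad p b (Suc q))\<^sup>2 =
   (1 - (ht p b)\<^sup>2) * (z q)\<^sup>2 + (?S q)\<^sup>2 / (rad p b q)\<^sup>2"
   unfolding SS w2 by (simp only: d)
  then show ?case using Suc by (simp add: algebra_simps)
 qed
 from this[of p] show ?thesis by (simp add: rad_last)
qed

text \<open>Cauchy-Schwarz: no point of the hyperplane is nearer to the origin than its
  distance.\<close>

lemma ht_sq_le:
 "(ht p b)\<^sup>2 \<le> (\<Sum>j<p. (y j)\<^sup>2) + (b 0 + (\<Sum>j<p. b (Suc j) * y j))\<^sup>2"
proof -
 define S where "S = b 0 + (\<Sum>j<p. b (Suc j) * y j)"
 define B where "B = (\<Sum>j<p. (b (Suc j))\<^sup>2)"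
 define Q where "Q = (\<Sum>j<p. (y j)\<^sup>2)"
 define C where "C = (\<Sum>j<p. b (Suc j) * y j)"
 have CS: "C\<^sup>2 \<le> B * Q" unfolding C_def B_def Q_def by (rule Cauchy_Schwarz_ineq_sum)
 have "0 \<le> B" "0 \<le> Q" unfolding B_def Q_def by (auto intro!: sum_nonneg)
 have r: "(rad p b 0)\<^sup>2 = 1 + B" by (simp add: rad_sq B_def lessThan_atLeast0)
 have "(S - C)\<^sup>2 \<le> (1 + B) * (Q + S\<^sup>2)"
 proof -
  have "- 2 * S * C \<le> Q + B * S\<^sup>2"
  proof (cases "B = 0")
   case True
   then have "C = 0" using CS by simp
   then show ?thesis using \<open>0 \<le> Q\<close> True by simp
  next
   case False
   then have B: "0 < B" using \<open>0 \<le> B\<close> by simp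
   have "0 \<le> (C + B * S)\<^sup>2" by simp
   then have "- 2 * S * C * B \<le> C\<^sup>2 + B\<^sup>2 * S\<^sup>2" by (simp add: power2_eq_square algebra_simps)
   also have "\<dots> \<le> (Q + B * S\<^sup>2) * B" using CS by (simp add: power2_eq_square algebra_simps)
   finally have "(- 2 * S * C) * B \<le> (Q + B * S\<^sup>2) * B" by simp
   then show ?thesis using B by (simp only: mult_le_cancel_right_pos)
  qed
  then show ?thesis using CS \<open>0 \<le> Q\<close> \<open>0 \<le> B\<close> by (simp add: power2_eq_square algebra_simps)
 qed
 moreover have "S - C = b 0" by (simp add: S_def C_def)
 ultimately have "(b 0)\<^sup>2 \<le> (1 + B) * (Q + S\<^sup>2)" by simp
 then show ?thesis unfolding ht_def power_divide r S_def[symmetric] Q_def[symmetric]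
  using \<open>0 \<le> B\<close> by (simp add: field_simps)
qed

lemma scf_pos: "(ht p b)\<^sup>2 < 1 ==> 0 < scf p b j"
 unfolding scf_def using rad_pos by (intro divide_pos_pos mult_pos_pos) auto

definition affD :: "nat => (nat => real) => real" where
 "affD p b = sqrt (1 - (ht p b)\<^sup>2) ^ p / rad p b 0"

lemma scales_aff:
 assumes "(ht p b)\<^sup>2 < 1"
 shows "scales {..<p} (aff p b) (affD p b)"
proof (rule scales_cong[OF scales_lower_triangular[of p "scf p b" "shearT p b"
    "\<lambda>j. - (b (Suc j) * b 0 / (rad p b 0)\<^sup>2)"]])
 show "scf p b j \<noteq> 0" for j using scf_pos[OF assms, of j] by simp
 have "(\<Prod>j<p. \<bar>scf p b j\<bar>) = (\<Prod>j<p. scf p b j)"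
  using scf_pos[OF assms] by (intro prod.cong) (auto simp: less_imp_le)
 then show "(\<Prod>j<p. \<bar>scf p b j\<bar>) = affD p b"
  by (simp add: scf_prod rad_last affD_def)
qed (simp add: aff_def)

text \<open>The affine map \<open>aff\<close> in homogeneous coordinates: a lower triangular matrix,
  with positive diagonal as soon as the hyperplane meets the open ball.\<close>

definition affL :: "nat => (nat => real) => nat => nat => real" where
 "affL p b j l = (case j of 0 => 1 | Suc j' =>
  (case l of 0 => - (b (Suc j') * b 0 / (rad p b 0)\<^sup>2)
   | Suc l' => if l' < j' then shearT p b j' l' else scf p b j'))"

lemma hv_aff:
 assumes "j < Suc p"
 shows "hv p (aff p b z) j = (\<Sum>l\<le>j. affL p b j l * hv p z l)"
proof (cases j)
 case (Suc i)
 then have i: "i < p" using assms by simp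
 have "(\<Sum>l\<le>j. affL p b j l * hv p z l) = affL p b j 0 + (\<Sum>l\<le>i. affL p b j (Suc l) * hv p z (Suc l))"
  unfolding Suc by (subst sum.atMost_Suc_shift) simp
 also have "(\<Sum>l\<le>i. affL p b j (Suc l) * hv p z (Suc l)) =
  (\<Sum>l<i. affL p b j (Suc l) * hv p z (Suc l)) + affL p b j (Suc i) * hv p z (Suc i)"
  by (simp flip: lessThan_Suc_atMost)
 also have "(\<Sum>l<i. affL p b j (Suc l) * hv p z (Suc l)) = (\<Sum>l<i. shearT p b i l * z l)"
  using i by (intro sum.cong) (auto simp: affL_def Suc)
 finally show ?thesis using i by (simp add: Suc affL_def aff_def)
qed (simp add: affL_def)

text \<open>Triangular column operations respect the last axis: by forward substitution the earlier
  entries of the target stay 0, and the last one is only rescaled by a positive factor, which the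
  weights absorb.\<close>

lemma feas_triangular:
 assumes M: "0 < M" and I: "finite I"
  and B: "\<And>i j. i \<in> I ==> j < M ==> B i j = (\<Sum>l\<le>j. L j l * A i l)"
  and L: "\<And>j. j < M ==> 0 < L j j"
 shows "feas I k M B (last_unit M) \<longleftrightarrow> feas I k M A (last_unit M)"
proof -
 have swap: "(\<Sum>i\<in>I. f i * B i j) = (\<Sum>l\<le>j. L j l * (\<Sum>i\<in>I. f i * A i l))"
  if "j < M" for f :: "nat => real" and j
 proof -
  have "(\<Sum>i\<in>I. f i * B i j) = (\<Sum>i\<in>I. f i * (\<Sum>l\<le>j. L j l * A i l))"
   using B that by (intro sum.cong) auto
  also have "\<dots> = (\<Sum>l\<le>j. L j l * (\<Sum>i\<in>I. f i * A i l))" by (rule sum_mult_swap)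
  finally show ?thesis .
 qed
 have e: "last_unit M j = 0" if "Suc j < M" for j using that by (simp add: last_unit_def)
 have e1: "last_unit M (M - 1) = 1" using M by (simp add: last_unit_def)
 have top: "(\<Sum>l\<le>M - 1. L (M - 1) l * f l) = L (M - 1) (M - 1) * f (M - 1)"
  if "\<And>l. Suc l < M ==> f l = 0" for f :: "nat => real"
 proof -
  have "(\<Sum>l\<le>M - 1. L (M - 1) l * f l) = (\<Sum>l\<in>{M - 1}. L (M - 1) l * f l)"
   using that by (intro sum.mono_neutral_right) auto
  then show ?thesis by simp
 qed
 show ?thesis
 proof
  assume "feas I k M A (last_unit M)"
  then obtain f where f: "\<And>i. i \<in> I ==> k \<le> i ==> 0 \<le> f i" "\<And>j. j < M ==> (\<Sum>i\<in>I. f i * A i j) = last_unit M j"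
   unfolding feas_def by blast
  \<comment> \<open>The last diagonal entry, by which all weights are divided here and multiplied in
    the converse direction.\<close>
  define c where "c = L (M - 1) (M - 1)"
  have c: "0 < c" using L M by (simp add: c_def)
  have "(\<Sum>i\<in>I. f i / c * B i j) = last_unit M j" if j: "j < M" for j
  proof -
   have "(\<Sum>i\<in>I. f i * B i j) = c * last_unit M j"
   proof (cases "Suc j < M")
    case True
    then have "(\<Sum>l\<le>j. L j l * (\<Sum>i\<in>I. f i * A i l)) = 0"
     using f(2) e by (intro sum.neutral) auto
    then show ?thesis using swap[OF j, of f] e[OF True] by simp
   next
    case False
    then have jM: "j = M - 1" using j by simp
    show ?thesis unfolding swap[OF j] unfolding jM
     by (subst top) (use f(2) e M in \<open>auto simp: c_def\<close>)
   qed
   then show ?thesis using c by (simp add: sum_divide_distrib[symmetric])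
  qed
  then show "feas I k M B (last_unit M)" unfolding feas_def using f(1) c
   by (intro exI[of _ "\<lambda>i. f i / c"]) auto
 next
  assume "feas I k M B (last_unit M)"
  then obtain f where f: "\<And>i. i \<in> I ==> k \<le> i ==> 0 \<le> f i" "\<And>j. j < M ==> (\<Sum>i\<in>I. f i * B i j) = last_unit M j"
   unfolding feas_def by blast
  define v where "v l = (\<Sum>i\<in>I. f i * A i l)" for l
  have v: "(\<Sum>l\<le>j. L j l * v l) = last_unit M j" if "j < M" for j
   using swap[OF that, of f] f(2)[OF that] by (simp add: v_def)
  have v0: "v l = 0" if "Suc l < M" for l
   using that
  proof (induction l rule: less_induct)
   case (less l)
   have "(\<Sum>l'\<le>l. L l l' * v l') = (\<Sum>l'\<in>{l}. L l l' * v l')"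
    using less by (intro sum.mono_neutral_right) auto
   then have "L l l * v l = 0" using v[of l] e[OF less.prems] less.prems by simp
   then show ?case using L[of l] less.prems by simp
  qed
  define c where "c = L (M - 1) (M - 1)"
  have c: "0 < c" using L M by (simp add: c_def)
  have v1: "c * v (M - 1) = 1" using v[of "M - 1"] top[of v] v0 e1 M by (simp add: c_def)
  have "(\<Sum>i\<in>I. c * f i * A i j) = last_unit M j" if "j < M" for j
  proof -
   have "(\<Sum>i\<in>I. c * f i * A i j) = c * v j" by (simp add: v_def sum_distrib_left mult.assoc)
   then show ?thesis using v0[of j] v1 e[of j] e1 that by (cases "Suc j < M") (auto simp: not_less le_Suc_eq less_Suc_eq_le)
  qed
  then show "feas I k M A (last_unit M)" unfolding feas_def using f(1) c
   by (intro exI[of _ "\<lambda>i. c * f i"]) auto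
 qed
qed

text \<open>A column operation acts on the coefficient vectors by the transposed map, which is upper
  triangular.\<close>

lemma boxvol_triangular:
 assumes B: "\<And>i j. i < M ==> j < M ==> B i j = (\<Sum>l\<le>j. L j l * A i l)"
  and L: "\<And>j. j < M ==> 0 < L j j"
 shows "boxvol M A = ennreal (\<Prod>j<M. L j j) * boxvol M B"
proof -
 have s: "scales {..<M} (\<lambda>z. \<lambda>l\<in>{..<M}. L l l * z l + (\<Sum>j\<in>{l<..<M}. L j l * z j)) (\<Prod>j<M. \<bar>L j j\<bar>)"
  using scales_upper_triangular[of M "\<lambda>j. L j j" "\<lambda>l j. L j l"] L by (simp add: less_imp_neq[symmetric])
 have P: "(\<Prod>j<M. \<bar>L j j\<bar>) = (\<Prod>j<M. L j j)" using L by (intro prod.cong) (auto simp: less_imp_le)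
 let ?F = "\<lambda>b. (\<Prod>i<M. indicator {0..1} (\<Sum>l<M. b l * A i l)) :: ennreal"
 have F: "?F \<in> borel_measurable (leb {..<M})"
 proof (intro borel_measurable_prod_ennreal measurable_compose[OF _ borel_measurable_indicator])
  show "(\<lambda>b. \<Sum>l<M. b l * A i l) \<in> borel_measurable (leb {..<M})" for i
   by (intro borel_measurable_sum borel_measurable_times leb_component borel_measurable_const)
 qed simp
 have eq: "(\<Sum>l<M. (\<lambda>l\<in>{..<M}. L l l * z l + (\<Sum>j\<in>{l<..<M}. L j l * z j)) l * A i l) = (\<Sum>j<M. z j * B i j)"
  if "i < M" for z i
 proof -
  have "(\<Sum>l<M. (\<lambda>l\<in>{..<M}. L l l * z l + (\<Sum>j\<in>{l<..<M}. L j l * z j)) l * A i l) =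
   (\<Sum>l<M. (\<Sum>j<M. if l \<le> j then L j l * z j else 0) * A i l)"
  proof (intro sum.cong refl)
   fix l assume l: "l \<in> {..<M}"
   have "(\<Sum>j<M. if l \<le> j then L j l * z j else 0) = (\<Sum>j\<in>{l..<M}. L j l * z j)"
    by (intro sum.mono_neutral_cong_right) auto
   also have "\<dots> = L l l * z l + (\<Sum>j\<in>{Suc l..<M}. L j l * z j)"
    using l by (intro sum.atLeast_Suc_lessThan) auto
   also have "{Suc l..<M} = {l<..<M}" by auto
   finally show "(\<lambda>l\<in>{..<M}. L l l * z l + (\<Sum>j\<in>{l<..<M}. L j l * z j)) l * A i l =
    (\<Sum>j<M. if l \<le> j then L j l * z j else 0) * A i l" using l by simp
  qed
  also have "\<dots> = (\<Sum>l<M. \<Sum>j<M. (if l \<le> j then L j l * z j * A i l else 0))"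
   unfolding sum_distrib_right by (intro sum.cong refl) auto
  also have "\<dots> = (\<Sum>j<M. \<Sum>l<M. (if l \<le> j then L j l * z j * A i l else 0))" by (rule sum.swap)
  also have "\<dots> = (\<Sum>j<M. z j * B i j)"
  proof (intro sum.cong refl)
   fix j assume j: "j \<in> {..<M}"
   have "(\<Sum>l<M. (if l \<le> j then L j l * z j * A i l else 0)) = (\<Sum>l\<le>j. L j l * z j * A i l)"
    using j by (intro sum.mono_neutral_cong_right) auto
   then show "(\<Sum>l<M. (if l \<le> j then L j l * z j * A i l else 0)) = z j * B i j"
    using B[OF that, of j] j by (simp add: sum_distrib_left mult.assoc mult.left_commute)
  qed
  finally show ?thesis .
 qed
 have *: "(\<Prod>i<M. indicator {0..1} (\<Sum>l<M. (\<lambda>l\<in>{..<M}. L l l * z l + (\<Sum>j\<in>{l<..<M}. L j l * z j)) l * A i l) :: ennreal)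
  = (\<Prod>i<M. indicator {0..1} (\<Sum>j<M. z j * B i j))" for z
  by (intro prod.cong refl) (simp only: eq lessThan_iff)
 show ?thesis
  using scalesD(3)[OF s F] unfolding P * boxvol_def[symmetric] .
qed

lemma hv_cong: "(\<And>i. i < p ==> x i = y i) ==> hv p x j = hv p y j"
 by (cases j) (auto simp: hv_def)

lemma lin_hv: "(\<Sum>j<Suc p. b j * hv p y j) = b 0 + (\<Sum>j<p. b (Suc j) * y j)"
 by (subst sum.lessThan_Suc_shift) simp

text \<open>The height over \<open>y\<close> of the hyperplane with coefficients
  \<open>b\<close>.\<close>

definition lin :: "nat => (nat => real) => (nat => real) => real" where
 "lin p b y = (\<Sum>j<Suc p. b j * hv p y j)"

definition wt1 :: "real => real => real" where
 "wt1 s h = (if h\<^sup>2 < 1 then (1 - h\<^sup>2) powr s else 0)"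

lemma wt1_measurable [measurable]: "wt1 s \<in> borel_measurable borel"
 unfolding wt1_def[abs_def] by measurable

lemma wt1_nonneg [simp]: "0 \<le> wt1 s h"
 by (simp add: wt1_def)

lemma weight_measurable:
 fixes c r s :: real
 assumes [measurable]: "\<psi> \<in> borel_measurable borel"
 shows "(\<lambda>u. ennreal (wt1 s ((c + u) / r) / r) * \<psi> u) \<in> borel_measurable lborel"
 by measurable

lemma weight_measurable2:
 fixes c r s :: real
 assumes [measurable]: "\<psi> \<in> borel_measurable borel"
 shows "(\<lambda>h. ennreal (wt1 s ((c + (- c + r * h)) / r) / r) * \<psi> (- c + r * h)) \<in> borel_measurable lborel"
 by measurable

lemma weight_measurable3:
 fixes c r s :: real
 shows "(\<lambda>h. indicator {0<..} (r * h - c) * ennreal (wt1 s h)) \<in> borel_measurable lborel"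
 by measurable

lemma nn_integral_wt1: "s > -1 ==> (\<integral>\<^sup>+ h. ennreal (wt1 s h) \<partial>lborel) = ennreal (Beta (1 / 2) (s + 1))"
 unfolding wt1_def by (rule nn_integral_beta_unit)

lemma leb_upd:
 assumes "f \<in> N \<rightarrow>\<^sub>M leb {..<p}" "h \<in> borel_measurable N"
 shows "(\<lambda>z. (f z)(p := h z)) \<in> N \<rightarrow>\<^sub>M leb {..<Suc p}"
proof -
 have "(\<lambda>z. (f z, h z)) \<in> N \<rightarrow>\<^sub>M leb {..<p} \<Otimes>\<^sub>M lborel" using assms by measurable
 from measurable_comp[OF this measurable_add_dim[of p "{..<p}" "\<lambda>_. lborel"]]
 show ?thesis by (simp add: comp_def lessThan_Suc)
qed

lemma lin_measurable:
 assumes f: "f \<in> N \<rightarrow>\<^sub>M leb {..<Suc p}" and h: "h \<in> N \<rightarrow>\<^sub>M leb {..<p}"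
 shows "(\<lambda>z. lin p (f z) (h z)) \<in> borel_measurable N"
 unfolding lin_def
 by (intro borel_measurable_sum borel_measurable_times measurable_compose[OF f leb_component]
   measurable_compose[OF h measurable_hv]) simp

lemma rad_measurable [measurable]: "(\<lambda>b. rad p b 0) \<in> borel_measurable (leb {..<Suc p})"
proof -
 have [measurable]: "(\<lambda>b. \<Sum>j = 0..<p. (b (Suc j))\<^sup>2) \<in> borel_measurable (leb {..<Suc p})"
  by (intro borel_measurable_sum borel_measurable_power leb_component) auto
 show ?thesis unfolding rad_def by measurable
qed

lemma ht_measurable [measurable]: "ht p \<in> borel_measurable (leb {..<Suc p})"
 unfolding ht_def[abs_def] by (intro borel_measurable_divide rad_measurable leb_component) auto

lemma sum_sq_upd: "(\<Sum>j<Suc p. ((y(p := t)) j)\<^sup>2) = (\<Sum>j<p. (y j)\<^sup>2) + (t::real)\<^sup>2"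
 by simp

text \<open>One minus the squared norm factors as (1 - ht^2) (1 - |z|^2), so every section is a
  scaled copy of the central one.\<close>

lemma bdens_aff:
 assumes h: "(ht p b)\<^sup>2 < 1"
 shows "bdens (Suc p) g ((aff p b z)(p := lin p b (aff p b z))) =
  (1 - (ht p b)\<^sup>2) powr g * bdens (Suc p) g (z(p := 0))"
proof -
 define Q where "Q = (\<Sum>j<p. (z j)\<^sup>2)"
 define H where "H = (ht p b)\<^sup>2"
 have e: "(\<Sum>j<Suc p. (((aff p b z)(p := lin p b (aff p b z))) j)\<^sup>2) = H + (1 - H) * Q"
  unfolding sum_sq_upd lin_def lin_hv Q_def H_def using h by (intro aff_quadratic) simp
 have e0: "(\<Sum>j<Suc p. ((z(p := 0)) j)\<^sup>2) = Q" unfolding sum_sq_upd Q_def by simp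
 have H: "H < 1" using h by (simp add: H_def)
 have f: "1 - (H + (1 - H) * Q) = (1 - H) * (1 - Q)" by (simp add: algebra_simps)
 have iff: "H + (1 - H) * Q < 1 \<longleftrightarrow> Q < 1"
 proof -
  have "H + (1 - H) * Q < 1 \<longleftrightarrow> 0 < (1 - H) * (1 - Q)" using f by linarith
  then show ?thesis using H by (simp add: zero_less_mult_iff)
 qed
 show ?thesis
 proof (cases "Q < 1")
  case True
  have "((1 - H) * (1 - Q)) powr g = (1 - H) powr g * (1 - Q) powr g"
   using True H by (simp add: powr_mult)
  then show ?thesis unfolding bdens_def e e0 iff f using True by (simp add: H_def)
 next
  case False
  then show ?thesis unfolding bdens_def e e0 iff by simp
 qed
qed

lemma bdens_outside:
 assumes "\<not> (ht p b)\<^sup>2 < 1"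
 shows "bdens (Suc p) g (y(p := lin p b y)) = 0"
proof -
 have "(ht p b)\<^sup>2 \<le> (\<Sum>j<Suc p. ((y(p := lin p b y)) j)\<^sup>2)"
  unfolding sum_sq_upd lin_def lin_hv by (rule ht_sq_le)
 then show ?thesis using assms unfolding bdens_def by simp
qed

lemma sqrt_power_powr: "0 < x ==> sqrt x ^ n = x powr (real n / 2)"
 by (simp add: powr_half_sqrt[symmetric] powr_realpow[symmetric] powr_powr)

section \<open>Slices of the beta law by parallel hyperplanes\<close>

context
 fixes p :: nat and g :: real
 assumes g: "g > -1"
begin

text \<open>Mass of the central section. Its value is obtained afterwards from the total mass
  1.\<close>

definition C0 :: ennreal where
 "C0 = (\<integral>\<^sup>+ z. ennreal (bdens (Suc p) g (z(p := 0))) \<partial>leb {..<p})"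

lemma bdens_lin_measurable:
 assumes "f \<in> N \<rightarrow>\<^sub>M leb {..<Suc p}" "h \<in> N \<rightarrow>\<^sub>M leb {..<p}"
 shows "(\<lambda>z. bdens (Suc p) g ((h z)(p := lin p (f z) (h z)))) \<in> borel_measurable N"
 by (rule measurable_compose[OF leb_upd bdens_measurable]) (use assms in \<open>auto intro: lin_measurable\<close>)

lemma bdens_zero_measurable [measurable]:
 "(\<lambda>z. bdens (Suc p) g (z(p := 0))) \<in> borel_measurable (leb {..<p})"
 by (rule measurable_compose[OF leb_upd bdens_measurable]) auto

text \<open>The Jacobian contributes (1 - ht^2)^(p/2) / rad and the density contributes (1 -
  ht^2)^g.\<close>

lemma nn_integral_bdens_section:
 assumes b: "b \<in> space (leb {..<Suc p})"
 shows "(\<integral>\<^sup>+ y. ennreal (bdens (Suc p) g (y(p := lin p b y))) \<partial>leb {..<p}) =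
  C0 * ennreal (wt1 (g + real p / 2) (ht p b) / rad p b 0)"
proof (cases "(ht p b)\<^sup>2 < 1")
 case True
 have H: "0 < 1 - (ht p b)\<^sup>2" using True by simp
 have "(\<lambda>y. ennreal (bdens (Suc p) g (y(p := lin p b y)))) \<in> borel_measurable (leb {..<p})"
  by (intro measurable_compose[OF _ measurable_ennreal] bdens_lin_measurable measurable_const b) auto
 from scalesD(3)[OF scales_aff[OF True] this]
 have "(\<integral>\<^sup>+ y. ennreal (bdens (Suc p) g (y(p := lin p b y))) \<partial>leb {..<p}) =
  ennreal (affD p b) * (\<integral>\<^sup>+ z. ennreal ((1 - (ht p b)\<^sup>2) powr g) * ennreal (bdens (Suc p) g (z(p := 0))) \<partial>leb {..<p})"
  by (simp add: bdens_aff[OF True] ennreal_mult bdens_nonneg[OF g])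
 also have "\<dots> = ennreal (affD p b) * (ennreal ((1 - (ht p b)\<^sup>2) powr g) * C0)"
  unfolding C0_def by (subst nn_integral_cmult) auto
 also have "\<dots> = C0 * ennreal (affD p b * (1 - (ht p b)\<^sup>2) powr g)"
  using scalesD(2)[OF scales_aff[OF True]] by (simp add: ennreal_mult ac_simps)
 also have "affD p b * (1 - (ht p b)\<^sup>2) powr g = wt1 (g + real p / 2) (ht p b) / rad p b 0"
  using H by (simp add: affD_def wt1_def sqrt_power_powr powr_add mult.commute)
 finally show ?thesis .
next
 case False
 then show ?thesis by (simp add: bdens_outside wt1_def)
qed

text \<open>Raising the constant coefficient by \<open>u\<close> sweeps through the parallel
  hyperplanes; the substitution u = rad h - b_0 then passes to the signed distance h.\<close>

lemma nn_integral_height: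
 assumes b: "b \<in> space (leb {..<Suc p})" and \<psi>[measurable]: "\<psi> \<in> borel_measurable borel"
 shows "(\<integral>\<^sup>+ x. \<psi> (x p - lin p b x) \<partial>bdist (Suc p) g) =
  C0 * (\<integral>\<^sup>+ h. \<psi> (rad p b 0 * h - b 0) * ennreal (wt1 (g + real p / 2) h) \<partial>lborel)"
proof -
 interpret lp: pair_sigma_finite "leb {..<p}" "lborel :: real measure"
  by (intro pair_sigma_finite.intro sigma_finite_leb lborel.sigma_finite_measure_axioms) simp
 have linx: "lin p b (y(p := t)) = lin p b y" for y t
  unfolding lin_def by (intro sum.cong refl arg_cong2[where f = "(*)"] hv_cong) auto
 have linu: "t + lin p b y = lin p (b(0 := b 0 + t)) y" for t y
  unfolding lin_def lin_hv by simp
 have restr: "lin p b (restrict y {..<p}) = lin p b y" for y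
  unfolding lin_def by (intro sum.cong refl arg_cong2[where f = "(*)"] hv_cong) auto
 have ml: "(\<lambda>x. lin p b x) \<in> borel_measurable (leb {..<Suc p})"
 proof -
  have "(\<lambda>x. lin p b (restrict x {..<p})) \<in> borel_measurable (leb {..<Suc p})"
   by (intro lin_measurable measurable_const b measurable_restrict_subset) auto
  then show ?thesis by (simp add: restr)
 qed
 have mx: "(\<lambda>x. x p) \<in> borel_measurable (leb {..<Suc p})" by (rule leb_component) simp
 have [measurable]: "(\<lambda>x. \<psi> (x p - lin p b x)) \<in> borel_measurable (leb {..<Suc p})"
  using ml mx by measurable
 have F: "(\<lambda>x. ennreal (bdens (Suc p) g x) * \<psi> (x p - lin p b x)) \<in> borel_measurable (leb (insert p {..<p}))"
  unfolding lessThan_Suc[symmetric] by measurable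
 have "(\<integral>\<^sup>+ x. \<psi> (x p - lin p b x) \<partial>bdist (Suc p) g) =
  (\<integral>\<^sup>+ x. ennreal (bdens (Suc p) g x) * \<psi> (x p - lin p b x) \<partial>leb (insert p {..<p}))"
  unfolding bdist_def lessThan_Suc[symmetric] by (rule nn_integral_density) measurable
 also have "\<dots> = (\<integral>\<^sup>+ y. \<integral>\<^sup>+ t. ennreal (bdens (Suc p) g (y(p := t))) * \<psi> ((y(p := t)) p - lin p b (y(p := t))) \<partial>lborel \<partial>leb {..<p})"
  by (rule lebP.product_nn_integral_insert[OF _ _ F]) auto
 also have "\<dots> = (\<integral>\<^sup>+ y. \<integral>\<^sup>+ t. ennreal (bdens (Suc p) g (y(p := t))) * \<psi> (t - lin p b y) \<partial>lborel \<partial>leb {..<p})"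
  by (simp add: linx)
 also have "\<dots> = (\<integral>\<^sup>+ y. \<integral>\<^sup>+ u. ennreal (bdens (Suc p) g (y(p := lin p (b(0 := b 0 + u)) y))) * \<psi> u \<partial>lborel \<partial>leb {..<p})"
 proof (rule nn_integral_cong)
  fix y assume y: "y \<in> space (leb {..<p})"
  have "(\<lambda>t. y(p := t)) \<in> lborel \<rightarrow>\<^sub>M leb {..<Suc p}"
   by (intro leb_upd measurable_const y) auto
  from measurable_compose[OF this bdens_measurable]
  have "(\<lambda>t. ennreal (bdens (Suc p) g (y(p := t)))) \<in> borel_measurable lborel" by measurable
  then have [measurable]: "(\<lambda>t. ennreal (bdens (Suc p) g (y(p := t)))) \<in> borel_measurable borel" by simp
  have "(\<integral>\<^sup>+ t. ennreal (bdens (Suc p) g (y(p := t))) * \<psi> (t - lin p b y) \<partial>lborel) =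
   ennreal \<bar>1\<bar> * (\<integral>\<^sup>+ u. ennreal (bdens (Suc p) g (y(p := lin p b y + 1 * u))) * \<psi> (lin p b y + 1 * u - lin p b y) \<partial>lborel)"
   by (intro nn_integral_real_affine) auto
  then show "(\<integral>\<^sup>+ t. ennreal (bdens (Suc p) g (y(p := t))) * \<psi> (t - lin p b y) \<partial>lborel) =
   (\<integral>\<^sup>+ u. ennreal (bdens (Suc p) g (y(p := lin p (b(0 := b 0 + u)) y))) * \<psi> u \<partial>lborel)"
   unfolding linu[symmetric] by (simp add: add.commute)
 qed
 also have "\<dots> = (\<integral>\<^sup>+ u. \<integral>\<^sup>+ y. ennreal (bdens (Suc p) g (y(p := lin p (b(0 := b 0 + u)) y))) * \<psi> u \<partial>leb {..<p} \<partial>lborel)"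
 proof (rule lp.Fubini'[symmetric])
  have "(\<lambda>z. b(0 := b 0 + snd z)) \<in> leb {..<p} \<Otimes>\<^sub>M lborel \<rightarrow>\<^sub>M leb {..<Suc p}"
  proof -
   have "(\<lambda>z. \<lambda>j\<in>{..<Suc p}. if j = 0 then b 0 + snd z else b j) \<in> leb {..<p} \<Otimes>\<^sub>M lborel \<rightarrow>\<^sub>M leb {..<Suc p}"
    by (intro measurable_restrict) auto
   moreover have "(\<lambda>j\<in>{..<Suc p}. if j = 0 then b 0 + t else b j) = b(0 := b 0 + t)" for t
    using b by (auto simp: fun_eq_iff space_PiM PiE_def extensional_def)
   ultimately show ?thesis by simp
  qed
  then have [measurable]: "(\<lambda>z. bdens (Suc p) g ((fst z)(p := lin p (b(0 := b 0 + snd z)) (fst z)))) \<in> borel_measurable (leb {..<p} \<Otimes>\<^sub>M lborel)"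
   by (intro bdens_lin_measurable) auto
  show "(\<lambda>(y, u). ennreal (bdens (Suc p) g (y(p := lin p (b(0 := b 0 + u)) y))) * \<psi> u) \<in> borel_measurable (leb {..<p} \<Otimes>\<^sub>M lborel)"
   by (simp add: case_prod_beta)
 qed
 also have "\<dots> = (\<integral>\<^sup>+ u. C0 * (ennreal (wt1 (g + real p / 2) ((b 0 + u) / rad p b 0) / rad p b 0) * \<psi> u) \<partial>lborel)"
 proof (rule nn_integral_cong)
  fix u
  let ?b = "b(0 := b 0 + u)"
  have bs: "?b \<in> space (leb {..<Suc p})" using b by (auto simp: space_PiM PiE_def extensional_def)
  have r: "rad p ?b 0 = rad p b 0" by (simp add: rad_def)
  have h: "ht p ?b = (b 0 + u) / rad p b 0" by (simp add: ht_def r)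
  have "(\<lambda>y. ennreal (bdens (Suc p) g (y(p := lin p ?b y)))) \<in> borel_measurable (leb {..<p})"
   by (intro measurable_compose[OF _ measurable_ennreal] bdens_lin_measurable measurable_const bs) auto
  then have "(\<integral>\<^sup>+ y. ennreal (bdens (Suc p) g (y(p := lin p ?b y))) * \<psi> u \<partial>leb {..<p}) =
   (\<integral>\<^sup>+ y. ennreal (bdens (Suc p) g (y(p := lin p ?b y))) \<partial>leb {..<p}) * \<psi> u"
   by (rule nn_integral_multc)
  then show "(\<integral>\<^sup>+ y. ennreal (bdens (Suc p) g (y(p := lin p ?b y))) * \<psi> u \<partial>leb {..<p}) =
   C0 * (ennreal (wt1 (g + real p / 2) ((b 0 + u) / rad p b 0) / rad p b 0) * \<psi> u)"
   unfolding nn_integral_bdens_section[OF bs] h r by (simp add: mult.assoc)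
 qed
 also have "\<dots> = C0 * (\<integral>\<^sup>+ u. ennreal (wt1 (g + real p / 2) ((b 0 + u) / rad p b 0) / rad p b 0) * \<psi> u \<partial>lborel)"
  by (rule nn_integral_cmult) (rule weight_measurable[OF \<psi>])
 also have "(\<integral>\<^sup>+ u. ennreal (wt1 (g + real p / 2) ((b 0 + u) / rad p b 0) / rad p b 0) * \<psi> u \<partial>lborel) =
  (\<integral>\<^sup>+ h. \<psi> (rad p b 0 * h - b 0) * ennreal (wt1 (g + real p / 2) h) \<partial>lborel)"
 proof -
  have r: "0 < rad p b 0" by (rule rad_pos)
  have "(\<integral>\<^sup>+ u. ennreal (wt1 (g + real p / 2) ((b 0 + u) / rad p b 0) / rad p b 0) * \<psi> u \<partial>lborel) =
   ennreal \<bar>rad p b 0\<bar> * (\<integral>\<^sup>+ h. ennreal (wt1 (g + real p / 2) ((b 0 + (- b 0 + rad p b 0 * h)) / rad p b 0) / rad p b 0) * \<psi> (- b 0 + rad p b 0 * h) \<partial>lborel)"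
   using r by (intro nn_integral_real_affine) auto
  also have "\<dots> = (\<integral>\<^sup>+ h. ennreal \<bar>rad p b 0\<bar> * (ennreal (wt1 (g + real p / 2) ((b 0 + (- b 0 + rad p b 0 * h)) / rad p b 0) / rad p b 0) * \<psi> (- b 0 + rad p b 0 * h)) \<partial>lborel)"
   by (rule nn_integral_cmult[symmetric]) (rule weight_measurable2[OF \<psi>])
  also have "\<dots> = (\<integral>\<^sup>+ h. \<psi> (rad p b 0 * h - b 0) * ennreal (wt1 (g + real p / 2) h) \<partial>lborel)"
   using r by (intro nn_integral_cong)
    (simp add: mult.assoc[symmetric] ennreal_mult'[symmetric] mult.commute)
  finally show ?thesis .
 qed
 finally show ?thesis .
qed

text \<open>The test function 1 compares the total mass with the one-dimensional Beta
  integral.\<close>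

lemma C0_eq: "C0 = ennreal (beta_const 1 (g + real p / 2))"
proof -
 define s where "s = g + real p / 2"
 have s: "s > -1" using g by (simp add: s_def add_strict_increasing2)
 define b where "b = (\<lambda>j\<in>{..<Suc p}. 0::real)"
 have b: "b \<in> space (leb {..<Suc p})" by (auto simp: b_def space_PiM)
 interpret prob_space "bdist (Suc p) g" by (rule prob_space_bdist[OF g])
 have "(1::ennreal) = (\<integral>\<^sup>+ x. 1 \<partial>bdist (Suc p) g)" using emeasure_space_1 by simp
 also have "\<dots> = C0 * ennreal (Beta (1 / 2) (s + 1))"
  using nn_integral_height[OF b, of "\<lambda>_. 1"] nn_integral_wt1[OF s] by (simp add: s_def)
 finally have 1: "C0 * ennreal (Beta (1 / 2) (s + 1)) = 1" by simp
 have bc: "0 < beta_const 1 s" using s by (intro beta_const_pos) auto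
 have Bpos: "0 < Beta (1 / 2) (s + 1)" using s by (simp add: Beta_def Gamma_real_pos)
 have "beta_const 1 s * Beta (1 / 2) (s + 1) = 1"
  by (rule beta_const_1[OF s])
 then have 2: "ennreal (Beta (1 / 2) (s + 1)) * ennreal (beta_const 1 s) = 1"
  using bc Bpos by (simp add: ennreal_mult[symmetric] mult.commute)
 have "C0 = C0 * (ennreal (Beta (1 / 2) (s + 1)) * ennreal (beta_const 1 s))" unfolding 2 by simp
 also have "\<dots> = ennreal (beta_const 1 s)" unfolding mult.assoc[symmetric] 1 by simp
 finally show ?thesis by (simp add: s_def)
qed

text \<open>Upper tail of the projection of the beta law onto a line.\<close>

definition Fbar :: "real => ennreal" where
 "Fbar a = (\<integral>\<^sup>+ h. indicator {a<..} h * ennreal (beta_const 1 (g + real p / 2) * wt1 (g + real p / 2) h) \<partial>lborel)"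

lemma Fbar_measurable [measurable]: "Fbar \<in> borel_measurable borel"
proof -
 have "(\<lambda>(a, h). indicator {0<..} (h - a) * ennreal (beta_const 1 (g + real p / 2) * wt1 (g + real p / 2) h)) \<in> borel_measurable (borel \<Otimes>\<^sub>M (lborel :: real measure))"
  by measurable
 then have "(\<lambda>a. \<integral>\<^sup>+ h. indicator {0<..} (h - a) * ennreal (beta_const 1 (g + real p / 2) * wt1 (g + real p / 2) h) \<partial>lborel) \<in> borel_measurable (borel :: real measure)"
  by (rule lborel.borel_measurable_nn_integral)
 moreover have "indicator {0<..} (h - a) = (indicator {a<..} h :: ennreal)" for a h :: real by (simp add: indicator_def)
 ultimately show ?thesis unfolding Fbar_def[abs_def] by simp
qed

lemma nn_integral_above:
 assumes b: "b \<in> space (leb {..<Suc p})"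
 shows "(\<integral>\<^sup>+ x. indicator {0<..} (x p - lin p b x) \<partial>bdist (Suc p) g) = Fbar (ht p b)"
proof -
 have r: "0 < rad p b 0" by (rule rad_pos)
 have bc: "0 \<le> beta_const 1 (g + real p / 2)"
  using beta_const_pos[of 1 "g + real p / 2"] g by (simp add: add_strict_increasing2)
 have "(\<integral>\<^sup>+ x. indicator {0<..} (x p - lin p b x) \<partial>bdist (Suc p) g) =
  C0 * (\<integral>\<^sup>+ h. indicator {0<..} (rad p b 0 * h - b 0) * ennreal (wt1 (g + real p / 2) h) \<partial>lborel)"
  by (rule nn_integral_height[OF b]) simp
 also have "\<dots> = (\<integral>\<^sup>+ h. C0 * (indicator {0<..} (rad p b 0 * h - b 0) * ennreal (wt1 (g + real p / 2) h)) \<partial>lborel)"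
  by (rule nn_integral_cmult[symmetric]) (rule weight_measurable3)
 also have "\<dots> = Fbar (ht p b)"
  unfolding Fbar_def C0_eq
 proof (intro nn_integral_cong)
  fix h
  have "indicator {0<..} (rad p b 0 * h - b 0) = (indicator {ht p b<..} h :: ennreal)"
   using r by (auto simp: indicator_def ht_def field_simps)
  then show "ennreal (beta_const 1 (g + real p / 2)) * (indicator {0<..} (rad p b 0 * h - b 0) * ennreal (wt1 (g + real p / 2) h)) =
   indicator {ht p b<..} h * ennreal (beta_const 1 (g + real p / 2) * wt1 (g + real p / 2) h)"
   using bc by (simp add: ennreal_mult ac_simps)
 qed
 finally show ?thesis .
qed

end

lemma ennreal_inverse_scale:
 assumes "0 < D"
 shows "inverse (x::ennreal) = ennreal D * inverse (ennreal D * x)"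
proof (cases x)
 case (real r)
 show ?thesis
 proof (cases "r = 0")
  case True
  then show ?thesis using assms real by (simp add: ennreal_mult_top)
 next
  case False
  then show ?thesis using assms real by (simp add: ennreal_mult[symmetric] inverse_ennreal)
 qed
next
 case top
 then show ?thesis using assms by (simp add: ennreal_mult_top)
qed

section \<open>Separation of the height and the shape of the vertices\<close>

context
 fixes p :: nat and g :: real and k :: nat
 assumes g: "g > -1" and k: "k \<le> Suc p"
begin

definition feas_ind :: "(nat => nat => real) => ennreal" where
 "feas_ind A = indicator {A. feas {..<Suc p} k (Suc p) A (last_unit (Suc p))} A"

text \<open>The angle event times the absolute determinant that arises when heights are exchanged
  for hyperplane coefficients.\<close>

definition HH :: "(nat => nat => real) => ennreal" where
 "HH A = feas_ind A * inverse (boxvol (Suc p) A)"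

text \<open>The integral over shapes in the central hyperplane.\<close>

definition E0 :: ennreal where
 "E0 = (\<integral>\<^sup>+ Z. HH (rows (Suc p) (hv p) Z) * (\<Prod>i<Suc p. ennreal (bdens (Suc p) g ((Z i)(p := 0))))
  \<partial>PiM {..<Suc p} (\<lambda>_. leb {..<p}))"

text \<open>Collects the integrals over shapes and over slopes. Its value is left open, since it
  cancels between the angle and the facet probabilities.\<close>

definition KK :: ennreal where
 "KK = E0 * (\<integral>\<^sup>+ b. ennreal (rad p b 0 / rad p b 0 ^ (p + 2)) \<partial>leb {1..<Suc p})"

lemma feas_ind_measurable [measurable]: "feas_ind \<in> borel_measurable borel"
 unfolding feas_ind_def[abs_def] using borel_feas[of "{..<Suc p}" k "Suc p" "last_unit (Suc p)"]
 by (intro borel_measurable_indicator) (simp add: pred_def)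

lemma HH_measurable [measurable]: "HH \<in> borel_measurable borel"
 unfolding HH_def[abs_def] by measurable

text \<open>The event is invariant under the triangular map, and the determinant picks up the
  determinant of that map.\<close>

lemma HH_aff:
 assumes h: "(ht p b)\<^sup>2 < 1"
 shows "HH (rows (Suc p) (hv p) (\<lambda>i\<in>{..<Suc p}. aff p b (Z i))) = ennreal (affD p b) * HH (rows (Suc p) (hv p) Z)"
proof -
 let ?B = "rows (Suc p) (hv p) (\<lambda>i\<in>{..<Suc p}. aff p b (Z i))" and ?A = "rows (Suc p) (hv p) Z"
 have B: "?B i j = (\<Sum>l\<le>j. affL p b j l * ?A i l)" if "i < Suc p" "j < Suc p" for i j
  using that hv_aff[of j p b "Z i"] by (simp add: rows_def)
 have L: "0 < affL p b j j" for j
  using scf_pos[OF h] by (cases j) (auto simp: affL_def)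
 have "(\<Prod>j<Suc p. affL p b j j) = (\<Prod>j<p. scf p b j)"
  by (subst prod.lessThan_Suc_shift) (simp add: affL_def)
 also have "\<dots> = affD p b" by (simp add: scf_prod rad_last affD_def)
 finally have P: "(\<Prod>j<Suc p. affL p b j j) = affD p b" .
 have bx: "boxvol (Suc p) ?A = ennreal (affD p b) * boxvol (Suc p) ?B"
  unfolding P[symmetric] by (rule boxvol_triangular[OF B L])
 have "inverse (boxvol (Suc p) ?B) = ennreal (affD p b) * inverse (boxvol (Suc p) ?A)"
  unfolding bx by (rule ennreal_inverse_scale[OF scalesD(2)[OF scales_aff[OF h]]])
 moreover have "feas {..<Suc p} k (Suc p) ?B (last_unit (Suc p)) \<longleftrightarrow> feas {..<Suc p} k (Suc p) ?A (last_unit (Suc p))"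
  by (rule feas_triangular[where L = "affL p b"]) (use B L in auto)
 then have "feas_ind ?B = feas_ind ?A"
  by (simp only: feas_ind_def indicator_def mem_Collect_eq)
 ultimately show ?thesis unfolding HH_def by (simp add: ac_simps)
qed

lemma rows_hv_measurable:
 assumes f: "f \<in> N \<rightarrow>\<^sub>M PiM {..<Suc p} (\<lambda>_. leb {..<p})"
 shows "(\<lambda>z. rows (Suc p) (hv p) (f z)) \<in> borel_measurable N"
 by (rule measurable_compose[OF f measurable_rows]) auto

lemma prod_bdens_measurable:
 assumes b: "b \<in> N \<rightarrow>\<^sub>M leb {..<Suc p}" and f: "f \<in> N \<rightarrow>\<^sub>M PiM {..<Suc p} (\<lambda>_. leb {..<p})"
 shows "(\<lambda>z. \<Prod>i<Suc p. ennreal (bdens (Suc p) g ((f z i)(p := lin p (b z) (f z i))))) \<in> borel_measurable N"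
 by (intro borel_measurable_prod_ennreal measurable_compose[OF _ measurable_ennreal]
   bdens_lin_measurable[OF g] b measurable_compose[OF f measurable_component_singleton])

text \<open>\<open>affD\<close> occurs once for each of the \<open>p + 1\<close> points and once
  from the determinant. Together with the densities the exponent of 1 - ht^2 becomes p (p + 2) / 2 +
  g (p + 1), which is the exponent given to \<open>wt1\<close>.\<close>

lemma inner_integral:
 assumes b: "b \<in> space (leb {..<Suc p})"
 shows "(\<integral>\<^sup>+ Y. HH (rows (Suc p) (hv p) Y) * (\<Prod>i<Suc p. ennreal (bdens (Suc p) g ((Y i)(p := lin p b (Y i)))))
   \<partial>PiM {..<Suc p} (\<lambda>_. leb {..<p})) =
  ennreal (wt1 (((2 * g + real (Suc p)) * real (Suc p) - 1) / 2) (ht p b) / rad p b 0 ^ (p + 2)) * E0"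
  (is "?L = _")
proof (cases "(ht p b)\<^sup>2 < 1")
 case True
 let ?M = "PiM {..<Suc p} (\<lambda>_. leb {..<p})"
 have D: "0 < affD p b" using scalesD(2)[OF scales_aff[OF True]] .
 have H: "0 < 1 - (ht p b)\<^sup>2" using True by simp
 have meas: "(\<lambda>Y. HH (rows (Suc p) (hv p) Y) * (\<Prod>i<Suc p. ennreal (bdens (Suc p) g ((Y i)(p := lin p b (Y i)))))) \<in> borel_measurable ?M"
  by (intro borel_measurable_times_ennreal measurable_compose[OF rows_hv_measurable HH_measurable] prod_bdens_measurable measurable_const b) auto
 have "?L = ennreal (affD p b ^ Suc p) * (\<integral>\<^sup>+ Z. HH (rows (Suc p) (hv p) (\<lambda>i\<in>{..<Suc p}. aff p b (Z i))) *
   (\<Prod>i<Suc p. ennreal (bdens (Suc p) g (((\<lambda>i\<in>{..<Suc p}. aff p b (Z i)) i)(p := lin p b ((\<lambda>i\<in>{..<Suc p}. aff p b (Z i)) i))))) \<partial>?M)"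
  using nn_integral_scales_points[OF scales_aff[OF True] finite_lessThan meas] unfolding card_lessThan .
 also have "(\<integral>\<^sup>+ Z. HH (rows (Suc p) (hv p) (\<lambda>i\<in>{..<Suc p}. aff p b (Z i))) *
   (\<Prod>i<Suc p. ennreal (bdens (Suc p) g (((\<lambda>i\<in>{..<Suc p}. aff p b (Z i)) i)(p := lin p b ((\<lambda>i\<in>{..<Suc p}. aff p b (Z i)) i))))) \<partial>?M)
  = (\<integral>\<^sup>+ Z. ennreal (affD p b * ((1 - (ht p b)\<^sup>2) powr g) ^ Suc p) *
   (HH (rows (Suc p) (hv p) Z) * (\<Prod>i<Suc p. ennreal (bdens (Suc p) g ((Z i)(p := 0))))) \<partial>?M)"
 proof (rule nn_integral_cong)
  fix Z
  have "(\<Prod>i<Suc p. ennreal (bdens (Suc p) g (((\<lambda>i\<in>{..<Suc p}. aff p b (Z i)) i)(p := lin p b ((\<lambda>i\<in>{..<Suc p}. aff p b (Z i)) i)))))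
   = (\<Prod>i<Suc p. ennreal ((1 - (ht p b)\<^sup>2) powr g) * ennreal (bdens (Suc p) g ((Z i)(p := 0))))"
   by (intro prod.cong refl) (simp add: bdens_aff[OF True] ennreal_mult bdens_nonneg[OF g] del: fun_upd_apply)
  also have "\<dots> = ennreal (((1 - (ht p b)\<^sup>2) powr g) ^ Suc p) * (\<Prod>i<Suc p. ennreal (bdens (Suc p) g ((Z i)(p := 0))))"
   by (simp only: prod.distrib prod_constant card_lessThan ennreal_power powr_ge_zero)
  finally show "HH (rows (Suc p) (hv p) (\<lambda>i\<in>{..<Suc p}. aff p b (Z i))) *
   (\<Prod>i<Suc p. ennreal (bdens (Suc p) g (((\<lambda>i\<in>{..<Suc p}. aff p b (Z i)) i)(p := lin p b ((\<lambda>i\<in>{..<Suc p}. aff p b (Z i)) i)))))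
   = ennreal (affD p b * ((1 - (ht p b)\<^sup>2) powr g) ^ Suc p) *
   (HH (rows (Suc p) (hv p) Z) * (\<Prod>i<Suc p. ennreal (bdens (Suc p) g ((Z i)(p := 0)))))"
   using D unfolding HH_aff[OF True] by (simp only: ennreal_mult less_imp_le zero_le_power powr_ge_zero ac_simps)
 qed
 also have "\<dots> = ennreal (affD p b * ((1 - (ht p b)\<^sup>2) powr g) ^ Suc p) * E0"
  unfolding E0_def
 proof (rule nn_integral_cmult)
  show "(\<lambda>Z. HH (rows (Suc p) (hv p) Z) * (\<Prod>i<Suc p. ennreal (bdens (Suc p) g ((Z i)(p := 0))))) \<in> borel_measurable ?M"
   by (intro borel_measurable_times_ennreal measurable_compose[OF rows_hv_measurable HH_measurable] borel_measurable_prod_ennreal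
     measurable_compose[OF _ measurable_ennreal] measurable_compose[OF _ bdens_zero_measurable[OF g]] measurable_component_singleton) auto
 qed
 finally have "?L = ennreal (affD p b ^ Suc p) * (ennreal (affD p b * ((1 - (ht p b)\<^sup>2) powr g) ^ Suc p) * E0)" .
 moreover have "ennreal (affD p b ^ Suc p * (affD p b * ((1 - (ht p b)\<^sup>2) powr g) ^ Suc p)) =
  ennreal (affD p b ^ Suc p) * ennreal (affD p b * ((1 - (ht p b)\<^sup>2) powr g) ^ Suc p)"
  using D by (intro ennreal_mult) auto
 moreover have "affD p b ^ Suc p * (affD p b * ((1 - (ht p b)\<^sup>2) powr g) ^ Suc p) =
  wt1 (((2 * g + real (Suc p)) * real (Suc p) - 1) / 2) (ht p b) / rad p b 0 ^ (p + 2)"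
 proof -
  define q where "q = 1 - (ht p b)\<^sup>2"
  have q: "0 < q" using H by (simp add: q_def)
  have "affD p b ^ (p + 2) * (q powr g) ^ Suc p = q powr (real p / 2 * (real p + 2)) * q powr (g * (real p + 1)) / rad p b 0 ^ (p + 2)"
   unfolding affD_def q_def[symmetric] sqrt_power_powr[OF q] power_divide
   using q by (simp only: powr_power) (simp add: algebra_simps)
  also have "q powr (real p / 2 * (real p + 2)) * q powr (g * (real p + 1)) = q powr (((2 * g + real (Suc p)) * real (Suc p) - 1) / 2)"
   unfolding powr_add[symmetric] by (intro arg_cong2[where f = "(powr)"] refl) (simp add: field_simps)
  finally show ?thesis using True by (simp add: wt1_def q_def ac_simps)
 qed
 ultimately show ?thesis by (simp only: mult.assoc)
next
 case False
 have "(\<Prod>i<Suc p. ennreal (bdens (Suc p) g ((Y i)(p := lin p b (Y i))))) = 0" for Y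
  by (intro prod_zero) (auto simp: bdens_outside[OF False] simp del: fun_upd_apply)
 then have "?L = (\<integral>\<^sup>+ Y. 0 \<partial>PiM {..<Suc p} (\<lambda>_. leb {..<p}))"
  by (intro nn_integral_cong) (simp only: mult_zero_right)
 then show ?thesis using False by (simp add: wt1_def)
qed

text \<open>The constant coefficient is replaced by the signed distance; the remaining slopes then
  integrate to a number that does not involve the test function.\<close>

lemma outer_integral:
 assumes \<phi>[measurable]: "\<phi> \<in> borel_measurable borel"
 shows "(\<integral>\<^sup>+ b. \<phi> (ht p b) * (ennreal (wt1 s (ht p b) / rad p b 0 ^ (p + 2)) * E0) \<partial>leb {..<Suc p}) =
  KK * (\<integral>\<^sup>+ h. \<phi> h * ennreal (wt1 s h) \<partial>lborel)"
proof -
 have ins: "{..<Suc p} = insert 0 {1..<Suc p}" by auto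
 have rad1[measurable]: "(\<lambda>b. rad p b 0) \<in> borel_measurable (leb {1..<Suc p})"
 proof -
  have [measurable]: "(\<lambda>b. \<Sum>j = 0..<p. (b (Suc j))\<^sup>2) \<in> borel_measurable (leb {1..<Suc p})"
   by (intro borel_measurable_sum borel_measurable_power leb_component) auto
  show ?thesis unfolding rad_def by measurable
 qed
 have F: "(\<lambda>b. \<phi> (ht p b) * (ennreal (wt1 s (ht p b) / rad p b 0 ^ (p + 2)) * E0)) \<in> borel_measurable (leb (insert 0 {1..<Suc p}))"
  unfolding ins[symmetric] by measurable
 have "(\<integral>\<^sup>+ b. \<phi> (ht p b) * (ennreal (wt1 s (ht p b) / rad p b 0 ^ (p + 2)) * E0) \<partial>leb {..<Suc p}) =
  (\<integral>\<^sup>+ b. \<integral>\<^sup>+ t. \<phi> (ht p (b(0 := t))) * (ennreal (wt1 s (ht p (b(0 := t))) / rad p (b(0 := t)) 0 ^ (p + 2)) * E0) \<partial>lborel \<partial>leb {1..<Suc p})"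
  unfolding ins by (rule lebP.product_nn_integral_insert[OF _ _ F]) auto
 also have "\<dots> = (\<integral>\<^sup>+ b. ennreal (rad p b 0 / rad p b 0 ^ (p + 2)) * (E0 * (\<integral>\<^sup>+ h. \<phi> h * ennreal (wt1 s h) \<partial>lborel)) \<partial>leb {1..<Suc p})"
 proof (rule nn_integral_cong)
  fix b
  define r where "r = rad p b 0"
  have r: "0 < r" by (simp add: r_def rad_pos)
  have rt: "rad p (b(0 := t)) 0 = r" for t by (simp add: rad_def r_def)
  have hh: "ht p (b(0 := t)) = t / r" for t by (simp add: ht_def rt)
  have "(\<integral>\<^sup>+ t. \<phi> (t / r) * (ennreal (wt1 s (t / r) / r ^ (p + 2)) * E0) \<partial>lborel) =
   ennreal \<bar>r\<bar> * (\<integral>\<^sup>+ h. \<phi> ((0 + r * h) / r) * (ennreal (wt1 s ((0 + r * h) / r) / r ^ (p + 2)) * E0) \<partial>lborel)"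
   using r by (intro nn_integral_real_affine) auto
  also have "\<dots> = ennreal \<bar>r\<bar> * (\<integral>\<^sup>+ h. (ennreal (1 / r ^ (p + 2)) * E0) * (\<phi> h * ennreal (wt1 s h)) \<partial>lborel)"
  proof (rule arg_cong[where f = "\<lambda>X. ennreal \<bar>r\<bar> * X"], rule nn_integral_cong)
   fix h :: real
   have "ennreal (wt1 s h / r ^ (p + 2)) = ennreal (1 / r ^ (p + 2)) * ennreal (wt1 s h)"
    using r by (simp add: ennreal_mult[symmetric])
   then show "\<phi> ((0 + r * h) / r) * (ennreal (wt1 s ((0 + r * h) / r) / r ^ (p + 2)) * E0) =
    (ennreal (1 / r ^ (p + 2)) * E0) * (\<phi> h * ennreal (wt1 s h))"
    using r by (simp add: ac_simps)
  qed
  also have "\<dots> = ennreal \<bar>r\<bar> * ((ennreal (1 / r ^ (p + 2)) * E0) * (\<integral>\<^sup>+ h. \<phi> h * ennreal (wt1 s h) \<partial>lborel))"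
   by (subst nn_integral_cmult) auto
  also have "\<dots> = ennreal (r / r ^ (p + 2)) * (E0 * (\<integral>\<^sup>+ h. \<phi> h * ennreal (wt1 s h) \<partial>lborel))"
  proof -
   have "ennreal (r / r ^ (p + 2)) = ennreal \<bar>r\<bar> * ennreal (1 / r ^ (p + 2))"
    using r by (simp add: ennreal_mult[symmetric])
   then show ?thesis by (simp add: mult.assoc)
  qed
  finally show "(\<integral>\<^sup>+ t. \<phi> (ht p (b(0 := t))) * (ennreal (wt1 s (ht p (b(0 := t))) / rad p (b(0 := t)) 0 ^ (p + 2)) * E0) \<partial>lborel) =
   ennreal (rad p b 0 / rad p b 0 ^ (p + 2)) * (E0 * (\<integral>\<^sup>+ h. \<phi> h * ennreal (wt1 s h) \<partial>lborel))"
   unfolding hh rt r_def[symmetric] .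
 qed
 also have "\<dots> = (\<integral>\<^sup>+ b. ennreal (rad p b 0 / rad p b 0 ^ (p + 2)) \<partial>leb {1..<Suc p}) * (E0 * (\<integral>\<^sup>+ h. \<phi> h * ennreal (wt1 s h) \<partial>lborel))"
  by (rule nn_integral_multc) measurable
 finally show ?thesis by (simp add: KK_def ac_simps)
qed

text \<open>The section of the ball is parametrised by its hyperplane; the shape of the
 points inside the section turns out to be independent of the height of the hyperplane.\<close>

lemma simplex_height_law:
 assumes \<Psi>: "\<Psi> \<in> borel_measurable (PiM {..<Suc p} (\<lambda>_. leb {..<Suc p}))" and \<phi>[measurable]: "\<phi> \<in> borel_measurable borel"
  and eq: "\<And>Y b. Y \<in> space (PiM {..<Suc p} (\<lambda>_. leb {..<p})) ==> b \<in> space (leb {..<Suc p}) ==>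
   generic (Suc p) (rows (Suc p) (hv p) Y) ==>
   \<Psi> (\<lambda>i\<in>{..<Suc p}. (Y i)(p := lin p b (Y i))) = \<phi> (ht p b)"
 shows "(\<integral>\<^sup>+ X. feas_ind (rows (Suc p) (hv (Suc p)) X) * \<Psi> X \<partial>PiM {..<Suc p} (\<lambda>_. bdist (Suc p) g)) =
  KK * (\<integral>\<^sup>+ h. \<phi> h * ennreal (wt1 (((2 * g + real (Suc p)) * real (Suc p) - 1) / 2) h) \<partial>lborel)"
proof -
 let ?s = "((2 * g + real (Suc p)) * real (Suc p) - 1) / 2"
 let ?P = "PiM {..<Suc p} (\<lambda>_. leb {..<p})" and ?Q = "PiM {..<Suc p} (\<lambda>_. leb {..<Suc p})"
 note [measurable] = \<Psi>
 have rm[measurable]: "rows (Suc p) (hv (Suc p)) \<in> borel_measurable ?Q"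
  by (rule measurable_rows) auto
 let ?G = "\<lambda>X. (\<Prod>i<Suc p. ennreal (bdens (Suc p) g (X i))) * (feas_ind (rows (Suc p) (hv (Suc p)) X) * \<Psi> X)"
 have G[measurable]: "?G \<in> borel_measurable ?Q"
  by (intro borel_measurable_times_ennreal borel_measurable_prod_ennreal \<Psi> measurable_compose[OF rm feas_ind_measurable]
    measurable_compose[OF _ measurable_ennreal] measurable_compose[OF _ bdens_measurable] measurable_component_singleton)
 interpret pp: pair_sigma_finite "leb {..<Suc p}" ?P
  by (intro pair_sigma_finite.intro sigma_finite_leb lebPP.sigma_finite) auto
 have comb: "(\<lambda>t. \<lambda>i\<in>{..<Suc p}. (Y i)(p := t i)) \<in> leb {..<Suc p} \<rightarrow>\<^sub>M ?Q" if Y: "Y \<in> space ?P" for Y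
  by (intro measurable_restrict leb_upd measurable_const leb_component) (use Y in \<open>auto simp: space_PiM PiE_def Pi_def\<close>)
 have "(\<integral>\<^sup>+ X. feas_ind (rows (Suc p) (hv (Suc p)) X) * \<Psi> X \<partial>PiM {..<Suc p} (\<lambda>_. bdist (Suc p) g)) = (\<integral>\<^sup>+ X. ?G X \<partial>?Q)"
  by (rule nn_integral_PiM_bdist[OF g]) auto
 also have "\<dots> = (\<integral>\<^sup>+ Y. \<integral>\<^sup>+ t. ?G (\<lambda>i\<in>{..<Suc p}. (Y i)(p := t i)) \<partial>leb {..<Suc p} \<partial>?P)"
  by (rule nn_integral_split_points[OF _ G]) simp
 also have "\<dots> = (\<integral>\<^sup>+ Y. \<integral>\<^sup>+ b. \<phi> (ht p b) * (HH (rows (Suc p) (hv p) Y) *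
   (\<Prod>i<Suc p. ennreal (bdens (Suc p) g ((Y i)(p := lin p b (Y i)))))) \<partial>leb {..<Suc p} \<partial>?P)"
 proof (rule nn_integral_cong_AE)
  show "AE Y in ?P. (\<integral>\<^sup>+ t. ?G (\<lambda>i\<in>{..<Suc p}. (Y i)(p := t i)) \<partial>leb {..<Suc p}) =
   (\<integral>\<^sup>+ b. \<phi> (ht p b) * (HH (rows (Suc p) (hv p) Y) *
   (\<Prod>i<Suc p. ennreal (bdens (Suc p) g ((Y i)(p := lin p b (Y i)))))) \<partial>leb {..<Suc p})"
   using AE_generic_leb[of p] AE_space
  proof eventually_elim
   case (elim Y)
   let ?A = "rows (Suc p) (hv p) Y"
   \<comment> \<open>The angle event sees only the first \<open>p\<close> coordinates, so changing
     the heights leaves it alone.\<close>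
   have fe: "feas_ind (rows (Suc p) (hv (Suc p)) (\<lambda>i\<in>{..<Suc p}. (Y i)(p := t i))) = feas_ind ?A" for t
   proof -
    have "hv (Suc p) ((Y i)(p := t i)) j = hv p (Y i) j" if "j < Suc p" for i j
     using that by (cases j) (auto simp: hv_def)
    then show ?thesis unfolding feas_ind_def
     by (simp only: mem_Collect_eq indicator_def) (subst feas_cong[where B = ?A and w' = "last_unit (Suc p)"], auto simp: rows_def)
   qed
   have "(\<integral>\<^sup>+ t. ?G (\<lambda>i\<in>{..<Suc p}. (Y i)(p := t i)) \<partial>leb {..<Suc p}) =
    inverse (boxvol (Suc p) ?A) * (\<integral>\<^sup>+ b. ?G (\<lambda>i\<in>{..<Suc p}. (Y i)(p := (\<lambda>i\<in>{..<Suc p}. \<Sum>j<Suc p. b j * ?A i j) i)) \<partial>leb {..<Suc p})"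
    by (rule nn_integral_generic_matrix[OF elim(1) measurable_compose[OF comb[OF elim(2)] G]])
   also have "(\<integral>\<^sup>+ b. ?G (\<lambda>i\<in>{..<Suc p}. (Y i)(p := (\<lambda>i\<in>{..<Suc p}. \<Sum>j<Suc p. b j * ?A i j) i)) \<partial>leb {..<Suc p}) =
    (\<integral>\<^sup>+ b. (\<Prod>i<Suc p. ennreal (bdens (Suc p) g ((Y i)(p := lin p b (Y i))))) * (feas_ind ?A * \<phi> (ht p b)) \<partial>leb {..<Suc p})"
   proof (rule nn_integral_cong)
    fix b assume b: "b \<in> space (leb {..<Suc p})"
    have X: "(\<lambda>i\<in>{..<Suc p}. (Y i)(p := (\<lambda>i\<in>{..<Suc p}. \<Sum>j<Suc p. b j * ?A i j) i)) = (\<lambda>i\<in>{..<Suc p}. (Y i)(p := lin p b (Y i)))"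
     by (intro restrict_ext) (simp add: rows_def lin_def del: sum.lessThan_Suc)
    have P: "(\<Prod>i<Suc p. ennreal (bdens (Suc p) g ((\<lambda>i\<in>{..<Suc p}. (Y i)(p := lin p b (Y i))) i))) =
     (\<Prod>i<Suc p. ennreal (bdens (Suc p) g ((Y i)(p := lin p b (Y i)))))"
     by (intro prod.cong refl) simp
    show "?G (\<lambda>i\<in>{..<Suc p}. (Y i)(p := (\<lambda>i\<in>{..<Suc p}. \<Sum>j<Suc p. b j * ?A i j) i)) =
     (\<Prod>i<Suc p. ennreal (bdens (Suc p) g ((Y i)(p := lin p b (Y i))))) * (feas_ind ?A * \<phi> (ht p b))"
     unfolding X fe[of "\<lambda>i. lin p b (Y i)"] eq[OF elim(2) b elim(1)] P ..
   qed
   also have "inverse (boxvol (Suc p) ?A) * \<dots> = (\<integral>\<^sup>+ b. inverse (boxvol (Suc p) ?A) *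
    ((\<Prod>i<Suc p. ennreal (bdens (Suc p) g ((Y i)(p := lin p b (Y i))))) * (feas_ind ?A * \<phi> (ht p b))) \<partial>leb {..<Suc p})"
    by (intro nn_integral_cmult[symmetric] borel_measurable_times_ennreal prod_bdens_measurable measurable_const elim(2)) auto
   also have "\<dots> = (\<integral>\<^sup>+ b. \<phi> (ht p b) * (HH ?A * (\<Prod>i<Suc p. ennreal (bdens (Suc p) g ((Y i)(p := lin p b (Y i)))))) \<partial>leb {..<Suc p})"
    unfolding HH_def by (simp only: ac_simps)
   finally show ?case .
  qed
 qed
 also have "\<dots> = (\<integral>\<^sup>+ b. \<integral>\<^sup>+ Y. \<phi> (ht p b) * (HH (rows (Suc p) (hv p) Y) *
   (\<Prod>i<Suc p. ennreal (bdens (Suc p) g ((Y i)(p := lin p b (Y i)))))) \<partial>?P \<partial>leb {..<Suc p})"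
 proof (rule pp.Fubini')
  show "(\<lambda>(b, Y). \<phi> (ht p b) * (HH (rows (Suc p) (hv p) Y) * (\<Prod>i<Suc p. ennreal (bdens (Suc p) g ((Y i)(p := lin p b (Y i)))))))
   \<in> borel_measurable (leb {..<Suc p} \<Otimes>\<^sub>M ?P)"
   unfolding case_prod_beta
   by (intro borel_measurable_times_ennreal prod_bdens_measurable measurable_compose[OF rows_hv_measurable HH_measurable]
     measurable_compose[OF measurable_compose[OF measurable_fst ht_measurable] \<phi>]) auto
 qed
 also have "\<dots> = (\<integral>\<^sup>+ b. \<phi> (ht p b) * (ennreal (wt1 ?s (ht p b) / rad p b 0 ^ (p + 2)) * E0) \<partial>leb {..<Suc p})"
 proof (rule nn_integral_cong)
  fix b assume b: "b \<in> space (leb {..<Suc p})"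
  have "(\<lambda>Y. HH (rows (Suc p) (hv p) Y) * (\<Prod>i<Suc p. ennreal (bdens (Suc p) g ((Y i)(p := lin p b (Y i)))))) \<in> borel_measurable ?P"
   by (intro borel_measurable_times_ennreal prod_bdens_measurable measurable_compose[OF rows_hv_measurable HH_measurable] measurable_const b) auto
  from nn_integral_cmult[OF this] inner_integral[OF b]
  show "(\<integral>\<^sup>+ Y. \<phi> (ht p b) * (HH (rows (Suc p) (hv p) Y) *
   (\<Prod>i<Suc p. ennreal (bdens (Suc p) g ((Y i)(p := lin p b (Y i)))))) \<partial>?P) =
   \<phi> (ht p b) * (ennreal (wt1 ?s (ht p b) / rad p b 0 ^ (p + 2)) * E0)" by simp
 qed
 also have "\<dots> = KK * (\<integral>\<^sup>+ h. \<phi> h * ennreal (wt1 ?s h) \<partial>lborel)"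
  by (rule outer_integral[OF \<phi>])
 finally show ?thesis .
qed

end

subsection \<open>Trigonometric form of the one-dimensional weights\<close>

lemma nn_integral_sin_substitution:
 fixes \<phi> :: "real => real"
 assumes [measurable]: "\<phi> \<in> borel_measurable borel" and nn: "\<And>h. 0 \<le> \<phi> h"
 shows "(\<integral>\<^sup>+ h. ennreal (\<phi> h * (if h\<^sup>2 < 1 then (1 - h\<^sup>2) powr s else 0)) \<partial>lborel) =
  (\<integral>\<^sup>+ x. ennreal (\<phi> (sin x) * cos x powr (2 * s + 1)) * indicator {- (pi / 2)<..<pi / 2} x \<partial>lborel)"
proof -
 define f where "f h = \<phi> h * (if h\<^sup>2 < 1 then (1 - h\<^sup>2) powr s else 0)" for h
 have [measurable]: "f \<in> borel_measurable borel" unfolding f_def[abs_def] by measurable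
 have "(\<integral>\<^sup>+ h. ennreal (f h) \<partial>lborel) = (\<integral>\<^sup>+ h. f h * indicator {sin (- (pi / 2))..sin (pi / 2)} h \<partial>lborel)"
 proof (intro nn_integral_cong)
  fix h
  have "f h = 0" if "h \<notin> {-1..1}"
  proof -
   have "1 < \<bar>h\<bar>" using that by auto
   then have "\<not> h\<^sup>2 < 1" by (simp add: abs_square_less_1)
   then show ?thesis by (simp add: f_def)
  qed
  then show "ennreal (f h) = ennreal (f h * indicator {sin (- (pi / 2))..sin (pi / 2)} h)"
   by (auto simp: indicator_def)
 qed
 also have "\<dots> = (\<integral>\<^sup>+ x. f (sin x) * cos x * indicator {- (pi / 2)..pi / 2} x \<partial>lborel)"
 proof (rule nn_integral_substitution)
  show "set_borel_measurable borel {sin (- (pi / 2))..sin (pi / 2)} f"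
   unfolding set_borel_measurable_def by measurable
  show "(sin has_real_derivative cos x) (at x)" for x by (rule DERIV_sin)
  show "continuous_on {- (pi / 2)..pi / 2} cos" by (intro continuous_intros)
  show "0 \<le> cos x" if "x \<in> {- (pi / 2)..pi / 2}" for x using that by (intro cos_ge_zero) auto
 qed simp
 also have "\<dots> = (\<integral>\<^sup>+ x. ennreal (\<phi> (sin x) * cos x powr (2 * s + 1)) * indicator {- (pi / 2)<..<pi / 2} x \<partial>lborel)"
 proof (intro nn_integral_cong_AE AE_I[of _ _ "{- (pi / 2), pi / 2}"])
  have k: "ennreal (f (sin x) * cos x * indicator {- (pi / 2)..pi / 2} x) =
   ennreal (\<phi> (sin x) * cos x powr (2 * s + 1)) * indicator {- (pi / 2)<..<pi / 2} x"
   if x: "x \<noteq> - (pi / 2)" "x \<noteq> pi / 2" for x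
  proof (cases "x \<in> {- (pi / 2)<..<pi / 2}")
   case True
   then have c: "0 < cos x" by (intro cos_gt_zero_pi) auto
   have s2: "1 - (sin x)\<^sup>2 = (cos x)\<^sup>2" by (simp add: cos_squared_eq)
   then have "(sin x)\<^sup>2 < 1" using c by (smt (verit) zero_less_power)
   moreover have "((cos x)\<^sup>2) powr s = cos x powr (2 * s)"
    using c by (simp add: powr_powr flip: powr_numeral)
   moreover have "cos x powr (2 * s) * cos x = cos x powr (2 * s + 1)"
    using c by (simp add: powr_add)
   ultimately have "f (sin x) * cos x = \<phi> (sin x) * cos x powr (2 * s + 1)"
    by (simp add: f_def s2)
   then show ?thesis using True by simp
  next
   case False
   then have "x \<notin> {- (pi / 2)..pi / 2}" using x by auto
   then show ?thesis using False by simp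
  qed
  show "{x \<in> space lborel. ennreal (f (sin x) * cos x * indicator {- (pi / 2)..pi / 2} x) \<noteq>
   ennreal (\<phi> (sin x) * cos x powr (2 * s + 1)) * indicator {- (pi / 2)<..<pi / 2} x} \<subseteq> {- (pi / 2), pi / 2}"
  proof
   fix x assume x: "x \<in> {x \<in> space lborel. ennreal (f (sin x) * cos x * indicator {- (pi / 2)..pi / 2} x) \<noteq>
    ennreal (\<phi> (sin x) * cos x powr (2 * s + 1)) * indicator {- (pi / 2)<..<pi / 2} x}"
   show "x \<in> {- (pi / 2), pi / 2}"
   proof (rule ccontr)
    assume "x \<notin> {- (pi / 2), pi / 2}"
    then show False using k[of x] x by simp
   qed
  qed
 qed (auto simp: emeasure_lborel_countable)
 finally show ?thesis by (simp add: f_def)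
qed

abbreviation hpi :: "real set" where "hpi \<equiv> {- (pi / 2)<..<pi / 2}"

lemma cos_pos_hpi: "x \<in> hpi ==> 0 < cos x"
 by (intro cos_gt_zero_pi) auto

lemma nn_integral_cos_powr:
 assumes "s > -1"
 shows "(\<integral>\<^sup>+ x. ennreal (cos x powr (2 * s + 1)) * indicator hpi x \<partial>lborel) = ennreal (1 / beta_const 1 s)"
proof -
 have "1 / beta_const 1 s = Beta (1 / 2) (s + 1)"
  using beta_const_1[OF assms] beta_const_pos[of 1 s] assms by (simp add: field_simps)
 then show ?thesis
  using nn_integral_sin_substitution[of "\<lambda>_. 1" s] nn_integral_beta_unit[OF assms] by simp
qed

lemma cos_powr_integral:
 assumes "s > -1"
 shows "set_integrable lborel hpi (\<lambda>x. cos x powr (2 * s + 1))"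
  and "(LBINT x:hpi. cos x powr (2 * s + 1)) = 1 / beta_const 1 s"
proof -
 have nn: "(\<integral>\<^sup>+ x. ennreal (indicator hpi x * cos x powr (2 * s + 1)) \<partial>lborel) = ennreal (1 / beta_const 1 s)"
  using nn_integral_cos_powr[OF assms]
  by (simp add: ennreal_mult'' ennreal_indicator mult.commute)
 have pos: "0 < beta_const 1 s" using assms by (intro beta_const_pos) auto
 have [measurable]: "(\<lambda>x. indicator hpi x * cos x powr (2 * s + 1)) \<in> borel_measurable lborel" by measurable
 show "set_integrable lborel hpi (\<lambda>x. cos x powr (2 * s + 1))"
  unfolding set_integrable_def
  by (rule integrableI_nonneg) (use nn in \<open>auto simp: less_top[symmetric]\<close>)
 show "(LBINT x:hpi. cos x powr (2 * s + 1)) = 1 / beta_const 1 s"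
  unfolding set_lebesgue_integral_def
  by (subst integral_eq_nn_integral) (use nn pos in \<open>auto\<close>)
qed

text \<open>All Gamma factors cancel except for one step of the functional equation. This product
  fixes the weights in the analytic form of the recursion.\<close>

lemma beta_const_product:
 assumes "a \<ge> 0"
 shows "beta_const 1 ((a - 1) / 2) * beta_const 1 (a / 2) = (a + 1) / (2 * pi)"
proof -
 define A B C where "A = Gamma (a / 2 + 1 / 2)" "B = Gamma (a / 2 + 1)" "C = Gamma (a / 2 + 3 / 2)"
 have pos: "0 < A" "0 < B" using assms by (auto simp: A_B_C_def intro!: Gamma_real_pos)
 have C: "C = (a / 2 + 1 / 2) * A"
  using Gamma_plus1[of "a / 2 + 1 / 2"] assms by (simp add: A_B_C_def nonpos_Ints_def add.commute)
 have e: "1 / 2 + (a - 1) / 2 + 1 = a / 2 + 1" "(a - 1) / 2 + 1 = a / 2 + 1 / 2" "1 / 2 + a / 2 + 1 = a / 2 + 3 / 2"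
  by (simp_all add: field_simps)
 have p: "pi powr (1 / 2) * pi powr (1 / 2) = pi" by (simp flip: powr_add)
 have "beta_const 1 ((a - 1) / 2) * beta_const 1 (a / 2) =
  (B / (pi powr (1 / 2) * A)) * (C / (pi powr (1 / 2) * B))"
  unfolding beta_const_def e A_B_C_def by simp
 also have "\<dots> = C / (pi * A)" using pos p by (simp add: field_simps)
 also have "\<dots> = (a + 1) / (2 * pi)" using pos C by (simp add: field_simps)
 finally show ?thesis .
qed

text \<open>Dominated convergence along exhausting sets. The exceptional point \<open>z\<close>
  accommodates sets that leave out a neighbourhood of 0.\<close>

lemma lborel_set_integral_tendsto:
 fixes f :: "real => 'a :: {banach, second_countable_topology}"
 assumes f: "set_integrable lborel A f" and B: "\<And>n. B n \<in> sets borel" "\<And>n. B n \<subseteq> A"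
  and A: "A \<in> sets borel"
  and ev: "\<And>x. x \<in> A ==> x \<noteq> z ==> eventually (\<lambda>n. x \<in> B n) sequentially"
 shows "(\<lambda>n. LBINT x:B n. f x) \<longlonglongrightarrow> (LBINT x:A. f x)"
 unfolding set_lebesgue_integral_def
proof (rule integral_dominated_convergence[where w = "\<lambda>x. norm (indicator A x *\<^sub>R f x)"])
 have int: "integrable lborel (\<lambda>x. indicator A x *\<^sub>R f x)" using f by (simp add: set_integrable_def)
 then show "integrable lborel (\<lambda>x. norm (indicator A x *\<^sub>R f x))" by (rule integrable_norm)
 show "(\<lambda>x. indicator A x *\<^sub>R f x) \<in> borel_measurable lborel" using int by (rule borel_measurable_integrable)
 show "(\<lambda>x. indicator (B n) x *\<^sub>R f x) \<in> borel_measurable lborel" for n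
 proof -
  have "set_integrable lborel (B n) f" using f B by (intro set_integrable_subset[OF f]) auto
  then show ?thesis unfolding set_integrable_def by (rule borel_measurable_integrable)
 qed
 show "AE x in lborel. (\<lambda>n. indicator (B n) x *\<^sub>R f x) \<longlonglongrightarrow> indicator A x *\<^sub>R f x"
 proof (rule AE_I[of _ _ "{z}"], rule subsetI)
  fix x assume x: "x \<in> {x \<in> space lborel. \<not> (\<lambda>n. indicator (B n) x *\<^sub>R f x) \<longlonglongrightarrow> indicator A x *\<^sub>R f x}"
  show "x \<in> {z}"
  proof (rule ccontr)
   assume "x \<notin> {z}"
   then have xz: "x \<noteq> z" by simp
   have "eventually (\<lambda>n. indicator (B n) x *\<^sub>R f x = indicator A x *\<^sub>R f x) sequentially"
   proof (cases "x \<in> A")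
    case True
    from ev[OF True xz] show ?thesis by eventually_elim (use True in auto)
   next
    case False
    then have "x \<notin> B n" for n using B(2) by blast
    then show ?thesis using False by simp
   qed
   then have "(\<lambda>n. indicator (B n) x *\<^sub>R f x) \<longlonglongrightarrow> indicator A x *\<^sub>R f x"
    by (rule tendsto_eventually)
   then show False using x by simp
  qed
 qed auto
 show "AE x in lborel. norm (indicator (B n) x *\<^sub>R f x) \<le> norm (indicator A x *\<^sub>R f x)" for n
  using B(2)[of n] by (intro AE_I2) (auto simp: indicator_def)
qed

section \<open>The one-dimensional kernels and their growth\<close>

locale kernel =
 fixes \<alpha> :: real
 assumes alpha: "0 \<le> \<alpha>"
begin

definition cc :: real where "cc = beta_const 1 ((\<alpha> - 1) / 2)"

text \<open>On \<open>hpi\<close> this is the distribution function of the one-dimensional beta law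
  at sin t.\<close>

definition ff :: "real => real" where
 "ff t = 1 / 2 + (LBINT y=ereal 0..ereal t. cc * cos y powr \<alpha>)"

definition gi :: "real => real" where
 "gi x = (LBINT y=ereal 0..ereal x. cc * cos y powr (- \<alpha> - 1))"

text \<open>With cosh y = 1 / cos x this is the continuation of \<open>ff\<close> to the imaginary
  point i y.\<close>

definition gg :: "real => complex" where
 "gg x = 1 / 2 + \<i> * cr (gi x)"

lemma cc_pos: "0 < cc"
 unfolding cc_def using alpha by (intro beta_const_pos) auto

lemma cos_powr_continuous: "S \<subseteq> hpi ==> continuous_on S (\<lambda>y. cc * cos y powr r)"
 by (intro continuous_intros ballI) (metis cos_pos_hpi less_irrefl subsetD)

lemma cos_primitive_deriv:
 assumes x: "x \<in> hpi"
 shows "((\<lambda>t. LBINT y=ereal 0..ereal t. cc * cos y powr r) has_real_derivative cc * cos x powr r) (at x)"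
proof -
 \<comment> \<open>A closed interval inside \<open>hpi\<close> with \<open>x\<close> in its
   interior, so that the derivative within it is the full derivative.\<close>
 define a where "a = (\<bar>x\<bar> + pi / 2) / 2"
 have a: "\<bar>x\<bar> < a" "a < pi / 2" "0 \<le> a" using x by (auto simp: a_def abs_if split: if_splits)
 have sub: "{-a..a} \<subseteq> hpi" using a by auto
 have "((\<lambda>u. LBINT y=ereal 0..ereal u. cc * cos y powr r) has_vector_derivative (cc * cos x powr r)) (at x within {-a..a})"
  using a by (intro interval_integral_FTC2 cos_powr_continuous sub) auto
 moreover have "at x within {-a..a} = at x"
  using a by (intro at_within_interior) (auto simp: abs_less_iff)
 ultimately show ?thesis by (simp add: has_real_derivative_iff_has_vector_derivative zero_ereal_def)
qed

lemma ff_deriv: "x \<in> hpi ==> (ff has_real_derivative cc * cos x powr \<alpha>) (at x)"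
 unfolding ff_def[abs_def] by (rule derivative_eq_intros cos_primitive_deriv | simp)+

lemma gi_deriv: "x \<in> hpi ==> (gi has_real_derivative cc * cos x powr (- \<alpha> - 1)) (at x)"
 unfolding gi_def[abs_def] by (rule cos_primitive_deriv)

lemma ff_0: "ff 0 = 1 / 2" and gi_0: "gi 0 = 0"
 by (simp_all add: ff_def gi_def)

lemma gi_minus: "gi (- x) = - gi x"
proof -
 have "gi (- x) = (LBINT y=ereal 0..ereal (- x). cc * cos (- y) powr (- \<alpha> - 1))" by (simp add: gi_def)
 also have "\<dots> = (LBINT y=ereal x..ereal 0. cc * cos y powr (- \<alpha> - 1))"
  by (subst interval_integral_reflect) simp
 also have "\<dots> = - gi x" unfolding gi_def by (rule interval_integral_endpoints_reverse)
 finally show ?thesis .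
qed

lemma ff_minus: "ff (- x) = 1 - ff x"
proof -
 have "(LBINT y=ereal 0..ereal (- x). cc * cos (- y) powr \<alpha>) = (LBINT y=ereal x..ereal 0. cc * cos y powr \<alpha>)"
  by (subst interval_integral_reflect) simp
 also have "\<dots> = - (LBINT y=ereal 0..ereal x. cc * cos y powr \<alpha>)"
  by (rule interval_integral_endpoints_reverse)
 finally show ?thesis by (simp add: ff_def)
qed

lemma ff_lipschitz: "x \<in> hpi ==> \<bar>ff x - 1 / 2\<bar> \<le> cc * \<bar>x\<bar>"
proof -
 assume x: "x \<in> hpi"
 have "norm (ff x - ff 0) \<le> cc * norm (x - 0)"
 proof (rule field_differentiable_bound[of hpi ff "\<lambda>x. cc * cos x powr \<alpha>"])
  fix z assume z: "z \<in> hpi"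
  show "(ff has_field_derivative cc * cos z powr \<alpha>) (at z within hpi)"
   using ff_deriv[OF z] by (rule has_field_derivative_at_within)
  have "cos z powr \<alpha> \<le> 1" using cos_pos_hpi[OF z] alpha by (intro powr_le1) auto
  then show "norm (cc * cos z powr \<alpha>) \<le> cc" using cc_pos by simp
 qed (use x in auto)
 then show ?thesis by (simp add: ff_0)
qed

lemma gi_lipschitz:
 assumes x: "\<bar>x\<bar> \<le> pi / 4"
 shows "\<bar>gi x\<bar> \<le> cc * cos (pi / 4) powr (- \<alpha> - 1) * \<bar>x\<bar>"
proof -
 have "norm (gi x - gi 0) \<le> (cc * cos (pi / 4) powr (- \<alpha> - 1)) * norm (x - 0)"
 proof (rule field_differentiable_bound[of "{- (pi / 4)..pi / 4}" gi "\<lambda>x. cc * cos x powr (- \<alpha> - 1)"])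
  fix z assume z: "z \<in> {- (pi / 4)..pi / 4}"
  then have "- (pi / 4) \<le> z" "z \<le> pi / 4" by auto
  with pi_gt_zero have "- (pi / 2) < z" "z < pi / 2" by linarith+
  then have zh: "z \<in> hpi" by simp
  show "(gi has_field_derivative cc * cos z powr (- \<alpha> - 1)) (at z within {- (pi / 4)..pi / 4})"
   using gi_deriv[OF zh] by (rule has_field_derivative_at_within)
  have "cos (pi / 4) \<le> cos \<bar>z\<bar>" using z by (intro cos_monotone_0_pi_le) auto
  then have "cos (pi / 4) \<le> cos z" by simp
  then have "cos z powr (- \<alpha> - 1) \<le> cos (pi / 4) powr (- \<alpha> - 1)"
   using alpha by (intro powr_mono2') (auto simp: cos_45)
  then show "norm (cc * cos z powr (- \<alpha> - 1)) \<le> cc * cos (pi / 4) powr (- \<alpha> - 1)"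
   using cc_pos by simp
 qed (use x in auto)
 then show ?thesis by (simp add: gi_0)
qed

text \<open>The primitive grows like cos^(-\<alpha>) for positive \<alpha> but logarithmically for
  \<alpha> = 0; the extra exponent \<open>e\<close> covers both. The proof compares derivatives with
  an explicit majorant.\<close>

lemma gi_growth:
 assumes e: "0 < e"
 shows "\<exists>K>0. \<forall>x\<in>hpi. \<bar>gi x\<bar> \<le> K * cos x powr (- \<alpha> - e)"
proof -
 define C1 where "C1 = 2 / e"
 define C2 :: real where "C2 = 2 powr (\<alpha> + 1)"
 define K where "K = cc * (C1 + 2 * C2)"
 have C: "0 < C1" "0 < C2" using e by (auto simp: C1_def C2_def)
 have K: "0 < K" using C cc_pos by (simp add: K_def)
 \<comment> \<open>Majorant minus \<open>gi\<close>. The \<open>C1\<close> term dominates where cos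
   < 1/2, since there sin is at least 1/2; the \<open>C2\<close> term dominates where cos is at
   least 1/2.\<close>
 define H where "H x = cc * (C1 * cos x powr (- \<alpha> - e) + C2 * x) - gi x" for x
 have ge: "0 \<le> H x \<and> 0 \<le> gi x" if x: "0 \<le> x" "x < pi / 2" for x
 proof
  have hz: "z \<in> hpi" if "0 \<le> z" "z \<le> x" for z using that x by auto
  have "H 0 \<le> H x"
  proof (rule DERIV_nonneg_imp_nondecreasing[OF x(1)])
   fix z assume z: "0 \<le> z" "z \<le> x"
   note zh = hz[OF z]
   have cz: "0 < cos z" using cos_pos_hpi[OF zh] .
   have sz: "0 \<le> sin z" using z x by (intro sin_ge_zero) auto
   define D where "D = cc * (C1 * ((- \<alpha> - e) * cos z powr (- \<alpha> - e - 1) * (- sin z)) + C2) - cc * cos z powr (- \<alpha> - 1)"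
   have dpow: "((\<lambda>x. cos x powr (- \<alpha> - e)) has_real_derivative (- \<alpha> - e) * cos z powr (- \<alpha> - e - 1) * (- sin z)) (at z)"
    using DERIV_fun_powr[OF DERIV_cos cz, of "- \<alpha> - e"] by simp
   have "(H has_real_derivative D) (at z)"
    unfolding H_def[abs_def] D_def
    by (intro DERIV_diff DERIV_cmult DERIV_add DERIV_cmult_Id dpow gi_deriv zh)
   moreover have "0 \<le> D"
   proof -
    have main: "cos z powr (- \<alpha> - 1) \<le> C1 * ((\<alpha> + e) * cos z powr (- \<alpha> - e - 1) * sin z) + C2"
    proof (cases "1 / 2 \<le> cos z")
     case True
     have "cos z powr (- \<alpha> - 1) \<le> (1 / 2) powr (- \<alpha> - 1)"
      using True alpha by (intro powr_mono2') auto
     also have "(1 / 2 :: real) powr (- \<alpha> - 1) = C2"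
      by (simp add: C2_def powr_divide powr_minus_divide[of 2 "\<alpha> + 1", symmetric])
       (simp add: powr_minus field_simps flip: powr_add)
     finally have "cos z powr (- \<alpha> - 1) \<le> C2" .
     moreover have "0 \<le> C1 * ((\<alpha> + e) * cos z powr (- \<alpha> - e - 1) * sin z)"
      using C sz alpha e by (intro mult_nonneg_nonneg) auto
     ultimately show ?thesis by linarith
    next
     case False
     have "(sin z)\<^sup>2 = 1 - (cos z)\<^sup>2" by (simp add: sin_squared_eq)
     moreover have "(cos z)\<^sup>2 \<le> (1 / 2)\<^sup>2" using False cz by (intro power_mono) auto
     ultimately have "(1 / 2)\<^sup>2 \<le> (sin z)\<^sup>2" by (simp add: power2_eq_square)
     then have s2: "1 / 2 \<le> sin z" using sz by (rule power2_le_imp_le)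
     have "cos z powr (- \<alpha> - 1) \<le> cos z powr (- \<alpha> - e - 1)"
      using cz e by (intro powr_mono') auto
     also have "\<dots> = C1 * (e * cos z powr (- \<alpha> - e - 1) * (1 / 2))" using e by (simp add: C1_def)
     also have "\<dots> \<le> C1 * ((\<alpha> + e) * cos z powr (- \<alpha> - e - 1) * sin z)"
      using C s2 alpha e by (intro mult_left_mono mult_mono) auto
     finally show ?thesis using C by linarith
    qed
    have "D = cc * (C1 * ((\<alpha> + e) * cos z powr (- \<alpha> - e - 1) * sin z) + C2 - cos z powr (- \<alpha> - 1))"
     unfolding D_def by (simp add: algebra_simps)
    then show ?thesis using main cc_pos by simp
   qed
   ultimately show "\<exists>y. (H has_real_derivative y) (at z) \<and> 0 \<le> y" by blast
  qed
  moreover have "0 \<le> H 0" using C cc_pos by (simp add: H_def gi_0)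
  ultimately show "0 \<le> H x" by linarith
  have "gi 0 \<le> gi x"
  proof (rule DERIV_nonneg_imp_nondecreasing[OF x(1)])
   fix z assume z: "0 \<le> z" "z \<le> x"
   show "\<exists>y. (gi has_real_derivative y) (at z) \<and> 0 \<le> y"
    using gi_deriv[OF hz[OF z]] cc_pos by (intro exI[of _ "cc * cos z powr (- \<alpha> - 1)"]) auto
  qed
  then show "0 \<le> gi x" by (simp add: gi_0)
 qed
 have pos: "\<bar>gi x\<bar> \<le> K * cos x powr (- \<alpha> - e)" if x: "0 \<le> x" "x < pi / 2" for x
 proof -
  have xh: "x \<in> hpi" using x by auto
  have "1 powr (- \<alpha> - e) \<le> cos x powr (- \<alpha> - e)"
   using cos_pos_hpi[OF xh] alpha e by (intro powr_mono2') auto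
  then have 1: "1 \<le> cos x powr (- \<alpha> - e)" by simp
  have "\<bar>gi x\<bar> \<le> cc * (C1 * cos x powr (- \<alpha> - e) + C2 * x)" using ge[OF x] by (simp add: H_def)
  also have "\<dots> \<le> cc * (C1 * cos x powr (- \<alpha> - e) + C2 * 2)"
   using cc_pos C x pi_less_4 by (intro mult_left_mono add_left_mono) auto
  also have "\<dots> \<le> cc * (C1 * cos x powr (- \<alpha> - e) + C2 * 2 * cos x powr (- \<alpha> - e))"
   using cc_pos C 1 by (intro mult_left_mono add_left_mono) auto
  also have "\<dots> = K * cos x powr (- \<alpha> - e)" by (simp add: K_def algebra_simps)
  finally show ?thesis .
 qed
 have "\<bar>gi x\<bar> \<le> K * cos x powr (- \<alpha> - e)" if "x \<in> hpi" for x
 proof (cases "0 \<le> x")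
  case True
  then show ?thesis using pos that by auto
 next
  case False
  then show ?thesis using pos[of "- x"] that by (auto simp: gi_minus)
 qed
 then show ?thesis using K by blast
qed

end

section \<open>A complex vector field and its divergence\<close>

lemma has_vector_derivative_quot3:
 fixes h V D :: "real => complex"
 assumes h: "(h has_vector_derivative h') (at t)" and V: "(V has_vector_derivative V') (at t)"
  and D: "(D has_vector_derivative D') (at t)" and nz: "D t \<noteq> 0"
 shows "((\<lambda>t. h t * V t / D t) has_vector_derivative
  (h' * V t / D t + h t * V' / D t - h t * V t * D' / (D t)\<^sup>2)) (at t)"
proof -
 have "((inverse \<circ> D) has_vector_derivative (D' * (- (inverse (D t) ^ Suc (Suc 0))))) (at t)"
  by (rule field_vector_diff_chain_at[OF D DERIV_inverse[OF nz]])
 then have i: "((\<lambda>t. inverse (D t)) has_vector_derivative (D' * (- (inverse (D t) ^ Suc (Suc 0))))) (at t)"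
  by (simp add: comp_def)
 have "((\<lambda>t. h t * V t * inverse (D t)) has_vector_derivative
  ((h t * V t) * (D' * (- (inverse (D t) ^ Suc (Suc 0)))) + (h t * V' + h' * V t) * inverse (D t))) (at t)"
  by (intro has_vector_derivative_mult h V i)
 moreover have "(h t * V t) * (D' * (- (inverse (D t) ^ Suc (Suc 0)))) + (h t * V' + h' * V t) * inverse (D t)
  = h' * V t / D t + h t * V' / D t - h t * V t * D' / (D t)\<^sup>2"
  using nz by (simp add: field_simps power2_eq_square)
 ultimately show ?thesis by (simp add: divide_inverse)
qed

lemma of_real_vector_derivative:
 "(f has_real_derivative f') (at t) ==> ((\<lambda>t. cr (f t)) has_vector_derivative cr f') (at t)"
 by (rule has_vector_derivative_of_real) (simp add: has_real_derivative_iff_has_vector_derivative)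

text \<open>The factor j is absorbed by j binom(N, j) = N binom(N - 1, j - 1), which leaves a second
  binomial expansion.\<close>

lemma binomial_weighted_sum:
 fixes x z :: complex
 shows "(\<Sum>j\<le>N. of_nat (N choose j) * (A + B * of_nat j) * x ^ (N - j) * z ^ j) =
  A * (x + z) ^ N + B * of_nat N * z * (x + z) ^ (N - 1)"
proof -
 have 1: "(\<Sum>j\<le>N. of_nat (N choose j) * x ^ (N - j) * z ^ j) = (x + z) ^ N"
  using binomial_ring[of z x N] by (simp add: add.commute mult.commute mult.left_commute)
 have 2: "(\<Sum>j\<le>N. of_nat (N choose j) * of_nat j * x ^ (N - j) * z ^ j) = of_nat N * z * (x + z) ^ (N - 1)"
 proof (cases N)
  case (Suc M)
  have "(\<Sum>j\<le>N. of_nat (N choose j) * of_nat j * x ^ (N - j) * z ^ j) =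
   (\<Sum>j\<le>M. of_nat (Suc M choose Suc j) * of_nat (Suc j) * x ^ (M - j) * z ^ Suc j)"
   unfolding Suc by (subst sum.atMost_Suc_shift) simp
  also have "\<dots> = (\<Sum>j\<le>M. of_nat (Suc M) * z * (of_nat (M choose j) * x ^ (M - j) * z ^ j))"
  proof (intro sum.cong refl)
   fix j
   have "(of_nat (Suc M choose Suc j) * of_nat (Suc j) :: complex) = of_nat (Suc M) * of_nat (M choose j)"
    using Suc_times_binomial[of j M] by (metis mult.commute of_nat_mult)
   then show "of_nat (Suc M choose Suc j) * of_nat (Suc j) * x ^ (M - j) * z ^ Suc j =
    of_nat (Suc M) * z * (of_nat (M choose j) * x ^ (M - j) * z ^ j)" by simp
  qed
  also have "\<dots> = of_nat (Suc M) * z * (z + x) ^ M"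
   unfolding sum_distrib_left[symmetric]
   using binomial_ring[of z x M] by (simp add: mult.commute mult.left_commute)
  finally show ?thesis by (simp add: Suc add.commute)
 qed simp
 have "(\<Sum>j\<le>N. of_nat (N choose j) * (A + B * of_nat j) * x ^ (N - j) * z ^ j) =
  A * (\<Sum>j\<le>N. of_nat (N choose j) * x ^ (N - j) * z ^ j) +
  B * (\<Sum>j\<le>N. of_nat (N choose j) * of_nat j * x ^ (N - j) * z ^ j)"
  unfolding sum_distrib_left sum.distrib[symmetric] by (intro sum.cong refl) (simp add: algebra_simps)
 then show ?thesis unfolding 1 2 by (simp add: mult.assoc)
qed

definition pp :: "real => real => real" where "pp t x = cos t * cos x"

text \<open>Up to the factor -cos x, the image of \<open>pp\<close> under d/dt + i cos x d/dx. In
  the open square it vanishes only at the origin.\<close>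

definition DD :: "real => real => complex" where
 "DD t x = cr (sin t) + \<i> * cr (cos t * sin x)"

lemma pp_pos: "t \<in> hpi ==> x \<in> hpi ==> 0 < pp t x"
 unfolding pp_def using cos_pos_hpi by simp

lemma pp_le_1: "t \<in> hpi ==> x \<in> hpi ==> pp t x \<le> 1"
 unfolding pp_def using cos_pos_hpi by (intro mult_le_one) (auto intro: less_imp_le)

lemma norm_DD: "(norm (DD t x))\<^sup>2 = 1 - (pp t x)\<^sup>2"
proof -
 have "(norm (DD t x))\<^sup>2 = (sin t)\<^sup>2 + (cos t * sin x)\<^sup>2" by (simp add: DD_def cmod_power2)
 also have "\<dots> = 1 - (pp t x)\<^sup>2"
  by (simp add: pp_def power_mult_distrib sin_squared_eq algebra_simps)
 finally show ?thesis .
qed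

lemma norm_DD_ge: "\<bar>sin t\<bar> \<le> norm (DD t x)" "\<bar>sin x\<bar> \<le> norm (DD t x)"
proof -
 have "(\<bar>sin t\<bar>)\<^sup>2 \<le> (norm (DD t x))\<^sup>2" by (simp add: DD_def cmod_power2)
 then show "\<bar>sin t\<bar> \<le> norm (DD t x)" by (rule power2_le_imp_le) simp
 have "(cos t)\<^sup>2 * (cos x)\<^sup>2 \<le> 1 * (cos x)\<^sup>2"
  by (intro mult_right_mono) (simp_all add: abs_square_le_1)
 then have "(\<bar>sin x\<bar>)\<^sup>2 \<le> (norm (DD t x))\<^sup>2"
  unfolding norm_DD by (simp add: pp_def power_mult_distrib sin_squared_eq)
 then show "\<bar>sin x\<bar> \<le> norm (DD t x)" by (rule power2_le_imp_le) simp
qed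

lemma norm_DD_le_1: "norm (DD t x) \<le> 1"
proof -
 have "(norm (DD t x))\<^sup>2 \<le> 1\<^sup>2" unfolding norm_DD by simp
 then show ?thesis by (rule power2_le_imp_le) simp
qed

lemma sin_nonzero_hpi: "x \<in> hpi ==> x \<noteq> 0 ==> sin x \<noteq> 0"
 using sin_gt_zero[of x] sin_gt_zero[of "- x"] by (cases "0 < x") auto

lemma DD_nonzero: "t \<in> hpi ==> x \<in> hpi ==> t \<noteq> 0 \<or> x \<noteq> 0 ==> DD t x \<noteq> 0"
 using norm_DD_ge[of t x] sin_nonzero_hpi[of t] sin_nonzero_hpi[of x] norm_DD_ge[where t=t and x=x] by auto

lemma pp_powr_deriv:
 assumes "t \<in> hpi" "x \<in> hpi"
 shows "((\<lambda>t. pp t x powr r) has_real_derivative r * pp t x powr (r - 1) * (- sin t * cos x)) (at t)"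
  "((\<lambda>x. pp t x powr r) has_real_derivative r * pp t x powr (r - 1) * (- cos t * sin x)) (at x)"
proof -
 have 1: "((\<lambda>t. pp t x) has_real_derivative - sin t * cos x) (at t)"
  and 2: "((\<lambda>x. pp t x) has_real_derivative - cos t * sin x) (at x)"
  unfolding pp_def by (auto intro!: derivative_eq_intros)
 show "((\<lambda>t. pp t x powr r) has_real_derivative r * pp t x powr (r - 1) * (- sin t * cos x)) (at t)"
  using DERIV_fun_powr[OF 1 pp_pos[OF assms], of r] by simp
 show "((\<lambda>x. pp t x powr r) has_real_derivative r * pp t x powr (r - 1) * (- cos t * sin x)) (at x)"
  using DERIV_fun_powr[OF 2 pp_pos[OF assms], of r] by simp
qed

context kernel
begin

text \<open>Its binomial expansion produces the mixed powers of \<open>ff\<close> and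
  \<open>gg\<close> in the recursion.\<close>

definition WW :: "real => real => complex" where
 "WW t x = cr (ff t) + cr (pp t x powr \<alpha>) * gg x"

definition Wt :: "real => real => complex" where
 "Wt t x = cr (cc * cos t powr \<alpha>) +
  cr (\<alpha> * pp t x powr (\<alpha> - 1) * (- sin t * cos x)) * gg x"

definition Wx :: "real => real => complex" where
 "Wx t x = cr (pp t x powr \<alpha>) * (\<i> * cr (cc * cos x powr (- \<alpha> - 1))) +
  cr (\<alpha> * pp t x powr (\<alpha> - 1) * (- cos t * sin x)) * gg x"

lemma gg_deriv: "x \<in> hpi ==> (gg has_vector_derivative \<i> * cr (cc * cos x powr (- \<alpha> - 1))) (at x)"
 unfolding gg_def[abs_def]
 using has_vector_derivative_add[OF has_vector_derivative_const has_vector_derivative_mult[OF has_vector_derivative_const of_real_vector_derivative[OF gi_deriv]], of x "1/2" "\<i>"]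
 by simp

lemma WW_deriv:
 assumes "t \<in> hpi" "x \<in> hpi"
 shows "((\<lambda>t. WW t x) has_vector_derivative Wt t x) (at t)"
  "(WW t has_vector_derivative Wx t x) (at x)"
proof -
 have "((\<lambda>t. cr (ff t) + cr (pp t x powr \<alpha>) * gg x) has_vector_derivative
  cr (cc * cos t powr \<alpha>) + (cr (pp t x powr \<alpha>) * 0 +
   cr (\<alpha> * pp t x powr (\<alpha> - 1) * (- sin t * cos x)) * gg x)) (at t)"
  by (intro has_vector_derivative_add has_vector_derivative_mult has_vector_derivative_const
    of_real_vector_derivative ff_deriv pp_powr_deriv assms)
 then show "((\<lambda>t. WW t x) has_vector_derivative Wt t x) (at t)"
  unfolding WW_def Wt_def by simp
 have "((\<lambda>x. cr (ff t) + cr (pp t x powr \<alpha>) * gg x) has_vector_derivative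
  0 + (cr (pp t x powr \<alpha>) * (\<i> * cr (cc * cos x powr (- \<alpha> - 1))) +
   cr (\<alpha> * pp t x powr (\<alpha> - 1) * (- cos t * sin x)) * gg x)) (at x)"
  by (intro has_vector_derivative_add has_vector_derivative_mult has_vector_derivative_const
    of_real_vector_derivative gg_deriv pp_powr_deriv assms)
 then show "(WW t has_vector_derivative Wx t x) (at x)"
  unfolding WW_def[abs_def] Wx_def by simp
qed

text \<open>The contributions of the derivatives of \<open>ff\<close> and \<open>gg\<close> cancel,
  because i i = -1 and the powers of cos x multiply to 1. What is left comes from differentiating
  \<open>pp\<close> and carries the factor \<open>DD\<close>.\<close>

lemma Wt_Wx:
 assumes "t \<in> hpi" "x \<in> hpi"
 shows "Wt t x + \<i> * cr (cos x) * Wx t x =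
  - cr (\<alpha> * pp t x powr (\<alpha> - 1) * cos x) * gg x * DD t x"
proof -
 have ct: "0 < cos t" and cx: "0 < cos x" using cos_pos_hpi assms by auto
 have "pp t x powr \<alpha> * cos x powr (- \<alpha> - 1) * cos x = cos t powr \<alpha> * (cos x powr \<alpha> * cos x powr (- \<alpha> - 1) * cos x powr 1)"
  using ct cx by (simp add: pp_def powr_mult)
 also have "cos x powr \<alpha> * cos x powr (- \<alpha> - 1) * cos x powr 1 = 1"
  using cx by (simp flip: powr_add)
 finally have e: "pp t x powr \<alpha> * cos x powr (- \<alpha> - 1) * cos x = cos t powr \<alpha>" by simp
 have "\<i> * cr (cos x) * (cr (pp t x powr \<alpha>) * (\<i> * cr (cc * cos x powr (- \<alpha> - 1))))
  = - cr (cc * (pp t x powr \<alpha> * cos x powr (- \<alpha> - 1) * cos x))"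
  by (simp add: algebra_simps)
 then have "\<i> * cr (cos x) * (cr (pp t x powr \<alpha>) * (\<i> * cr (cc * cos x powr (- \<alpha> - 1))))
  = - cr (cc * cos t powr \<alpha>)" unfolding e .
 then show ?thesis unfolding Wt_def Wx_def DD_def
  by (auto simp: algebra_simps)
qed

lemma ff_cont: "continuous_on hpi ff"
 using ff_deriv by (intro continuous_at_imp_continuous_on ballI) (blast intro: DERIV_isCont)

lemma gi_cont: "continuous_on hpi gi"
 using gi_deriv by (intro continuous_at_imp_continuous_on ballI) (blast intro: DERIV_isCont)

lemma gg_cont: "continuous_on hpi gg"
 unfolding gg_def[abs_def] by (intro continuous_intros gi_cont)

lemma cont_pieces:
 assumes S: "S \<subseteq> hpi \<times> hpi"
 shows "continuous_on S (\<lambda>z. ff (fst z))" "continuous_on S (\<lambda>z. gg (snd z))"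
  "continuous_on S (\<lambda>z. pp (fst z) (snd z) powr r)" "continuous_on S (\<lambda>z. cos (snd z) powr r)"
  "continuous_on S (\<lambda>z. WW (fst z) (snd z))" "continuous_on S (\<lambda>z. DD (fst z) (snd z))"
proof -
 show f: "continuous_on S (\<lambda>z. ff (fst z))"
  by (rule continuous_on_compose2[OF ff_cont]) (use S in \<open>auto intro!: continuous_intros\<close>)
 show g: "continuous_on S (\<lambda>z. gg (snd z))"
  by (rule continuous_on_compose2[OF gg_cont]) (use S in \<open>auto intro!: continuous_intros\<close>)
 have p: "continuous_on S (\<lambda>z. pp (fst z) (snd z) powr r)" for r
 proof (intro continuous_on_powr continuous_on_const ballI)
  show "continuous_on S (\<lambda>z. pp (fst z) (snd z))" unfolding pp_def by (intro continuous_intros)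
  show "pp (fst z) (snd z) \<noteq> 0" if "z \<in> S" for z
  proof -
   have "fst z \<in> hpi" "snd z \<in> hpi" using that S by auto
   from pp_pos[OF this] show ?thesis by simp
  qed
 qed
 then show "continuous_on S (\<lambda>z. pp (fst z) (snd z) powr r)" .
 show "continuous_on S (\<lambda>z. cos (snd z) powr r)"
 proof (intro continuous_on_powr continuous_on_const ballI)
  show "continuous_on S (\<lambda>z. cos (snd z))" by (intro continuous_intros)
  show "cos (snd z) \<noteq> 0" if "z \<in> S" for z
  proof -
   have "snd z \<in> hpi" using that S by auto
   from cos_pos_hpi[OF this] show ?thesis by simp
  qed
 qed
 show "continuous_on S (\<lambda>z. WW (fst z) (snd z))" unfolding WW_def by (intro continuous_intros f g p)
 show "continuous_on S (\<lambda>z. DD (fst z) (snd z))" unfolding DD_def by (intro continuous_intros)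
qed

end

locale kernel_pair = kernel +
 fixes k N :: nat
begin

abbreviation A0 :: real where "A0 \<equiv> \<alpha> * real k"

text \<open>The component crossing the edges t = const; \<open>Psi\<close> is the one crossing the
  edges x = const.\<close>

definition phi :: "real => real => complex" where
 "phi t x = cr (pp t x powr (A0 + 1)) * (WW t x ^ N - 1) / DD t x"

definition Psi :: "real => real => complex" where
 "Psi t x = cr (cos x * pp t x powr (A0 + 1)) * (WW t x ^ N - 1) / DD t x"

definition phit :: "real => real => complex" where
 "phit t x = cr ((A0 + 1) * pp t x powr A0 * (- sin t * cos x)) * (WW t x ^ N - 1) / DD t x +
  cr (pp t x powr (A0 + 1)) * (of_nat N * WW t x ^ (N - 1) * Wt t x) / DD t x -
  cr (pp t x powr (A0 + 1)) * (WW t x ^ N - 1) *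
   (cr (cos t) - \<i> * cr (sin t * sin x)) / (DD t x)\<^sup>2"

definition Psix :: "real => real => complex" where
 "Psix t x = cr (- sin x * pp t x powr (A0 + 1) + cos x * ((A0 + 1) * pp t x powr A0 * (- cos t * sin x))) * (WW t x ^ N - 1) / DD t x +
  cr (cos x * pp t x powr (A0 + 1)) * (of_nat N * WW t x ^ (N - 1) * Wx t x) / DD t x -
  cr (cos x * pp t x powr (A0 + 1)) * (WW t x ^ N - 1) *
   (\<i> * cr (cos t * cos x)) / (DD t x)\<^sup>2"

text \<open>The negative divergence after \<open>DD\<close> has been cancelled: no singular
  denominator is left and the variables separate in each summand.\<close>

definition RR :: "real => real => complex" where
 "RR t x = cr (cos x) * (cr ((A0 + 1) * pp t x powr A0) * (WW t x ^ N - 1) +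
  cr (pp t x powr (A0 + 1)) * (of_nat N * WW t x ^ (N - 1)) * cr (\<alpha> * pp t x powr (\<alpha> - 1)) * gg x)"

lemma VV_deriv:
 fixes f :: "real => complex"
 assumes "(f has_vector_derivative f') (at t)"
 shows "((\<lambda>t. f t ^ N - 1) has_vector_derivative of_nat N * f t ^ (N - 1) * f') (at t)"
proof -
 have "((\<lambda>z::complex. z ^ N - 1) has_field_derivative of_nat N * f t ^ (N - 1)) (at (f t))"
  by (auto intro!: derivative_eq_intros)
 from field_vector_diff_chain_at[OF assms this] show ?thesis by (simp add: comp_def mult.commute)
qed

lemma phi_deriv:
 assumes tx: "t \<in> hpi" "x \<in> hpi" "DD t x \<noteq> 0"
 shows "((\<lambda>t. phi t x) has_vector_derivative phit t x) (at t)"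
 unfolding phi_def phit_def
proof (rule has_vector_derivative_quot3)
 show "((\<lambda>t. cr (pp t x powr (A0 + 1))) has_vector_derivative
  cr ((A0 + 1) * pp t x powr A0 * (- sin t * cos x))) (at t)"
  using of_real_vector_derivative[OF pp_powr_deriv(1)[OF tx(1,2), of "A0 + 1"]] by simp
 show "((\<lambda>t. WW t x ^ N - 1) has_vector_derivative of_nat N * WW t x ^ (N - 1) * Wt t x) (at t)"
  by (rule VV_deriv[OF WW_deriv(1)[OF tx(1,2)]])
 have "((\<lambda>t. cr (sin t) + \<i> * cr (cos t * sin x)) has_vector_derivative
  cr (cos t) + (\<i> * cr (- sin t * sin x) + 0 * cr (cos t * sin x))) (at t)"
  by (intro has_vector_derivative_add has_vector_derivative_mult has_vector_derivative_const of_real_vector_derivative)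
   (auto intro!: derivative_eq_intros)
 then show "((\<lambda>t. DD t x) has_vector_derivative cr (cos t) - \<i> * cr (sin t * sin x)) (at t)"
  unfolding DD_def by simp
qed (rule tx)

lemma Psi_deriv:
 assumes tx: "t \<in> hpi" "x \<in> hpi" "DD t x \<noteq> 0"
 shows "(Psi t has_vector_derivative Psix t x) (at x)"
 unfolding Psi_def[abs_def] Psix_def
proof (rule has_vector_derivative_quot3)
 show "((\<lambda>x. cr (cos x * pp t x powr (A0 + 1))) has_vector_derivative
  cr (- sin x * pp t x powr (A0 + 1) + cos x * ((A0 + 1) * pp t x powr A0 * (- cos t * sin x)))) (at x)"
  using of_real_vector_derivative[OF DERIV_mult[OF DERIV_cos pp_powr_deriv(2)[OF tx(1,2), of "A0 + 1"]]]
  by (simp add: add.commute mult.commute mult.left_commute)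
 show "((\<lambda>x. WW t x ^ N - 1) has_vector_derivative of_nat N * WW t x ^ (N - 1) * Wx t x) (at x)"
  by (rule VV_deriv[OF WW_deriv(2)[OF tx(1,2)]])
 have "((\<lambda>x. cr (sin t) + \<i> * cr (cos t * sin x)) has_vector_derivative
  0 + (\<i> * cr (cos t * cos x) + 0 * cr (cos t * sin x))) (at x)"
  by (intro has_vector_derivative_add has_vector_derivative_mult has_vector_derivative_const of_real_vector_derivative)
   (auto intro!: derivative_eq_intros)
 then show "(DD t has_vector_derivative \<i> * cr (cos t * cos x)) (at x)"
  unfolding DD_def[abs_def] by simp
qed (rule tx)

text \<open>By the three equations each derivative combination carries \<open>D\<close>. The term
  from differentiating 1 / D cancels the one from differentiating the weight c = cos x of the second
  component.\<close>

lemma divergence_algebra: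
 fixes h ht hx V D Vt Vx Dt Dx :: complex and s c h1 :: complex
 assumes D: "D \<noteq> 0" and 1: "ht + \<i> * c * hx = - h1 * c * D"
  and 2: "Vt + \<i> * c * Vx = - u * c * D" and 3: "Dt + \<i> * c * Dx = - \<i> * s * D"
 shows "(ht * V / D + h * Vt / D - h * V * Dt / D\<^sup>2) +
  \<i> * ((- s * h + c * hx) * V / D + c * h * Vx / D - c * h * V * Dx / D\<^sup>2) = - (c * (h1 * V + h * u))"
proof -
 have "(ht * V / D + h * Vt / D - h * V * Dt / D\<^sup>2) +
  \<i> * ((- s * h + c * hx) * V / D + c * h * Vx / D - c * h * V * Dx / D\<^sup>2) =
  ((ht + \<i> * c * hx) * V - \<i> * s * h * V + h * (Vt + \<i> * c * Vx)) / D - h * V * (Dt + \<i> * c * Dx) / D\<^sup>2"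
  by (simp add: add_divide_distrib diff_divide_distrib algebra_simps)
 also have "\<dots> = - (c * (h1 * V + h * u))"
  unfolding 1 2 3 using D by (simp add: field_simps power2_eq_square)
 finally show ?thesis .
qed

lemma divergence:
 assumes tx: "t \<in> hpi" "x \<in> hpi" "DD t x \<noteq> 0"
 shows "phit t x + \<i> * Psix t x = - RR t x"
proof -
 let ?c = "cr (cos x)" and ?s = "cr (sin x)"
 let ?h = "cr (pp t x powr (A0 + 1))" and ?V = "WW t x ^ N - 1"
 let ?h1 = "cr ((A0 + 1) * pp t x powr A0)"
 let ?u = "of_nat N * WW t x ^ (N - 1) * cr (\<alpha> * pp t x powr (\<alpha> - 1)) * gg x"
 have 1: "cr ((A0 + 1) * pp t x powr A0 * (- sin t * cos x)) +
  \<i> * ?c * cr ((A0 + 1) * pp t x powr A0 * (- cos t * sin x)) = - ?h1 * ?c * DD t x"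
  unfolding DD_def by (simp add: algebra_simps)
 have 2: "of_nat N * WW t x ^ (N - 1) * Wt t x + \<i> * ?c * (of_nat N * WW t x ^ (N - 1) * Wx t x) = - ?u * ?c * DD t x"
 proof -
  have "of_nat N * WW t x ^ (N - 1) * Wt t x + \<i> * ?c * (of_nat N * WW t x ^ (N - 1) * Wx t x) =
   of_nat N * WW t x ^ (N - 1) * (Wt t x + \<i> * ?c * Wx t x)" by (simp add: algebra_simps)
  then show ?thesis unfolding Wt_Wx[OF tx(1,2)] by (simp add: algebra_simps)
 qed
 have 3: "(cr (cos t) - \<i> * cr (sin t * sin x)) + \<i> * ?c * (\<i> * cr (cos t * cos x)) = - \<i> * ?s * DD t x"
 proof -
  have cc: "?c * ?c = 1 - ?s * ?s"
   by (metis cos_squared_eq of_real_1 of_real_diff of_real_mult power2_eq_square)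
  have "(cr (cos t) - \<i> * cr (sin t * sin x)) + \<i> * ?c * (\<i> * cr (cos t * cos x)) =
   cr (cos t) - \<i> * cr (sin t * sin x) - cr (cos t) * (?c * ?c)"
   by (simp add: algebra_simps)
  also have "\<dots> = - \<i> * ?s * DD t x"
   unfolding cc DD_def by (simp add: algebra_simps)
  finally show ?thesis .
 qed
 from divergence_algebra[OF tx(3) 1 2 3, of ?V ?h]
 show ?thesis unfolding phit_def Psix_def RR_def by (simp add: mult.assoc)
qed

text \<open>The derivative of the power adds \<alpha> j to the factor A0 + 1 of the j-th binomial
  term, which gives the weight \<alpha> (k + j) + 1.\<close>

lemma RR_expand:
 assumes tx: "t \<in> hpi" "x \<in> hpi"
 shows "RR t x = (\<Sum>j\<le>N. of_nat (N choose j) * cr (\<alpha> * real (k + j) + 1) *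
   cr (cos t powr (\<alpha> * real (k + j)) * ff t ^ (N - j)) *
   (cr (cos x powr (\<alpha> * real (k + j) + 1)) * gg x ^ j))
  - cr (A0 + 1) * cr (cos t powr A0) * cr (cos x powr (A0 + 1))"
proof -
 have p: "0 < pp t x" and ct: "0 < cos t" and cx: "0 < cos x" using pp_pos cos_pos_hpi tx by auto
 define z where "z = cr (pp t x powr \<alpha>) * gg x"
 have W: "WW t x = cr (ff t) + z" by (simp add: WW_def z_def)
 have pw: "pp t x powr (A0 + 1) * pp t x powr (\<alpha> - 1) = pp t x powr A0 * pp t x powr \<alpha>"
  using p by (simp flip: powr_add)
 have "RR t x = cr (cos x * pp t x powr A0) * (cr (A0 + 1) * WW t x ^ N +
  cr \<alpha> * of_nat N * z * WW t x ^ (N - 1)) - cr ((A0 + 1) * (cos x * pp t x powr A0))"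
 proof -
  have "cr (pp t x powr (A0 + 1)) * (of_nat N * WW t x ^ (N - 1)) * cr (\<alpha> * pp t x powr (\<alpha> - 1)) * gg x
   = cr (pp t x powr (A0 + 1) * pp t x powr (\<alpha> - 1)) * (cr \<alpha> * of_nat N * gg x * WW t x ^ (N - 1))"
   by (simp add: algebra_simps)
  also have "\<dots> = cr (pp t x powr A0) * (cr \<alpha> * of_nat N * z * WW t x ^ (N - 1))"
   unfolding pw z_def by (simp add: algebra_simps)
  finally show ?thesis unfolding RR_def by (auto simp: algebra_simps)
 qed
 also have "cr (A0 + 1) * WW t x ^ N + cr \<alpha> * of_nat N * z * WW t x ^ (N - 1) =
  (\<Sum>j\<le>N. of_nat (N choose j) * (cr (A0 + 1) + cr \<alpha> * of_nat j) * cr (ff t) ^ (N - j) * z ^ j)"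
  unfolding W by (rule binomial_weighted_sum[symmetric])
 also have "cr (cos x * pp t x powr A0) * \<dots> = (\<Sum>j\<le>N. of_nat (N choose j) * cr (\<alpha> * real (k + j) + 1) *
   cr (cos t powr (\<alpha> * real (k + j)) * ff t ^ (N - j)) *
   (cr (cos x powr (\<alpha> * real (k + j) + 1)) * gg x ^ j))"
  unfolding sum_distrib_left
 proof (intro sum.cong refl)
  fix j
  have "pp t x powr A0 * (pp t x powr \<alpha>) ^ j = pp t x powr (\<alpha> * real (k + j))"
   using p by (simp add: powr_realpow[symmetric] powr_powr powr_add[symmetric] algebra_simps)
  also have "\<dots> = cos t powr (\<alpha> * real (k + j)) * cos x powr (\<alpha> * real (k + j))"
   using ct cx by (simp add: pp_def powr_mult)
  finally have e: "cos x * (pp t x powr A0 * (pp t x powr \<alpha>) ^ j) = cos t powr (\<alpha> * real (k + j)) * cos x powr (\<alpha> * real (k + j) + 1)"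
   using cx by (simp add: powr_add)
  have "cr (cos x * pp t x powr A0) * z ^ j = cr (cos x * (pp t x powr A0 * (pp t x powr \<alpha>) ^ j)) * gg x ^ j"
   unfolding z_def by (simp add: power_mult_distrib)
  also have "\<dots> = cr (cos t powr (\<alpha> * real (k + j))) * (cr (cos x powr (\<alpha> * real (k + j) + 1)) * gg x ^ j)"
   unfolding e by simp
  finally have f: "cr (cos x * pp t x powr A0) * z ^ j = \<dots>" .
  have "cr (A0 + 1) + cr \<alpha> * of_nat j = cr (\<alpha> * real (k + j) + 1)"
   by (simp add: algebra_simps)
  then have "cr (cos x * pp t x powr A0) * (of_nat (N choose j) * (cr (A0 + 1) + cr \<alpha> * of_nat j) * cr (ff t) ^ (N - j) * z ^ j)
   = of_nat (N choose j) * cr (\<alpha> * real (k + j) + 1) * cr (ff t) ^ (N - j) * (cr (cos x * pp t x powr A0) * z ^ j)"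
   by (simp only: ac_simps)
  then show "cr (cos x * pp t x powr A0) * (of_nat (N choose j) * (cr (A0 + 1) + cr \<alpha> * of_nat j) * cr (ff t) ^ (N - j) * z ^ j)
   = of_nat (N choose j) * cr (\<alpha> * real (k + j) + 1) *
   cr (cos t powr (\<alpha> * real (k + j)) * ff t ^ (N - j)) *
   (cr (cos x powr (\<alpha> * real (k + j) + 1)) * gg x ^ j)"
   unfolding f by (simp add: ac_simps)
 qed
 also have "(A0 + 1) * (cos x * pp t x powr A0) = (A0 + 1) * (cos t powr A0 * cos x powr (A0 + 1))"
  using ct cx by (simp add: pp_def powr_mult powr_add)
 finally show ?thesis by (simp add: mult.assoc)
qed

end

section \<open>Bounds near the boundary of the square and near the origin\<close>

context kernel_pair
begin

text \<open>The exponent is so small that a product of \<open>N\<close> such factors grows slower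
  than cos^(-1/2) and is absorbed by one factor cos x. The choice operator provides one constant for
  all later bounds.\<close>

definition Mb :: real where
 "Mb = (SOME M. 1 \<le> M \<and> (\<forall>t\<in>hpi. \<forall>x\<in>hpi. norm (WW t x) \<le> M * cos x powr (- (1 / (2 * (real N + 1))))
  \<and> cos x powr \<alpha> * norm (gg x) \<le> M * cos x powr (- (1 / (2 * (real N + 1))))
  \<and> \<bar>ff t\<bar> \<le> M))"

lemma ff_bound: "t \<in> hpi ==> \<bar>ff t\<bar> \<le> 1 / 2 + cc * 2"
proof -
 assume t: "t \<in> hpi"
 then have "\<bar>t\<bar> \<le> 2" using pi_less_4 by (auto simp: abs_if)
 then have "cc * \<bar>t\<bar> \<le> cc * 2" using cc_pos by (intro mult_left_mono) auto
 then show ?thesis using ff_lipschitz[OF t] by linarith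
qed

lemma Mb: "1 \<le> Mb" "t \<in> hpi ==> x \<in> hpi ==> norm (WW t x) \<le> Mb * cos x powr (- (1 / (2 * (real N + 1))))"
 "x \<in> hpi ==> cos x powr \<alpha> * norm (gg x) \<le> Mb * cos x powr (- (1 / (2 * (real N + 1))))"
 "t \<in> hpi ==> \<bar>ff t\<bar> \<le> Mb"
proof -
 define e where "e = 1 / (2 * (real N + 1))"
 have e: "0 < e" by (simp add: e_def)
 obtain K where K: "0 < K" "\<And>x. x \<in> hpi ==> \<bar>gi x\<bar> \<le> K * cos x powr (- \<alpha> - e)"
  using gi_growth[OF e] by blast
 define M where "M = 1 + 2 * cc + K"
 have M: "1 \<le> M" using K cc_pos by (simp add: M_def)
 have ge1: "1 \<le> cos x powr (- e)" if "x \<in> hpi" for x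
 proof -
  have "1 powr (- e) \<le> cos x powr (- e)" using cos_pos_hpi[OF that] e by (intro powr_mono2') auto
  then show ?thesis by simp
 qed
 have gb: "cos x powr \<alpha> * norm (gg x) \<le> (1 / 2 + K) * cos x powr (- e)" if x: "x \<in> hpi" for x
 proof -
  have cx: "0 < cos x" using cos_pos_hpi[OF x] .
  have "norm (gg x) \<le> norm (1 / 2 :: complex) + norm (\<i> * cr (gi x))"
   unfolding gg_def by (rule norm_triangle_ineq)
  also have "\<dots> \<le> 1 / 2 + K * cos x powr (- \<alpha> - e)" using K(2)[OF x] by (simp add: norm_mult)
  finally have "cos x powr \<alpha> * norm (gg x) \<le> cos x powr \<alpha> * (1 / 2 + K * cos x powr (- \<alpha> - e))"
   by (intro mult_left_mono) auto
  also have "\<dots> = cos x powr \<alpha> * (1 / 2) + K * (cos x powr \<alpha> * cos x powr (- \<alpha> - e))" by (simp add: algebra_simps)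
  also have "cos x powr \<alpha> * cos x powr (- \<alpha> - e) = cos x powr (- e)" using cx by (simp flip: powr_add)
  also have "cos x powr \<alpha> * (1 / 2) \<le> 1 / 2 * cos x powr (- e)"
  proof -
   have "cos x powr \<alpha> \<le> 1" using cx alpha by (intro powr_le1) auto
   then show ?thesis using ge1[OF x] by linarith
  qed
  finally show ?thesis by (simp add: algebra_simps)
 qed
 have "\<forall>t\<in>hpi. \<forall>x\<in>hpi. norm (WW t x) \<le> M * cos x powr (- e) \<and> cos x powr \<alpha> * norm (gg x) \<le> M * cos x powr (- e) \<and> \<bar>ff t\<bar> \<le> M"
 proof (intro ballI conjI)
  fix t x assume t: "t \<in> hpi" and x: "x \<in> hpi"
  have ct: "0 < cos t" and cx: "0 < cos x" using cos_pos_hpi t x by auto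
  have f: "\<bar>ff t\<bar> \<le> 1 / 2 + cc * 2" by (rule ff_bound[OF t])
  then show "\<bar>ff t\<bar> \<le> M" using K by (simp add: M_def)
  show "cos x powr \<alpha> * norm (gg x) \<le> M * cos x powr (- e)"
   using gb[OF x] by (rule order_trans) (use cc_pos in \<open>auto simp: M_def intro!: mult_right_mono\<close>)
  have "norm (WW t x) \<le> \<bar>ff t\<bar> + pp t x powr \<alpha> * norm (gg x)"
   unfolding WW_def by (rule order_trans[OF norm_triangle_ineq]) (simp add: norm_mult)
  also have "pp t x powr \<alpha> * norm (gg x) \<le> cos x powr \<alpha> * norm (gg x)"
  proof (intro mult_right_mono powr_mono2)
   have "cos t * cos x \<le> 1 * cos x" using cx by (intro mult_right_mono) auto
   then show "pp t x \<le> cos x" by (simp add: pp_def)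
   show "0 \<le> pp t x" using pp_pos[OF t x] by simp
  qed (use alpha in auto)
  also note gb[OF x]
  also have "\<bar>ff t\<bar> \<le> (1 / 2 + cc * 2) * cos x powr (- e)"
  proof -
   have "(1 / 2 + cc * 2) * 1 \<le> (1 / 2 + cc * 2) * cos x powr (- e)"
    using ge1[OF x] cc_pos by (intro mult_left_mono) auto
   then have "1 / 2 + cc * 2 \<le> (1 / 2 + cc * 2) * cos x powr (- e)" by (simp only: mult_1_right)
   with f show ?thesis by (rule order_trans)
  qed
  finally show "norm (WW t x) \<le> M * cos x powr (- e)" by (simp add: M_def algebra_simps)
 qed
 with M have "1 \<le> M \<and> (\<forall>t\<in>hpi. \<forall>x\<in>hpi. norm (WW t x) \<le> M * cos x powr (- e) \<and> cos x powr \<alpha> * norm (gg x) \<le> M * cos x powr (- e) \<and> \<bar>ff t\<bar> \<le> M)"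
  by blast
 then have "\<exists>M. 1 \<le> M \<and> (\<forall>t\<in>hpi. \<forall>x\<in>hpi. norm (WW t x) \<le> M * cos x powr (- e) \<and> cos x powr \<alpha> * norm (gg x) \<le> M * cos x powr (- e) \<and> \<bar>ff t\<bar> \<le> M)"
  by (rule exI[of _ M])
 from someI_ex[OF this[unfolded e_def], folded Mb_def] have S: "1 \<le> Mb \<and> (\<forall>t\<in>hpi. \<forall>x\<in>hpi. norm (WW t x) \<le> Mb * cos x powr (- (1 / (2 * (real N + 1))))
  \<and> cos x powr \<alpha> * norm (gg x) \<le> Mb * cos x powr (- (1 / (2 * (real N + 1)))) \<and> \<bar>ff t\<bar> \<le> Mb)"
  .
 have 0: "0 \<in> hpi" by simp
 from S 0 show "1 \<le> Mb" "t \<in> hpi ==> x \<in> hpi ==> norm (WW t x) \<le> Mb * cos x powr (- (1 / (2 * (real N + 1))))"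
  "x \<in> hpi ==> cos x powr \<alpha> * norm (gg x) \<le> Mb * cos x powr (- (1 / (2 * (real N + 1))))"
  "t \<in> hpi ==> \<bar>ff t\<bar> \<le> Mb" by blast+
qed

lemma cos_small_power:
 assumes x: "x \<in> hpi" and j: "j \<le> N"
 shows "cos x * (cos x powr (- (1 / (2 * (real N + 1))))) ^ j \<le> 1"
proof -
 have cx: "0 < cos x" "cos x \<le> 1" using cos_pos_hpi[OF x] by auto
 have "cos x * (cos x powr (- (1 / (2 * (real N + 1))))) ^ j = cos x powr (1 - real j / (2 * (real N + 1)))"
 proof -
  have "(cos x powr (- (1 / (2 * (real N + 1))))) ^ j = cos x powr (- (real j / (2 * (real N + 1))))"
   using cx by (simp add: powr_power)
  then have "cos x * (cos x powr (- (1 / (2 * (real N + 1))))) ^ j = cos x powr 1 * cos x powr (- (real j / (2 * (real N + 1))))"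
   using cx by simp
  then show ?thesis by (simp only: powr_add[symmetric]) simp
 qed
 also have "\<dots> \<le> 1" using cx j by (intro powr_le1) (auto simp: field_simps)
 finally show ?thesis .
qed

definition Cb :: real where "Cb = Mb ^ N + 1"

lemma Cb_pos: "1 \<le> Cb"
 using Mb(1) by (simp add: Cb_def)

lemma VV_bound:
 assumes t: "t \<in> hpi" and x: "x \<in> hpi"
 shows "cos x * norm (WW t x ^ N - 1) \<le> Cb"
proof -
 have cx: "0 < cos x" "cos x \<le> 1" using cos_pos_hpi[OF x] by auto
 have "norm (WW t x ^ N - 1) \<le> norm (WW t x) ^ N + 1"
  using norm_triangle_ineq4[of "WW t x ^ N" 1] by (simp add: norm_power)
 also have "\<dots> \<le> (Mb * cos x powr (- (1 / (2 * (real N + 1))))) ^ N + 1"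
  using Mb(2)[OF t x] by (intro add_right_mono power_mono) auto
 finally have "cos x * norm (WW t x ^ N - 1) \<le> cos x * ((Mb * cos x powr (- (1 / (2 * (real N + 1))))) ^ N + 1)"
  using cx by (intro mult_left_mono) auto
 also have "\<dots> = Mb ^ N * (cos x * (cos x powr (- (1 / (2 * (real N + 1))))) ^ N) + cos x"
  by (simp add: power_mult_distrib algebra_simps)
 also have "\<dots> \<le> Mb ^ N * 1 + 1"
  using cos_small_power[OF x order_refl] Mb(1) cx by (intro add_mono mult_left_mono) auto
 finally show ?thesis by (simp add: Cb_def)
qed

lemma A0_nonneg: "0 \<le> \<alpha> * real k"
 using alpha by simp

lemma pp_powr_le: "t \<in> hpi ==> x \<in> hpi ==> pp t x powr (\<alpha> * real k + 1) \<le> cos t * cos x"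
proof -
 assume t: "t \<in> hpi" and x: "x \<in> hpi"
 have "pp t x powr (\<alpha> * real k + 1) = pp t x powr (\<alpha> * real k) * pp t x"
  using pp_pos[OF t x] by (simp add: powr_add)
 also have "\<dots> \<le> 1 * pp t x"
  using pp_pos[OF t x] pp_le_1[OF t x] A0_nonneg by (intro mult_right_mono powr_le1) auto
 finally show ?thesis by (simp add: pp_def)
qed

text \<open>The power of \<open>pp\<close> supplies cos t cos x: the factor cos x pays for the
  growth of \<open>WW\<close>, and cos t is kept as decay towards the edges t = +-pi/2.\<close>

lemma phi_bound:
 assumes t: "t \<in> hpi" and x: "x \<in> hpi" and D: "DD t x \<noteq> 0"
 shows "norm (phi t x) \<le> cos t * Cb / norm (DD t x)"
proof -
 have "norm (phi t x) = pp t x powr (\<alpha> * real k + 1) * norm (WW t x ^ N - 1) / norm (DD t x)"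
  unfolding phi_def by (simp add: norm_mult norm_divide)
 also have "\<dots> \<le> (cos t * cos x) * norm (WW t x ^ N - 1) / norm (DD t x)"
  using pp_powr_le[OF t x] by (intro divide_right_mono mult_right_mono) auto
 also have "\<dots> \<le> cos t * Cb / norm (DD t x)"
  using VV_bound[OF t x] cos_pos_hpi[OF t] by (intro divide_right_mono) (auto simp: mult.assoc)
 finally show ?thesis .
qed

lemma Psi_phi: "Psi t x = cr (cos x) * phi t x"
 unfolding Psi_def phi_def by simp

text \<open>The extra weight cos x of \<open>Psi\<close> survives as decay towards the edges x =
  +-pi/2.\<close>

lemma Psi_bound:
 assumes t: "t \<in> hpi" and x: "x \<in> hpi" "x \<noteq> 0"
 shows "norm (Psi t x) \<le> cos x * Cb / \<bar>sin x\<bar>"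
proof -
 have D: "DD t x \<noteq> 0" using DD_nonzero[OF t x(1)] x by simp
 have s: "0 < \<bar>sin x\<bar>" using sin_nonzero_hpi[OF x] by simp
 have "norm (Psi t x) \<le> cos x * (cos t * Cb / norm (DD t x))"
  unfolding Psi_phi norm_mult norm_of_real using phi_bound[OF t x(1) D] cos_pos_hpi[OF x(1)]
  by (intro mult_mono) auto
 also have "\<dots> \<le> cos x * (1 * Cb / \<bar>sin x\<bar>)"
  using Cb_pos cos_pos_hpi[OF x(1)] cos_pos_hpi[OF t] s norm_DD_ge(2)[of x t]
  by (intro mult_left_mono frac_le mult_right_mono) auto
 finally show ?thesis by simp
qed

lemma one_minus_powr_le:
 assumes "0 < q" "q \<le> 1"
 shows "1 - q powr \<alpha> \<le> max 1 \<alpha> * (1 - q)"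
proof (cases "\<alpha> \<le> 1")
 case True
 have "q powr 1 \<le> q powr \<alpha>" using assms True by (intro powr_mono') auto
 then show ?thesis using True assms by simp
next
 case False
 show ?thesis
 proof (cases "q = 1")
  case False
  then have "q < 1" using assms by simp
  have "\<exists>z. q < z \<and> z < 1 \<and> 1 powr \<alpha> - q powr \<alpha> = (1 - q) * (\<alpha> * z powr (\<alpha> - 1))"
   using \<open>q < 1\<close> assms by (intro MVT2 has_real_derivative_powr) auto
  then obtain z where z: "q < z" "z < 1" "1 - q powr \<alpha> = (1 - q) * (\<alpha> * z powr (\<alpha> - 1))" by auto
  have "z powr (\<alpha> - 1) \<le> 1" using z assms \<open>\<not> \<alpha> \<le> 1\<close> by (intro powr_le1) auto
  then have "(1 - q) * (\<alpha> * z powr (\<alpha> - 1)) \<le> (1 - q) * (\<alpha> * 1)"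
   using \<open>q < 1\<close> \<open>\<not> \<alpha> \<le> 1\<close> by (intro mult_left_mono) auto
  then show ?thesis using z(3) \<open>\<not> \<alpha> \<le> 1\<close> by (simp add: mult.commute)
 qed simp
qed

text \<open>At the origin \<open>WW\<close> equals 1, and |WW - 1| is at most a multiple of |DD|,
  because t, x and 1 - pp^\<alpha> are. The geometric sum carries this over to the power, so the
  quotient stays bounded.\<close>

lemma Psi_bounded_near_0: "\<exists>C. \<forall>t\<in>hpi. \<forall>x. \<bar>x\<bar> \<le> pi / 4 \<longrightarrow> DD t x \<noteq> 0 \<longrightarrow> norm (Psi t x) \<le> C"
proof -
 define C1 where "C1 = cc * (pi / 2)"
 define C2 where "C2 = cc * cos (pi / 4) powr (- \<alpha> - 1) * (pi / 2)"
 define C3 where "C3 = max 1 \<alpha> / 2"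
 define CW where "CW = Mb * cos (pi / 4) powr (- (1 / (2 * (real N + 1))))"
 define C where "C = (C1 + C2 + C3) * (\<Sum>i<N. CW ^ i)"
 have abs_le_sin: "\<bar>y\<bar> \<le> pi / 2 * \<bar>sin y\<bar>" if "\<bar>y\<bar> \<le> pi / 2" for y
 proof -
  \<comment> \<open>Jordan's inequality, from the concavity of the sine.\<close>
  have *: "y \<le> pi / 2 * sin y" if y: "0 \<le> y" "y \<le> pi / 2" for y
  proof -
   have conc: "concave_on {0..pi} sin"
   proof (rule f''_le0_imp_concave)
    show "convex {0..pi}" by simp
    show "(sin has_real_derivative cos x) (at x)" for x by (rule DERIV_sin)
    show "(cos has_real_derivative - sin x) (at x)" for x by (rule DERIV_cos)
    show "- sin x \<le> 0" if "x \<in> {0..pi}" for x using that by (auto intro: sin_ge_zero)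
   qed
   define u where "u = 2 * y / pi"
   have u: "0 \<le> u" "u \<le> 1" using y by (auto simp: u_def field_simps)
   have "(1 - u) * sin 0 + u * sin (pi / 2) \<le> sin ((1 - u) *\<^sub>R 0 + u *\<^sub>R (pi / 2))"
    using conc u by (intro concave_onD) auto
   then show ?thesis by (simp add: u_def field_simps)
  qed
  show ?thesis
  proof (cases "0 \<le> y")
   case True
   then have "0 \<le> sin y" using that pi_gt_zero by (intro sin_ge_zero) auto
   then show ?thesis using *[of y] that True by simp
  next
   case False
   then have "0 \<le> sin (- y)" using that pi_gt_zero by (intro sin_ge_zero) auto
   then show ?thesis using *[of "- y"] that False by simp
  qed
 qed
 have "norm (Psi t x) \<le> C" if t: "t \<in> hpi" and x4: "\<bar>x\<bar> \<le> pi / 4" and D: "DD t x \<noteq> 0" for t x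
 proof -
  have x: "x \<in> hpi" using x4 pi_gt_zero unfolding greaterThanLessThan_iff by linarith
  have cx: "0 < cos x" "cos x \<le> 1" and ct: "0 < cos t" "cos t \<le> 1" using cos_pos_hpi t x by auto
  have p: "0 < pp t x" "pp t x \<le> 1" using pp_pos pp_le_1 t x by auto
  let ?d = "norm (DD t x)"
  have f: "\<bar>ff t - 1 / 2\<bar> \<le> C1 * ?d"
  proof -
   have "\<bar>t\<bar> \<le> pi / 2 * \<bar>sin t\<bar>" using t by (intro abs_le_sin) auto
   also have "\<dots> \<le> pi / 2 * ?d" using norm_DD_ge(1) by (intro mult_left_mono) auto
   finally have "cc * \<bar>t\<bar> \<le> cc * (pi / 2 * ?d)" using cc_pos by (intro mult_left_mono) auto
   then show ?thesis using ff_lipschitz[OF t] by (simp add: C1_def mult.assoc)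
  qed
  have gk: "\<bar>gi x\<bar> \<le> C2 * ?d"
  proof -
   have "\<bar>x\<bar> \<le> pi / 2 * \<bar>sin x\<bar>" using x by (intro abs_le_sin) auto
   also have "\<dots> \<le> pi / 2 * ?d" using norm_DD_ge(2) by (intro mult_left_mono) auto
   finally have "cc * cos (pi / 4) powr (- \<alpha> - 1) * \<bar>x\<bar> \<le> cc * cos (pi / 4) powr (- \<alpha> - 1) * (pi / 2 * ?d)"
    using cc_pos by (intro mult_left_mono) auto
   then show ?thesis using gi_lipschitz[OF x4] by (simp add: C2_def mult.assoc)
  qed
  have q: "1 - pp t x powr \<alpha> \<le> max 1 \<alpha> * ?d"
  proof -
   have "1 - pp t x \<le> 1 - (pp t x)\<^sup>2" using p by (simp add: power2_eq_square mult_le_one)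
   also have "\<dots> = ?d * ?d" unfolding norm_DD[symmetric] by (simp add: power2_eq_square)
   also have "\<dots> \<le> ?d * 1" using norm_DD_le_1 by (intro mult_left_mono) auto
   finally have "max 1 \<alpha> * (1 - pp t x) \<le> max 1 \<alpha> * ?d" by (intro mult_left_mono) auto
   then show ?thesis using one_minus_powr_le[OF p] by linarith
  qed
  have pa: "0 \<le> pp t x powr \<alpha>" "pp t x powr \<alpha> \<le> 1" using p alpha by (auto intro: powr_le1)
  have W_eq: "WW t x - 1 = cr (ff t - 1 / 2) + cr (pp t x powr \<alpha>) * (\<i> * cr (gi x))
   - cr ((1 - pp t x powr \<alpha>) / 2)"
   unfolding WW_def gg_def by (simp add: complex_eq_iff algebra_simps diff_divide_distrib)
  have "norm (WW t x - 1) \<le> \<bar>ff t - 1 / 2\<bar> + pp t x powr \<alpha> * \<bar>gi x\<bar> + (1 - pp t x powr \<alpha>) / 2"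
  proof -
   let ?A = "cr (ff t - 1 / 2)" and ?B = "cr (pp t x powr \<alpha>) * (\<i> * cr (gi x))"
    and ?C = "cr ((1 - pp t x powr \<alpha>) / 2)"
   have "norm (WW t x - 1) \<le> norm (?A + ?B) + norm ?C" unfolding W_eq by (rule norm_triangle_ineq4)
   also have "\<dots> \<le> norm ?A + norm ?B + norm ?C" by (intro add_right_mono norm_triangle_ineq)
   also have "norm ?A = \<bar>ff t - 1 / 2\<bar>" by (rule norm_of_real)
   also have "norm ?B = pp t x powr \<alpha> * \<bar>gi x\<bar>" by (simp add: norm_mult)
   also have "norm ?C = (1 - pp t x powr \<alpha>) / 2" unfolding norm_of_real using pa by simp
   finally show ?thesis .
  qed
  also have "\<dots> \<le> C1 * ?d + 1 * (C2 * ?d) + (max 1 \<alpha> * ?d) / 2"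
   using f gk q pa by (intro add_mono mult_mono divide_right_mono) auto
  finally have W1: "norm (WW t x - 1) \<le> (C1 + C2 + C3) * ?d" by (simp add: C3_def algebra_simps)
  have W: "norm (WW t x) \<le> CW"
  proof -
   have "cos (pi / 4) \<le> cos \<bar>x\<bar>" using x4 by (intro cos_monotone_0_pi_le) auto
   then have "cos x powr (- (1 / (2 * (real N + 1)))) \<le> cos (pi / 4) powr (- (1 / (2 * (real N + 1))))"
    by (intro powr_mono2') (auto simp: cos_45)
   then have "Mb * cos x powr (- (1 / (2 * (real N + 1)))) \<le> CW" unfolding CW_def using Mb(1) by (intro mult_left_mono) auto
   then show ?thesis using Mb(2)[OF t x] by linarith
  qed
  have "norm (WW t x ^ N - 1) = norm ((WW t x - 1) * (\<Sum>i<N. WW t x ^ i))"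
   by (simp add: power_diff_1_eq)
  also have "\<dots> \<le> ((C1 + C2 + C3) * ?d) * (\<Sum>i<N. CW ^ i)"
   unfolding norm_mult
  proof (intro mult_mono W1)
   show "norm (\<Sum>i<N. WW t x ^ i) \<le> (\<Sum>i<N. CW ^ i)"
    by (intro sum_norm_le) (simp add: norm_power power_mono[OF W])
  qed (use order_trans[OF norm_ge_zero W1] in auto)
  finally have V: "norm (WW t x ^ N - 1) \<le> C * ?d" by (simp add: C_def ac_simps)
  have d: "0 < ?d" using D by simp
  have "norm (Psi t x) = cos x * pp t x powr (\<alpha> * real k + 1) * norm (WW t x ^ N - 1) / ?d"
   unfolding Psi_def using cx by (simp add: norm_mult norm_divide)
  also have "\<dots> \<le> 1 * norm (WW t x ^ N - 1) / ?d"
  proof (intro divide_right_mono mult_right_mono mult_le_one)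
   show "pp t x powr (\<alpha> * real k + 1) \<le> 1" using p A0_nonneg by (intro powr_le1) auto
  qed (use cx in auto)
  also have "\<dots> \<le> C" using V d by (simp add: field_simps)
  finally show ?thesis .
 qed
 then show ?thesis by blast
qed

subsection \<open>Integration over rectangles\<close>

text \<open>The divergence theorem by hand: the fundamental theorem in t inside, and in x after
  exchanging the order. The rectangle misses x = 0, so \<open>DD\<close> has no zero on it.\<close>

lemma RR_rectangle:
 assumes a: "0 < a" "a < pi / 2" and uv: "u \<le> v" "{u..v} \<subseteq> hpi" "0 \<notin> {u..v}"
 shows "integral {u..v} (\<lambda>x. integral {-a..a} (\<lambda>t. RR t x)) =
  - integral {u..v} (\<lambda>x. phi a x - phi (- a) x) - \<i> * integral {-a..a} (\<lambda>t. Psi t v - Psi t u)"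
proof -
 have ah: "{-a..a} \<subseteq> hpi" using a by auto
 have D: "DD t x \<noteq> 0" if "t \<in> {-a..a}" "x \<in> {u..v}" for t x
 proof -
  have "x \<noteq> 0" using that uv(3) by metis
  then show ?thesis using DD_nonzero[of t x] ah uv(2) that by blast
 qed
 have R: "{-a..a} \<times> {u..v} \<subseteq> hpi \<times> hpi" using ah uv(2) by blast
 have D': "DD (fst z) (snd z) \<noteq> 0" if "z \<in> {-a..a} \<times> {u..v}" for z
  using D[of "fst z" "snd z"] that by auto
 note CI = continuous_on_add continuous_on_diff continuous_on_mult continuous_on_divide continuous_on_power
  continuous_on_of_real continuous_on_minus continuous_on_const continuous_on_sin continuous_on_cos
  continuous_on_fst continuous_on_snd continuous_on_id ballI
 have contPsix: "continuous_on ({-a..a} \<times> {u..v}) (\<lambda>z. Psix (fst z) (snd z))"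
  unfolding Psix_def Wx_def
  by (intro CI cont_pieces[OF R]) (use D' in auto)
 have contphi: "continuous_on ({-a..a} \<times> {u..v}) (\<lambda>z. phi (fst z) (snd z))"
  unfolding phi_def by (intro CI cont_pieces[OF R]) (use D' in auto)
 have Px: "continuous_on {-a..a} (\<lambda>t. Psix t x)" if "x \<in> {u..v}" for x
  by (rule continuous_on_compose2[OF contPsix, of "{-a..a}" "\<lambda>t. (t, x)", simplified]) (use that in \<open>auto intro!: continuous_intros\<close>)
 have inner: "integral {-a..a} (\<lambda>t. RR t x) = - (phi a x - phi (- a) x) - \<i> * integral {-a..a} (\<lambda>t. Psix t x)"
  if x: "x \<in> {u..v}" for x
 proof -
  have "((\<lambda>t. phit t x) has_integral (phi a x - phi (- a) x)) {-a..a}"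
  proof (rule fundamental_theorem_of_calculus)
   fix t assume t: "t \<in> {-a..a}"
   have "((\<lambda>t. phi t x) has_vector_derivative phit t x) (at t)"
    using t x ah uv(2) D[OF t x] by (intro phi_deriv) auto
   then show "((\<lambda>t. phi t x) has_vector_derivative phit t x) (at t within {-a..a})"
    by (rule has_vector_derivative_at_within)
  qed (use a in auto)
  moreover have "((\<lambda>t. Psix t x) has_integral integral {-a..a} (\<lambda>t. Psix t x)) {-a..a}"
   by (intro integrable_integral integrable_continuous_real Px x)
  ultimately have "((\<lambda>t. - phit t x - \<i> * Psix t x) has_integral (- (phi a x - phi (- a) x) - \<i> * integral {-a..a} (\<lambda>t. Psix t x))) {-a..a}"
   by (intro has_integral_diff has_integral_neg has_integral_mult_right)
  moreover have "- phit t x - \<i> * Psix t x = RR t x" if t: "t \<in> {-a..a}" for t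
  proof -
   have "phit t x + \<i> * Psix t x = - RR t x"
    using t x ah uv(2) D[OF t x] by (intro divergence) auto
   then show ?thesis by (simp add: algebra_simps) (metis add.commute add_diff_cancel_right' diff_minus_eq_add minus_diff_eq)
  qed
  ultimately have "((\<lambda>t. RR t x) has_integral (- (phi a x - phi (- a) x) - \<i> * integral {-a..a} (\<lambda>t. Psix t x))) {-a..a}"
   by (subst has_integral_cong[symmetric]) auto
  then show ?thesis by (rule integral_unique)
 qed
 have outer: "integral {-a..a} (\<lambda>t. integral {u..v} (\<lambda>x. Psix t x)) = integral {-a..a} (\<lambda>t. Psi t v - Psi t u)"
 proof (rule integral_cong)
  fix t assume t: "t \<in> {-a..a}"
  have "((\<lambda>x. Psix t x) has_integral (Psi t v - Psi t u)) {u..v}"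
  proof (rule fundamental_theorem_of_calculus[OF uv(1)])
   fix x assume x: "x \<in> {u..v}"
   have "(Psi t has_vector_derivative Psix t x) (at x)"
    using t x ah uv(2) D[OF t x] by (intro Psi_deriv) auto
   then show "(Psi t has_vector_derivative Psix t x) (at x within {u..v})" by (rule has_vector_derivative_at_within)
  qed
  then show "integral {u..v} (\<lambda>x. Psix t x) = Psi t v - Psi t u" by (rule integral_unique)
 qed
 have cb: "cbox (u, -a) (v, a) = {u..v} \<times> {-a..a}" by (simp add: cbox_Pair_eq)
 have c2: "continuous_on (cbox (u, -a) (v, a)) (\<lambda>(x, t). Psix t x)"
  unfolding cb case_prod_beta
  by (rule continuous_on_compose2[OF contPsix, of "{u..v} \<times> {-a..a}" "\<lambda>z. (snd z, fst z)", simplified])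
   (auto intro!: continuous_intros)
 have swap: "integral {u..v} (\<lambda>x. integral {-a..a} (\<lambda>t. Psix t x)) = integral {-a..a} (\<lambda>t. integral {u..v} (\<lambda>x. Psix t x))"
  using integral_swap_continuous[OF c2] by simp
 have i1: "(\<lambda>x. phi a x - phi (- a) x) integrable_on {u..v}"
 proof (intro integrable_continuous_real continuous_on_diff)
  show "continuous_on {u..v} (phi a)"
   by (rule continuous_on_compose2[OF contphi, of "{u..v}" "\<lambda>x. (a, x)", simplified]) (use a in \<open>auto intro!: continuous_intros\<close>)
  show "continuous_on {u..v} (phi (- a))"
   by (rule continuous_on_compose2[OF contphi, of "{u..v}" "\<lambda>x. (- a, x)", simplified]) (use a in \<open>auto intro!: continuous_intros\<close>)
 qed
 have i2: "(\<lambda>x. integral {-a..a} (\<lambda>t. Psix t x)) integrable_on {u..v}"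
 proof (intro integrable_continuous_real)
  have "continuous_on ({u..v} \<times> cbox (-a) a) (\<lambda>(x, t). Psix t x)" using c2 unfolding cb by simp
  from integral_continuous_on_param[OF this] show "continuous_on {u..v} (\<lambda>x. integral {-a..a} (\<lambda>t. Psix t x))" by simp
 qed
 have "integral {u..v} (\<lambda>x. integral {-a..a} (\<lambda>t. RR t x)) =
  integral {u..v} (\<lambda>x. - (phi a x - phi (- a) x) - \<i> * integral {-a..a} (\<lambda>t. Psix t x))"
  by (intro integral_cong inner)
 also have "\<dots> = - integral {u..v} (\<lambda>x. phi a x - phi (- a) x) - \<i> * integral {u..v} (\<lambda>x. integral {-a..a} (\<lambda>t. Psix t x))"
  using i1 i2 by (simp add: integral_diff integrable_neg integrable_on_cmult_left del: minus_diff_eq)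
 finally show ?thesis unfolding swap outer .
qed

end

section \<open>Passage from rectangles to the whole square\<close>

context kernel_pair
begin

definition uj :: "nat => real => real" where
 "uj j t = cos t powr (\<alpha> * real (k + j)) * ff t ^ (N - j)"

definition vj :: "nat => real => complex" where
 "vj j x = cr (cos x powr (\<alpha> * real (k + j) + 1)) * gg x ^ j"

definition kap :: "nat => complex" where
 "kap j = of_nat (N choose j) * cr (\<alpha> * real (k + j) + 1)"

lemma set_integrable_hpi:
 fixes f :: "real => 'a::{banach, second_countable_topology}"
 assumes c: "continuous_on hpi f" and b: "\<And>x. x \<in> hpi ==> norm (f x) \<le> B"
 shows "set_integrable lborel hpi f"
 unfolding set_integrable_def
proof (rule Bochner_Integration.integrable_bound[where f = "\<lambda>x. indicator hpi x * B"])
 show "integrable lborel (\<lambda>x. indicator hpi x * B)"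
  by (intro integrable_mult_left) (simp add: integrable_indicator_iff)
 show "(\<lambda>x. indicator hpi x *\<^sub>R f x) \<in> borel_measurable lborel"
  using borel_measurable_continuous_on_indicator[OF _ c] by simp
 show "AE x in lborel. norm (indicator hpi x *\<^sub>R f x) \<le> norm (indicator hpi x * B)"
  using b by (intro AE_I2) (force simp: indicator_def intro: order_trans[OF _ abs_ge_self])
qed

lemma cos_powr_cont: "continuous_on hpi (\<lambda>x. cos x powr r)"
 by (intro continuous_on_powr continuous_intros ballI) (metis cos_pos_hpi less_irrefl)

lemma uj_integrable: "set_integrable lborel hpi (uj j)"
proof (rule set_integrable_hpi)
 show "continuous_on hpi (uj j)" unfolding uj_def[abs_def] by (intro continuous_intros cos_powr_cont ff_cont)
 fix t assume t: "t \<in> hpi"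
 have "cos t powr (\<alpha> * real (k + j)) \<le> 1" using cos_pos_hpi[OF t] alpha by (intro powr_le1) auto
 then have "cos t powr (\<alpha> * real (k + j)) * \<bar>ff t\<bar> ^ (N - j) \<le> 1 * Mb ^ (N - j)"
  using Mb(4)[OF t] by (intro mult_mono power_mono) auto
 then show "norm (uj j t) \<le> Mb ^ (N - j)" by (simp add: uj_def abs_mult power_abs)
qed

lemma vj_integrable:
 assumes j: "j \<le> N"
 shows "set_integrable lborel hpi (vj j)"
proof (rule set_integrable_hpi)
 show "continuous_on hpi (vj j)" unfolding vj_def[abs_def] by (intro continuous_intros cos_powr_cont gg_cont)
 fix x assume x: "x \<in> hpi"
 have cx: "0 < cos x" "cos x \<le> 1" using cos_pos_hpi[OF x] by auto
 have "norm (vj j x) = cos x powr (\<alpha> * real (k + j) + 1) * norm (gg x) ^ j"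
  by (simp add: vj_def norm_mult norm_power)
 also have "cos x powr (\<alpha> * real (k + j) + 1) = cos x powr (\<alpha> * real k) * (cos x * (cos x powr \<alpha>) ^ j)"
  using cx by (simp add: powr_power powr_add algebra_simps)
 also have "\<dots> * norm (gg x) ^ j = cos x powr (\<alpha> * real k) * (cos x * (cos x powr \<alpha> * norm (gg x)) ^ j)"
  by (simp add: power_mult_distrib mult.assoc)
 also have "\<dots> \<le> 1 * (cos x * (Mb * cos x powr (- (1 / (2 * (real N + 1))))) ^ j)"
 proof (rule mult_mono)
  show "cos x powr (\<alpha> * real k) \<le> 1" using cx A0_nonneg by (intro powr_le1) auto
  show "cos x * (cos x powr \<alpha> * norm (gg x)) ^ j \<le> cos x * (Mb * cos x powr (- (1 / (2 * (real N + 1))))) ^ j"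
   using cx Mb(3)[OF x] by (intro mult_left_mono power_mono) auto
 qed (use cx in auto)
 also have "\<dots> = Mb ^ j * (cos x * (cos x powr (- (1 / (2 * (real N + 1))))) ^ j)"
  by (simp add: power_mult_distrib)
 also have "\<dots> \<le> Mb ^ j * 1" using cos_small_power[OF x j] Mb(1) by (intro mult_left_mono) auto
 finally show "norm (vj j x) \<le> Mb ^ j" by simp
qed

lemma cosA0_integrable:
 "set_integrable lborel hpi (\<lambda>t. cos t powr (\<alpha> * real k))"
 "(LBINT t:hpi. cos t powr (\<alpha> * real k)) = 1 / beta_const 1 ((\<alpha> * real k - 1) / 2)"
 "set_integrable lborel hpi (\<lambda>t. cos t powr (\<alpha> * real k + 1))"
 "(LBINT t:hpi. cos t powr (\<alpha> * real k + 1)) = 1 / beta_const 1 (\<alpha> * real k / 2)"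
proof -
 have e: "2 * ((\<alpha> * real k - 1) / 2) + 1 = \<alpha> * real k" "2 * (\<alpha> * real k / 2) + 1 = \<alpha> * real k + 1" by (simp_all add: diff_divide_distrib)
 have "-1 < (\<alpha> * real k - 1) / 2" "-1 < \<alpha> * real k / 2" using A0_nonneg by simp_all
 from this[THEN cos_powr_integral(1)] this[THEN cos_powr_integral(2)]
 show "set_integrable lborel hpi (\<lambda>t. cos t powr (\<alpha> * real k))"
  "(LBINT t:hpi. cos t powr (\<alpha> * real k)) = 1 / beta_const 1 ((\<alpha> * real k - 1) / 2)"
  "set_integrable lborel hpi (\<lambda>t. cos t powr (\<alpha> * real k + 1))"
  "(LBINT t:hpi. cos t powr (\<alpha> * real k + 1)) = 1 / beta_const 1 (\<alpha> * real k / 2)"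
  unfolding e by blast+
qed

lemma set_integrable_of_real:
 "set_integrable lborel A (f :: real => real) ==> set_integrable lborel A (\<lambda>x. cr (f x))"
 unfolding set_integrable_def
 using integrable_of_real[where 'a = complex, of lborel "\<lambda>x. indicator A x *\<^sub>R f x"]
 by (simp add: scaleR_conv_of_real)

lemma set_integral_has_integral:
 fixes f :: "real => complex"
 assumes "set_integrable lborel hpi f" "{u..v} \<subseteq> hpi"
 shows "(f has_integral (LBINT x:{u..v}. f x)) {u..v}"
proof -
 have "set_integrable lborel {u..v} f" using assms by (intro set_integrable_subset[OF assms(1)]) auto
 from set_borel_integral_eq_integral[OF this] show ?thesis by (simp add: has_integral_integral)
qed

text \<open>The double integral of \<open>RR\<close> in separated form, which is defined for the
  full square and lets the limits in the two variables be taken one at a time.\<close>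

definition Urec :: "real set => real set => complex" where
 "Urec A B = (\<Sum>j\<le>N. kap j * (LBINT t:A. cr (uj j t)) * (LBINT x:B. vj j x)) -
  cr (\<alpha> * real k + 1) * (LBINT t:A. cr (cos t powr (\<alpha> * real k))) *
   (LBINT x:B. cr (cos x powr (\<alpha> * real k + 1)))"

lemma RR_double_integral:
 assumes a: "{-a..a} \<subseteq> hpi" and uv: "{u..v} \<subseteq> hpi"
 shows "integral {u..v} (\<lambda>x. integral {-a..a} (\<lambda>t. RR t x)) = Urec {-a..a} {u..v}"
proof -
 let ?U = "\<lambda>j. LBINT t:{-a..a}. cr (uj j t)"
 let ?V = "LBINT t:{-a..a}. cr (cos t powr (\<alpha> * real k))"
 have ui: "set_integrable lborel hpi (\<lambda>t. cr (uj j t))" for j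
  by (rule set_integrable_of_real[OF uj_integrable])
 have c0: "set_integrable lborel hpi (\<lambda>t. cr (cos t powr r))" if "set_integrable lborel hpi (\<lambda>t. cos t powr r)" for r
  using that by (rule set_integrable_of_real)
 have inner: "integral {-a..a} (\<lambda>t. RR t x) =
  (\<Sum>j\<le>N. kap j * ?U j * vj j x) - cr (\<alpha> * real k + 1) * ?V * cr (cos x powr (\<alpha> * real k + 1))"
  if x: "x \<in> {u..v}" for x
 proof -
  have "((\<lambda>t. (\<Sum>j\<le>N. kap j * cr (uj j t) * vj j x) - cr (\<alpha> * real k + 1) * cr (cos t powr (\<alpha> * real k)) * cr (cos x powr (\<alpha> * real k + 1)))
   has_integral ((\<Sum>j\<le>N. kap j * ?U j * vj j x) - cr (\<alpha> * real k + 1) * ?V * cr (cos x powr (\<alpha> * real k + 1)))) {-a..a}"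
   by (intro has_integral_diff has_integral_sum has_integral_mult_left has_integral_mult_right
     set_integral_has_integral ui c0 cosA0_integrable a finite_atMost)
  moreover have "(\<Sum>j\<le>N. kap j * cr (uj j t) * vj j x) - cr (\<alpha> * real k + 1) * cr (cos t powr (\<alpha> * real k)) * cr (cos x powr (\<alpha> * real k + 1)) = RR t x"
   if "t \<in> {-a..a}" for t
  proof -
   have "t \<in> hpi" "x \<in> hpi" using that x a uv by blast+
   from RR_expand[OF this] show ?thesis by (simp add: kap_def uj_def vj_def)
  qed
  ultimately have "((\<lambda>t. RR t x) has_integral ((\<Sum>j\<le>N. kap j * ?U j * vj j x) - cr (\<alpha> * real k + 1) * ?V * cr (cos x powr (\<alpha> * real k + 1)))) {-a..a}"
   by (rule has_integral_eq[rotated])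
  then show ?thesis by (rule integral_unique)
 qed
 have "integral {u..v} (\<lambda>x. integral {-a..a} (\<lambda>t. RR t x)) = integral {u..v} (\<lambda>x. (\<Sum>j\<le>N. kap j * ?U j * vj j x) - cr (\<alpha> * real k + 1) * ?V * cr (cos x powr (\<alpha> * real k + 1)))"
  by (intro integral_cong inner)
 also have "\<dots> = Urec {-a..a} {u..v}"
  unfolding Urec_def
  by (intro integral_unique has_integral_diff has_integral_sum has_integral_mult_right
     set_integral_has_integral vj_integrable c0 cosA0_integrable uv finite_atMost) auto
 finally show ?thesis .
qed

lemma cont_phi_Psi:
 assumes S: "S \<subseteq> hpi \<times> hpi" and D: "\<And>z. z \<in> S ==> DD (fst z) (snd z) \<noteq> 0"
 shows "continuous_on S (\<lambda>z. phi (fst z) (snd z))" "continuous_on S (\<lambda>z. Psi (fst z) (snd z))"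
 unfolding phi_def Psi_def
 by (intro continuous_on_mult continuous_on_divide continuous_on_diff continuous_on_power continuous_on_of_real
   continuous_on_const continuous_on_cos continuous_on_snd continuous_on_id ballI cont_pieces[OF S] D; assumption)+

text \<open>The factor cos a is the decay that removes the edges t = +-a in the final limit.\<close>

lemma phi_integral_bound:
 assumes a: "0 < a" "a < pi / 2" and s: "s = a \<or> s = - a" and uv: "u \<le> v" "{u..v} \<subseteq> hpi"
 shows "norm (integral {u..v} (\<lambda>x. phi s x)) \<le> cos a * Cb / sin a * (v - u)" "continuous_on {u..v} (phi s)"
proof -
 have sh: "s \<in> hpi" "s \<noteq> 0" using a s by auto
 have D: "DD s x \<noteq> 0" if "x \<in> {u..v}" for x using DD_nonzero[of s x] sh uv that by blast
 have *: "continuous_on ({s} \<times> {u..v}) (\<lambda>z. phi (fst z) (snd z))"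
  by (rule cont_phi_Psi) (use sh uv D in auto)
 show c: "continuous_on {u..v} (phi s)"
  by (rule continuous_on_compose2[OF *, of "{u..v}" "\<lambda>x. (s, x)", simplified]) (auto intro!: continuous_intros)
 have sa: "0 < sin a" using a by (intro sin_gt_zero) auto
 show "norm (integral {u..v} (\<lambda>x. phi s x)) \<le> cos a * Cb / sin a * (v - u)"
 proof (rule integral_bound[OF uv(1) c])
  fix x assume x: "x \<in> {u..v}"
  then have xh: "x \<in> hpi" using uv by blast
  have "norm (phi s x) \<le> cos s * Cb / norm (DD s x)" by (rule phi_bound[OF sh(1) xh D[OF x]])
  also have "\<dots> \<le> cos s * Cb / sin a"
   using norm_DD_ge(1)[of s x] s sa cos_pos_hpi[OF sh(1)] Cb_pos D[OF x]
   by (intro divide_left_mono mult_pos_pos mult_nonneg_nonneg) auto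
  finally show "norm (phi s x) \<le> cos a * Cb / sin a" using s by auto
 qed
qed

lemma Psi_integral_bound:
 assumes a: "0 < a" "a < pi / 2" and x: "x \<in> hpi" "x \<noteq> 0"
 shows "norm (integral {-a..a} (\<lambda>t. Psi t x)) \<le> cos x * Cb / \<bar>sin x\<bar> * pi" "continuous_on {-a..a} (\<lambda>t. Psi t x)"
proof -
 have ah: "{-a..a} \<subseteq> hpi" using a by auto
 have D: "DD t x \<noteq> 0" if "t \<in> {-a..a}" for t using DD_nonzero[of t x] ah x that by blast
 have *: "continuous_on ({-a..a} \<times> {x}) (\<lambda>z. Psi (fst z) (snd z))"
  by (rule cont_phi_Psi) (use ah x D in auto)
 show c: "continuous_on {-a..a} (\<lambda>t. Psi t x)"
  by (rule continuous_on_compose2[OF *, of "{-a..a}" "\<lambda>t. (t, x)", simplified]) (auto intro!: continuous_intros)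
 have "norm (integral {-a..a} (\<lambda>t. Psi t x)) \<le> cos x * Cb / \<bar>sin x\<bar> * (a - (- a))"
  by (rule integral_bound[OF _ c]) (use a ah Psi_bound[OF _ x] in auto)
 also have "\<dots> \<le> cos x * Cb / \<bar>sin x\<bar> * pi"
  using a cos_pos_hpi[OF x(1)] Cb_pos by (intro mult_left_mono) auto
 finally show "norm (integral {-a..a} (\<lambda>t. Psi t x)) \<le> cos x * Cb / \<bar>sin x\<bar> * pi" .
qed

text \<open>The shift by 2 keeps \<open>eps n\<close> below pi/4 and below \<open>bn n\<close>
  already for n = 0.\<close>

definition eps :: "nat => real" where "eps n = 1 / (real n + 2)"

definition bn :: "nat => real" where "bn n = pi / 2 - eps n"

lemma eps_props: "0 < eps n" "eps n \<le> 1 / 2" "eps n \<le> pi / 4" "eps n < bn n" "0 < bn n" "bn n < pi / 2"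
proof -
 show 1: "0 < eps n" "eps n \<le> 1 / 2" by (auto simp: eps_def field_simps)
 have "3 < pi" by (rule pi_gt3)
 then show "eps n \<le> pi / 4" "eps n < bn n" "0 < bn n" "bn n < pi / 2" using 1 by (auto simp: bn_def)
qed

lemma eps_tendsto: "eps \<longlonglongrightarrow> 0"
 unfolding eps_def[abs_def]
 using LIMSEQ_ignore_initial_segment[OF lim_1_over_n[where 'a = real], of 2] by (simp add: add.commute)

lemma cos_bn_tendsto: "(\<lambda>n. cos (bn n) / sin (bn n)) \<longlonglongrightarrow> 0"
proof -
 have "bn \<longlonglongrightarrow> pi / 2 - 0" unfolding bn_def[abs_def] by (intro tendsto_intros eps_tendsto)
 then have "(\<lambda>n. cos (bn n) / sin (bn n)) \<longlonglongrightarrow> cos (pi / 2) / sin (pi / 2)"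
  by (intro tendsto_intros) auto
 then show ?thesis by simp
qed

text \<open>For nonzero t the field is continuous across the cut x = 0, and the uniform bound near
  the origin is an integrable majorant.\<close>

lemma Psi_jump_tendsto:
 assumes a: "0 < a" "a < pi / 2"
 shows "(\<lambda>n. integral {-a..a} (\<lambda>t. Psi t (eps n)) - integral {-a..a} (\<lambda>t. Psi t (- eps n))) \<longlonglongrightarrow> 0"
proof -
 have ah: "{-a..a} \<subseteq> hpi" using a by auto
 obtain C where C: "\<And>t x. t \<in> hpi ==> \<bar>x\<bar> \<le> pi / 4 ==> DD t x \<noteq> 0 ==> norm (Psi t x) \<le> C"
  using Psi_bounded_near_0 by blast
 \<comment> \<open>The single value t = 0, where the field passes through its singularity, is reset
   to 0 without changing the integral.\<close>
 define f where "f n t = (if t = 0 then 0 else Psi t (eps n) - Psi t (- eps n))" for n t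
 have eh: "eps n \<in> hpi" "- eps n \<in> hpi" "eps n \<noteq> 0" "- eps n \<noteq> 0" for n
  using eps_props[of n] by auto
 have int: "((\<lambda>t. Psi t (eps n) - Psi t (- eps n)) has_integral
  (integral {-a..a} (\<lambda>t. Psi t (eps n)) - integral {-a..a} (\<lambda>t. Psi t (- eps n)))) {-a..a}" for n
  by (intro has_integral_diff integrable_integral integrable_continuous_real Psi_integral_bound(2)[OF a] eh)
 have intf: "(f n has_integral (integral {-a..a} (\<lambda>t. Psi t (eps n)) - integral {-a..a} (\<lambda>t. Psi t (- eps n)))) {-a..a}" for n
  by (rule has_integral_spike[OF _ _ int, of "{0}"]) (auto simp: f_def)
 have "(\<lambda>n. integral {-a..a} (f n)) \<longlonglongrightarrow> integral {-a..a} (\<lambda>t. 0)"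
 proof (rule dominated_convergence(2))
  show "f n integrable_on {-a..a}" for n using intf by blast
  show "(\<lambda>t. C + C) integrable_on {-a..a}" by (rule integrable_const_ivl)
  show "norm (f n t) \<le> C + C" if t: "t \<in> {-a..a}" for n t
  proof -
   have th: "t \<in> hpi" using t ah by blast
   have "norm (Psi t (eps n)) \<le> C" "norm (Psi t (- eps n)) \<le> C"
    using eps_props[of n] eh DD_nonzero[OF th eh(1)[of n]] DD_nonzero[OF th eh(2)[of n]] by (auto intro!: C th)
   then show ?thesis using norm_triangle_ineq4[of "Psi t (eps n)" "Psi t (- eps n)"] norm_ge_zero[of "Psi t (eps n)"]
    by (auto simp: f_def simp del: norm_ge_zero)
  qed
  show "(\<lambda>n. f n t) \<longlonglongrightarrow> 0" if t: "t \<in> {-a..a}" for t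
  proof (cases "t = 0")
   case False
   have th: "t \<in> hpi" using t ah by blast
   have "isCont (Psi t) 0"
    using Psi_deriv[OF th, of 0] DD_nonzero[OF th, of 0] False
    by (intro has_vector_derivative_continuous[of _ "Psix t 0"]) auto
   then have "(\<lambda>n. Psi t (eps n)) \<longlonglongrightarrow> Psi t 0" "(\<lambda>n. Psi t (- eps n)) \<longlonglongrightarrow> Psi t 0"
    using eps_tendsto tendsto_minus[OF eps_tendsto] by (auto intro: isCont_tendsto_compose)
   then have "(\<lambda>n. Psi t (eps n) - Psi t (- eps n)) \<longlonglongrightarrow> Psi t 0 - Psi t 0" by (rule tendsto_diff)
   then show ?thesis using False by (simp add: f_def)
  qed (simp add: f_def)
 qed
 moreover have "integral {-a..a} (f n) = integral {-a..a} (\<lambda>t. Psi t (eps n)) - integral {-a..a} (\<lambda>t. Psi t (- eps n))" for n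
  using intf by (rule integral_unique)
 ultimately show ?thesis by simp
qed

definition Bset :: "nat => real set" where "Bset n = {eps n..bn n} \<union> {- bn n..- eps n}"

lemma Bset_props: "Bset n \<subseteq> hpi" "{eps n..bn n} \<subseteq> hpi" "{- bn n..- eps n} \<subseteq> hpi"
 using eps_props[of n] by (auto simp: Bset_def)

lemma set_integral_Bset:
 fixes f :: "real => complex"
 assumes "set_integrable lborel hpi f"
 shows "(LBINT x:Bset n. f x) = (LBINT x:{eps n..bn n}. f x) + (LBINT x:{- bn n..- eps n}. f x)"
  "(\<lambda>n. LBINT x:Bset n. f x) \<longlonglongrightarrow> (LBINT x:hpi. f x)"
proof -
 have "{eps n..bn n} \<inter> {- bn n..- eps n} = {}" using eps_props[of n] by auto
 then show "(LBINT x:Bset n. f x) = (LBINT x:{eps n..bn n}. f x) + (LBINT x:{- bn n..- eps n}. f x)"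
  unfolding Bset_def using Bset_props[of n]
  by (intro set_integral_Un set_integrable_subset[OF assms]) auto
 show "(\<lambda>n. LBINT x:Bset n. f x) \<longlonglongrightarrow> (LBINT x:hpi. f x)"
 proof (rule lborel_set_integral_tendsto[OF assms, where z = 0])
  show "Bset n \<in> sets borel" for n by (simp add: Bset_def)
  fix x assume x: "x \<in> hpi" "x \<noteq> (0::real)"
  define d where "d = min \<bar>x\<bar> (pi / 2 - \<bar>x\<bar>)"
  have "0 < d" using x by (auto simp: d_def)
  then have "eventually (\<lambda>n. eps n < d) sequentially"
   using eps_tendsto by (intro order_tendstoD(2)[of _ 0])
  then show "eventually (\<lambda>n. x \<in> Bset n) sequentially"
   by eventually_elim (auto simp: Bset_def bn_def d_def abs_if split: if_splits)
 qed (use Bset_props in auto)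
qed

lemma Urec_Bset:
 "Urec A (Bset n) = Urec A {eps n..bn n} + Urec A {- bn n..- eps n}"
 "(\<lambda>n. Urec A (Bset n)) \<longlonglongrightarrow> Urec A hpi"
proof -
 have c0: "set_integrable lborel hpi (\<lambda>t. cr (cos t powr (\<alpha> * real k + 1)))"
  using cosA0_integrable(3) by (rule set_integrable_of_real)
 show "Urec A (Bset n) = Urec A {eps n..bn n} + Urec A {- bn n..- eps n}"
  unfolding Urec_def set_integral_Bset(1)[OF c0]
  by (simp add: set_integral_Bset(1)[OF vj_integrable] algebra_simps sum.distrib)
 show "(\<lambda>n. Urec A (Bset n)) \<longlonglongrightarrow> Urec A hpi"
  unfolding Urec_def by (intro tendsto_intros set_integral_Bset(2) vj_integrable c0) auto
qed

text \<open>For fixed \<open>a\<close> the limit in \<open>n\<close> disposes of the edges near x =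
  +-pi/2 and of the jump at x = 0; only the edges t = +-a remain.\<close>

lemma Urec_bound:
 assumes a: "0 < a" "a < pi / 2"
 shows "norm (Urec {-a..a} hpi) \<le> cos a * Cb / sin a * (2 * pi)"
proof (rule tendsto_le[OF sequentially_bot])
 have ah: "{-a..a} \<subseteq> hpi" using a by auto
 define e where "e n = integral {-a..a} (\<lambda>t. Psi t (eps n)) - integral {-a..a} (\<lambda>t. Psi t (- eps n))" for n
 show "(\<lambda>n. norm (Urec {-a..a} (Bset n))) \<longlonglongrightarrow> norm (Urec {-a..a} hpi)"
  by (intro tendsto_norm Urec_Bset(2))
 have "(\<lambda>n. cos a * Cb / sin a * (2 * pi) + 2 * pi * Cb * (cos (bn n) / sin (bn n)) + norm (e n)) \<longlonglongrightarrow>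
  cos a * Cb / sin a * (2 * pi) + 2 * pi * Cb * 0 + norm (0::complex)"
  using Psi_jump_tendsto[OF a] unfolding e_def by (intro tendsto_intros cos_bn_tendsto)
 then show "(\<lambda>n. cos a * Cb / sin a * (2 * pi) + 2 * pi * Cb * (cos (bn n) / sin (bn n)) + norm (e n)) \<longlonglongrightarrow>
  cos a * Cb / sin a * (2 * pi)" by simp
 have "norm (Urec {-a..a} (Bset n)) \<le> cos a * Cb / sin a * (2 * pi) + 2 * pi * Cb * (cos (bn n) / sin (bn n)) + norm (e n)" for n
 proof -
  note ep = eps_props[of n]
  have bh: "bn n \<in> hpi" "bn n \<noteq> 0" "- bn n \<in> hpi" "- bn n \<noteq> 0" "eps n \<in> hpi" "eps n \<noteq> 0" "- eps n \<in> hpi" "- eps n \<noteq> 0"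
   using ep by auto
  have sb: "0 < sin (bn n)" using ep by (intro sin_gt_zero) auto
  have ca: "0 \<le> cos a * Cb / sin a"
   using a Cb_pos sin_gt_zero[of a] cos_gt_zero[of a] by (intro divide_nonneg_nonneg mult_nonneg_nonneg) auto
  let ?P = "\<lambda>u v. integral {u..v} (\<lambda>x. phi a x - phi (- a) x)"
  let ?Q = "\<lambda>x. integral {-a..a} (\<lambda>t. Psi t x)"
  have Qd: "integral {-a..a} (\<lambda>t. Psi t v - Psi t u) = ?Q v - ?Q u"
   if "u \<in> hpi" "u \<noteq> 0" "v \<in> hpi" "v \<noteq> 0" for u v
   using that by (intro Henstock_Kurzweil_Integration.integral_diff integrable_continuous_real Psi_integral_bound(2)[OF a])
  have Pb: "norm (?P u v) \<le> cos a * Cb / sin a * pi" if uv: "u \<le> v" "{u..v} \<subseteq> hpi" "v - u \<le> pi / 2" for u v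
  proof -
   have "?P u v = integral {u..v} (phi a) - integral {u..v} (phi (- a))"
    by (intro Henstock_Kurzweil_Integration.integral_diff integrable_continuous_real phi_integral_bound(2)[OF a _ uv(1,2)]) auto
   then have "norm (?P u v) \<le> norm (integral {u..v} (phi a)) + norm (integral {u..v} (phi (- a)))"
    by (simp add: norm_triangle_ineq4)
   also have "\<dots> \<le> cos a * Cb / sin a * (v - u) + cos a * Cb / sin a * (v - u)"
    by (intro add_mono phi_integral_bound(1)[OF a _ uv(1,2)]) auto
   also have "\<dots> \<le> cos a * Cb / sin a * (pi / 2) + cos a * Cb / sin a * (pi / 2)"
    using ca uv(3) by (intro add_mono mult_left_mono) auto
   also have "\<dots> = cos a * Cb / sin a * pi" by (simp add: algebra_simps)
   finally show ?thesis .
  qed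
  have U1: "Urec {-a..a} {eps n..bn n} = - ?P (eps n) (bn n) - \<i> * (?Q (bn n) - ?Q (eps n))"
   unfolding RR_double_integral[OF ah Bset_props(2), symmetric] Qd[OF bh(5,6,1,2), symmetric]
   using ep Bset_props(2)[of n] by (intro RR_rectangle[OF a]) auto
  have U2: "Urec {-a..a} {- bn n..- eps n} = - ?P (- bn n) (- eps n) - \<i> * (?Q (- eps n) - ?Q (- bn n))"
   unfolding RR_double_integral[OF ah Bset_props(3), symmetric] Qd[OF bh(3,4,7,8), symmetric]
   using ep Bset_props(3)[of n] by (intro RR_rectangle[OF a]) auto
  \<comment> \<open>The edges of both rectangles along the cut have opposite signs and combine to
    the jump \<open>e n\<close>.\<close>
  have U3: "Urec {-a..a} (Bset n) = - ?P (eps n) (bn n) - ?P (- bn n) (- eps n) - \<i> * ?Q (bn n) + \<i> * ?Q (- bn n) + \<i> * e n"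
   unfolding Urec_Bset(1) e_def U1 U2 by (simp add: algebra_simps)
  have "norm (Urec {-a..a} (Bset n)) \<le> norm (?P (eps n) (bn n)) + norm (?P (- bn n) (- eps n)) + norm (?Q (bn n)) + norm (?Q (- bn n)) + norm (e n)"
  proof -
   have "norm (- A - B - \<i> * C + \<i> * D + \<i> * E) \<le> norm A + norm B + norm C + norm D + norm E" for A B C D E :: complex
   proof -
    have "norm (- A - B - \<i> * C + \<i> * D + \<i> * E) \<le> norm (- A - B - \<i> * C + \<i> * D) + norm (\<i> * E)" by (rule norm_triangle_ineq)
    also have "norm (- A - B - \<i> * C + \<i> * D) \<le> norm (- A - B - \<i> * C) + norm (\<i> * D)" by (rule norm_triangle_ineq)
    also have "norm (- A - B - \<i> * C) \<le> norm (- A - B) + norm (\<i> * C)" by (rule norm_triangle_ineq4)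
    also have "norm (- A - B) \<le> norm (- A) + norm B" by (rule norm_triangle_ineq4)
    finally show ?thesis by (simp add: norm_mult)
   qed
   then show ?thesis unfolding U3 .
  qed
  also have "\<dots> \<le> cos a * Cb / sin a * pi + cos a * Cb / sin a * pi + cos (bn n) * Cb / \<bar>sin (bn n)\<bar> * pi + cos (- bn n) * Cb / \<bar>sin (- bn n)\<bar> * pi + norm (e n)"
  proof -
   have u1: "eps n \<le> bn n" using ep(4) by simp
   have u2: "- bn n \<le> - eps n" using ep(4) by simp
   have u3: "bn n - eps n \<le> pi / 2" using ep(1) unfolding bn_def by linarith
   have u4: "- eps n - - bn n \<le> pi / 2" using u3 by linarith
   have "norm (?P (eps n) (bn n)) \<le> cos a * Cb / sin a * pi"
    by (rule Pb[of "eps n" "bn n", OF u1 Bset_props(2) u3])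
   moreover have "norm (?P (- bn n) (- eps n)) \<le> cos a * Cb / sin a * pi"
    by (rule Pb[of "- bn n" "- eps n", OF u2 Bset_props(3) u4])
   moreover note Psi_integral_bound(1)[OF a bh(1,2)] Psi_integral_bound(1)[OF a bh(3,4)]
   ultimately show ?thesis by (intro add_mono order_refl)
  qed
  also have "\<dots> = cos a * Cb / sin a * (2 * pi) + 2 * pi * Cb * (cos (bn n) / sin (bn n)) + norm (e n)"
  proof -
   have s: "\<bar>sin (bn n)\<bar> = sin (bn n)" "\<bar>sin (- bn n)\<bar> = sin (bn n)" "cos (- bn n) = cos (bn n)" using sb by auto
   have "A * B / C * q + A * B / C * q + E * B / F * q + E * B / F * q + z = A * B / C * (2 * q) + 2 * q * B * (E / F) + z"
    for A B C E F q z :: real by (simp add: algebra_simps)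
   then show ?thesis unfolding s .
  qed
  finally show ?thesis .
 qed
 then show "eventually (\<lambda>n. norm (Urec {-a..a} (Bset n)) \<le> cos a * Cb / sin a * (2 * pi) + 2 * pi * Cb * (cos (bn n) / sin (bn n)) + norm (e n)) sequentially"
  by simp
qed

text \<open>The second limit, \<open>a\<close> to pi/2. It has to come second because the jump at x
  = 0 is controlled for fixed \<open>a\<close> only.\<close>

lemma Urec_zero: "Urec hpi hpi = 0"
proof -
 have hb: "(\<lambda>n. LBINT t:{- bn n..bn n}. f t) \<longlonglongrightarrow> (LBINT t:hpi. f t)"
  if f: "set_integrable lborel hpi f" for f :: "real => complex"
 proof (rule lborel_set_integral_tendsto[OF f, where z = 0])
  show "{- bn n..bn n} \<subseteq> hpi" for n using eps_props[of n] by auto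
  fix x assume x: "x \<in> hpi" "x \<noteq> (0::real)"
  have "0 < pi / 2 - \<bar>x\<bar>" using x by auto
  then have "eventually (\<lambda>n. eps n < pi / 2 - \<bar>x\<bar>) sequentially"
   using eps_tendsto by (intro order_tendstoD(2)[of _ 0])
  then show "eventually (\<lambda>n. x \<in> {- bn n..bn n}) sequentially"
   by eventually_elim (auto simp: bn_def)
 qed auto
 have "(\<lambda>n. Urec {- bn n..bn n} hpi) \<longlonglongrightarrow> Urec hpi hpi"
  unfolding Urec_def using uj_integrable cosA0_integrable(1)
  by (intro tendsto_intros hb) (auto intro: set_integrable_of_real)
 then have 1: "(\<lambda>n. norm (Urec {- bn n..bn n} hpi)) \<longlonglongrightarrow> norm (Urec hpi hpi)" by (rule tendsto_norm)
 have "(\<lambda>n. Cb * (2 * pi) * (cos (bn n) / sin (bn n))) \<longlonglongrightarrow> Cb * (2 * pi) * 0"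
  by (intro tendsto_intros cos_bn_tendsto)
 then have 2: "(\<lambda>n. Cb * (2 * pi) * (cos (bn n) / sin (bn n))) \<longlonglongrightarrow> 0" by simp
 have "norm (Urec {- bn n..bn n} hpi) \<le> Cb * (2 * pi) * (cos (bn n) / sin (bn n))" for n
  using Urec_bound[of "bn n"] eps_props[of n] by (simp add: ac_simps)
 then have "norm (Urec hpi hpi) \<le> 0"
  by (intro tendsto_le[OF sequentially_bot 2 1] always_eventually) auto
 then show ?thesis by simp
qed

text \<open>The two normalising constants with index m multiply to (\<alpha> m + 1) / (2 pi), which
  matches the weights \<open>kap\<close>. The subtracted term has m = k and turns into the
  1.\<close>

theorem kernel_relation:
 "(\<Sum>j\<le>N. of_nat (N choose j) *
  cr (beta_const 1 ((\<alpha> * real (k + j) - 1) / 2) * (LBINT t:hpi. uj j t)) *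
  (cr (beta_const 1 (\<alpha> * real (k + j) / 2)) * (LBINT x:hpi. vj j x))) = 1"
proof -
 have b: "beta_const 1 ((\<alpha> * real m - 1) / 2) * beta_const 1 (\<alpha> * real m / 2) = (\<alpha> * real m + 1) / (2 * pi)" for m
  using alpha by (intro beta_const_product) auto
 have U: "(LBINT t:hpi. cr (f t)) = cr (LBINT t:hpi. f t)" for f :: "real => real"
  by (rule set_integral_complex_of_real)
 have "(\<Sum>j\<le>N. of_nat (N choose j) *
  cr (beta_const 1 ((\<alpha> * real (k + j) - 1) / 2) * (LBINT t:hpi. uj j t)) *
  (cr (beta_const 1 (\<alpha> * real (k + j) / 2)) * (LBINT x:hpi. vj j x))) =
  (\<Sum>j\<le>N. cr (1 / (2 * pi)) * (kap j * cr (LBINT t:hpi. uj j t) * (LBINT x:hpi. vj j x)))"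
 proof (intro sum.cong refl)
  fix j
  have "of_nat (N choose j) *
   cr (beta_const 1 ((\<alpha> * real (k + j) - 1) / 2) * (LBINT t:hpi. uj j t)) *
   (cr (beta_const 1 (\<alpha> * real (k + j) / 2)) * (LBINT x:hpi. vj j x)) =
   of_nat (N choose j) * cr (beta_const 1 ((\<alpha> * real (k + j) - 1) / 2) * beta_const 1 (\<alpha> * real (k + j) / 2)) *
   cr (LBINT t:hpi. uj j t) * (LBINT x:hpi. vj j x)"
   by (simp only: of_real_mult ac_simps)
  also have "\<dots> = cr (1 / (2 * pi)) * (kap j * cr (LBINT t:hpi. uj j t) * (LBINT x:hpi. vj j x))"
   unfolding b kap_def by simp
  finally show "of_nat (N choose j) *
   cr (beta_const 1 ((\<alpha> * real (k + j) - 1) / 2) * (LBINT t:hpi. uj j t)) *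
   (cr (beta_const 1 (\<alpha> * real (k + j) / 2)) * (LBINT x:hpi. vj j x)) = \<dots>" .
 qed
 also have "\<dots> = cr (1 / (2 * pi)) * (\<Sum>j\<le>N. kap j * cr (LBINT t:hpi. uj j t) * (LBINT x:hpi. vj j x))"
  by (rule sum_distrib_left[symmetric])
 also have "(\<Sum>j\<le>N. kap j * cr (LBINT t:hpi. uj j t) * (LBINT x:hpi. vj j x)) =
  cr ((\<alpha> * real k + 1) * (1 / beta_const 1 ((\<alpha> * real k - 1) / 2)) * (1 / beta_const 1 (\<alpha> * real k / 2)))"
  using Urec_zero unfolding Urec_def U cosA0_integrable(2,4) by simp
 also have "(\<alpha> * real k + 1) * (1 / beta_const 1 ((\<alpha> * real k - 1) / 2)) * (1 / beta_const 1 (\<alpha> * real k / 2)) = 2 * pi"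
 proof -
  have "(\<alpha> * real k + 1) * (1 / beta_const 1 ((\<alpha> * real k - 1) / 2)) * (1 / beta_const 1 (\<alpha> * real k / 2))
   = (\<alpha> * real k + 1) / (beta_const 1 ((\<alpha> * real k - 1) / 2) * beta_const 1 (\<alpha> * real k / 2))" by simp
  then show ?thesis unfolding b using A0_nonneg by (simp add: add_nonneg_pos)
 qed
 finally show ?thesis by simp
qed

end

subsection \<open>The recursion for the expected internal angles\<close>

lemma distr_PiM_map:
 assumes I: "finite I" and M: "prob_space M" and f[measurable]: "f \<in> M \<rightarrow>\<^sub>M M'"
 shows "distr (PiM I (\<lambda>_. M)) (PiM I (\<lambda>_. M')) (\<lambda>X. \<lambda>i\<in>I. f (X i)) = PiM I (\<lambda>_. distr M M' f)"
proof -
 have s: "sets (PiM I (\<lambda>_. M')) = sets (PiM I (\<lambda>_. distr M M' f))" by (intro sets_PiM_cong) auto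
 have f': "f \<in> M \<rightarrow>\<^sub>M distr M M' f" by simp
 have "distr (PiM I (\<lambda>_. M)) (PiM I (\<lambda>_. M')) (\<lambda>X. \<lambda>i\<in>I. f (X i)) =
  distr (PiM I (\<lambda>_. M)) (PiM I (\<lambda>_. distr M M' f)) (compose I f)"
  by (rule distr_cong[OF refl s]) (simp add: compose_def)
 also have "\<dots> = PiM I (\<lambda>_. distr M (distr M M' f) f)"
  by (rule distr_PiM_finite_prob_space') (auto intro: I M f' prob_space.prob_space_distr)
 also have "distr M (distr M M' f) f = distr M M' f" by (rule distr_cong) auto
 finally show ?thesis .
qed

lemma feas_permute:
 assumes p: "bij p" and k: "\<And>i. k \<le> p i \<longleftrightarrow> k \<le> i"
 shows "feas I k M (\<lambda>i. A (p i)) w \<longleftrightarrow> feas (p ` I) k M A w"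
proof -
 have inj: "inj_on p I" using p by (meson bij_is_inj inj_on_subset subset_UNIV)
 have s: "(\<Sum>i\<in>p ` I. l i * A i j) = (\<Sum>i\<in>I. l (p i) * A (p i) j)" for l :: "nat => real" and j
  using inj by (simp add: sum.reindex)
 show ?thesis
 proof
  assume "feas I k M (\<lambda>i. A (p i)) w"
  then obtain l where l: "\<forall>i\<in>I. k \<le> i \<longrightarrow> 0 \<le> l i" "\<forall>j<M. (\<Sum>i\<in>I. l i * A (p i) j) = w j"
   unfolding feas_def by blast
  have i: "inv p (p i) = i" for i using p by (simp add: bij_is_inj)
  show "feas (p ` I) k M A w" unfolding feas_def s
   by (rule exI[of _ "\<lambda>i. l (inv p i)"]) (use l k i in auto)
 next
  assume "feas (p ` I) k M A w"
  then obtain l where "\<forall>i\<in>p ` I. k \<le> i \<longrightarrow> 0 \<le> l i" "\<forall>j<M. (\<Sum>i\<in>I. l (p i) * A (p i) j) = w j"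
   unfolding feas_def s by blast
  then show "feas I k M (\<lambda>i. A (p i)) w" unfolding feas_def
   by (intro exI[of _ "\<lambda>i. l (p i)"]) (use k in auto)
 qed
qed

lemma lower_facet_permute:
 assumes p: "bij p" and G: "G \<subseteq> I"
 shows "lower_facet I G M (\<lambda>i. A (p i)) \<longleftrightarrow> lower_facet (p ` I) (p ` G) M A"
proof -
 have "p ` I - p ` G = p ` (I - G)" using p by (simp add: image_set_diff bij_is_inj)
 then show ?thesis unfolding lower_facet_def by simp
qed

lemma card_bases:
 assumes kN: "k \<le> N" and kM: "k \<le> M"
 shows "card (bases N k M) = (N - k) choose (M - k)"
proof -
 let ?B = "{B. B \<subseteq> {k..<N} \<and> card B = M - k}"
 have "bases N k M = (\<lambda>B. {..<k} \<union> B) ` ?B"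
 proof (intro equalityI subsetI)
  fix G assume G: "G \<in> bases N k M"
  then have G': "{..<k} \<subseteq> G" "G \<subseteq> {..<N}" "card G = M" by (auto simp: bases_def)
  then have "finite G" using finite_subset by blast
  then have "card (G - {..<k}) = M - k" using G' by (simp add: card_Diff_subset)
  moreover have "G - {..<k} \<subseteq> {k..<N}" using G' by auto
  moreover have "G = {..<k} \<union> (G - {..<k})" using G' by auto
  ultimately show "G \<in> (\<lambda>B. {..<k} \<union> B) ` ?B" by blast
 next
  fix G assume "G \<in> (\<lambda>B. {..<k} \<union> B) ` ?B"
  then obtain B where B: "B \<subseteq> {k..<N}" "card B = M - k" "G = {..<k} \<union> B" by blast
  have "finite B" using B finite_subset by blast
  moreover have "{..<k} \<inter> B = {}" using B by auto
  ultimately have "card G = M" using B kM by (simp add: card_Un_disjoint)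
  then show "G \<in> bases N k M" using B kN by (auto simp: bases_def)
 qed
 moreover have "inj_on (\<lambda>B. {..<k} \<union> B) ?B"
 proof (rule inj_onI)
  fix B C assume "B \<in> ?B" "C \<in> ?B" and e: "{..<k} \<union> B = {..<k} \<union> C"
  then have "B = ({..<k} \<union> B) - {..<k}" "C = ({..<k} \<union> C) - {..<k}" by auto
  then show "B = C" using e by simp
 qed
 ultimately show ?thesis by (simp add: card_image n_subsets)
qed

text \<open>By exchangeability all bases then have the probability of the first one. The permutation
  must not mix the free rows with the constrained ones.\<close>

lemma basis_permutation:
 assumes G: "{..<k} \<subseteq> G" "G \<subseteq> {..<N}" "card G = M" and k: "k \<le> M" and M: "M \<le> N"
 shows "\<exists>p. p permutes {..<N} \<and> (\<forall>i. k \<le> p i \<longleftrightarrow> k \<le> i) \<and> p ` {..<M} = G"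
proof -
 have fin: "finite G" using G finite_subset by blast
 have "card {k..<M} = card (G - {..<k})" using G fin by (simp add: card_Diff_subset)
 then obtain f where f: "bij_betw f {k..<M} (G - {..<k})"
  using fin finite_same_card_bij[of "{k..<M}" "G - {..<k}"] by auto
 have "card {M..<N} = card ({..<N} - G)" using G fin by (simp add: card_Diff_subset)
 then obtain h where h: "bij_betw h {M..<N} ({..<N} - G)"
  using finite_same_card_bij[of "{M..<N}" "{..<N} - G"] by auto
 define p where "p i = (if i < k then i else if i < M then f i else if i < N then h i else i)" for i
 have b1: "bij_betw p {..<k} {..<k}"
  by (rule bij_betw_cong[THEN iffD2, OF _ bij_betw_id]) (auto simp: p_def)
 have b2: "bij_betw p {k..<M} (G - {..<k})"
  by (rule bij_betw_cong[THEN iffD2, OF _ f]) (auto simp: p_def)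
 have b3: "bij_betw p {M..<N} ({..<N} - G)"
  by (rule bij_betw_cong[THEN iffD2, OF _ h]) (use k in \<open>auto simp: p_def\<close>)
 have b12: "bij_betw p ({..<k} \<union> {k..<M}) ({..<k} \<union> (G - {..<k}))" by (rule bij_betw_combine[OF b1 b2]) auto
 have e12: "{..<k} \<union> {k..<M} = {..<M}" "{..<k} \<union> (G - {..<k}) = G" using k G by auto
 note b12 = b12[unfolded e12]
 have b: "bij_betw p ({..<M} \<union> {M..<N}) (G \<union> ({..<N} - G))" by (rule bij_betw_combine[OF b12 b3]) auto
 have e: "{..<M} \<union> {M..<N} = {..<N}" "G \<union> ({..<N} - G) = {..<N}" using M G by auto
 note b = b[unfolded e]
 have perm: "p permutes {..<N}" by (rule bij_imp_permutes[OF b]) (use k M in \<open>auto simp: p_def\<close>)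
 moreover have "k \<le> p i \<longleftrightarrow> k \<le> i" for i
 proof (cases "i < k")
  case True
  then show ?thesis by (simp add: p_def)
 next
  case False
  then consider "i \<in> {k..<M}" | "i \<in> {M..<N}" | "N \<le> i" by force
  then have "k \<le> p i"
  proof cases
   case 1
   then have "p i \<in> G - {..<k}" using b2 bij_betwE by blast
   then show ?thesis by auto
  next
   case 2
   then have "p i \<notin> {..<k}" using b3 bij_betwE G(1) by blast
   then show ?thesis by simp
  next
   case 3
   then show ?thesis using False k M by (simp add: p_def)
  qed
  then show ?thesis using False by simp
 qed
 moreover have "p ` {..<M} = G" using b12 by (rule bij_betw_imp_surj_on)
 ultimately show ?thesis by blast
qed

definition flip :: "nat => (nat => nat => real) => nat => nat => real" where
 "flip c A i j = (if j = c then - A i j else A i j)"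

lemma feas_flip_last: "0 < M ==> feas I k (Suc M) (flip M A) (\<lambda>j. - last_unit (Suc M) j) \<longleftrightarrow> feas I k (Suc M) A (last_unit (Suc M))"
proof -
 have "(\<Sum>i\<in>I. l i * flip M A i j) = - last_unit (Suc M) j \<longleftrightarrow> (\<Sum>i\<in>I. l i * A i j) = last_unit (Suc M) j"
  if "j < Suc M" for l :: "nat => real" and j
  by (cases "j = M") (simp_all add: flip_def last_unit_def sum_negf)
 then show ?thesis unfolding feas_def by blast
qed

text \<open>The one remaining row is off the hyperplane by genericity, and negating the heights
  swaps the two sides.\<close>

lemma lower_facet_flip:
 assumes gen: "generic (Suc M) A"
 shows "lower_facet {..<Suc M} {..<M} M (flip M A) \<longleftrightarrow> \<not> lower_facet {..<Suc M} {..<M} M A"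
proof -
 have d: "{..<Suc M} - {..<M} = {M}" by auto
 obtain b where b: "\<And>i. i < M ==> (\<Sum>j<M. b j * A i j) = A i M"
  using generic_cols_solve[OF gen, of "{..<M}" "\<lambda>i. A i M"] by auto
 have uniq: "(\<Sum>j<M. b' j * A M j) = (\<Sum>j<M. b j * A M j)" if "\<And>i. i < M ==> A i M = (\<Sum>j<M. b' j * A i j)" for b'
 proof (rule sum.cong[OF refl])
  fix j assume "j \<in> {..<M}"
  then have "b' j = b j"
   using generic_cols_unique[OF gen, of "{..<M}" b' b j] that b by simp
  then show "b' j * A M j = b j * A M j" by simp
 qed
 have ne: "A M M \<noteq> (\<Sum>j<M. b j * A M j)"
 proof
  assume e: "A M M = (\<Sum>j<M. b j * A M j)"
  define c where "c = (\<lambda>j. if j = M then -1 else b j)"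
  have "(\<Sum>j<Suc M. c j * A i j) = 0" if "i < Suc M" for i
  proof -
   have "(\<Sum>j<M. c j * A i j) = (\<Sum>j<M. b j * A i j)" by (intro sum.cong) (auto simp: c_def)
   moreover have "(\<Sum>j<M. b j * A i j) = A i M" using b[of i] e that by (cases "i = M") auto
   ultimately show ?thesis by (simp add: c_def)
  qed
  then have "c M = (\<lambda>_. 0) M"
   using generic_cols_unique[OF gen, of "{..<Suc M}" c "\<lambda>_. 0" M] by simp
  then show False by (simp add: c_def)
 qed
 have 1: "lower_facet {..<Suc M} {..<M} M A \<longleftrightarrow> A M M > (\<Sum>j<M. b j * A M j)"
 proof
  assume "lower_facet {..<Suc M} {..<M} M A"
  then obtain b' where "\<And>i. i < M ==> A i M = (\<Sum>j<M. b' j * A i j)" "A M M > (\<Sum>j<M. b' j * A M j)"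
   unfolding lower_facet_def d by auto
  then show "A M M > (\<Sum>j<M. b j * A M j)" using uniq[of b'] by simp
 next
  assume "A M M > (\<Sum>j<M. b j * A M j)"
  then show "lower_facet {..<Suc M} {..<M} M A" unfolding lower_facet_def d
   using b by (intro exI[of _ b]) auto
 qed
 have fl: "(\<Sum>j<M. b' j * flip M A i j) = (\<Sum>j<M. b' j * A i j)" for b' i
  by (intro sum.cong) (auto simp: flip_def)
 have 2: "lower_facet {..<Suc M} {..<M} M (flip M A) \<longleftrightarrow> - A M M > - (\<Sum>j<M. b j * A M j)"
 proof
  assume "lower_facet {..<Suc M} {..<M} M (flip M A)"
  then obtain b' where b': "\<And>i. i < M ==> - A i M = (\<Sum>j<M. b' j * A i j)" "- A M M > (\<Sum>j<M. b' j * A M j)"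
   unfolding lower_facet_def d fl by (auto simp: flip_def)
  have "A i M = (\<Sum>j<M. (- b' j) * A i j)" if "i < M" for i
   using b'(1)[OF that] by (simp add: sum_negf)
  from uniq[of "\<lambda>j. - b' j", OF this] b'(2) show "- A M M > - (\<Sum>j<M. b j * A M j)" by (simp add: sum_negf)
 next
  assume "- A M M > - (\<Sum>j<M. b j * A M j)"
  then show "lower_facet {..<Suc M} {..<M} M (flip M A)" unfolding lower_facet_def d fl
   using b by (intro exI[of _ "\<lambda>j. - b j"]) (auto simp: flip_def sum_negf fl)
 qed
 show ?thesis unfolding 1 2 using ne by auto
qed

text \<open>What the recursion needs to know about a random point: general position, symmetry in
  each coordinate, and the law of the leading coordinates. The law is asked for only if
  \<open>Suc m < n\<close>, since uniform points on the sphere have no density in all coordinates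
  together.\<close>

locale beta_sample =
 fixes \<mu> :: "'a measure" and v :: "'a => nat => real" and n k :: nat and \<alpha> :: real
 assumes prob: "prob_space \<mu>"
  and v_meas [measurable]: "\<And>j. (\<lambda>x. v x j) \<in> borel_measurable \<mu>"
  and v_0: "\<And>x. v x 0 = 1"
  and v_generic: "\<And>b m. m < n ==> AE x in \<mu>. v x m \<noteq> (\<Sum>j<m. b j * v x j)"
  and v_flip: "\<And>c. 0 < c ==> c < n ==>
   \<exists>f\<in>\<mu> \<rightarrow>\<^sub>M \<mu>. distr \<mu> \<mu> f = \<mu> \<and> (\<forall>x j. v (f x) j = (if j = c then - v x j else v x j))"
  and v_law: "\<And>m. Suc m < n ==> distr \<mu> (leb {..<m}) (\<lambda>x. \<lambda>j\<in>{..<m}. v x (Suc j)) = bdist m ((\<alpha> - real m) / 2)"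
  and k: "1 \<le> k" and alpha: "real n - 3 \<le> \<alpha>"
begin

abbreviation Om :: "(nat => 'a) measure" where "Om \<equiv> PiM {..<n} (\<lambda>_. \<mu>)"

sublocale Om: prob_space Om
 by (intro prob_space_PiM prob)

definition pr :: "((nat => nat => real) => bool) => real" where
 "pr P = measure Om {X \<in> space Om. P (rows n v X)}"

lemma rows_meas [measurable]: "rows n v \<in> borel_measurable Om"
 by (rule measurable_rows[OF v_meas order_refl])

lemma AE_gen: "AE X in Om. generic n (rows n v X)"
 by (rule AE_generic[OF prob_space_imp_sigma_finite[OF prob] v_meas v_generic order_refl])

lemma pr_sets:
 assumes [measurable]: "Measurable.pred borel P"
 shows "{X \<in> space Om. P (rows n v X)} \<in> sets Om"
 by measurable

lemma pr_integral:
 assumes P: "Measurable.pred borel P"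
 shows "integrable Om (\<lambda>X. of_bool (P (rows n v X)) :: real)" "(\<integral>X. of_bool (P (rows n v X)) \<partial>Om) = pr P"
proof -
 let ?S = "{X \<in> space Om. P (rows n v X)}"
 note S = pr_sets[OF P]
 have e: "(of_bool (P (rows n v X)) :: real) = indicator ?S X" if "X \<in> space Om" for X
  using that by (simp add: indicator_def)
 have "integrable Om (indicator ?S :: _ => real)" using S by (simp add: integrable_indicator_iff less_top[symmetric])
 then show "integrable Om (\<lambda>X. of_bool (P (rows n v X)) :: real)"
  by (subst Bochner_Integration.integrable_cong[OF refl e]) auto
 have "(\<integral>X. of_bool (P (rows n v X)) \<partial>Om) = (\<integral>X. (indicator ?S X :: real) \<partial>Om)"
  by (intro Bochner_Integration.integral_cong refl e)
 then show "(\<integral>X. of_bool (P (rows n v X)) \<partial>Om) = pr P" using S by (simp add: pr_def Om.emeasure_eq_measure)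
qed

lemma pr_cong_generic:
 assumes "Measurable.pred borel P" "Measurable.pred borel Q" "\<And>A. generic n A ==> P A \<longleftrightarrow> Q A"
 shows "pr P = pr Q"
 unfolding pr_def
proof (rule measure_eq_AE)
 show "AE X in Om. X \<in> {X \<in> space Om. P (rows n v X)} \<longleftrightarrow> X \<in> {X \<in> space Om. Q (rows n v X)}"
  using AE_gen by eventually_elim (use assms(3) in auto)
qed (use assms pr_sets in auto)

lemma pr_transform:
 assumes T[measurable]: "T \<in> Om \<rightarrow>\<^sub>M Om" "distr Om Om T = Om" and P: "Measurable.pred borel P"
  and PQ: "\<And>X. X \<in> space Om ==> P (rows n v (T X)) \<longleftrightarrow> Q (rows n v X)"
 shows "pr P = pr Q"
proof -
 have "pr P = measure (distr Om Om T) {X \<in> space Om. P (rows n v X)}"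
  unfolding assms(2) pr_def ..
 also have "\<dots> = measure Om (T -` {X \<in> space Om. P (rows n v X)} \<inter> space Om)"
  by (rule measure_distr[OF T(1) pr_sets[OF P]])
 also have "T -` {X \<in> space Om. P (rows n v X)} \<inter> space Om = {X \<in> space Om. Q (rows n v X)}"
  using PQ measurable_space[OF T(1)] by auto
 finally show ?thesis by (simp add: pr_def)
qed

lemma pr_flip:
 assumes c: "0 < c" "c < n" and P: "Measurable.pred borel P"
 shows "pr P = pr (\<lambda>A. P (flip c A))"
proof -
 obtain f where f[measurable]: "f \<in> \<mu> \<rightarrow>\<^sub>M \<mu>" and d: "distr \<mu> \<mu> f = \<mu>"
  and v: "\<And>x j. v (f x) j = (if j = c then - v x j else v x j)" using v_flip[OF c] by blast
 show ?thesis
 proof (rule pr_transform[OF _ _ P])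
  show "(\<lambda>X. \<lambda>i\<in>{..<n}. f (X i)) \<in> Om \<rightarrow>\<^sub>M Om" by measurable
  show "distr Om Om (\<lambda>X. \<lambda>i\<in>{..<n}. f (X i)) = Om"
   unfolding distr_PiM_map[OF finite_lessThan prob f] d ..
  have "rows n v (\<lambda>i\<in>{..<n}. f (X i)) = flip c (rows n v X)" for X
   by (auto simp: rows_def flip_def v fun_eq_iff)
  then show "P (rows n v (\<lambda>i\<in>{..<n}. f (X i))) \<longleftrightarrow> P (flip c (rows n v X))" for X by simp
 qed
qed

lemma pr_permute:
 assumes p: "p permutes {..<n}" and P: "Measurable.pred borel P"
 shows "pr P = pr (\<lambda>A. P (\<lambda>i. A (p i)))"
proof (rule pr_transform[OF _ _ P])
 have pn: "p i < n \<longleftrightarrow> i < n" for i using permutes_in_image[OF p, of i] by simp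
 show "(\<lambda>X. \<lambda>i\<in>{..<n}. X (p i)) \<in> Om \<rightarrow>\<^sub>M Om"
  by (intro measurable_restrict measurable_component_singleton) (simp add: pn)
 show "distr Om Om (\<lambda>X. \<lambda>i\<in>{..<n}. X (p i)) = Om"
  by (rule distr_PiM_reindex[where K = "{..<n}" and M = "\<lambda>_. \<mu>"])
   (use prob permutes_inj_on[OF p] pn in auto)
 have "rows n v (\<lambda>i\<in>{..<n}. X (p i)) = (\<lambda>i. rows n v X (p i))" for X
  by (auto simp: rows_def pn fun_eq_iff)
 then show "P (rows n v (\<lambda>i\<in>{..<n}. X (p i))) \<longleftrightarrow> P (\<lambda>i. rows n v X (p i))" for X by simp
qed

text \<open>For \<open>M\<close> at least 2, the probability that the last coordinate direction lies
  in the cone at the face of \<open>N\<close> points projected to \<open>M - 1\<close> coordinates.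
  The diagonal values are the expected angles.\<close>

definition qq :: "nat => nat => real" where
 "qq N M = pr (\<lambda>A. feas {..<N} k M A (last_unit M))"

text \<open>The probability that the first \<open>M\<close> rows form the optimal basis of the
  program with \<open>N\<close> rows.\<close>

definition rr :: "nat => nat => real" where
 "rr N M = pr (\<lambda>A. feas {..<M} k M A (last_unit M) \<and> lower_facet {..<N} {..<M} M A)"

lemma pred_feas_lower: "finite I ==> finite G ==> Measurable.pred borel (\<lambda>A. feas G k M A w \<and> lower_facet I G M A)"
 by (intro pred_intros_logic borel_feas borel_lower_facet)

lemma rr_basis:
 assumes N: "N \<le> n" and M: "k \<le> M" "M < N" and G: "G \<in> bases N k M"
 shows "pr (\<lambda>A. feas G k M A (last_unit M) \<and> lower_facet {..<N} G M A) = rr N M"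
proof -
 have G': "{..<k} \<subseteq> G" "G \<subseteq> {..<N}" "card G = M" using G by (auto simp: bases_def)
 obtain p where p: "p permutes {..<N}" "\<And>i. k \<le> p i \<longleftrightarrow> k \<le> i" "p ` {..<M} = G"
  using basis_permutation[OF G' M(1)] M by auto
 have pN: "p ` {..<N} = {..<N}" using permutes_image[OF p(1)] .
 have bij: "bij p" using permutes_bij[OF p(1)] .
 have "rr N M = pr (\<lambda>A. feas {..<M} k M (\<lambda>i. A (p i)) (last_unit M) \<and> lower_facet {..<N} {..<M} M (\<lambda>i. A (p i)))"
  unfolding rr_def
  by (rule pr_permute[OF permutes_subset[OF p(1)] pred_feas_lower]) (use N in auto)
 also have "\<dots> = pr (\<lambda>A. feas G k M A (last_unit M) \<and> lower_facet {..<N} G M A)"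
  using M by (simp add: feas_permute[OF bij p(2)] lower_facet_permute[OF bij] p(3) pN)
 finally show ?thesis by simp
qed

text \<open>The expected number of optimal bases. Reflecting column \<open>M\<close> turns the
  unboundedness event into feasibility with one more column.\<close>

lemma qq_step:
 assumes N: "N \<le> n" and M: "k \<le> M" "M < N"
 shows "real ((N - k) choose (M - k)) * rr N M = qq N M - qq N (Suc M)"
proof -
 have M0: "0 < M" using M k by simp
 have finG: "finite G" if "G \<in> bases N k M" for G
  using that finite_subset[of G "{..<N}"] by (auto simp: bases_def)
 let ?P = "\<lambda>G A. feas G k M A (last_unit M) \<and> lower_facet {..<N} G M A"
 let ?Q = "\<lambda>A. feas {..<N} k M A (last_unit M)"
 let ?R = "\<lambda>A. feas {..<N} k (Suc M) A (\<lambda>j. - last_unit (Suc M) j)"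
 have mP: "Measurable.pred borel (?P G)" if "G \<in> bases N k M" for G
  using finG[OF that] by (intro pred_feas_lower) auto
 have mQ: "Measurable.pred borel ?Q" and mR: "Measurable.pred borel ?R" by (intro borel_feas finite_lessThan)+
 have "(\<Sum>G\<in>bases N k M. pr (?P G)) = (\<Sum>G\<in>bases N k M. \<integral>X. of_bool (?P G (rows n v X)) \<partial>Om)"
  by (intro sum.cong refl pr_integral(2)[symmetric] mP)
 also have "\<dots> = (\<integral>X. (\<Sum>G\<in>bases N k M. of_bool (?P G (rows n v X))) \<partial>Om)"
  by (intro Bochner_Integration.integral_sum[symmetric] pr_integral(1) mP)
 also have "\<dots> = (\<integral>X. of_bool (?Q (rows n v X)) - of_bool (?R (rows n v X)) \<partial>Om)"
 proof (rule integral_cong_AE)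
  show "(\<lambda>X. \<Sum>G\<in>bases N k M. of_bool (?P G (rows n v X)) :: real) \<in> borel_measurable Om"
   by (intro borel_measurable_sum borel_measurable_integrable pr_integral(1) mP)
  show "(\<lambda>X. of_bool (?Q (rows n v X)) - of_bool (?R (rows n v X)) :: real) \<in> borel_measurable Om"
   by (intro borel_measurable_diff borel_measurable_integrable pr_integral(1) mQ mR)
  show "AE X in Om. (\<Sum>G\<in>bases N k M. of_bool (?P G (rows n v X))) = (of_bool (?Q (rows n v X)) - of_bool (?R (rows n v X)) :: real)"
   using AE_gen by eventually_elim (rule optimal_bases_count[OF _ N M M0])
 qed
 also have "\<dots> = pr ?Q - pr ?R"
  by (simp only: Bochner_Integration.integral_diff[OF pr_integral(1)[OF mQ] pr_integral(1)[OF mR]] pr_integral(2)[OF mQ] pr_integral(2)[OF mR])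
 also have "pr ?R = pr (\<lambda>A. ?R (flip M A))"
  by (rule pr_flip[OF M0 _ mR]) (use M N in simp)
 also have "\<dots> = qq N (Suc M)" unfolding qq_def feas_flip_last[OF M0] ..
 also have "pr ?Q = qq N M" by (simp add: qq_def)
 finally have "(\<Sum>G\<in>bases N k M. pr (?P G)) = qq N M - qq N (Suc M)" .
 moreover have "(\<Sum>G\<in>bases N k M. pr (?P G)) = (\<Sum>G\<in>bases N k M. rr N M)"
  by (intro sum.cong refl rr_basis[OF N M])
 ultimately show ?thesis using card_bases[of k N M] M by simp
qed

text \<open>With \<open>k\<close> columns the free rows alone reach every target.\<close>

lemma qq_start:
 assumes "k \<le> N" "N \<le> n"
 shows "qq N k = 1"
proof -
 have "qq N k = pr (\<lambda>_. True)" unfolding qq_def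
 proof (rule pr_cong_generic)
  fix A assume gen: "generic n A"
  have "\<exists>l. \<forall>j<card {..<k}. (\<Sum>i<k. l i * A i j) = last_unit k j"
   by (rule generic_rows_solve[OF gen]) (use assms in auto)
  then have "feas {..<k} k k A (last_unit k)" unfolding feas_def by auto
  then show "feas {..<N} k k A (last_unit k) \<longleftrightarrow> True"
   using feas_mono_set[of "{..<k}" k k A "last_unit k" "{..<N}"] assms by auto
 qed (auto intro: borel_feas)
 then show ?thesis by (simp add: pr_def Om.prob_space)
qed

lemma qq_telescope:
 assumes "k \<le> N" "N \<le> n"
 shows "(\<Sum>M\<in>{k..<N}. real ((N - k) choose (M - k)) * rr N M) + qq N N = 1"
proof -
 have "(\<Sum>M\<in>{k..<N}. real ((N - k) choose (M - k)) * rr N M) = (\<Sum>M\<in>{k..<N}. qq N M - qq N (Suc M))"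
  by (intro sum.cong refl qq_step) (use assms in auto)
 also have "\<dots> = qq N k - qq N N"
  using sum_Suc_diff'[OF assms(1), of "\<lambda>M. - qq N M"] by simp
 finally show ?thesis using qq_start[OF assms] by simp
qed

text \<open>Reflecting the heights makes above and below equally likely for the single further
  point, and the feasibility event does not see the heights. No density is involved.\<close>

lemma rr_half:
 assumes n: "n = Suc M" and M: "k \<le> M"
 shows "rr n M = qq M M / 2"
proof -
 let ?F = "\<lambda>A. feas {..<M} k M A (last_unit M)" and ?L = "\<lambda>A. lower_facet {..<n} {..<M} M A"
 have M0: "0 < M" using M k by simp
 have mF: "Measurable.pred borel ?F" by (intro borel_feas finite_lessThan)
 have mFL: "Measurable.pred borel (\<lambda>A. ?F A \<and> ?L A)" by (rule pred_feas_lower) auto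
 have mFN: "Measurable.pred borel (\<lambda>A. ?F A \<and> \<not> ?L A)"
  by (intro pred_intros_logic borel_feas borel_lower_facet finite_lessThan)
 have Fflip: "?F (flip M A) \<longleftrightarrow> ?F A" for A by (rule feas_cong) (auto simp: flip_def)
 have "pr (\<lambda>A. ?F A \<and> ?L A) = pr (\<lambda>A. ?F (flip M A) \<and> ?L (flip M A))"
  by (rule pr_flip[OF M0 _ mFL]) (use n in simp)
 moreover have "pr (\<lambda>A. ?F (flip M A) \<and> ?L (flip M A)) = pr (\<lambda>A. ?F A \<and> \<not> ?L A)"
  unfolding pr_def
 proof (rule measure_eq_AE)
  show "AE X in Om. X \<in> {X \<in> space Om. ?F (flip M (rows n v X)) \<and> ?L (flip M (rows n v X))} \<longleftrightarrow>
   X \<in> {X \<in> space Om. ?F (rows n v X) \<and> \<not> ?L (rows n v X)}"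
   using AE_gen by eventually_elim (use lower_facet_flip[of M] n Fflip in auto)
  have [measurable]: "flip M \<in> borel_measurable borel"
  proof (rule measurable_matrix)
   show "(\<lambda>A. flip M A i j) \<in> borel_measurable borel" for i j
    using measurable_entry[of i j] by (cases "j = M") (simp_all add: flip_def)
  qed
  have "Measurable.pred borel (\<lambda>A. ?F (flip M A) \<and> ?L (flip M A))"
   using mFL by measurable
  then show "{X \<in> space Om. ?F (flip M (rows n v X)) \<and> ?L (flip M (rows n v X))} \<in> sets Om" by (rule pr_sets)
 qed (rule pr_sets[OF mFN])
 moreover have "pr (\<lambda>A. ?F A \<and> ?L A) + pr (\<lambda>A. ?F A \<and> \<not> ?L A) = qq M M"
 proof -
  have "qq M M = (\<integral>X. of_bool (?F (rows n v X) \<and> ?L (rows n v X)) + of_bool (?F (rows n v X) \<and> \<not> ?L (rows n v X)) \<partial>Om)"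
   unfolding qq_def pr_integral(2)[OF mF, symmetric] by (intro Bochner_Integration.integral_cong) auto
  then show ?thesis
   by (simp only: Bochner_Integration.integral_add[OF pr_integral(1)[OF mFL] pr_integral(1)[OF mFN]] pr_integral(2)[OF mFL] pr_integral(2)[OF mFN])
 qed
 ultimately show ?thesis by (simp add: rr_def)
qed

end

section \<open>Angle and facet probabilities through the height of the hyperplane\<close>

context beta_sample
begin

text \<open>An event that sees only \<open>N\<close> rows and \<open>m + 1\<close> columns is moved
  to independent points with the law in \<open>m\<close> dimensions.\<close>

lemma nn_pr_law:
 assumes m: "Suc m < n" and N: "N \<le> n" and P: "Measurable.pred borel P"
  and dep: "\<And>A B. (\<And>i j. i < N ==> j \<le> m ==> A i j = B i j) ==> P A \<longleftrightarrow> P B"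
 shows "ennreal (pr P) =
  (\<integral>\<^sup>+ Y. indicator {A. P A} (rows N (hv m) Y) \<partial>PiM {..<N} (\<lambda>_. bdist m ((\<alpha> - real m) / 2)))"
proof -
 let ?c = "\<lambda>x. \<lambda>j\<in>{..<m}. v x (Suc j)"
 let ?F = "\<lambda>Y. indicator {A. P A} (rows N (hv m) Y) :: ennreal"
 have c[measurable]: "?c \<in> \<mu> \<rightarrow>\<^sub>M leb {..<m}"
  by (intro measurable_restrict) (simp add: v_meas)
 have I[measurable]: "indicator {A. P A} \<in> borel_measurable (borel :: (nat => nat => real) measure)"
  using P by (intro borel_measurable_indicator) (simp add: pred_def)
 have R: "rows N (hv m) \<in> borel_measurable (PiM {..<N} (\<lambda>_. leb {..<m}))"
  by (rule measurable_rows) auto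
 have F: "?F \<in> borel_measurable (PiM {..<N} (\<lambda>_. leb {..<m}))"
  by (rule measurable_compose[OF R I])
 let ?t = "\<lambda>X. \<lambda>i\<in>{..<N}. ?c (X i)" and ?r = "\<lambda>X. \<lambda>i\<in>{..<N}. X i"
 have t: "?t \<in> PiM {..<N} (\<lambda>_. \<mu>) \<rightarrow>\<^sub>M PiM {..<N} (\<lambda>_. leb {..<m})"
 proof (rule measurable_restrict)
  fix i assume "i \<in> {..<N}"
  then have "(\<lambda>X. X i) \<in> PiM {..<N} (\<lambda>_. \<mu>) \<rightarrow>\<^sub>M \<mu>" by (rule measurable_component_singleton)
  then show "(\<lambda>X. ?c (X i)) \<in> PiM {..<N} (\<lambda>_. \<mu>) \<rightarrow>\<^sub>M leb {..<m}" by (rule measurable_compose[OF _ c])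
 qed
 have r: "?r \<in> Om \<rightarrow>\<^sub>M PiM {..<N} (\<lambda>_. \<mu>)"
  using N by (intro measurable_restrict measurable_component_singleton) auto
 have d1: "distr (PiM {..<N} (\<lambda>_. \<mu>)) (PiM {..<N} (\<lambda>_. leb {..<m})) ?t = PiM {..<N} (\<lambda>_. bdist m ((\<alpha> - real m) / 2))"
  unfolding distr_PiM_map[OF finite_lessThan prob c] v_law[OF m] ..
 have d2: "distr Om (PiM {..<N} (\<lambda>_. \<mu>)) ?r = PiM {..<N} (\<lambda>_. \<mu>)"
  using distr_PiM_reindex[of "{..<n}" "\<lambda>_. \<mu>" "\<lambda>i. i" "{..<N}"] prob N by auto
 have "(\<integral>\<^sup>+ Y. ?F Y \<partial>PiM {..<N} (\<lambda>_. bdist m ((\<alpha> - real m) / 2))) = (\<integral>\<^sup>+ X. ?F (?t X) \<partial>PiM {..<N} (\<lambda>_. \<mu>))"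
  unfolding d1[symmetric] by (rule nn_integral_distr[OF t]) (simp only: measurable_distr_eq1 F)
 also have "\<dots> = (\<integral>\<^sup>+ X. ?F (?t X) \<partial>distr Om (PiM {..<N} (\<lambda>_. \<mu>)) ?r)" unfolding d2 ..
 also have "\<dots> = (\<integral>\<^sup>+ X. ?F (?t (?r X)) \<partial>Om)"
  by (rule nn_integral_distr[OF r]) (simp only: measurable_distr_eq1 measurable_compose[OF t F])
 also have "\<dots> = (\<integral>\<^sup>+ X. indicator {X \<in> space Om. P (rows n v X)} X \<partial>Om)"
 proof (rule nn_integral_cong)
  fix X assume X: "X \<in> space Om"
  have "P (rows N (hv m) (?t (?r X))) \<longleftrightarrow> P (rows n v X)"
  proof (rule dep)
   fix i j assume ij: "i < N" "j \<le> m"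
   show "rows N (hv m) (?t (?r X)) i j = rows n v X i j"
    using ij N by (cases j) (simp_all add: rows_def v_0)
  qed
  then show "?F (?t (?r X)) = indicator {X \<in> space Om. P (rows n v X)} X"
   using X by (simp add: indicator_def)
 qed
 also have "\<dots> = ennreal (pr P)"
  using pr_sets[OF P] by (simp add: pr_def Om.emeasure_eq_measure)
 finally show ?thesis ..
qed

text \<open>The tail \<open>Fbar\<close> for all dimensions at once: with g = (\<alpha> - m) / 2 in
  dimension m its exponent is always (\<alpha> - 1) / 2.\<close>

definition Fb :: "real => ennreal" where
 "Fb a = (\<integral>\<^sup>+ h. indicator {a<..} h * ennreal (beta_const 1 ((\<alpha> - 1) / 2) * wt1 ((\<alpha> - 1) / 2) h) \<partial>lborel)"

lemma Fb_measurable [measurable]: "Fb \<in> borel_measurable borel"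
proof -
 have "(\<lambda>(a, h). indicator {0<..} (h - a) * ennreal (beta_const 1 ((\<alpha> - 1) / 2) * wt1 ((\<alpha> - 1) / 2) h)) \<in> borel_measurable (borel \<Otimes>\<^sub>M (lborel :: real measure))"
  by measurable
 then have "(\<lambda>a. \<integral>\<^sup>+ h. indicator {0<..} (h - a) * ennreal (beta_const 1 ((\<alpha> - 1) / 2) * wt1 ((\<alpha> - 1) / 2) h) \<partial>lborel) \<in> borel_measurable (borel :: real measure)"
  by (rule lborel.borel_measurable_nn_integral)
 moreover have "indicator {0<..} (h - a) = (indicator {a<..} h :: ennreal)" for a h :: real by (simp add: indicator_def)
 ultimately show ?thesis unfolding Fb_def[abs_def] by simp
qed

text \<open>Given the height h of the hyperplane through \<open>M\<close> points, each further point
  is above it with probability \<open>Fb h\<close>; the remaining factor is the density of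
  h.\<close>

definition IE :: "nat => nat => ennreal" where
 "IE N M = (\<integral>\<^sup>+ h. Fb h ^ (N - M) *
   ennreal (beta_const 1 ((\<alpha> * real M - 1) / 2) * wt1 ((\<alpha> * real M - 1) / 2) h) \<partial>lborel)"

context
 fixes p :: nat and g s :: real
 assumes p: "Suc (Suc p) < n" and kp: "k \<le> Suc p"
  and g_def: "g = (\<alpha> - real (Suc p)) / 2" and s_def: "s = (\<alpha> * real (Suc p) - 1) / 2"
begin

lemma g_gt: "-1 < g" and s_gt: "-1 < s" and s_eq: "((2 * g + real (Suc p)) * real (Suc p) - 1) / 2 = s"
 and Fbar_eq: "Fbar p g h = Fb h"
proof -
 have a: "real p \<le> \<alpha>" using p alpha by linarith
 then show "-1 < g" by (simp add: g_def)
 have "0 \<le> \<alpha> * real (Suc p)" using a by (intro mult_nonneg_nonneg) auto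
 then show "-1 < s" by (simp add: s_def)
 have "2 * g + real (Suc p) = \<alpha>" by (simp add: g_def field_simps)
 then show "((2 * g + real (Suc p)) * real (Suc p) - 1) / 2 = s" by (simp only: s_def)
 have e: "g + real p / 2 = (\<alpha> - 1) / 2" by (simp add: g_def field_simps)
 show "Fbar p g h = Fb h" unfolding Fbar_def[OF \<open>-1 < g\<close>] e Fb_def ..
qed

lemma feas_ind_eq: "feas_ind p k A = indicator {A. feas {..<Suc p} k (Suc p) A (last_unit (Suc p))} A"
 by (rule feas_ind_def[OF g_gt kp])

lemma qq_law: "ennreal (qq (Suc p) (Suc p)) = KK p g k * (\<integral>\<^sup>+ h. ennreal (wt1 s h) \<partial>lborel)"
proof -
 let ?P = "\<lambda>A. feas {..<Suc p} k (Suc p) A (last_unit (Suc p))"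
 have "ennreal (qq (Suc p) (Suc p)) =
  (\<integral>\<^sup>+ Y. indicator {A. ?P A} (rows (Suc p) (hv (Suc p)) Y) \<partial>PiM {..<Suc p} (\<lambda>_. bdist (Suc p) g))"
  unfolding qq_def g_def
 proof (rule nn_pr_law[OF p])
  show "Measurable.pred borel ?P" by (intro borel_feas finite_lessThan)
  fix A B :: "nat => nat => real" assume "\<And>i j. i < Suc p ==> j \<le> Suc p ==> A i j = B i j"
  then show "?P A \<longleftrightarrow> ?P B" by (intro feas_cong) auto
 qed (use p in simp)
 also have "\<dots> = (\<integral>\<^sup>+ Y. feas_ind p k (rows (Suc p) (hv (Suc p)) Y) * 1 \<partial>PiM {..<Suc p} (\<lambda>_. bdist (Suc p) g))"
  unfolding feas_ind_eq by simp
 also have "\<dots> = KK p g k * (\<integral>\<^sup>+ h. 1 * ennreal (wt1 s h) \<partial>lborel)"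
  unfolding s_eq[symmetric] by (rule simplex_height_law[OF g_gt kp, of "\<lambda>_. 1" "\<lambda>_. 1"]) auto
 finally show ?thesis by simp
qed

text \<open>Generic vertices determine the hyperplane through them, so the coefficients that exist
  by definition can only be \<open>b\<close>.\<close>

lemma lower_facet_section:
 assumes N: "Suc p \<le> N" and gen: "generic (Suc p) (rows (Suc p) (hv p) Y)"
  and X: "X = (\<lambda>i\<in>{..<Suc p}. (Y i)(p := lin p b (Y i)))"
 shows "lower_facet {..<N} {..<Suc p} (Suc p) (rows N (hv (Suc p)) (merge {..<Suc p} {Suc p..<N} (X, W))) \<longleftrightarrow>
  (\<forall>i\<in>{Suc p..<N}. lin p b (W i) < W i p)"
proof -
 let ?A = "rows N (hv (Suc p)) (merge {..<Suc p} {Suc p..<N} (X, W))"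
 have drop: "hv (Suc p) x j = hv p x j" if "j < Suc p" for x j
  using that by (cases j) auto
 have upd: "hv p (x(p := t)) j = hv p x j" for x t j by (rule hv_cong) auto
 have A1: "?A i j = hv p (Y i) j" if "i < Suc p" "j < Suc p" for i j
  using that N by (simp add: rows_def merge_def X drop upd)
 have A2: "?A i (Suc p) = lin p b (Y i)" if "i < Suc p" for i
  using that N by (simp add: rows_def merge_def X)
 have A3: "?A i j = hv p (W i) j" if "i \<in> {Suc p..<N}" "j < Suc p" for i j
  using that by (simp add: rows_def merge_def drop)
 have A4: "?A i (Suc p) = W i p" if "i \<in> {Suc p..<N}" for i
  using that by (simp add: rows_def merge_def)
 have S1: "(\<Sum>j<Suc p. c j * ?A i j) = lin p c (Y i)" if "i < Suc p" for c i
  unfolding lin_def by (intro sum.cong refl) (simp add: A1 that)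
 have S2: "(\<Sum>j<Suc p. c j * ?A i j) = lin p c (W i)" if "i \<in> {Suc p..<N}" for c i
  unfolding lin_def by (intro sum.cong refl) (simp add: A3[OF that])
 have d: "{..<N} - {..<Suc p} = {Suc p..<N}" by auto
 have "lower_facet {..<N} {..<Suc p} (Suc p) ?A \<longleftrightarrow>
  (\<exists>c. (\<forall>i<Suc p. lin p b (Y i) = lin p c (Y i)) \<and> (\<forall>i\<in>{Suc p..<N}. lin p c (W i) < W i p))"
  unfolding lower_facet_def d by (simp add: A2 A4 S1 S2 Ball_def del: sum.lessThan_Suc)
 also have "\<dots> \<longleftrightarrow> (\<forall>i\<in>{Suc p..<N}. lin p b (W i) < W i p)"
 proof (intro iffI)
  assume "\<exists>c. (\<forall>i<Suc p. lin p b (Y i) = lin p c (Y i)) \<and> (\<forall>i\<in>{Suc p..<N}. lin p c (W i) < W i p)"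
  then obtain c where c: "\<And>i. i < Suc p ==> lin p b (Y i) = lin p c (Y i)" "\<forall>i\<in>{Suc p..<N}. lin p c (W i) < W i p"
   by blast
  have "c j = b j" if "j < Suc p" for j
  proof (rule generic_cols_unique[OF gen, of "{..<Suc p}"])
   fix i assume "i \<in> {..<Suc p}"
   then show "(\<Sum>j<card {..<Suc p}. c j * rows (Suc p) (hv p) Y i j) = (\<Sum>j<card {..<Suc p}. b j * rows (Suc p) (hv p) Y i j)"
    using c(1)[of i] by (simp add: rows_def lin_def del: sum.lessThan_Suc)
  qed (use that in auto)
  then have "lin p c y = lin p b y" for y unfolding lin_def by (intro sum.cong refl) simp
  then show "\<forall>i\<in>{Suc p..<N}. lin p b (W i) < W i p" using c(2) by simp
 qed auto
 finally show ?thesis .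
qed

lemma nn_integral_all_above:
 assumes b: "b \<in> space (leb {..<Suc p})"
 shows "(\<integral>\<^sup>+ W. indicator {W. \<forall>i\<in>{Suc p..<N}. lin p b (W i) < W i p} W \<partial>PiM {Suc p..<N} (\<lambda>_::nat. bdist (Suc p) g)) =
  Fb (ht p b) ^ (N - Suc p)"
proof -
 interpret product_sigma_finite "\<lambda>_::nat. bdist (Suc p) g"
  by (intro product_sigma_finite.intro prob_space_imp_sigma_finite prob_space_bdist g_gt)
 have hvm: "(\<lambda>x. hv p x j) \<in> borel_measurable (leb {..<Suc p})" for j
 proof (cases j)
  case (Suc i)
  then show ?thesis by (cases "i < p") (auto intro: leb_component)
 qed simp
 have L: "(\<lambda>x. lin p b x) \<in> borel_measurable (bdist (Suc p) g)"
  unfolding lin_def measurable_cong_sets[OF sets_bdist refl]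
  by (intro borel_measurable_sum borel_measurable_times borel_measurable_const hvm)
 have "(\<integral>\<^sup>+ W. indicator {W. \<forall>i\<in>{Suc p..<N}. lin p b (W i) < W i p} W \<partial>PiM {Suc p..<N} (\<lambda>_::nat. bdist (Suc p) g)) =
  (\<integral>\<^sup>+ W. (\<Prod>i\<in>{Suc p..<N}. indicator {0<..} (W i p - lin p b (W i))) \<partial>PiM {Suc p..<N} (\<lambda>_::nat. bdist (Suc p) g))"
 proof (rule nn_integral_cong)
  fix W :: "nat => nat => real"
  show "(indicator {W. \<forall>i\<in>{Suc p..<N}. lin p b (W i) < W i p} W :: ennreal) = (\<Prod>i\<in>{Suc p..<N}. indicator {0<..} (W i p - lin p b (W i)))"
  proof (cases "\<forall>i\<in>{Suc p..<N}. lin p b (W i) < W i p")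
   case True
   then show ?thesis by (auto intro!: prod.neutral[symmetric])
  next
   case False
   then obtain i where "i \<in> {Suc p..<N}" "\<not> lin p b (W i) < W i p" by blast
   then have "(\<Prod>i\<in>{Suc p..<N}. indicator {0<..} (W i p - lin p b (W i)) :: ennreal) = 0"
    by (intro prod_zero) (auto intro!: bexI[of _ i])
   then show ?thesis using False by simp
  qed
 qed
 also have "\<dots> = (\<Prod>i\<in>{Suc p..<N}. \<integral>\<^sup>+ x. indicator {0<..} (x p - lin p b x) \<partial>bdist (Suc p) g)"
 proof (rule product_nn_integral_prod)
  have "(\<lambda>x. x p - lin p b x) \<in> borel_measurable (bdist (Suc p) g)"
   by (intro borel_measurable_diff L) (simp add: measurable_cong_sets[OF sets_bdist refl] leb_component)
  then show "(\<lambda>x. indicator {0<..} (x p - lin p b x) :: ennreal) \<in> borel_measurable (bdist (Suc p) g)"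
   by (rule measurable_compose) simp
 qed simp
 also have "\<dots> = Fb (ht p b) ^ (N - Suc p)"
  unfolding nn_integral_above[OF g_gt b] Fbar_eq by simp
 finally show ?thesis .
qed

text \<open>Fubini over the first \<open>p + 1\<close> points: the other points contribute a
  function of the height alone, as the height law requires. The constant is the one of
  \<open>qq_law\<close>.\<close>

lemma rr_law:
 assumes N: "N \<le> n" "Suc p < N"
 shows "ennreal (rr N (Suc p)) = KK p g k * (\<integral>\<^sup>+ h. Fb h ^ (N - Suc p) * ennreal (wt1 s h) \<partial>lborel)"
proof -
 interpret psf: product_sigma_finite "\<lambda>_::nat. bdist (Suc p) g"
  by (intro product_sigma_finite.intro prob_space_imp_sigma_finite prob_space_bdist g_gt)
 let ?I = "{..<Suc p}" and ?K = "{Suc p..<N}"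
 let ?P1 = "\<lambda>A. feas {..<Suc p} k (Suc p) A (last_unit (Suc p))"
 let ?P2 = "\<lambda>A. lower_facet {..<N} {..<Suc p} (Suc p) A"
 let ?R = "rows N (hv (Suc p))"
 have U: "?I \<union> ?K = {..<N}" and D: "?I \<inter> ?K = {}" using N by auto
 have sP: "sets (PiM I (\<lambda>_::nat. bdist (Suc p) g)) = sets (PiM I (\<lambda>_. leb {..<Suc p}))" for I
  by (intro sets_PiM_cong) auto
 have spP: "space (PiM I (\<lambda>_::nat. bdist (Suc p) g)) = space (PiM I (\<lambda>_. leb {..<Suc p}))" for I
  by (rule sets_eq_imp_space_eq[OF sP])
 have m2: "indicator {A. ?P2 A} \<in> borel_measurable (borel :: (nat => nat => real) measure)"
  using borel_lower_facet[of "{..<N}" "{..<Suc p}" "Suc p"]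
  by (intro borel_measurable_indicator) (simp add: pred_def)
 have m12: "indicator {A. ?P1 A \<and> ?P2 A} \<in> borel_measurable (borel :: (nat => nat => real) measure)"
  using pred_feas_lower[of "{..<N}" "{..<Suc p}" "Suc p" "last_unit (Suc p)"]
  by (intro borel_measurable_indicator) (simp add: pred_def)
 have Rm: "?R \<in> borel_measurable (PiM {..<N} (\<lambda>_. leb {..<Suc p}))" by (rule measurable_rows) auto
 have mg: "(\<lambda>z. merge ?I ?K z) \<in> PiM ?I (\<lambda>_. leb {..<Suc p}) \<Otimes>\<^sub>M PiM ?K (\<lambda>_. leb {..<Suc p}) \<rightarrow>\<^sub>M PiM {..<N} (\<lambda>_. leb {..<Suc p})"
  using measurable_merge[of ?I ?K "\<lambda>_. leb {..<Suc p}"] unfolding U .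
 define \<Psi> where "\<Psi> X = (\<integral>\<^sup>+ W. indicator {A. ?P2 A} (?R (merge ?I ?K (X, W))) \<partial>PiM ?K (\<lambda>_. bdist (Suc p) g))" for X
 have RW: "(\<lambda>W. ?R (merge ?I ?K (X, W))) \<in> borel_measurable (PiM ?K (\<lambda>_. bdist (Suc p) g))"
  if "X \<in> space (PiM ?I (\<lambda>_. leb {..<Suc p}))" for X
  unfolding measurable_cong_sets[OF sP refl]
  by (rule measurable_compose[OF measurable_Pair1' measurable_compose[OF mg Rm]]) (rule that)
 have \<Psi>m: "\<Psi> \<in> borel_measurable (PiM ?I (\<lambda>_. leb {..<Suc p}))"
  unfolding \<Psi>_def[abs_def]
 proof (rule sigma_finite_measure.borel_measurable_nn_integral)
  show "sigma_finite_measure (PiM ?K (\<lambda>_. bdist (Suc p) g))" by (rule psf.sigma_finite) simp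
  have "(\<lambda>z. indicator {A. ?P2 A} (?R (merge ?I ?K z)) :: ennreal) \<in> borel_measurable (PiM ?I (\<lambda>_. leb {..<Suc p}) \<Otimes>\<^sub>M PiM ?K (\<lambda>_. leb {..<Suc p}))"
   by (rule measurable_compose[OF measurable_compose[OF mg Rm] m2])
  moreover have s: "sets (PiM ?I (\<lambda>_. leb {..<Suc p}) \<Otimes>\<^sub>M PiM ?K (\<lambda>_. bdist (Suc p) g)) = sets (PiM ?I (\<lambda>_. leb {..<Suc p}) \<Otimes>\<^sub>M PiM ?K (\<lambda>_. leb {..<Suc p}))"
   by (intro sets_pair_measure_cong refl sP)
  ultimately show "(\<lambda>(X, W). indicator {A. ?P2 A} (?R (merge ?I ?K (X, W))) :: ennreal) \<in> borel_measurable (PiM ?I (\<lambda>_. leb {..<Suc p}) \<Otimes>\<^sub>M PiM ?K (\<lambda>_. bdist (Suc p) g))"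
   unfolding case_prod_beta' prod.collapse by (simp only: measurable_cong_sets[OF s refl])
 qed
 have "ennreal (rr N (Suc p)) =
  (\<integral>\<^sup>+ Z. indicator {A. ?P1 A \<and> ?P2 A} (?R Z) \<partial>PiM {..<N} (\<lambda>_. bdist (Suc p) g))"
  unfolding rr_def g_def
 proof (rule nn_pr_law[OF p N(1) pred_feas_lower])
  fix A B :: "nat => nat => real" assume e: "\<And>i j. i < N ==> j \<le> Suc p ==> A i j = B i j"
  have "?P1 A \<longleftrightarrow> ?P1 B" using e N by (intro feas_cong) auto
  moreover have "?P2 A \<longleftrightarrow> ?P2 B" using e N by (intro lower_facet_cong) auto
  ultimately show "?P1 A \<and> ?P2 A \<longleftrightarrow> ?P1 B \<and> ?P2 B" by simp
 qed auto
 also have "\<dots> = (\<integral>\<^sup>+ X. (\<integral>\<^sup>+ W. indicator {A. ?P1 A \<and> ?P2 A} (?R (merge ?I ?K (X, W))) \<partial>PiM ?K (\<lambda>_. bdist (Suc p) g)) \<partial>PiM ?I (\<lambda>_. bdist (Suc p) g))"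
  unfolding U[symmetric]
 proof (rule psf.product_nn_integral_fold[OF D])
  show "(\<lambda>Z. indicator {A. ?P1 A \<and> lower_facet (?I \<union> ?K) {..<Suc p} (Suc p) A} (?R Z) :: ennreal) \<in> borel_measurable (PiM (?I \<union> ?K) (\<lambda>_. bdist (Suc p) g))"
   unfolding U measurable_cong_sets[OF sP refl] by (rule measurable_compose[OF Rm m12])
 qed auto
 also have "\<dots> = (\<integral>\<^sup>+ X. feas_ind p k (rows (Suc p) (hv (Suc p)) X) * \<Psi> X \<partial>PiM ?I (\<lambda>_. bdist (Suc p) g))"
 proof (rule nn_integral_cong)
  fix X assume "X \<in> space (PiM ?I (\<lambda>_. bdist (Suc p) g))"
  then have X: "X \<in> space (PiM ?I (\<lambda>_. leb {..<Suc p}))" unfolding spP .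
  have "?P1 (?R (merge ?I ?K (X, W))) \<longleftrightarrow> ?P1 (rows (Suc p) (hv (Suc p)) X)" for W
   by (rule feas_cong) (use N in \<open>auto simp: rows_def merge_def\<close>)
  then have "indicator {A. ?P1 A \<and> ?P2 A} (?R (merge ?I ?K (X, W))) =
   feas_ind p k (rows (Suc p) (hv (Suc p)) X) * indicator {A. ?P2 A} (?R (merge ?I ?K (X, W)))" for W
   unfolding feas_ind_eq by (simp add: indicator_def)
  then show "(\<integral>\<^sup>+ W. indicator {A. ?P1 A \<and> ?P2 A} (?R (merge ?I ?K (X, W))) \<partial>PiM ?K (\<lambda>_. bdist (Suc p) g)) =
   feas_ind p k (rows (Suc p) (hv (Suc p)) X) * \<Psi> X"
   unfolding \<Psi>_def by (simp only: nn_integral_cmult[OF measurable_compose[OF RW[OF X] m2]])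
 qed
 also have "\<dots> = KK p g k * (\<integral>\<^sup>+ h. Fb h ^ (N - Suc p) * ennreal (wt1 s h) \<partial>lborel)"
  unfolding s_eq[symmetric]
 proof (rule simplex_height_law[OF g_gt kp \<Psi>m])
  show "(\<lambda>h. Fb h ^ (N - Suc p)) \<in> borel_measurable borel" by measurable
  fix Y b assume Y: "Y \<in> space (PiM ?I (\<lambda>_. leb {..<p}))" and b: "b \<in> space (leb {..<Suc p})"
   and gen: "generic (Suc p) (rows (Suc p) (hv p) Y)"
  have "\<Psi> (\<lambda>i\<in>?I. (Y i)(p := lin p b (Y i))) =
   (\<integral>\<^sup>+ W. indicator {W. \<forall>i\<in>?K. lin p b (W i) < W i p} W \<partial>PiM ?K (\<lambda>_. bdist (Suc p) g))"
   unfolding \<Psi>_def using lower_facet_section[OF _ gen refl, of N b] N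
   by (intro nn_integral_cong) (simp add: indicator_def)
  then show "\<Psi> (\<lambda>i\<in>?I. (Y i)(p := lin p b (Y i))) = Fb (ht p b) ^ (N - Suc p)"
   unfolding nn_integral_all_above[OF b] .
 qed
 finally show ?thesis .
qed

lemma rr_IE:
 assumes N: "N \<le> n" "Suc p < N"
 shows "ennreal (rr N (Suc p)) = ennreal (qq (Suc p) (Suc p)) * IE N (Suc p)"
proof -
 have c: "0 < beta_const 1 s" using s_gt by (intro beta_const_pos) auto
 have B: "0 \<le> Beta (1 / 2) (s + 1)" using s_gt by (simp add: Beta_def Gamma_real_nonneg)
 have one: "ennreal (Beta (1 / 2) (s + 1)) * ennreal (beta_const 1 s) = 1"
  using beta_const_1[OF s_gt] B c by (simp add: ennreal_mult[symmetric] mult.commute)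
 have "IE N (Suc p) = (\<integral>\<^sup>+ h. ennreal (beta_const 1 s) * (Fb h ^ (N - Suc p) * ennreal (wt1 s h)) \<partial>lborel)"
  unfolding IE_def s_def[symmetric] using c by (intro nn_integral_cong) (simp add: ennreal_mult ac_simps)
 also have "\<dots> = ennreal (beta_const 1 s) * (\<integral>\<^sup>+ h. Fb h ^ (N - Suc p) * ennreal (wt1 s h) \<partial>lborel)"
  by (rule nn_integral_cmult) measurable
 finally have "ennreal (qq (Suc p) (Suc p)) * IE N (Suc p) =
  KK p g k * (ennreal (Beta (1 / 2) (s + 1)) * ennreal (beta_const 1 s)) * (\<integral>\<^sup>+ h. Fb h ^ (N - Suc p) * ennreal (wt1 s h) \<partial>lborel)"
  unfolding qq_law nn_integral_wt1[OF s_gt] by (simp only: ac_simps)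
 then show ?thesis unfolding rr_law[OF N] one by simp
qed

end

lemma rr_eq:
 assumes "k \<le> M" "M < N" "N \<le> n" "Suc M < n"
 shows "ennreal (rr N M) = ennreal (qq M M) * IE N M"
proof -
 obtain p where "M = Suc p" using k assms(1) by (cases M) auto
 then show ?thesis using rr_IE[of p "(\<alpha> - real (Suc p)) / 2" "(\<alpha> * real (Suc p) - 1) / 2" N] assms by blast
qed

end

section \<open>The height integrals in trigonometric form\<close>

context kernel
begin

definition hh :: "real => real" where
 "hh x = (LBINT y=ereal x..ereal (pi / 2). cc * cos y powr \<alpha>)"

lemma cc_cos_integrable: "set_integrable lborel hpi (\<lambda>y. cc * cos y powr \<alpha>)"
 and cc_cos_integral: "(LBINT y:hpi. cc * cos y powr \<alpha>) = 1"
proof -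
 have s: "-1 < (\<alpha> - 1) / 2" using alpha by simp
 have e: "2 * ((\<alpha> - 1) / 2) + 1 = \<alpha>" by (simp add: field_simps)
 note I = cos_powr_integral[OF s, unfolded e, folded cc_def]
 show "set_integrable lborel hpi (\<lambda>y. cc * cos y powr \<alpha>)" by (rule set_integrable_mult_right) (rule I(1))
 show "(LBINT y:hpi. cc * cos y powr \<alpha>) = 1" using I(2) cc_pos by simp
qed

text \<open>Reflection halves the total mass 1, so the tail at 0 is 1/2; the rest is additivity of
  the integral.\<close>

lemma hh_ff:
 assumes x: "x \<in> hpi"
 shows "hh x = ff (- x)"
proof -
 let ?f = "\<lambda>y. cc * cos y powr \<alpha>"
 have I: "interval_lebesgue_integrable lborel (ereal (- (pi / 2))) (ereal (pi / 2)) ?f"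
  using cc_cos_integrable by (simp add: interval_lebesgue_integrable_def einterval_eq)
 have sub: "interval_lebesgue_integrable lborel (ereal a) (ereal b) ?f"
  if "- (pi / 2) \<le> a" "a \<le> b" "b \<le> pi / 2" for a b
  using cc_cos_integrable that
  by (auto simp: interval_lebesgue_integrable_def einterval_eq intro: set_integrable_subset)
 have tot: "(LBINT y=ereal (- (pi / 2))..ereal (pi / 2). ?f y) = 1"
  using cc_cos_integral by (simp add: interval_integral_Ioo einterval_eq interval_lebesgue_integral_def)
 have "(LBINT y=ereal (- (pi / 2))..ereal 0. ?f y) + hh 0 = 1"
  unfolding hh_def tot[symmetric] by (rule interval_integral_sum) (use I in \<open>simp add: min_def max_def\<close>)
 moreover have "hh 0 = (LBINT y=ereal (- (pi / 2))..ereal 0. ?f y)"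
 proof -
  have "(LBINT y=ereal 0..ereal (pi / 2). ?f (- y)) = (LBINT y=ereal (- (pi / 2))..ereal 0. ?f y)"
   by (subst interval_integral_reflect) simp
  then show ?thesis by (simp add: hh_def)
 qed
 ultimately have h0: "hh 0 = 1 / 2" by simp
 have "(LBINT y=ereal 0..ereal x. ?f y) + hh x = hh 0"
  unfolding hh_def
 proof (rule interval_integral_sum)
  show "interval_lebesgue_integrable lborel (min (ereal 0) (min (ereal x) (ereal (pi / 2)))) (max (ereal 0) (max (ereal x) (ereal (pi / 2)))) ?f"
   using x sub[of 0 "pi / 2"] sub[of x "pi / 2"] pi_gt_zero by (auto simp: min_def max_def)
 qed
 then show ?thesis unfolding h0 ff_minus by (simp add: ff_def)
qed

lemma ff_nonneg:
 assumes "x \<in> hpi"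
 shows "0 \<le> ff x"
proof -
 have "0 \<le> hh (- x)"
  unfolding hh_def using assms cc_pos
  by (subst interval_lebesgue_integral_le_eq) (auto simp: set_lebesgue_integral_def intro!: Bochner_Integration.integral_nonneg)
 then show ?thesis using hh_ff[of "- x"] assms by simp
qed

lemma nn_integral_tail:
 assumes x: "x \<in> hpi"
 shows "(\<integral>\<^sup>+ h. indicator {sin x<..} h * ennreal (cc * wt1 ((\<alpha> - 1) / 2) h) \<partial>lborel) = ennreal (ff (- x))"
proof -
 let ?f = "\<lambda>y. cc * cos y powr \<alpha>"
 have "(\<integral>\<^sup>+ h. indicator {sin x<..} h * ennreal (cc * wt1 ((\<alpha> - 1) / 2) h) \<partial>lborel) =
  (\<integral>\<^sup>+ h. ennreal (indicator {sin x<..} h * cc * (if h\<^sup>2 < 1 then (1 - h\<^sup>2) powr ((\<alpha> - 1) / 2) else 0)) \<partial>lborel)"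
  by (intro nn_integral_cong) (auto simp: indicator_def wt1_def)
 also have "\<dots> = (\<integral>\<^sup>+ y. ennreal (indicator {sin x<..} (sin y) * cc * cos y powr (2 * ((\<alpha> - 1) / 2) + 1)) * indicator hpi y \<partial>lborel)"
  by (rule nn_integral_sin_substitution) (use cc_pos in \<open>auto simp: indicator_def\<close>)
 also have "\<dots> = (\<integral>\<^sup>+ y. ennreal (indicator {x<..<pi / 2} y * ?f y) \<partial>lborel)"
 proof (intro nn_integral_cong)
  fix y
  have e: "2 * ((\<alpha> - 1) / 2) + 1 = \<alpha>" by (simp add: field_simps)
  have "sin x < sin y \<longleftrightarrow> x < y" if "y \<in> hpi" using that x by (intro sin_mono_less_eq) auto
  then show "ennreal (indicator {sin x<..} (sin y) * cc * cos y powr (2 * ((\<alpha> - 1) / 2) + 1)) * indicator hpi y =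
   ennreal (indicator {x<..<pi / 2} y * ?f y)"
   unfolding e using x by (auto simp: indicator_def)
 qed
 also have "\<dots> = ennreal (LBINT y:{x<..<pi / 2}. ?f y)"
  unfolding set_lebesgue_integral_def real_scaleR_def
 proof (rule nn_integral_eq_integral)
  have "set_integrable lborel {x<..<pi / 2} ?f"
   by (rule set_integrable_subset[OF cc_cos_integrable]) (use x in auto)
  then show "integrable lborel (\<lambda>y. indicator {x<..<pi / 2} y * ?f y)" by (simp add: set_integrable_def)
 qed (use cc_pos in auto)
 also have "(LBINT y:{x<..<pi / 2}. ?f y) = hh x"
  unfolding hh_def using x by (simp add: interval_lebesgue_integral_le_eq)
 finally show ?thesis using hh_ff[OF x] by simp
qed

text \<open>The probability that \<open>q\<close> further points lie above the hyperplane through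
  \<open>m\<close> points.\<close>

definition II :: "nat => nat => real" where
 "II q m = beta_const 1 ((\<alpha> * real m - 1) / 2) * (LBINT t:hpi. cos t powr (\<alpha> * real m) * ff t ^ q)"

lemma II_integrable: "set_integrable lborel hpi (\<lambda>t. cos t powr (\<alpha> * real m) * ff t ^ q)"
proof -
 interpret kernel_pair \<alpha> m q by unfold_locales
 show ?thesis using uj_integrable[of 0] by (simp add: uj_def[abs_def])
qed

lemma lborel_set_integral_hpi_reflect: "(LBINT t:hpi. f (- t)) = (LBINT t:hpi. (f t :: real))"
proof -
 have "(LBINT t:hpi. f t) = (\<integral>t. indicator hpi (- t) *\<^sub>R f (- t) \<partial>lborel)"
  unfolding set_lebesgue_integral_def
  using lborel_integral_real_affine[of "-1" "\<lambda>t. indicator hpi t *\<^sub>R f t" 0] by simp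
 also have "\<dots> = (LBINT t:hpi. f (- t))"
  unfolding set_lebesgue_integral_def
  by (intro Bochner_Integration.integral_cong refl) (auto simp: indicator_def)
 finally show ?thesis ..
qed

text \<open>The reflection of t replaces \<open>ff\<close> by 1 - ff. The value agrees with the one
  found from symmetry in \<open>rr_half\<close>.\<close>

lemma II_half: "II 1 m = 1 / 2"
proof -
 have s: "-1 < (\<alpha> * real m - 1) / 2"
 proof -
  have "0 \<le> \<alpha> * real m" using alpha by simp
  then show ?thesis by simp
 qed
 have e: "2 * ((\<alpha> * real m - 1) / 2) + 1 = \<alpha> * real m" by (simp add: field_simps)
 note C = cos_powr_integral[OF s, unfolded e]
 have b: "0 < beta_const 1 ((\<alpha> * real m - 1) / 2)" using s by (intro beta_const_pos) auto
 let ?J = "LBINT t:hpi. cos t powr (\<alpha> * real m) * ff t ^ 1"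
 have "?J = (LBINT t:hpi. cos (- t) powr (\<alpha> * real m) * ff (- t) ^ 1)"
  by (rule lborel_set_integral_hpi_reflect[symmetric])
 also have "\<dots> = (LBINT t:hpi. cos t powr (\<alpha> * real m) - cos t powr (\<alpha> * real m) * ff t ^ 1)"
  by (simp add: ff_minus algebra_simps)
 also have "\<dots> = (LBINT t:hpi. cos t powr (\<alpha> * real m)) - ?J"
  by (rule set_integral_diff(2)[OF C(1) II_integrable])
 finally have "2 * ?J = 1 / beta_const 1 ((\<alpha> * real m - 1) / 2)" unfolding C(2) by simp
 then show ?thesis using b unfolding II_def by (simp add: field_simps)
qed

lemma II_nonneg: "0 \<le> II q m"
proof -
 have "0 \<le> \<alpha> * real m" using alpha by simp
 then have "0 < beta_const 1 ((\<alpha> * real m - 1) / 2)" by (intro beta_const_pos) auto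
 moreover have "0 \<le> indicator hpi t *\<^sub>R (cos t powr (\<alpha> * real m) * ff t ^ q)" for t
  using ff_nonneg[of t] by (simp add: indicator_def)
 ultimately show ?thesis unfolding II_def set_lebesgue_integral_def
  by (intro mult_nonneg_nonneg Bochner_Integration.integral_nonneg) (auto intro: less_imp_le)
qed

lemma II_0: "II 0 m = 1"
proof -
 have "0 \<le> \<alpha> * real m" using alpha by simp
 then have s: "-1 < (\<alpha> * real m - 1) / 2" by simp
 have e: "2 * ((\<alpha> * real m - 1) / 2) + 1 = \<alpha> * real m" by (simp add: field_simps)
 have b: "0 < beta_const 1 ((\<alpha> * real m - 1) / 2)" using s by (intro beta_const_pos) auto
 show ?thesis using cos_powr_integral(2)[OF s, unfolded e] b by (simp add: II_def)
qed

end

context beta_sample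
begin

text \<open>Substitution h = sin x, under which the tail becomes ff (-x), and a final reflection of
  x.\<close>

lemma IE_II:
 assumes al: "0 \<le> \<alpha>"
 shows "IE N M = ennreal (kernel.II \<alpha> (N - M) M)"
proof -
 interpret K: kernel \<alpha> by unfold_locales (rule al)
 let ?s = "(\<alpha> * real M - 1) / 2" and ?q = "N - M"
 have "0 \<le> \<alpha> * real M" using al by simp
 then have s: "-1 < ?s" by simp
 have b: "0 < beta_const 1 ?s" using s by (intro beta_const_pos) auto
 have e: "2 * ?s + 1 = \<alpha> * real M" by (simp add: field_simps)
 have Fb_sin: "Fb (sin x) = ennreal (K.ff (- x))" if "x \<in> hpi" for x
  using K.nn_integral_tail[OF that] by (simp add: Fb_def K.cc_def)
 \<comment> \<open>The substitution rule is stated for real functions; on the open unit interval the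
   tail is finite, so the conversion loses nothing.\<close>
 let ?\<phi> = "\<lambda>h. beta_const 1 ?s * enn2real (Fb h) ^ ?q"
 have Fb_eq: "Fb h = ennreal (enn2real (Fb h))" if "h\<^sup>2 < 1" for h
 proof -
  have "\<bar>h\<bar> < 1" using that by (simp add: abs_square_less_1)
  then have "sin (arcsin h) = h" "arcsin h \<in> hpi" using arcsin_lt_bounded[of h] by auto
  then have "Fb h = ennreal (K.ff (- arcsin h))" using Fb_sin by metis
  then show ?thesis by simp
 qed
 have "IE N M = (\<integral>\<^sup>+ h. ennreal (?\<phi> h * (if h\<^sup>2 < 1 then (1 - h\<^sup>2) powr ?s else 0)) \<partial>lborel)"
  unfolding IE_def
 proof (intro nn_integral_cong)
  fix h
  show "Fb h ^ ?q * ennreal (beta_const 1 ?s * wt1 ?s h) = ennreal (?\<phi> h * (if h\<^sup>2 < 1 then (1 - h\<^sup>2) powr ?s else 0))"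
  proof (cases "h\<^sup>2 < 1")
   case True
   have "Fb h ^ ?q = ennreal (enn2real (Fb h) ^ ?q)"
    by (subst Fb_eq[OF True]) (simp add: ennreal_power)
   then have "Fb h ^ ?q * ennreal (beta_const 1 ?s * wt1 ?s h) = ennreal (enn2real (Fb h) ^ ?q * (beta_const 1 ?s * wt1 ?s h))"
    using b by (simp add: ennreal_mult)
   then show ?thesis using True by (simp add: wt1_def ac_simps)
  qed (simp add: wt1_def)
 qed
 also have "\<dots> = (\<integral>\<^sup>+ x. ennreal (?\<phi> (sin x) * cos x powr (2 * ?s + 1)) * indicator hpi x \<partial>lborel)"
  by (rule nn_integral_sin_substitution) (use b in auto)
 also have "\<dots> = (\<integral>\<^sup>+ x. ennreal (indicator hpi x * (beta_const 1 ?s * (cos (- x) powr (\<alpha> * real M) * K.ff (- x) ^ ?q))) \<partial>lborel)"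
 proof (intro nn_integral_cong)
  fix x
  show "ennreal (?\<phi> (sin x) * cos x powr (2 * ?s + 1)) * indicator hpi x =
   ennreal (indicator hpi x * (beta_const 1 ?s * (cos (- x) powr (\<alpha> * real M) * K.ff (- x) ^ ?q)))"
  proof (cases "x \<in> hpi")
   case True
   then have "0 \<le> K.ff (- x)" by (intro K.ff_nonneg) auto
   then have "enn2real (Fb (sin x)) = K.ff (- x)" using Fb_sin[OF True] by simp
   then show ?thesis using True unfolding e by (simp add: ac_simps)
  qed simp
 qed
 also have "\<dots> = ennreal (LBINT x:hpi. beta_const 1 ?s * (cos (- x) powr (\<alpha> * real M) * K.ff (- x) ^ ?q))"
  unfolding set_lebesgue_integral_def real_scaleR_def
 proof (rule nn_integral_eq_integral)
  let ?u = "\<lambda>t. indicator hpi t *\<^sub>R (beta_const 1 ?s * (cos t powr (\<alpha> * real M) * K.ff t ^ ?q))"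
  have "integrable lborel ?u"
   using set_integrable_mult_right[OF K.II_integrable] by (simp add: set_integrable_def)
  then have "integrable lborel (\<lambda>t. ?u (0 + (-1) * t))" by (subst lborel_integrable_real_affine_iff) auto
  moreover have "(\<lambda>t. ?u (0 + (-1) * t)) = (\<lambda>x. indicator hpi x * (beta_const 1 ?s * (cos (- x) powr (\<alpha> * real M) * K.ff (- x) ^ ?q)))"
   by (auto simp: fun_eq_iff indicator_def)
  ultimately show "integrable lborel (\<lambda>x. indicator hpi x * (beta_const 1 ?s * (cos (- x) powr (\<alpha> * real M) * K.ff (- x) ^ ?q)))"
   by (simp only:)
 next
  show "AE x in lborel. 0 \<le> indicator hpi x * (beta_const 1 ?s * (cos (- x) powr (\<alpha> * real M) * K.ff (- x) ^ ?q))"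
   using b K.ff_nonneg[of "- x" for x] by (intro AE_I2) (auto simp: indicator_def intro!: mult_nonneg_nonneg zero_le_power)
 qed
 also have "(LBINT x:hpi. beta_const 1 ?s * (cos (- x) powr (\<alpha> * real M) * K.ff (- x) ^ ?q)) = K.II ?q M"
  unfolding K.II_def set_integral_mult_right
  using K.lborel_set_integral_hpi_reflect[of "\<lambda>x. cos x powr (\<alpha> * real M) * K.ff x ^ ?q"] by simp
 finally show ?thesis .
qed

text \<open>The case \<open>Suc M = n\<close> is outside the reach of the height law; there both
  sides carry the factor 1/2 found by symmetry.\<close>

lemma rr_II:
 assumes al: "0 \<le> \<alpha>" and M: "k \<le> M" "M < N" "N \<le> n"
 shows "rr N M = qq M M * kernel.II \<alpha> (N - M) M"
proof (cases "Suc M < n")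
 case True
 interpret K: kernel \<alpha> by unfold_locales (rule al)
 have nn: "0 \<le> rr N M" "0 \<le> qq M M" by (simp_all add: rr_def qq_def pr_def)
 have "ennreal (rr N M) = ennreal (qq M M * K.II (N - M) M)"
  using rr_eq[OF M True] nn K.II_nonneg by (simp add: IE_II[OF al] ennreal_mult)
 then show ?thesis using nn K.II_nonneg by (simp add: ennreal_inj)
next
 case False
 interpret K: kernel \<alpha> by unfold_locales (rule al)
 have e: "N = n" "n = Suc M" using False M by auto
 have "rr N M = qq M M / 2" using rr_half[OF e(2) M(1)] by (simp only: e(1))
 moreover have "N - M = 1" using e by simp
 ultimately show ?thesis by (simp only: K.II_half times_divide_eq_right mult_1_right)
qed

text \<open>Both the angle probabilities and the trigonometric integrals satisfy the same
 triangular system, whose diagonal entries equal 1.\<close>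

theorem qq_formula:
 assumes al: "0 \<le> \<alpha>" and N: "k \<le> N" "N \<le> n"
 shows "cr (qq N N) = cr (beta_const 1 (\<alpha> * real N / 2)) *
  (LBINT x:hpi. cr (cos x powr (\<alpha> * real N + 1)) * kernel.gg \<alpha> x ^ (N - k))"
 using N
proof (induction N rule: less_induct)
 case (less N)
 define d where "d = N - k"
 have Nd: "N = k + d" using less.prems by (simp add: d_def)
 interpret K: kernel_pair \<alpha> k d by unfold_locales (rule al)
 define Js where "Js j = cr (beta_const 1 (\<alpha> * real (k + j) / 2)) * (LBINT x:hpi. K.vj j x)" for j
 have IH: "cr (qq (k + j) (k + j)) = Js j" if "j < d" for j
  using less.IH[of "k + j"] that less.prems by (simp add: Nd Js_def K.vj_def)
 have uj: "beta_const 1 ((\<alpha> * real (k + j) - 1) / 2) * (LBINT t:hpi. K.uj j t) = K.II (d - j) (k + j)" for j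
  by (simp add: K.II_def K.uj_def)
 have R: "(\<Sum>j\<le>d. of_nat (d choose j) * cr (K.II (d - j) (k + j)) * Js j) = 1"
  using K.kernel_relation unfolding uj Js_def .
 have "(\<Sum>M\<in>{k..<N}. real ((N - k) choose (M - k)) * rr N M) = (\<Sum>j<d. real (d choose j) * rr N (k + j))"
  unfolding Nd using sum.shift_bounds_nat_ivl[of "\<lambda>M. real ((k + d - k) choose (M - k)) * rr (k + d) M" 0 k d]
  by (simp add: add.commute atLeast0LessThan)
 then have T: "(\<Sum>j<d. real (d choose j) * rr N (k + j)) + qq N N = 1"
  using qq_telescope[OF less.prems] by simp
 have a: "cr (\<Sum>j<d. real (d choose j) * rr N (k + j)) =
  (\<Sum>j<d. of_nat (d choose j) * cr (K.II (d - j) (k + j)) * Js j)"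
  unfolding of_real_sum
 proof (rule sum.cong[OF refl])
  fix j assume j: "j \<in> {..<d}"
  have "rr N (k + j) = qq (k + j) (k + j) * K.II (N - (k + j)) (k + j)"
   by (rule rr_II[OF al]) (use j Nd less.prems in auto)
  moreover have "N - (k + j) = d - j" by (simp add: Nd)
  ultimately show "cr (real (d choose j) * rr N (k + j)) = of_nat (d choose j) * cr (K.II (d - j) (k + j)) * Js j"
   using IH[of j] j by (simp add: mult.commute mult.left_commute)
 qed
 have b: "(\<Sum>j\<le>d. of_nat (d choose j) * cr (K.II (d - j) (k + j)) * Js j) =
  (\<Sum>j<d. of_nat (d choose j) * cr (K.II (d - j) (k + j)) * Js j) + Js d"
  unfolding lessThan_Suc_atMost[symmetric] sum.lessThan_Suc diff_self_eq_0 K.II_0 by simp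
 have "cr ((\<Sum>j<d. real (d choose j) * rr N (k + j)) + qq N N) = 1"
  unfolding T by (rule of_real_1)
 then have 1: "(\<Sum>j<d. of_nat (d choose j) * cr (K.II (d - j) (k + j)) * Js j) + cr (qq N N) = 1"
  unfolding of_real_add a .
 have 2: "(\<Sum>j<d. of_nat (d choose j) * cr (K.II (d - j) (k + j)) * Js j) + Js d = 1"
  using R unfolding b .
 have "y = z" if "x + y = 1" "x + z = 1" for x y z :: complex
  using that by (metis add_left_cancel)
 from this[OF 1 2] have "cr (qq N N) = Js d" .
 then show ?case by (simp add: Js_def K.vj_def Nd)
qed

end

subsection \<open>Internal angles as measures of cones\<close>

text \<open>Weights are attached to indices and not to points, so coinciding vertices are
  covered.\<close>

lemma convex_hull_image_explicit:
 fixes X :: "'i => 'a::real_vector"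
 assumes I: "finite I"
 shows "convex hull (X ` I) = {\<Sum>i\<in>I. t i *\<^sub>R X i |t. (\<forall>i\<in>I. 0 \<le> t i) \<and> sum t I = 1}" (is "_ = ?C")
proof
 have "convex ?C"
 proof (rule convexI)
  fix x y u w assume "x \<in> ?C" "y \<in> ?C" and u: "0 \<le> (u::real)" "0 \<le> w" "u + w = 1"
  then obtain s t where s: "\<forall>i\<in>I. 0 \<le> s i" "sum s I = 1" "x = (\<Sum>i\<in>I. s i *\<^sub>R X i)"
   and t: "\<forall>i\<in>I. 0 \<le> t i" "sum t I = 1" "y = (\<Sum>i\<in>I. t i *\<^sub>R X i)" by blast
  have "u *\<^sub>R x + w *\<^sub>R y = (\<Sum>i\<in>I. (u * s i + w * t i) *\<^sub>R X i)"
   unfolding s t by (simp add: scaleR_sum_right scaleR_add_left sum.distrib)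
  moreover have "(\<Sum>i\<in>I. u * s i + w * t i) = 1"
   using s(2) t(2) u(3) by (simp add: sum.distrib sum_distrib_left[symmetric])
  moreover have "\<forall>i\<in>I. 0 \<le> u * s i + w * t i" using s(1) t(1) u by simp
  ultimately show "u *\<^sub>R x + w *\<^sub>R y \<in> ?C" by (intro CollectI exI[of _ "\<lambda>i. u * s i + w * t i"]) simp
 qed
 moreover have "X ` I \<subseteq> ?C"
 proof
  fix x assume "x \<in> X ` I"
  then obtain i where i: "i \<in> I" "x = X i" by blast
  have "(\<Sum>j\<in>I. (if j = i then 1 else 0) *\<^sub>R X j) = (\<Sum>j\<in>I. if j = i then X j else 0)"
   by (intro sum.cong) auto
  then show "x \<in> ?C" using i I by (intro CollectI exI[of _ "\<lambda>j. if j = i then 1 else 0"]) simp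
 qed
 ultimately show "convex hull (X ` I) \<subseteq> ?C" by (rule hull_minimal[rotated])
 show "?C \<subseteq> convex hull (X ` I)"
 proof safe
  fix t :: "'i => real" assume t: "\<forall>i\<in>I. 0 \<le> t i" "sum t I = 1"
  show "(\<Sum>i\<in>I. t i *\<^sub>R X i) \<in> convex hull (X ` I)"
   by (rule convex_sum[OF I convex_convex_hull t(2)]) (use t(1) in \<open>auto intro: hull_inc\<close>)
 qed
qed

text \<open>A relative interior point remains in the hull when pushed slightly away from the
  barycentre. It is thus a mixture containing the barycentre, which adds a positive amount to every
  weight.\<close>

lemma rel_interior_hull_positive:
 fixes X :: "nat => 'a::euclidean_space"
 assumes k: "1 \<le> k" and z: "z \<in> rel_interior (convex hull (X ` {..<k}))"
 shows "\<exists>t. (\<forall>i<k. 0 < t i) \<and> sum t {..<k} = 1 \<and> z = (\<Sum>i<k. t i *\<^sub>R X i)"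
proof -
 let ?S = "convex hull (X ` {..<k})"
 define b where "b = (\<Sum>i<k. (1 / real k) *\<^sub>R X i)"
 have "b \<in> ?S" unfolding b_def using k by (intro convex_sum) (auto intro: hull_inc)
 then have "b \<in> affine hull ?S" by (rule hull_inc)
 then obtain m where m: "m > 1" "(1 - m) *\<^sub>R b + m *\<^sub>R z \<in> ?S"
  using convex_rel_interior_if[OF convex_convex_hull z] by blast
 then obtain s where s: "\<forall>i\<in>{..<k}. 0 \<le> s i" "sum s {..<k} = 1" "(1 - m) *\<^sub>R b + m *\<^sub>R z = (\<Sum>i<k. s i *\<^sub>R X i)"
  unfolding convex_hull_image_explicit[OF finite_lessThan] by blast
 define t where "t i = s i / m + (1 - 1 / m) / real k" for i
 have m1: "0 < 1 - 1 / m" "0 < m" using m by auto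
 have "z = (1 / m) *\<^sub>R ((1 - m) *\<^sub>R b + m *\<^sub>R z) + (1 - 1 / m) *\<^sub>R b"
  using m1 by (simp add: algebra_simps divide_inverse)
 also have "\<dots> = (\<Sum>i<k. t i *\<^sub>R X i)"
 proof -
  have "(1 / m) *\<^sub>R (\<Sum>i<k. s i *\<^sub>R X i) = (\<Sum>i<k. (s i / m) *\<^sub>R X i)"
   by (simp add: scaleR_sum_right)
  moreover have "(1 - 1 / m) *\<^sub>R b = (\<Sum>i<k. ((1 - 1 / m) / real k) *\<^sub>R X i)"
   unfolding b_def by (simp add: scaleR_sum_right)
  ultimately show ?thesis unfolding s(3) t_def by (simp only: sum.distrib scaleR_left_distrib)
 qed
 finally have "z = (\<Sum>i<k. t i *\<^sub>R X i)" .
 moreover have "sum t {..<k} = 1"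
  unfolding t_def using s(2) k by (simp add: sum.distrib sum_divide_distrib[symmetric])
 moreover have "0 < t i" if "i < k" for i
  unfolding t_def using s(1) that m1 k by (intro add_nonneg_pos divide_nonneg_pos divide_pos_pos) auto
 ultimately show ?thesis by blast
qed

text \<open>The tangent cone at the face with its apex moved to the origin: differences of
  barycentric weights, of total 0 and with free sign on the face.\<close>

definition face_cone :: "nat => nat => (nat => 'a::real_vector) => 'a set" where
 "face_cone k n X = {\<Sum>i<n. l i *\<^sub>R X i |l. (\<forall>i<n. k \<le> i \<longrightarrow> 0 \<le> l i) \<and> (\<Sum>i<n. l i) = 0}"

text \<open>Blowing up the simplex at a point of the face gives an increasing family of sets
 with union the cone, also for degenerate simplices.\<close>

lemma internal_angle_cone:
 fixes X :: "nat => 'a::euclidean_space"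
 assumes k: "1 \<le> k" "k \<le> n"
 shows "internal_angle (convex hull (X ` {..<k})) (convex hull (X ` {..<n})) =
  measure lebesgue (ball 0 1 \<inter> face_cone k n X) / measure lebesgue (ball 0 1 :: 'a set)"
proof -
 let ?F = "convex hull (X ` {..<k})" and ?T = "convex hull (X ` {..<n})"
 define z where "z = (SOME z. z \<in> rel_interior ?F)"
 have "X ` {..<k} \<noteq> {}" using k by (auto simp: lessThan_empty_iff)
 then have "rel_interior ?F \<noteq> {}" by (simp add: rel_interior_eq_empty)
 then have "\<exists>z. z \<in> rel_interior ?F" by blast
 then have z: "z \<in> rel_interior ?F" unfolding z_def by (rule someI_ex)
 obtain t where t: "\<And>i. i < k ==> 0 < t i" "sum t {..<k} = 1" "z = (\<Sum>i<k. t i *\<^sub>R X i)"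
  using rel_interior_hull_positive[OF k(1) z] by blast
 define c where "c i = (if i < k then t i else 0)" for i
 have c_sum: "(\<Sum>i<n. c i) = 1" "z = (\<Sum>i<n. c i *\<^sub>R X i)"
 proof -
  have "(\<Sum>i<n. c i) = (\<Sum>i<k. t i)" by (rule sum.mono_neutral_cong_right) (use k in \<open>auto simp: c_def\<close>)
  then show "(\<Sum>i<n. c i) = 1" using t(2) by simp
  have "(\<Sum>i<n. c i *\<^sub>R X i) = (\<Sum>i<k. t i *\<^sub>R X i)" by (rule sum.mono_neutral_cong_right) (use k in \<open>auto simp: c_def\<close>)
  then show "z = (\<Sum>i<n. c i *\<^sub>R X i)" using t(3) by simp
 qed
 have c_nn: "0 \<le> c i" for i using t(1)[of i] by (auto simp: c_def intro: less_imp_le)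
 have T: "?T = {\<Sum>i<n. s i *\<^sub>R X i |s. (\<forall>i\<in>{..<n}. 0 \<le> s i) \<and> sum s {..<n} = 1}"
  by (rule convex_hull_image_explicit) simp
 have zT: "z \<in> ?T" unfolding T using c_sum c_nn by (intro CollectI exI[of _ c]) auto
 define A where "A r = {y. z + r *\<^sub>R y \<in> ?T}" for r
 have compT: "compact ?T" by (intro compact_convex_hull finite_imp_compact) simp
 have mono: "A s \<subseteq> A r" if "0 < r" "r \<le> s" for r s
 proof
  fix y assume "y \<in> A s"
  then have y: "z + s *\<^sub>R y \<in> ?T" by (simp add: A_def)
  have "(1 - r / s) *\<^sub>R z + (r / s) *\<^sub>R (z + s *\<^sub>R y) \<in> ?T"
   by (rule convexD[OF convex_convex_hull zT y]) (use that in auto)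
  moreover have "(1 - r / s) *\<^sub>R z + (r / s) *\<^sub>R (z + s *\<^sub>R y) = z + r *\<^sub>R y"
   using that by (simp add: algebra_simps)
  ultimately show "y \<in> A r" by (simp add: A_def)
 qed
 have sub: "A r \<subseteq> face_cone k n X" if r: "0 < r" for r
 proof
  fix y assume "y \<in> A r"
  then obtain s where s: "\<forall>i\<in>{..<n}. 0 \<le> s i" "sum s {..<n} = 1" "z + r *\<^sub>R y = (\<Sum>i<n. s i *\<^sub>R X i)"
   unfolding A_def T by blast
  define l where "l i = (s i - c i) / r" for i
  have "(\<Sum>i<n. l i *\<^sub>R X i) = (1 / r) *\<^sub>R ((\<Sum>i<n. s i *\<^sub>R X i) - (\<Sum>i<n. c i *\<^sub>R X i))"
   unfolding l_def by (simp add: scaleR_sum_right scaleR_diff_left sum_subtractf diff_divide_distrib scaleR_diff_right)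
  also have "\<dots> = y" unfolding s(3)[symmetric] c_sum(2)[symmetric] using r by simp
  finally have "y = (\<Sum>i<n. l i *\<^sub>R X i)" ..
  moreover have "(\<Sum>i<n. l i) = 0"
   unfolding l_def sum_divide_distrib[symmetric] sum_subtractf s(2) c_sum(1) by simp
  moreover have "\<forall>i<n. k \<le> i \<longrightarrow> 0 \<le> l i" using s(1) r by (auto simp: l_def c_def)
  ultimately show "y \<in> face_cone k n X" unfolding face_cone_def by blast
 qed
 have ex: "\<exists>r>0. y \<in> A r" if "y \<in> face_cone k n X" for y
 proof -
  from that obtain l where "y = (\<Sum>i<n. l i *\<^sub>R X i) \<and> (\<forall>i<n. k \<le> i \<longrightarrow> 0 \<le> l i) \<and> (\<Sum>i<n. l i) = 0"
   unfolding face_cone_def mem_Collect_eq by (rule exE)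
  then have l': "\<forall>i<n. k \<le> i \<longrightarrow> 0 \<le> l i" and l: "(\<Sum>i<n. l i) = 0" "y = (\<Sum>i<n. l i *\<^sub>R X i)"
   by simp_all
  define m where "m = Min (t ` {..<k})"
  define L where "L = (\<Sum>i<n. \<bar>l i\<bar>)"
  have "m \<in> t ` {..<k}" unfolding m_def using k by (intro Min_in) (auto simp: lessThan_empty_iff)
  then have m0: "0 < m" using t(1) by auto
  have mt: "m \<le> t i" if "i < k" for i unfolding m_def using that by (intro Min_le) auto
  have L0: "0 \<le> L" unfolding L_def by (intro sum_nonneg) auto
  \<comment> \<open>\<open>m\<close> is the least barycentric weight of \<open>z\<close> and
    \<open>L\<close> bounds every entry of \<open>l\<close>, so this step keeps all weights
    nonnegative; the summand 1 guards against L = 0.\<close>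
  define r where "r = m / (1 + L)"
  have r: "0 < r" using m0 L0 by (simp add: r_def)
  have rL: "r * L \<le> m"
  proof -
   have "r * L \<le> r * (1 + L)" using r L0 by (intro mult_left_mono) auto
   then show ?thesis using L0 by (simp add: r_def)
  qed
  have "0 \<le> c i + r * l i" if i: "i < n" for i
  proof (cases "k \<le> i")
   case True
   then show ?thesis using l' i c_nn[of i] r by simp
  next
   case False
   have "\<bar>l i\<bar> \<le> L" unfolding L_def using i by (intro member_le_sum) auto
   then have "r * \<bar>l i\<bar> \<le> r * L" using r by (intro mult_left_mono) auto
   then have "r * \<bar>l i\<bar> \<le> t i" using rL mt[of i] False by simp
   moreover have "- (r * \<bar>l i\<bar>) \<le> r * l i" using r by (simp add: abs_if)
   ultimately show ?thesis using False by (simp add: c_def)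
  qed
  moreover have "(\<Sum>i<n. c i + r * l i) = 1"
   using c_sum(1) l(1) by (simp add: sum.distrib sum_distrib_left[symmetric])
  moreover have "z + r *\<^sub>R y = (\<Sum>i<n. (c i + r * l i) *\<^sub>R X i)"
   unfolding c_sum(2) l(2) by (simp add: scaleR_add_left sum.distrib scaleR_sum_right)
  ultimately have "z + r *\<^sub>R y \<in> ?T" unfolding T by (intro CollectI exI[of _ "\<lambda>i. c i + r * l i"]) auto
  then show ?thesis using r by (auto simp: A_def)
 qed
 define q where "q m = 1 / (real m + 1)" for m :: nat
 have q0: "0 < q m" for m by (simp add: q_def)
 have q_anti: "q m' \<le> q m" if "m \<le> m'" for m m' using that by (simp add: q_def frac_le)
 have U: "(\<Union>m. ball 0 1 \<inter> A (q m)) = ball 0 1 \<inter> face_cone k n X"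
 proof
  show "(\<Union>m. ball 0 1 \<inter> A (q m)) \<subseteq> ball 0 1 \<inter> face_cone k n X" using sub[OF q0] by blast
  show "ball 0 1 \<inter> face_cone k n X \<subseteq> (\<Union>m. ball 0 1 \<inter> A (q m))"
  proof
   fix y assume y: "y \<in> ball 0 1 \<inter> face_cone k n X"
   then obtain r where r: "r > 0" "y \<in> A r" using ex by blast
   obtain m where "inverse (real (Suc m)) < r" using reals_Archimedean[OF r(1)] by blast
   then have "q m \<le> r" by (simp add: q_def inverse_eq_divide add.commute)
   then have "y \<in> A (q m)" using mono[OF q0[of m]] r(2) by blast
   then show "y \<in> (\<Union>m. ball 0 1 \<inter> A (q m))" using y by blast
  qed
 qed
 have closedA: "closed (A r)" for r
 proof -
  have "A r = (\<lambda>y. z + r *\<^sub>R y) -` ?T" by (auto simp: A_def)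
  then show ?thesis using compT by (simp add: compact_imp_closed continuous_closed_vimage)
 qed
 have meas: "ball 0 1 \<inter> A r \<in> lmeasurable" for r
  using closedA[of r] by (intro fmeasurable_Int_fmeasurable) (auto intro: lborelD borel_closed)
 have mono_meas: "measure lebesgue (ball 0 1 \<inter> A s) \<le> measure lebesgue (ball 0 1 \<inter> A r)" if "0 < r" "r \<le> s" for r s
  using mono[OF that] by (intro measure_mono_fmeasurable meas) (auto intro: fmeasurableD meas)
 let ?L = "measure lebesgue (ball 0 1 \<inter> face_cone k n X)"
 have lim: "(\<lambda>m. measure lebesgue (ball 0 1 \<inter> A (q m))) \<longlonglongrightarrow> ?L"
  unfolding U[symmetric]
 proof (rule Lim_measure_incseq)
  show "range (\<lambda>m. ball 0 1 \<inter> A (q m)) \<subseteq> sets lebesgue" using meas by (auto intro: fmeasurableD)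
  show "incseq (\<lambda>m. ball 0 1 \<inter> A (q m))"
  proof (rule incseq_SucI)
   fix m
   have "A (q m) \<subseteq> A (q (Suc m))" by (rule mono[OF q0 q_anti]) simp
   then show "ball 0 1 \<inter> A (q m) \<subseteq> ball 0 1 \<inter> A (q (Suc m))" by blast
  qed
  have "emeasure lebesgue (\<Union>m. ball 0 1 \<inter> A (q m)) \<le> emeasure lebesgue (ball 0 1 :: 'a set)"
   by (rule emeasure_mono) auto
  also have "\<dots> < \<infinity>" using lmeasurable_ball[of "0::'a" 1] by (simp add: fmeasurable_def)
  finally show "emeasure lebesgue (\<Union>m. ball 0 1 \<inter> A (q m)) \<noteq> \<infinity>" by simp
 qed
 have le_L: "measure lebesgue (ball 0 1 \<inter> A r) \<le> ?L" if r: "0 < r" for r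
 proof (rule LIMSEQ_le_const[OF lim])
  obtain m where "inverse (real (Suc m)) < r" using reals_Archimedean[OF r] by blast
  then have "q m \<le> r" by (simp add: q_def inverse_eq_divide add.commute)
  then have "measure lebesgue (ball 0 1 \<inter> A r) \<le> measure lebesgue (ball 0 1 \<inter> A (q m'))" if "m \<le> m'" for m'
   using q_anti[OF that] by (intro mono_meas q0) auto
  then show "\<exists>M. \<forall>m\<ge>M. measure lebesgue (ball 0 1 \<inter> A r) \<le> measure lebesgue (ball 0 1 \<inter> A (q m))" by blast
 qed
 have tends: "((\<lambda>r. measure lebesgue (ball 0 1 \<inter> A r)) \<longlongrightarrow> ?L) (at_right 0)"
 proof (rule order_tendstoI)
  fix a assume "a < ?L"
  then have "eventually (\<lambda>m. a < measure lebesgue (ball 0 1 \<inter> A (q m))) sequentially"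
   by (rule order_tendstoD(1)[OF lim])
  then obtain m where m: "a < measure lebesgue (ball 0 1 \<inter> A (q m))" by (auto simp: eventually_sequentially)
  show "eventually (\<lambda>r. a < measure lebesgue (ball 0 1 \<inter> A r)) (at_right 0)"
   unfolding eventually_at_right_field
  proof (intro exI[of _ "q m"] conjI allI impI q0)
   fix r assume r: "0 < r" "r < q m"
   have "measure lebesgue (ball 0 1 \<inter> A (q m)) \<le> measure lebesgue (ball 0 1 \<inter> A r)"
    by (rule mono_meas) (use r in auto)
   with m show "a < measure lebesgue (ball 0 1 \<inter> A r)" by (rule less_le_trans)
  qed
 next
  fix a assume "?L < a"
  then show "eventually (\<lambda>r. measure lebesgue (ball 0 1 \<inter> A r) < a) (at_right 0)"
   unfolding eventually_at_right_field
   by (intro exI[of _ 1]) (use le_L in \<open>force intro: le_less_trans\<close>)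
 qed
 have ratio: "measure lebesgue (ball z r \<inter> ?T) / measure lebesgue (ball z r) =
  measure lebesgue (ball 0 1 \<inter> A r) / measure lebesgue (ball 0 1 :: 'a set)" if r: "0 < r" for r
 proof -
  let ?f = "\<lambda>x. r *\<^sub>R x + z"
  have ballim: "?f ` (ball 0 1) = ball z r"
  proof
   show "?f ` ball 0 1 \<subseteq> ball z r" using r by (auto simp: dist_norm)
   show "ball z r \<subseteq> ?f ` ball 0 1"
   proof
    fix x assume "x \<in> ball z r"
    then have "(1 / r) *\<^sub>R (x - z) \<in> ball 0 1" using r by (simp add: dist_norm norm_minus_commute)
    moreover have "x = ?f ((1 / r) *\<^sub>R (x - z))" using r by simp
    ultimately show "x \<in> ?f ` ball 0 1" by blast
   qed
  qed
  moreover have "inj ?f" using r by (intro injI) simp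
  ultimately have im: "?f ` (ball 0 1 \<inter> S) = ball z r \<inter> ?f ` S" for S by (simp add: image_Int)
  have "?f ` A r = ?T"
  proof
   show "?f ` A r \<subseteq> ?T" by (auto simp: A_def add.commute)
   show "?T \<subseteq> ?f ` A r"
   proof
    fix x assume "x \<in> ?T"
    then have "(1 / r) *\<^sub>R (x - z) \<in> A r" using r by (simp add: A_def)
    moreover have "x = ?f ((1 / r) *\<^sub>R (x - z))" using r by simp
    ultimately show "x \<in> ?f ` A r" by blast
   qed
  qed
  then have 1: "measure lebesgue (ball z r \<inter> ?T) = r ^ DIM('a) * measure lebesgue (ball 0 1 \<inter> A r)"
   using im[of "A r"] measure_lebesgue_affine[of r z "ball 0 1 \<inter> A r"] r by simp
  have "measure lebesgue (ball z r) = r ^ DIM('a) * measure lebesgue (ball 0 1 :: 'a set)"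
   using ballim measure_lebesgue_affine[of r z "ball 0 1"] r by simp
  then show ?thesis using 1 r by simp
 qed
 have "((\<lambda>r. measure lebesgue (ball z r \<inter> ?T) / measure lebesgue (ball z r)) \<longlongrightarrow>
  ?L / measure lebesgue (ball 0 1 :: 'a set)) (at_right 0)"
 proof (rule Lim_transform_eventually)
  show "((\<lambda>r. measure lebesgue (ball 0 1 \<inter> A r) / measure lebesgue (ball 0 1 :: 'a set)) \<longlongrightarrow> ?L / measure lebesgue (ball 0 1 :: 'a set)) (at_right 0)"
   using content_ball_pos[of 1 "0::'a"] by (intro tendsto_divide tends tendsto_const) simp
  show "eventually (\<lambda>r. measure lebesgue (ball 0 1 \<inter> A r) / measure lebesgue (ball 0 1 :: 'a set) =
   measure lebesgue (ball z r \<inter> ?T) / measure lebesgue (ball z r)) (at_right 0)"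
   unfolding eventually_at_right_field by (intro exI[of _ 1]) (use ratio in auto)
 qed
 then have "Lim (at_right 0) (\<lambda>r. measure lebesgue (ball z r \<inter> ?T) / measure lebesgue (ball z r)) =
  ?L / measure lebesgue (ball 0 1 :: 'a set)"
  by (intro tendsto_Lim) auto
 then show ?thesis unfolding internal_angle_def Let_def z_def .
qed

subsection \<open>Orthogonal invariance and coordinates\<close>

text \<open>Fubini for \<open>a (f x) * b (y - f x)\<close>, with the indicators of the given set and of the unit ball.\<close>

lemma lborel_distr_orthogonal:
 fixes f :: "'a::euclidean_space => 'a"
 assumes f: "orthogonal_transformation f"
 shows "distr lborel borel f = lborel"
proof (rule measure_eqI)
 have lin: "linear f" and nf: "norm (f x) = norm x" for x
  using f by (auto simp: orthogonal_transformation orthogonal_transformation_norm)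
 have "bounded_linear f" using lin linear_conv_bounded_linear by blast
 then have fm[measurable]: "f \<in> borel_measurable borel"
  by (intro borel_measurable_continuous_onI linear_continuous_on)
 have surj: "surj f" using f by (rule orthogonal_transformation_surj)
 have shift: "(\<integral>\<^sup>+ x. h (c + x) \<partial>lborel) = (\<integral>\<^sup>+ x. h x \<partial>lborel)"
  if "h \<in> borel_measurable borel" for h :: "'a => ennreal" and c
 proof -
  have "(\<integral>\<^sup>+ x. h x \<partial>lborel) = (\<integral>\<^sup>+ x. h x \<partial>distr lborel borel ((+) c))" by (simp add: lborel_distr_plus)
  also have "\<dots> = (\<integral>\<^sup>+ x. h (c + x) \<partial>lborel)" using that by (intro nn_integral_distr) auto
  finally show ?thesis ..
 qed
 fix A :: "'a set" assume "A \<in> sets (distr lborel borel f)"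
 then have A: "A \<in> sets borel" by simp
 let ?B = "ball 0 1 :: 'a set"
 define a b where "a = (indicator A :: 'a => ennreal)" and "b = (indicator ?B :: 'a => ennreal)"
 have [measurable]: "a \<in> borel_measurable borel" unfolding a_def using A by (rule borel_measurable_indicator)
 have [measurable]: "b \<in> borel_measurable borel" unfolding b_def by (rule borel_measurable_indicator) simp
 have bf: "b (- f x) = b x" for x using nf[of x] by (simp add: b_def indicator_def)
 have B: "emeasure lborel ?B \<noteq> 0" "emeasure lborel ?B \<noteq> \<top>"
  using content_ball_pos[of 1 "0::'a"] emeasure_lborel_ball_finite[of "0::'a" 1] by (auto simp: measure_def)
 have ea: "(\<integral>\<^sup>+ x. a x \<partial>lborel) = emeasure lborel A" and eb: "(\<integral>\<^sup>+ x. b x \<partial>lborel) = emeasure lborel ?B"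
  using A by (simp_all add: a_def b_def)
 have efa: "(\<integral>\<^sup>+ x. a (f x) \<partial>lborel) = emeasure (distr lborel borel f) A"
 proof -
  have "emeasure (distr lborel borel f) A = (\<integral>\<^sup>+ x. a x \<partial>distr lborel borel f)" using A by (simp add: a_def)
  also have "\<dots> = (\<integral>\<^sup>+ x. a (f x) \<partial>lborel)" by (rule nn_integral_distr) auto
  finally show ?thesis ..
 qed
 have "emeasure (distr lborel borel f) A * emeasure lborel ?B = (\<integral>\<^sup>+ x. a (f x) * emeasure lborel ?B \<partial>lborel)"
  unfolding efa[symmetric] by (rule nn_integral_multc[symmetric]) measurable
 also have "\<dots> = (\<integral>\<^sup>+ x. (\<integral>\<^sup>+ y. a (f x) * b (- f x + y) \<partial>lborel) \<partial>lborel)"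
 proof (rule nn_integral_cong)
  fix x
  have "(\<integral>\<^sup>+ y. a (f x) * b (- f x + y) \<partial>lborel) = a (f x) * (\<integral>\<^sup>+ y. b (- f x + y) \<partial>lborel)"
   by (rule nn_integral_cmult) measurable
  then show "a (f x) * emeasure lborel ?B = (\<integral>\<^sup>+ y. a (f x) * b (- f x + y) \<partial>lborel)"
   using shift[of b "- f x"] by (simp add: eb)
 qed
 also have "\<dots> = (\<integral>\<^sup>+ y. (\<integral>\<^sup>+ x. a (f x) * b (- f x + y) \<partial>lborel) \<partial>lborel)"
  by (rule lborel_pair.Fubini'[symmetric]) measurable
 \<comment> \<open>Shift x by a preimage of y under \<open>f\<close>; the unit ball is invariant
   under \<open>f\<close> and under negation.\<close>
 also have "\<dots> = (\<integral>\<^sup>+ y. (\<integral>\<^sup>+ x. a (f x + y) * b x \<partial>lborel) \<partial>lborel)"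
 proof (rule nn_integral_cong)
  fix y :: 'a
  obtain c where c: "f c = y" using surj by (metis surjD)
  have "(\<lambda>x. a (f x) * b (- f x + y)) \<in> borel_measurable borel" by measurable
  from shift[OF this, of c] show "(\<integral>\<^sup>+ x. a (f x) * b (- f x + y) \<partial>lborel) = (\<integral>\<^sup>+ x. a (f x + y) * b x \<partial>lborel)"
   by (simp add: linear_add[OF lin] c bf add.commute)
 qed
 also have "\<dots> = (\<integral>\<^sup>+ x. (\<integral>\<^sup>+ y. a (f x + y) * b x \<partial>lborel) \<partial>lborel)"
  by (rule lborel_pair.Fubini') measurable
 also have "\<dots> = (\<integral>\<^sup>+ x. emeasure lborel A * b x \<partial>lborel)"
 proof (rule nn_integral_cong)
  fix x
  have "(\<integral>\<^sup>+ y. a (f x + y) * b x \<partial>lborel) = (\<integral>\<^sup>+ y. a (f x + y) \<partial>lborel) * b x"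
   by (rule nn_integral_multc) measurable
  then show "(\<integral>\<^sup>+ y. a (f x + y) * b x \<partial>lborel) = emeasure lborel A * b x"
   using shift[of a "f x"] by (simp add: ea)
 qed
 also have "\<dots> = emeasure lborel A * (\<integral>\<^sup>+ x. b x \<partial>lborel)" by (rule nn_integral_cmult) measurable
 finally show "emeasure (distr lborel borel f) A = emeasure lborel A"
  using B by (simp add: eb ennreal_mult_cancel_left mult.commute[of _ "emeasure lborel ?B"])
qed simp

text \<open>An enumeration \<open>g\<close> of the index type translates vectors into functions on
  an initial segment, where the dimension can be lowered.\<close>

definition coords :: "(nat => 'd::finite) => real ^ 'd => nat => real" where
 "coords g x = (\<lambda>j\<in>{..<CARD('d)}. x $ g j)"

lemma coords_measurable [measurable]: "coords (g :: nat => 'd::finite) \<in> borel \<rightarrow>\<^sub>M leb {..<CARD('d)}"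
 unfolding coords_def[abs_def]
 by (intro measurable_restrict) (simp add: borel_measurable_continuous_onI continuous_intros)

lemma bdist_marginals:
 assumes "b > -1"
 shows "distr (bdist (m + d) b) (leb {..<m}) (\<lambda>y. restrict y {..<m}) = bdist m (b + real d / 2)"
 using assms
proof (induction d arbitrary: b)
 case 0
 have "distr (bdist m b) (leb {..<m}) (\<lambda>y. restrict y {..<m}) = distr (bdist m b) (bdist m b) (\<lambda>y. y)"
  by (rule distr_cong) (auto simp: space_PiM PiE_def extensional_restrict)
 also have "\<dots> = bdist m b" by (rule distr_id)
 finally have "distr (bdist m b) (leb {..<m}) (\<lambda>y. restrict y {..<m}) = bdist m b" .
 moreover have "b + real 0 / 2 = b" by simp
 ultimately show ?case by (simp only: add_0_right)
next
 case (Suc d)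
 let ?r = "\<lambda>m y. restrict y {..<m} :: nat => real"
 have r1: "?r (m + d) \<in> leb {..<Suc (m + d)} \<rightarrow>\<^sub>M leb {..<m + d}" by (rule measurable_restrict_subset) auto
 have r2: "?r m \<in> leb {..<m + d} \<rightarrow>\<^sub>M leb {..<m}" by (rule measurable_restrict_subset) auto
 have "distr (bdist (m + Suc d) b) (leb {..<m}) (?r m) =
  distr (bdist (Suc (m + d)) b) (leb {..<m}) (?r m \<circ> ?r (m + d))"
  by (rule distr_cong) (auto simp: fun_eq_iff)
 also have "\<dots> = distr (distr (bdist (Suc (m + d)) b) (leb {..<m + d}) (?r (m + d))) (leb {..<m}) (?r m)"
  by (rule distr_distr[symmetric, OF r2]) (simp add: measurable_cong_sets[OF sets_bdist refl] r1)
 also have "\<dots> = bdist m (b + 1 / 2 + real d / 2)"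
  unfolding bdist_marginal[OF Suc.prems] by (rule Suc.IH) (use Suc.prems in simp)
 also have "b + 1 / 2 + real d / 2 = b + real (Suc d) / 2" by (simp add: field_simps)
 finally show ?case .
qed

context
 fixes g :: "nat => 'd::finite"
 assumes g: "bij_betw g {..<CARD('d)} UNIV"
begin

lemma sum_coords: "(\<Sum>i\<in>UNIV. f i) = (\<Sum>j<CARD('d). f (g j))"
 using sum.reindex_bij_betw[OF g, of f] by simp

lemma prod_coords: "(\<Prod>i\<in>UNIV. f i) = (\<Prod>j<CARD('d). f (g j))"
 using prod.reindex_bij_betw[OF g, of f] by simp

lemma norm_coords: "(norm (x :: real ^ 'd))\<^sup>2 = (\<Sum>j<CARD('d). (coords g x j)\<^sup>2)"
 unfolding power2_norm_eq_inner inner_vec_def sum_coords by (simp add: coords_def power2_eq_square)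

lemma prod_Basis_coords:
 fixes f :: "real ^ 'd => 'c::comm_monoid_mult"
 shows "(\<Prod>b\<in>Basis. f b) = (\<Prod>j<CARD('d). f (axis (g j) 1))"
proof -
 have B: "(Basis :: (real ^ 'd) set) = (\<lambda>i. axis i 1) ` UNIV" by (auto simp: Basis_vec_def)
 have inj: "inj (\<lambda>i :: 'd. axis i (1::real))" by (rule injI) (simp add: axis_eq_axis)
 have "(\<Prod>b\<in>Basis. f b) = (\<Prod>i\<in>UNIV. f (axis i 1))"
  unfolding B by (simp only: prod.reindex[OF inj] comp_def)
 then show ?thesis by (simp add: prod_coords)
qed

text \<open>The inverse map transports the product measure to a measure with the right values on
  boxes, hence to Lebesgue measure.\<close>

lemma distr_coords: "distr lborel (leb {..<CARD('d)}) (coords g) = leb {..<CARD('d)}"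
proof -
 let ?D = "CARD('d)"
 define h where "h = inv_into {..<?D} g"
 define \<psi> :: "(nat => real) => real ^ 'd" where "\<psi> y = (\<chi> i. y (h i))" for y
 have hD: "h i < ?D" and gh: "g (h i) = i" for i
  using g inv_into_into[of i g "{..<?D}"] f_inv_into_f[of i g "{..<?D}"] by (auto simp: h_def bij_betw_def)
 have hg: "h (g j) = j" if "j < ?D" for j
  using g that by (simp add: h_def bij_betw_def)
 have \<psi>[measurable]: "\<psi> \<in> leb {..<?D} \<rightarrow>\<^sub>M borel"
 proof (subst borel_measurable_euclidean_space, intro ballI)
  fix b :: "real ^ 'd" assume "b \<in> Basis"
  then obtain i where b: "b = axis i 1" by (auto simp: Basis_vec_def)
  have "(\<lambda>y. \<psi> y \<bullet> b) = (\<lambda>y. y (h i))" unfolding b by (simp add: \<psi>_def inner_axis)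
  then show "(\<lambda>y. \<psi> y \<bullet> b) \<in> borel_measurable (leb {..<?D})" using leb_component[of "h i" "{..<?D}"] hD by simp
 qed
 have "lborel = distr (leb {..<?D}) borel \<psi>"
 proof (rule lborel_eqI)
  fix l u :: "real ^ 'd" assume lu: "\<And>b. b \<in> Basis ==> l \<bullet> b \<le> u \<bullet> b"
  have le: "l $ i \<le> u $ i" for i using lu[of "axis i 1"] by (simp add: inner_axis axis_in_Basis_iff)
  have "emeasure (distr (leb {..<?D}) borel \<psi>) (box l u) = emeasure (leb {..<?D}) (\<psi> -` box l u \<inter> space (leb {..<?D}))"
   by (rule emeasure_distr[OF \<psi>]) simp
  also have "\<psi> -` box l u \<inter> space (leb {..<?D}) = PiE {..<?D} (\<lambda>j. {l $ g j<..<u $ g j})"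
  proof -
   have "\<psi> y \<in> box l u \<longleftrightarrow> (\<forall>j<?D. l $ g j < y j \<and> y j < u $ g j)" for y
   proof -
    have "\<psi> y \<in> box l u \<longleftrightarrow> (\<forall>i. l $ i < y (h i) \<and> y (h i) < u $ i)"
     by (simp add: mem_box_cart \<psi>_def)
    also have "\<dots> \<longleftrightarrow> (\<forall>j<?D. l $ g j < y j \<and> y j < u $ g j)"
     using hD gh hg by metis
    finally show ?thesis .
   qed
   then show ?thesis by (auto simp: space_PiM PiE_def Pi_def)
  qed
  also have "emeasure (leb {..<?D}) (PiE {..<?D} (\<lambda>j. {l $ g j<..<u $ g j})) = (\<Prod>j<?D. emeasure lborel {l $ g j<..<u $ g j})"
   by (rule lebP.emeasure_PiM) auto
  also have "\<dots> = ennreal (\<Prod>j<?D. u $ g j - l $ g j)"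
   using le by (simp add: prod_ennreal)
  also have "(\<Prod>j<?D. u $ g j - l $ g j) = (\<Prod>b\<in>Basis. (u - l) \<bullet> b)"
   by (simp add: prod_Basis_coords inner_axis)
  finally show "emeasure (distr (leb {..<?D}) borel \<psi>) (box l u) = (\<Prod>b\<in>Basis. (u - l) \<bullet> b)" .
 qed simp
 then have "distr lborel (leb {..<?D}) (coords g) = distr (distr (leb {..<?D}) borel \<psi>) (leb {..<?D}) (coords g)" by simp
 also have "\<dots> = distr (leb {..<?D}) (leb {..<?D}) (coords g \<circ> \<psi>)"
  by (rule distr_distr) measurable
 also have "\<dots> = distr (leb {..<?D}) (leb {..<?D}) (\<lambda>y. y)"
 proof (rule distr_cong[OF refl refl])
  fix y assume "y \<in> space (leb {..<?D})"
  then show "(coords g \<circ> \<psi>) y = y"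
   by (auto simp: coords_def \<psi>_def hg fun_eq_iff space_PiM PiE_def extensional_def)
 qed
 also have "\<dots> = leb {..<?D}" by (rule distr_id)
 finally show ?thesis .
qed

lemma beta_distr_coords:
 assumes b: "b > -1"
 shows "distr (beta_distr b :: (real ^ 'd) measure) (leb {..<CARD('d)}) (coords g) = bdist CARD('d) b"
proof -
 let ?D = "CARD('d)"
 have "bdist ?D b = density (distr lborel (leb {..<?D}) (coords g)) (\<lambda>y. ennreal (bdens ?D b y))"
  by (simp add: bdist_def distr_coords)
 also have "\<dots> = distr (density lborel (\<lambda>x. ennreal (bdens ?D b (coords g x)))) (leb {..<?D}) (coords g)"
  by (rule density_distr) auto
 also have "(\<lambda>x. ennreal (bdens ?D b (coords g x))) =
  (\<lambda>x :: real ^ 'd. ennreal (beta_const (real ?D) b * (1 - (norm x)\<^sup>2) powr b * indicator (ball 0 1) x))"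
 proof
  fix x :: "real ^ 'd"
  have "(norm x)\<^sup>2 < 1 \<longleftrightarrow> x \<in> ball 0 1" by (simp add: abs_square_less_1)
  then show "ennreal (bdens ?D b (coords g x)) = ennreal (beta_const (real ?D) b * (1 - (norm x)\<^sup>2) powr b * indicator (ball 0 1) x)"
   unfolding bdens_def norm_coords[symmetric] by (simp add: indicator_def)
 qed
 also have "density lborel \<dots> = beta_distr b" using b by (simp add: beta_distr_def)
 finally show ?thesis ..
qed

end

lemma sets_beta_distr [simp, measurable_cong]: "sets (beta_distr b :: (real ^ 'd::finite) measure) = sets borel"
 and space_beta_distr [simp]: "space (beta_distr b :: (real ^ 'd::finite) measure) = UNIV"
 by (simp_all add: beta_distr_def)

text \<open>In the ball case the density is radial. On the sphere the normalisation by the norm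
  commutes with \<open>f\<close>, which reduces the claim to the uniform law on the ball.\<close>

lemma beta_distr_orthogonal:
 fixes f :: "real ^ 'd::finite => real ^ 'd"
 assumes f: "orthogonal_transformation f"
 shows "distr (beta_distr b) borel f = (beta_distr b :: (real ^ 'd) measure)"
proof -
 have nf: "norm (f x) = norm x" for x using f by (rule orthogonal_transformation_norm)
 have lin: "linear f" using f by (rule orthogonal_transformation_linear)
 have fm[measurable]: "f \<in> borel_measurable borel"
  using lin by (intro borel_measurable_continuous_onI linear_continuous_on) (simp add: linear_conv_bounded_linear)
 have dens: "distr (density lborel h) borel f = density lborel h"
  if h[measurable]: "h \<in> borel_measurable borel" and "\<And>x. h (f x) = h x" for h :: "real ^ 'd => ennreal"
 proof -
  have "distr (density lborel (\<lambda>x. h (f x))) borel f = density (distr lborel borel f) h"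
   by (rule density_distr[symmetric]) auto
  then show ?thesis by (simp add: that(2) lborel_distr_orthogonal[OF f])
 qed
 have ib: "indicator (ball 0 1) (f x) = (indicator (ball 0 1) x :: 'c::zero_neq_one)" for x
  by (simp add: indicator_def nf)
 show ?thesis
 proof (cases "b > -1")
  case True
  show ?thesis unfolding beta_distr_def if_P[OF True]
  proof (rule dens)
   have [measurable]: "ball (0 :: real ^ 'd) 1 \<in> sets borel" by simp
   show "(\<lambda>x :: real ^ 'd. ennreal (beta_const (real CARD('d)) b * (1 - (norm x)\<^sup>2) powr b * indicator (ball 0 1) x)) \<in> borel_measurable borel"
    by measurable
  qed (simp add: nf ib)
 next
  case False
  let ?U = "uniform_measure lborel (ball 0 1) :: (real ^ 'd) measure" and ?n = "\<lambda>x :: real ^ 'd. x /\<^sub>R norm x"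
  have nm[measurable]: "?n \<in> borel_measurable borel" by measurable
  have U: "distr ?U borel f = ?U" unfolding uniform_measure_def divide_ennreal_def
   by (rule dens, intro borel_measurable_times_ennreal borel_measurable_indicator borel_measurable_const, simp, simp add: ib)
  have "distr (distr ?U borel ?n) borel f = distr ?U borel (f \<circ> ?n)" by (rule distr_distr) measurable
  also have "f \<circ> ?n = ?n \<circ> f" by (auto simp: fun_eq_iff linear_scale[OF lin] nf)
  also have "distr ?U borel (?n \<circ> f) = distr (distr ?U borel f) borel ?n"
   by (rule distr_distr[symmetric]) measurable
  finally show ?thesis using False by (simp add: beta_distr_def U)
 qed
qed

lemma nn_integral_even:
 fixes f :: "real => ennreal"
 assumes [measurable]: "f \<in> borel_measurable borel" and even: "\<And>x. f (- x) = f x"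
 shows "(\<integral>\<^sup>+ x. f x \<partial>lborel) = 2 * (\<integral>\<^sup>+ x. f x * indicator {0..} x \<partial>lborel)"
proof -
 have "(\<integral>\<^sup>+ x. f x \<partial>lborel) = (\<integral>\<^sup>+ x. f x * indicator {0..} x + f x * indicator {..0} x \<partial>lborel)"
  by (rule nn_integral_cong_AE, rule AE_I'[of "{0}"]) (auto simp: indicator_def)
 also have "\<dots> = (\<integral>\<^sup>+ x. f x * indicator {0..} x \<partial>lborel) + (\<integral>\<^sup>+ x. f x * indicator {..0} x \<partial>lborel)"
  by (rule nn_integral_add) measurable
 also have "(\<integral>\<^sup>+ x. f x * indicator {..0} x \<partial>lborel) = (\<integral>\<^sup>+ x. f x * indicator {0..} x \<partial>lborel)"
  using nn_integral_real_affine[of "\<lambda>x. f x * indicator {..0} x" "-1" 0]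
  by (simp add: even indicator_def)
 finally show ?thesis by (simp add: mult_2)
qed

text \<open>Substitution r = sqrt (q + s^2): for fixed other coordinates with square sum q the last
  coordinate is exchanged for the norm.\<close>

lemma nn_integral_radial:
 fixes \<phi> :: "real => real"
 assumes [measurable]: "\<phi> \<in> borel_measurable borel" and nn: "\<And>r. 0 \<le> \<phi> r" and q: "0 < q"
 shows "(\<integral>\<^sup>+ s. ennreal (\<phi> (sqrt (q + s\<^sup>2))) * indicator {s. q + s\<^sup>2 < 1} s \<partial>lborel) =
  2 * (\<integral>\<^sup>+ r. ennreal (\<phi> r * r / sqrt (r\<^sup>2 - q)) * indicator {r. q < r\<^sup>2 \<and> 0 < r \<and> r < 1} r \<partial>lborel)"
proof -
 let ?h = "\<lambda>s. sqrt (q + s\<^sup>2)"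
 have hp: "0 < ?h s" for s using q by (intro real_sqrt_gt_zero add_pos_nonneg) auto
 have [measurable]: "{s. q + s\<^sup>2 < 1} \<in> sets borel" by measurable
 define f where "f r = \<phi> r * r / sqrt (r\<^sup>2 - q) * (if r < 1 then 1 else 0)" for r
 have [measurable]: "f \<in> borel_measurable borel" unfolding f_def[abs_def] by measurable
 have "(\<integral>\<^sup>+ s. ennreal (\<phi> (?h s)) * indicator {s. q + s\<^sup>2 < 1} s \<partial>lborel) =
  2 * (\<integral>\<^sup>+ s. ennreal (\<phi> (?h s)) * indicator {s. q + s\<^sup>2 < 1} s * indicator {0..} s \<partial>lborel)"
  by (rule nn_integral_even) (measurable, simp add: indicator_def)
 also have "(\<integral>\<^sup>+ s. ennreal (\<phi> (?h s)) * indicator {s. q + s\<^sup>2 < 1} s * indicator {0..} s \<partial>lborel) =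
  (\<integral>\<^sup>+ s. ennreal (f (?h s) * (s / ?h s)) * indicator {0..1} s \<partial>lborel)"
 proof (rule nn_integral_cong_AE, rule AE_I'[of "{0}"])
  show "{s \<in> space lborel. ennreal (\<phi> (?h s)) * indicator {s. q + s\<^sup>2 < 1} s * indicator {0..} s \<noteq>
   ennreal (f (?h s) * (s / ?h s)) * indicator {0..1} s} \<subseteq> {0}"
  proof (rule subsetI, rule ccontr)
   fix s assume s: "s \<in> {s \<in> space lborel. ennreal (\<phi> (?h s)) * indicator {s. q + s\<^sup>2 < 1} s * indicator {0..} s \<noteq>
    ennreal (f (?h s) * (s / ?h s)) * indicator {0..1} s}" and "s \<notin> {0}"
   then have "s \<noteq> 0" by simp
   show False
   proof (cases "0 < s")
    case True
    have h1: "?h s < 1 \<longleftrightarrow> q + s\<^sup>2 < 1" by simp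
    have "s \<le> 1" if "q + s\<^sup>2 < 1"
    proof -
     have "s\<^sup>2 < 1\<^sup>2" using that q by simp
     then show ?thesis using power2_less_imp_less[of s 1] by simp
    qed
    moreover have "(?h s)\<^sup>2 - q = s\<^sup>2" using q by (simp add: add_nonneg_nonneg less_imp_le)
    then have "f (?h s) * (s / ?h s) = \<phi> (?h s) * (if ?h s < 1 then 1 else 0)"
     using True hp[of s] by (simp add: f_def)
    ultimately show False using s True h1 by (auto simp: indicator_def split: if_splits)
   next
    case False
    then show False using s \<open>s \<noteq> 0\<close> by (simp add: indicator_def)
   qed
  qed
 qed auto
 also have "\<dots> = (\<integral>\<^sup>+ r. ennreal (f r) * indicator {?h 0..?h 1} r \<partial>lborel)"
 proof -
  have e: "ennreal (x * indicator A y) = ennreal x * indicator A y" for x y :: real and A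
   by (simp add: indicator_def)
  have "(\<integral>\<^sup>+ r. ennreal (f r * indicator {?h 0..?h 1} r) \<partial>lborel) =
   (\<integral>\<^sup>+ s. ennreal (f (?h s) * (s / ?h s) * indicator {0..1} s) \<partial>lborel)"
  proof (rule nn_integral_substitution[where g = ?h and g' = "\<lambda>s. s / ?h s" and a = 0 and b = 1])
   show "set_borel_measurable borel {?h 0..?h 1} f" unfolding set_borel_measurable_def by measurable
   show "(?h has_real_derivative s / ?h s) (at s)" for s
   proof -
    have "0 < q + s\<^sup>2" using q by (intro add_pos_nonneg) auto
    then show ?thesis by (auto intro!: derivative_eq_intros simp: divide_simps)
   qed
   show "continuous_on {0..1} (\<lambda>s. s / ?h s)"
    using hp by (intro continuous_intros) (metis less_irrefl)
   show "0 \<le> s / ?h s" if "s \<in> {0..1}" for s using that hp[of s] by simp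
  qed simp
  then show ?thesis unfolding e ..
 qed
 also have "\<dots> = (\<integral>\<^sup>+ r. ennreal (\<phi> r * r / sqrt (r\<^sup>2 - q)) * indicator {r. q < r\<^sup>2 \<and> 0 < r \<and> r < 1} r \<partial>lborel)"
 proof (rule nn_integral_cong)
  fix r :: real
  have h1: "r \<le> ?h 1" if "r < 1"
  proof -
   have "1 < ?h 1" using q by simp
   then show ?thesis using that by linarith
  qed
  have "?h 0 \<le> r \<and> r < 1 \<and> r\<^sup>2 \<noteq> q \<longleftrightarrow> q < r\<^sup>2 \<and> 0 < r \<and> r < 1"
  proof -
   have "sqrt q \<le> r \<and> r\<^sup>2 \<noteq> q \<longleftrightarrow> q < r\<^sup>2 \<and> 0 < r"
   proof
    assume "sqrt q \<le> r \<and> r\<^sup>2 \<noteq> q"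
    then have "q \<le> r\<^sup>2" "r\<^sup>2 \<noteq> q" "0 < sqrt q" "sqrt q \<le> r" using q by (auto intro: sqrt_le_D)
    moreover have "0 < r" using real_sqrt_gt_zero[OF q] \<open>sqrt q \<le> r \<and> r\<^sup>2 \<noteq> q\<close> by linarith
    ultimately show "q < r\<^sup>2 \<and> 0 < r" by auto
   next
    assume "q < r\<^sup>2 \<and> 0 < r"
    then show "sqrt q \<le> r \<and> r\<^sup>2 \<noteq> q" by (auto intro: real_le_lsqrt)
   qed
   then show ?thesis by auto
  qed
  then show "ennreal (f r) * indicator {?h 0..?h 1} r =
   ennreal (\<phi> r * r / sqrt (r\<^sup>2 - q)) * indicator {r. q < r\<^sup>2 \<and> 0 < r \<and> r < 1} r"
   using h1 by (cases "r\<^sup>2 = q") (auto simp: f_def indicator_def)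
 qed
 finally show ?thesis .
qed

text \<open>In the ball the last coordinate is exchanged for the norm r, then the other coordinates
  are divided by r. The radial integral splits off as a constant, which total mass 1
  determines.\<close>

lemma sphere_coords:
 fixes g :: "nat => 'd::finite"
 assumes g: "bij_betw g {..<CARD('d)} UNIV" and D: "CARD('d) = Suc p" and p: "1 \<le> p"
 shows "distr (beta_distr (-1) :: (real ^ 'd) measure) (leb {..<p}) (\<lambda>x. \<lambda>j\<in>{..<p}. x $ g j) = bdist p (-1 / 2)"
proof (rule measure_eqI)
 let ?L = "leb {..<p}" and ?c = "\<lambda>x :: real ^ 'd. \<lambda>j\<in>{..<p}. x $ g j"
 let ?U = "uniform_measure lborel (ball 0 1) :: (real ^ 'd) measure" and ?n = "\<lambda>x :: real ^ 'd. x /\<^sub>R norm x"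
 let ?V = "emeasure lborel (ball 0 1 :: (real ^ 'd) set)"
 define sq where "sq m y = (\<Sum>j<m. (y j)\<^sup>2)" for m and y :: "nat => real"
 define K :: ennreal where "K = 2 * (\<integral>\<^sup>+ r. ennreal (r ^ p) * indicator {0<..<1} r \<partial>lborel)"
 define w where "w z = ennreal (if sq p z < 1 then (1 - sq p z) powr (-1 / 2) else 0)" for z
 have V: "?V \<noteq> 0" "?V \<noteq> \<top>"
  using content_ball_pos[of 1 "0 :: real ^ 'd"] emeasure_lborel_ball_finite[of "0 :: real ^ 'd" 1] by (auto simp: measure_def)
 have nm[measurable]: "?n \<in> borel_measurable borel" by measurable
 have cm[measurable]: "?c \<in> borel \<rightarrow>\<^sub>M ?L"
  by (intro measurable_restrict) (simp add: borel_measurable_continuous_onI continuous_intros)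
 have sqm[measurable]: "sq m \<in> borel_measurable (leb {..<m})" for m
  unfolding sq_def[abs_def] by (intro borel_measurable_sum borel_measurable_power leb_component) auto
 have wm[measurable]: "w \<in> borel_measurable ?L" unfolding w_def[abs_def] by measurable
 have key: "emeasure (distr (beta_distr (-1) :: (real ^ 'd) measure) ?L ?c) A = K * (\<integral>\<^sup>+ z. indicator A z * w z \<partial>?L) / ?V"
  if A[measurable]: "A \<in> sets ?L" for A
 proof -
  define a where "a y r = (indicator A (\<lambda>j\<in>{..<p}. y j / r) :: real)" for y :: "nat => real" and r
  have a01: "ennreal (a y r) = indicator A (\<lambda>j\<in>{..<p}. y j / r)" "0 \<le> a y r" for y r
   by (simp_all add: a_def indicator_def)
  have div2: "(\<lambda>z. \<lambda>j\<in>{..<p}. fst z j / snd z) \<in> ?L \<Otimes>\<^sub>M borel \<rightarrow>\<^sub>M ?L"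
   by (intro measurable_restrict borel_measurable_divide measurable_snd measurable_compose[OF measurable_fst leb_component, unfolded measurable_lborel1])
    (auto intro: measurable_compose[OF measurable_fst leb_component])
  have a2: "(\<lambda>z. a (fst z) (snd z)) \<in> borel_measurable (?L \<Otimes>\<^sub>M borel)"
   unfolding a_def by (rule measurable_compose[OF div2]) simp
  have a1: "a y \<in> borel_measurable borel" if "y \<in> space ?L" for y
   using measurable_compose[OF measurable_Pair1'[OF that] a2] by simp
  have a3: "(\<lambda>y. a y r) \<in> borel_measurable ?L" for r
   using measurable_compose[OF measurable_Pair2'[of r borel ?L] a2] by simp
  define H where "H y r = ennreal (a y r * r / sqrt (r\<^sup>2 - sq p y)) * indicator {r. sq p y < r\<^sup>2 \<and> 0 < r \<and> r < 1} r" for y r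
  have sqf[measurable]: "(\<lambda>z. sq p (fst z)) \<in> borel_measurable (?L \<Otimes>\<^sub>M borel)"
   by (rule measurable_compose[OF measurable_fst sqm])
  have Hm: "(\<lambda>(y, r). H y r) \<in> borel_measurable (?L \<Otimes>\<^sub>M lborel)"
  proof -
   note a2[measurable]
   have "(\<lambda>z. ennreal (a (fst z) (snd z) * snd z / sqrt ((snd z)\<^sup>2 - sq p (fst z))) *
    indicator {z \<in> space (?L \<Otimes>\<^sub>M borel). sq p (fst z) < (snd z)\<^sup>2 \<and> 0 < snd z \<and> snd z < 1} z) \<in> borel_measurable (?L \<Otimes>\<^sub>M borel)"
    by measurable
   then have "(\<lambda>(y, r). H y r) \<in> borel_measurable (?L \<Otimes>\<^sub>M borel)"
    by (rule measurable_cong[THEN iffD1, rotated]) (auto simp: H_def indicator_def)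
   moreover have s: "sets (?L \<Otimes>\<^sub>M lborel) = sets (?L \<Otimes>\<^sub>M (borel :: real measure))" by (intro sets_pair_measure_cong) auto
   ultimately show ?thesis by (simp only: measurable_cong_sets[OF s refl])
  qed
  interpret lp: pair_sigma_finite ?L "lborel :: real measure"
   by (intro pair_sigma_finite.intro sigma_finite_leb lborel.sigma_finite_measure_axioms) simp
  define G where "G y = ennreal (a y (sqrt (sq (Suc p) y))) * indicator {y. sq (Suc p) y < 1} y" for y
  have rs: "(\<lambda>y. restrict y {..<p}) \<in> leb {..<Suc p} \<rightarrow>\<^sub>M ?L" by (rule measurable_restrict_subset) auto
  have arestr: "a (restrict y {..<p}) r = a y r" for y r
  proof -
   have "(\<lambda>j\<in>{..<p}. restrict y {..<p} j / r) = (\<lambda>j\<in>{..<p}. y j / r)" by (auto simp: restrict_def)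
   then show ?thesis by (simp only: a_def)
  qed
  have "(\<lambda>y. (restrict y {..<p}, sqrt (sq (Suc p) y))) \<in> leb {..<Suc p} \<rightarrow>\<^sub>M ?L \<Otimes>\<^sub>M borel"
   by (intro measurable_Pair rs) measurable
  from measurable_compose[OF this a2] have aG[measurable]: "(\<lambda>y. a y (sqrt (sq (Suc p) y))) \<in> borel_measurable (leb {..<Suc p})"
   by (simp add: arestr)
  have Gm[measurable]: "G \<in> borel_measurable (leb {..<Suc p})" unfolding G_def[abs_def] by measurable
  have "emeasure (distr (beta_distr (-1) :: (real ^ 'd) measure) ?L ?c) A = (\<integral>\<^sup>+ y. indicator A y \<partial>distr (distr ?U borel ?n) ?L ?c)"
   using A by (simp add: beta_distr_def)
  also have "\<dots> = (\<integral>\<^sup>+ x. indicator A (?c x) \<partial>distr ?U borel ?n)" by (rule nn_integral_distr) auto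
  also have "\<dots> = (\<integral>\<^sup>+ x. indicator A (?c (?n x)) \<partial>?U)" by (rule nn_integral_distr) auto
  also have "\<dots> = (\<integral>\<^sup>+ x. indicator A (?c (?n x)) * indicator (ball 0 1) x \<partial>lborel) / ?V"
   by (rule nn_integral_uniform_measure) auto
  also have "(\<integral>\<^sup>+ x. indicator A (?c (?n x)) * indicator (ball 0 1) x \<partial>lborel) = (\<integral>\<^sup>+ x. G (coords g x) \<partial>lborel)"
  proof (rule nn_integral_cong)
   fix x :: "real ^ 'd"
   have s: "sq (Suc p) (coords g x) = (norm x)\<^sup>2" using norm_coords[OF g, of x] by (simp only: sq_def D)
   have "(norm x)\<^sup>2 < 1 \<longleftrightarrow> norm x < 1" by (simp add: abs_square_less_1)
   moreover have "?c (?n x) = (\<lambda>j\<in>{..<p}. coords g x j / norm x)"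
    by (auto simp: coords_def D fun_eq_iff divide_inverse)
   ultimately show "indicator A (?c (?n x)) * indicator (ball 0 1) x = G (coords g x)"
    unfolding G_def a01 by (simp add: indicator_def s)
  qed
  also have "\<dots> = (\<integral>\<^sup>+ y. G y \<partial>leb {..<Suc p})"
  proof -
   have "(\<integral>\<^sup>+ y. G y \<partial>leb {..<Suc p}) = (\<integral>\<^sup>+ y. G y \<partial>distr lborel (leb {..<CARD('d)}) (coords g))"
    by (simp only: distr_coords[OF g, unfolded D] D)
   also have "\<dots> = (\<integral>\<^sup>+ x. G (coords g x) \<partial>lborel)"
   proof (rule nn_integral_distr)
    show "coords g \<in> lborel \<rightarrow>\<^sub>M leb {..<CARD('d)}" using coords_measurable[of g] by simp
    show "G \<in> borel_measurable (distr lborel (leb {..<CARD('d)}) (coords g))"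
     using Gm by (simp only: D measurable_distr_eq1)
   qed
   finally show ?thesis ..
  qed
  also have "\<dots> = (\<integral>\<^sup>+ y. (\<integral>\<^sup>+ s. G (y(p := s)) \<partial>lborel) \<partial>?L)"
   unfolding lessThan_Suc by (rule lebP.product_nn_integral_insert) (use Gm in \<open>simp_all add: lessThan_Suc\<close>)
  also have "\<dots> = (\<integral>\<^sup>+ y. 2 * (\<integral>\<^sup>+ r. H y r \<partial>lborel) \<partial>?L)"
  proof (rule nn_integral_cong_AE)
   \<comment> \<open>This serves to get a nonzero first coordinate, hence a positive square sum for
     the radial substitution.\<close>
   have "AE y in ?L. hv p y 1 \<noteq> (\<Sum>j<1. 0 * hv p y j)" by (rule hv_generic_AE[OF p])
   then show "AE y in ?L. (\<integral>\<^sup>+ s. G (y(p := s)) \<partial>lborel) =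
    2 * (\<integral>\<^sup>+ r. H y r \<partial>lborel)"
    using AE_space
   proof eventually_elim
    fix y assume y: "hv p y 1 \<noteq> (\<Sum>j<1. 0 * hv p y j)" "y \<in> space ?L"
    then have "y 0 \<noteq> 0" using p by (simp add: hv_def)
    then have "0 < (y 0)\<^sup>2" by simp
    also have "\<dots> \<le> sq p y" unfolding sq_def using p by (intro member_le_sum) auto
    finally have q: "0 < sq p y" .
    have "G (y(p := s)) = ennreal (a y (sqrt (sq p y + s\<^sup>2))) * indicator {s. sq p y + s\<^sup>2 < 1} s" for s
    proof -
     have "sq (Suc p) (y(p := s)) = sq p y + s\<^sup>2" by (simp add: sq_def)
     moreover have "a (y(p := s)) r = a y r" for r
     proof -
      have "(\<lambda>j\<in>{..<p}. (y(p := s)) j / r) = (\<lambda>j\<in>{..<p}. y j / r)" by (auto simp: restrict_def)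
      then show ?thesis by (simp only: a_def)
     qed
     ultimately show ?thesis by (simp add: G_def indicator_def)
    qed
    then show "(\<integral>\<^sup>+ s. G (y(p := s)) \<partial>lborel) =
     2 * (\<integral>\<^sup>+ r. H y r \<partial>lborel)"
     unfolding H_def using nn_integral_radial[OF a1[OF y(2)] a01(2) q] by simp
   qed
  qed
  also have "\<dots> = 2 * (\<integral>\<^sup>+ y. (\<integral>\<^sup>+ r. H y r \<partial>lborel) \<partial>?L)"
   by (rule nn_integral_cmult) (rule lborel.borel_measurable_nn_integral[OF Hm])
  also have "(\<integral>\<^sup>+ y. (\<integral>\<^sup>+ r. H y r \<partial>lborel) \<partial>?L) =
   (\<integral>\<^sup>+ r. (\<integral>\<^sup>+ y. H y r \<partial>?L) \<partial>lborel)"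
   by (rule lp.Fubini'[symmetric]) (rule Hm)
  \<comment> \<open>Scaling by r: the Jacobian gives r^p, and the factor r / sqrt (r^2 - |y|^2)
    becomes the weight \<open>w\<close> of the scaled point.\<close>
  also have "\<dots> = (\<integral>\<^sup>+ r. ennreal (r ^ p) * indicator {0<..<1} r * (\<integral>\<^sup>+ z. indicator A z * w z \<partial>?L) \<partial>lborel)"
  proof (rule nn_integral_cong)
   fix r :: real
   show "(\<integral>\<^sup>+ y. H y r \<partial>?L) =
    ennreal (r ^ p) * indicator {0<..<1} r * (\<integral>\<^sup>+ z. indicator A z * w z \<partial>?L)"
   proof (cases "0 < r \<and> r < 1")
    case True
    then have r: "0 < r" "r < 1" by auto
    let ?F = "\<lambda>y. ennreal (a y r * r / sqrt (r\<^sup>2 - sq p y)) * indicator {y. sq p y < r\<^sup>2} y"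
    have s: "scales {..<p} (\<lambda>z. \<lambda>j\<in>{..<p}. r * z j) (r ^ p)"
     by (rule scales_cong[OF scales_lower_triangular[of p "\<lambda>_. r" "\<lambda>_ _. 0" "\<lambda>_. 0"]]) (use r in auto)
    have Fm: "?F \<in> borel_measurable ?L" using a3[of r] by measurable
    have "(\<integral>\<^sup>+ y. H y r \<partial>?L) = (\<integral>\<^sup>+ y. ?F y \<partial>?L)"
     using True by (intro nn_integral_cong) (auto simp: H_def indicator_def)
    also have "\<dots> = ennreal (r ^ p) * (\<integral>\<^sup>+ z. ?F (\<lambda>j\<in>{..<p}. r * z j) \<partial>?L)" by (rule scalesD(3)[OF s Fm])
    also have "(\<integral>\<^sup>+ z. ?F (\<lambda>j\<in>{..<p}. r * z j) \<partial>?L) = (\<integral>\<^sup>+ z. indicator A z * w z \<partial>?L)"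
    proof (rule nn_integral_cong)
     fix z assume z: "z \<in> space ?L"
     have "(\<lambda>j\<in>{..<p}. (\<lambda>j\<in>{..<p}. r * z j) j / r) = z"
      using z r by (auto simp: space_PiM PiE_def extensional_def fun_eq_iff)
     then have az: "a (\<lambda>j\<in>{..<p}. r * z j) r = indicator A z" by (simp only: a_def)
     have sz: "sq p (\<lambda>j\<in>{..<p}. r * z j) = r\<^sup>2 * sq p z"
      unfolding sq_def sum_distrib_left by (intro sum.cong) (auto simp: power_mult_distrib)
     have lt: "r\<^sup>2 * sq p z < r\<^sup>2 \<longleftrightarrow> sq p z < 1" using r by simp
     show "?F (\<lambda>j\<in>{..<p}. r * z j) = indicator A z * w z"
     proof (cases "sq p z < 1")
      case True
      have "sqrt (r\<^sup>2 - r\<^sup>2 * sq p z) = r * sqrt (1 - sq p z)"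
      proof -
       have e: "r\<^sup>2 - r\<^sup>2 * sq p z = r\<^sup>2 * (1 - sq p z)" by (simp add: right_diff_distrib)
       show ?thesis unfolding e real_sqrt_mult using r by simp
      qed
      moreover have "(1 - sq p z) powr (-1 / 2) = 1 / sqrt (1 - sq p z)"
       using True by (simp add: powr_minus_divide powr_half_sqrt[symmetric])
      ultimately have "indicator A z * r / sqrt (r\<^sup>2 - r\<^sup>2 * sq p z) = (indicator A z * (1 - sq p z) powr (-1 / 2) :: real)"
       using r by simp
      then show ?thesis unfolding az w_def using True lt by (simp add: indicator_def sz)
     next
      case False
      then show ?thesis unfolding az w_def using lt by (simp add: indicator_def sz)
     qed
    qed
    finally show ?thesis using True by simp
   next
    case False
    then show ?thesis by (auto simp: H_def indicator_def)
   qed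
  qed
  also have "\<dots> = (\<integral>\<^sup>+ r. ennreal (r ^ p) * indicator {0<..<1} r \<partial>lborel) * (\<integral>\<^sup>+ z. indicator A z * w z \<partial>?L)"
   by (rule nn_integral_multc) measurable
  finally show ?thesis by (simp only: K_def mult.assoc)
 qed
 have c: "0 < beta_const (real p) (-1 / 2)" by (intro beta_const_pos) auto
 have B: "emeasure (bdist p (-1 / 2)) A = ennreal (beta_const (real p) (-1 / 2)) * (\<integral>\<^sup>+ z. indicator A z * w z \<partial>?L)"
  if A[measurable]: "A \<in> sets ?L" for A
 proof -
  have "emeasure (bdist p (-1 / 2)) A = (\<integral>\<^sup>+ z. ennreal (bdens p (-1 / 2) z) * indicator A z \<partial>?L)"
   unfolding bdist_def by (rule emeasure_density) auto
  also have "\<dots> = (\<integral>\<^sup>+ z. ennreal (beta_const (real p) (-1 / 2)) * (indicator A z * w z) \<partial>?L)"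
   using c by (intro nn_integral_cong) (simp add: bdens_def w_def sq_def ennreal_mult ac_simps)
  also have "\<dots> = ennreal (beta_const (real p) (-1 / 2)) * (\<integral>\<^sup>+ z. indicator A z * w z \<partial>?L)"
   by (rule nn_integral_cmult) measurable
  finally show ?thesis .
 qed
 fix A assume "A \<in> sets (distr (beta_distr (-1) :: (real ^ 'd) measure) ?L ?c)"
 then have A: "A \<in> sets ?L" by simp
 interpret bd: prob_space "bdist p (-1 / 2)" by (rule prob_space_bdist) simp
 let ?W = "\<integral>\<^sup>+ z. indicator (space ?L) z * w z \<partial>?L" and ?b = "ennreal (beta_const (real p) (-1 / 2))"
 \<comment> \<open>Both laws have mass 1, which forces their constants to agree.\<close>
 have b1: "?b * ?W = 1" using B[of "space ?L"] bd.emeasure_space_1 by simp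
 interpret U: prob_space ?U by (rule prob_space_uniform_measure) (use V in auto)
 have "emeasure (distr (beta_distr (-1) :: (real ^ 'd) measure) ?L ?c) (space ?L) = 1"
 proof -
  have "prob_space (distr (distr ?U borel ?n) ?L ?c)"
   by (intro prob_space.prob_space_distr U.prob_space_distr) auto
  from prob_space.emeasure_space_1[OF this] show ?thesis by (simp add: beta_distr_def)
 qed
 then have k1: "K / ?V * ?W = 1" using key[of "space ?L"] by (simp add: divide_ennreal_def ac_simps)
 have "K / ?V = K / ?V * (?b * ?W)" unfolding b1 by simp
 also have "\<dots> = ?b * (K / ?V * ?W)" by (simp only: ac_simps)
 finally have KV: "K / ?V = ?b" unfolding k1 by simp
 have "K * Z / ?V = ?b * Z" for Z
  unfolding KV[symmetric] by (simp only: divide_ennreal_def ac_simps)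
 then show "emeasure (distr (beta_distr (-1) :: (real ^ 'd) measure) ?L ?c) A = emeasure (bdist p (-1 / 2)) A"
  unfolding key[OF A] B[OF A] .
qed simp

subsection \<open>The expected internal angle\<close>

text \<open>Here \<open>b\<close> equals (\<alpha> - n + 1) / 2. It is at least -1, with equality
  exactly in the sphere case.\<close>

locale beta_simplex =
 fixes g :: "nat => 'd::finite" and n k p :: nat and \<alpha> b :: real
 assumes g: "bij_betw g {..<CARD('d)} UNIV" and D: "CARD('d) = Suc p" and p: "1 \<le> p" and n: "n = Suc (Suc p)"
  and kn: "1 \<le> k" "k \<le> n" and al: "real n - 3 \<le> \<alpha>" and b: "b = (\<alpha> - real (Suc p)) / 2"
begin

definition mu :: "(real ^ 'd) measure" where "mu = beta_distr b"

definition vv :: "real ^ 'd => nat => real" where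
 "vv x j = hv (Suc p) (coords g x) j"

lemma sets_mu [simp, measurable_cong]: "sets mu = sets borel" and space_mu [simp]: "space mu = UNIV"
 by (simp_all add: mu_def)

lemma g_inj: "j < Suc p ==> j' < Suc p ==> g j = g j' \<longleftrightarrow> j = j'"
 using g D by (auto simp: bij_betw_def inj_on_def)

lemma g_surj: "\<exists>j<Suc p. g j = i"
proof -
 have "i \<in> g ` {..<Suc p}" using bij_betw_imp_surj_on[OF g] D by simp
 then show ?thesis by auto
qed

lemma vv_simps [simp]: "vv x 0 = 1" "j < Suc p ==> vv x (Suc j) = x $ g j" "\<not> j < Suc p ==> vv x (Suc j) = 0"
 by (simp_all add: vv_def coords_def D)

text \<open>The starting law is that of all coordinates if b > -1 and that of \<open>p\<close>
  coordinates on the sphere. From there each coordinate dropped adds 1/2 to the exponent.\<close>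

lemma mu_law:
 assumes m: "m \<le> p"
 shows "distr mu (leb {..<m}) (\<lambda>x. \<lambda>j\<in>{..<m}. x $ g j) = bdist m ((\<alpha> - real m) / 2)"
proof -
 let ?c = "\<lambda>m x :: real ^ 'd. \<lambda>j\<in>{..<m}. x $ g j" and ?r = "\<lambda>m y. restrict y {..<m} :: nat => real"
 have cm[measurable]: "?c m' \<in> borel \<rightarrow>\<^sub>M leb {..<m'}" for m'
  by (intro measurable_restrict) (simp add: borel_measurable_continuous_onI continuous_intros)
 have via: "distr mu (leb {..<m}) (?c m) = bdist m (e + real d / 2)"
  if "distr mu (leb {..<m + d}) (?c (m + d)) = bdist (m + d) e" "e > -1" for d e
 proof -
  have rm: "?r m \<in> leb {..<m + d} \<rightarrow>\<^sub>M leb {..<m}" by (rule measurable_restrict_subset) auto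
  have "distr mu (leb {..<m}) (?c m) = distr mu (leb {..<m}) (?r m \<circ> ?c (m + d))"
   by (rule distr_cong) (auto simp: fun_eq_iff)
  also have "\<dots> = distr (distr mu (leb {..<m + d}) (?c (m + d))) (leb {..<m}) (?r m)"
   by (rule distr_distr[symmetric, OF rm]) (simp add: measurable_cong_sets[OF sets_mu refl] cm)
  also have "\<dots> = bdist m (e + real d / 2)" unfolding that(1) by (rule bdist_marginals[OF that(2)])
  finally show ?thesis .
 qed
 show ?thesis
 proof (cases "b > -1")
  case True
  obtain d where d: "Suc p = m + d" using m le_Suc_ex[of m "Suc p"] by auto
  have "distr mu (leb {..<m + d}) (?c (m + d)) = bdist (m + d) b"
   using beta_distr_coords[OF g True] unfolding mu_def coords_def[abs_def] D d .
  from via[OF this True] have "distr mu (leb {..<m}) (?c m) = bdist m (b + real d / 2)" .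
  moreover have "b + real d / 2 = (\<alpha> - real m) / 2"
  proof -
   have "real (Suc p) = real m + real d" using d by (metis of_nat_add)
   then show ?thesis unfolding b by (simp add: field_simps)
  qed
  ultimately show ?thesis by simp
 next
  case False
  then have b1: "b = -1" using al unfolding b n by (simp add: field_simps)
  then have ap: "\<alpha> = real p - 1" unfolding b by simp
  obtain d where d: "p = m + d" using m le_Suc_ex by auto
  have mu1: "mu = beta_distr (-1)" by (subst mu_def) (simp only: b1)
  have "distr mu (leb {..<m + d}) (?c (m + d)) = bdist (m + d) (-1 / 2)"
   using sphere_coords[OF g D p] unfolding mu1 d .
  from via[OF this] have "distr mu (leb {..<m}) (?c m) = bdist m (-1 / 2 + real d / 2)" by simp
  moreover have "-1 / 2 + real d / 2 = (\<alpha> - real m) / 2"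
   unfolding ap d by (simp add: field_simps)
  ultimately show ?thesis by (simp only:)
 qed
qed

text \<open>The mass is read off from a marginal, which treats ball and sphere alike.\<close>

lemma prob_mu: "prob_space mu"
proof -
 have m: "(\<lambda>x. \<lambda>j\<in>{..<p}. x $ g j) \<in> mu \<rightarrow>\<^sub>M leb {..<p}"
  by (intro measurable_restrict) (simp add: measurable_cong_sets[OF sets_mu refl] borel_measurable_continuous_onI continuous_intros)
 have "prob_space (bdist p ((\<alpha> - real p) / 2))"
  using al by (intro prob_space_bdist) (simp add: n field_simps)
 then have "emeasure (distr mu (leb {..<p}) (\<lambda>x. \<lambda>j\<in>{..<p}. x $ g j)) (space (leb {..<p})) = 1"
  unfolding mu_law[OF order_refl] using prob_space.emeasure_space_1 by fastforce
 also have "emeasure (distr mu (leb {..<p}) (\<lambda>x. \<lambda>j\<in>{..<p}. x $ g j)) (space (leb {..<p})) = emeasure mu (space mu)"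
  using measurable_space[OF m] by (subst emeasure_distr[OF m]) (auto intro!: arg_cong2[where f = emeasure])
 finally show ?thesis by (rule prob_spaceI)
qed

lemma mu_orthogonal: "orthogonal_transformation f ==> distr mu mu f = mu"
 unfolding mu_def using beta_distr_orthogonal[of f b] by (metis distr_cong sets_beta_distr)

lemma orthogonal_measurable: "orthogonal_transformation f ==> f \<in> mu \<rightarrow>\<^sub>M mu"
proof -
 assume "orthogonal_transformation f"
 then have "bounded_linear f" using orthogonal_transformation_linear linear_conv_bounded_linear by blast
 then have "f \<in> borel_measurable borel" by (intro borel_measurable_continuous_onI linear_continuous_on)
 then show ?thesis by (simp add: measurable_cong_sets[OF sets_mu sets_mu])
qed

text \<open>A rotation turns the normal into a coordinate axis, and a single coordinate has a
  density.\<close>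

lemma hyperplane_null:
 fixes a :: "real ^ 'd"
 assumes a: "a \<noteq> 0"
 shows "AE x in mu. a \<bullet> x \<noteq> c"
proof -
 let ?e = "norm a *\<^sub>R axis (g 0) 1 :: real ^ 'd"
 have "norm ?e = norm a" by (simp add: norm_axis_1)
 then obtain f where f: "orthogonal_transformation f" "f ?e = a"
  by (rule orthogonal_transformation_exists)
 note fm = orthogonal_measurable[OF f(1)]
 let ?c = "\<lambda>x :: real ^ 'd. \<lambda>j\<in>{..<1}. x $ g j"
 have cm: "?c \<in> mu \<rightarrow>\<^sub>M leb {..<1}"
  by (intro measurable_restrict) (simp add: measurable_cong_sets[OF sets_mu refl] borel_measurable_continuous_onI continuous_intros)
 have na: "0 < norm a" using a by simp
 have "AE y in leb {..<1}. hv 1 y 1 \<noteq> (\<Sum>j<1. (c / norm a) * hv 1 y j)" by (rule hv_generic_AE) simp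
 then have "AE y in leb {..<1}. 0 < ennreal (bdens 1 ((\<alpha> - real 1) / 2) y) \<longrightarrow> y 0 \<noteq> c / norm a"
  by eventually_elim (simp add: hv_def)
 then have "AE y in bdist 1 ((\<alpha> - real 1) / 2). y 0 \<noteq> c / norm a"
  unfolding bdist_def by (subst AE_density) auto
 then have "AE y in distr mu (leb {..<1}) ?c. y 0 \<noteq> c / norm a"
  unfolding mu_law[OF p] .
 from AE_distrD[OF cm this] have 0: "AE x in mu. x $ g 0 \<noteq> c / norm a" by simp
 have "AE x in mu. a \<bullet> f x \<noteq> c"
  using 0
 proof eventually_elim
  fix x assume x: "x $ g 0 \<noteq> c / norm a"
  have "a \<bullet> f x = f ?e \<bullet> f x" by (simp only: f(2))
  also have "\<dots> = ?e \<bullet> x" using f(1) by (simp add: orthogonal_transformation_def)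
  also have "\<dots> = norm a * x $ g 0" by (simp add: inner_axis')
  finally show "a \<bullet> f x \<noteq> c" using x na by (simp add: field_simps)
 qed
 then have "AE x in distr mu mu f. a \<bullet> x \<noteq> c"
  by (subst AE_distr_iff[OF fm]) auto
 then show ?thesis unfolding mu_orthogonal[OF f(1)] .
qed

sublocale beta_sample mu vv n k \<alpha>
proof (rule beta_sample.intro)
 show "prob_space mu" by (rule prob_mu)
 show vm: "(\<lambda>x. vv x j) \<in> borel_measurable mu" for j
 proof (cases j)
  case (Suc i)
  then show ?thesis by (cases "i < Suc p")
   (simp_all add: measurable_cong_sets[OF sets_mu refl] borel_measurable_continuous_onI continuous_intros)
 qed simp
 show "AE x in mu. vv x m \<noteq> (\<Sum>j<m. e j * vv x j)" if m: "m < n" for e m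
 proof (cases m)
  case 0
  then show ?thesis by simp
 next
  case (Suc i)
  then have i: "i < Suc p" using m n by simp
  \<comment> \<open>The normal vector that collects the linear terms; its component along
    \<open>axis (g i) 1\<close> is 1, so it is nonzero.\<close>
  define a :: "real ^ 'd" where "a = axis (g i) 1 - (\<Sum>j<i. e (Suc j) *\<^sub>R axis (g j) 1)"
  have ax: "a \<bullet> x = x $ g i - (\<Sum>j<i. e (Suc j) * x $ g j)" for x
   by (simp add: a_def inner_diff_left inner_sum_left inner_axis' )
  have "a \<bullet> axis (g i) 1 = 1"
  proof -
   have z: "(\<Sum>j<i. e (Suc j) * axis (g i) 1 $ g j) = 0"
   proof (intro sum.neutral ballI)
    fix j assume "j \<in> {..<i}"
    then have "g j \<noteq> g i" using g_inj[of j i] i by auto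
    then show "e (Suc j) * axis (g i) 1 $ g j = 0" by (simp add: axis_def)
   qed
   show ?thesis unfolding ax z by (simp add: axis_def)
  qed
  then have "a \<noteq> 0" by auto
  from hyperplane_null[OF this, of "e 0"] show ?thesis
  proof eventually_elim
   fix x assume "a \<bullet> x \<noteq> e 0"
   moreover have "(\<Sum>j<m. e j * vv x j) = e 0 + (\<Sum>j<i. e (Suc j) * x $ g j)"
    unfolding Suc sum.lessThan_Suc_shift using i by simp
   ultimately show "vv x m \<noteq> (\<Sum>j<m. e j * vv x j)" using i by (simp add: ax Suc)
  qed
 qed
 show "\<exists>f\<in>mu \<rightarrow>\<^sub>M mu. distr mu mu f = mu \<and> (\<forall>x j. vv (f x) j = (if j = c then - vv x j else vv x j))"
  if c: "0 < c" "c < n" for c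
 proof -
  obtain i where i: "c = Suc i" "i < Suc p" using c n by (cases c) auto
  define f :: "real ^ 'd => real ^ 'd" where "f x = (\<chi> q. if q = g i then - x $ q else x $ q)" for x
  have "orthogonal_transformation f"
   unfolding orthogonal_transformation_def
  proof (intro conjI allI)
   show "linear f" by (rule linearI) (simp_all add: f_def vec_eq_iff)
   show "f x \<bullet> f y = x \<bullet> y" for x y
    unfolding inner_vec_def by (intro sum.cong) (auto simp: f_def)
  qed
  moreover have "vv (f x) j = (if j = c then - vv x j else vv x j)" for x j
  proof (cases j)
   case (Suc j')
   then show ?thesis using g_inj[of j' i] i by (cases "j' < Suc p") (auto simp: f_def)
  qed (use i in simp)
  ultimately show ?thesis using mu_orthogonal orthogonal_measurable by blast
 qed
 show "distr mu (leb {..<m}) (\<lambda>x. \<lambda>j\<in>{..<m}. vv x (Suc j)) = bdist m ((\<alpha> - real m) / 2)" if "Suc m < n" for m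
 proof -
  have m: "m \<le> p" using that n by simp
  have "(\<lambda>x. \<lambda>j\<in>{..<m}. vv x (Suc j)) = (\<lambda>x. \<lambda>j\<in>{..<m}. x $ g j)"
   using m by (auto simp: fun_eq_iff)
  then show ?thesis using mu_law[OF m] by simp
 qed
qed (use kn al in auto)

text \<open>A direction has homogeneous coordinate 0, which encodes that the weights sum to
  0.\<close>

definition cone_row :: "real ^ 'd => nat => real" where
 "cone_row u j = (if j = 0 then 0 else vv u j)"

text \<open>The direction is stored as row \<open>n\<close>, so that target and matrix vary together
  in the measurability of feasibility.\<close>

definition cone_mat :: "(nat => real ^ 'd) => real ^ 'd => nat => nat => real" where
 "cone_mat X u i j = (if i = n then cone_row u j else rows n vv X i j)"

lemma face_cone_feas: "u \<in> face_cone k n X \<longleftrightarrow> feas {..<n} k n (rows n vv X) (cone_row u)"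
proof -
 have "(u = (\<Sum>i<n. l i *\<^sub>R X i) \<and> (\<Sum>i<n. l i) = 0) \<longleftrightarrow> (\<forall>j<n. (\<Sum>i<n. l i * rows n vv X i j) = cone_row u j)" for l
 proof -
  have r: "(\<Sum>i<n. l i * rows n vv X i j) = (\<Sum>i<n. l i * vv (X i) j)" for j
   by (intro sum.cong) (auto simp: rows_def)
  have sp: "(\<forall>j<n. P j) \<longleftrightarrow> P 0 \<and> (\<forall>j<Suc p. P (Suc j))" for P :: "nat => bool"
   unfolding n by (rule All_less_Suc2)
  have "(\<forall>j<n. (\<Sum>i<n. l i * rows n vv X i j) = cone_row u j) \<longleftrightarrow>
   (\<Sum>i<n. l i) = 0 \<and> (\<forall>j<Suc p. (\<Sum>i<n. l i * X i $ g j) = u $ g j)"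
   unfolding r sp by (simp add: cone_row_def)
  also have "(\<forall>j<Suc p. (\<Sum>i<n. l i * X i $ g j) = u $ g j) \<longleftrightarrow> u = (\<Sum>i<n. l i *\<^sub>R X i)"
  proof -
   have "u = (\<Sum>i<n. l i *\<^sub>R X i) \<longleftrightarrow> (\<forall>q. (\<Sum>i<n. l i * X i $ q) = u $ q)"
    unfolding vec_eq_iff by (auto simp: sum_component)
   then show ?thesis using g_surj by metis
  qed
  finally show ?thesis by blast
 qed
 then show ?thesis unfolding face_cone_def feas_def by blast
qed

lemma face_cone_measurable:
 "(\<lambda>(X, u). indicator (face_cone k n X) u :: ennreal) \<in> borel_measurable (Om \<Otimes>\<^sub>M borel)"
proof -
 have e: "feas {..<n} k n (rows n vv X) (cone_row u) \<longleftrightarrow> feas {..<n} k n (cone_mat X u) (cone_mat X u n)" for X u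
  by (rule feas_cong) (auto simp: cone_mat_def)
 have m: "(\<lambda>z. cone_mat (fst z) (snd z)) \<in> borel_measurable (Om \<Otimes>\<^sub>M borel)"
 proof (rule measurable_matrix)
  fix i j
  have 1: "(\<lambda>z. cone_row (snd z) j) \<in> borel_measurable (Om \<Otimes>\<^sub>M borel)"
  proof -
   have "(\<lambda>u. cone_row u j) \<in> borel_measurable borel"
    using v_meas[of j] by (simp add: cone_row_def measurable_cong_sets[OF sets_mu refl])
   then show ?thesis by (rule measurable_compose[OF measurable_snd])
  qed
  have 2: "(\<lambda>z. rows n vv (fst z) i j) \<in> borel_measurable (Om \<Otimes>\<^sub>M borel)"
   by (rule measurable_compose[OF measurable_compose[OF measurable_fst rows_meas] measurable_entry])
  show "(\<lambda>z. cone_mat (fst z) (snd z) i j) \<in> borel_measurable (Om \<Otimes>\<^sub>M borel)"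
   using 1 2 by (cases "i = n") (simp_all add: cone_mat_def)
 qed
 have "indicator {A. feas {..<n} k n A (A n)} \<in> borel_measurable (borel :: (nat => nat => real) measure)"
  using borel_feas_row[of "{..<n}" k n n] by (intro borel_measurable_indicator) (simp add: pred_def)
 from measurable_compose[OF m this]
 have "(\<lambda>z. indicator {A. feas {..<n} k n A (A n)} (cone_mat (fst z) (snd z)) :: ennreal) \<in> borel_measurable (Om \<Otimes>\<^sub>M borel)" .
 moreover have "indicator {A. feas {..<n} k n A (A n)} (cone_mat X u) = (indicator (face_cone k n X) u :: ennreal)" for X u
  by (simp add: indicator_def face_cone_feas e)
 ultimately show ?thesis by (simp add: case_prod_beta')
qed

lemma face_cone_scale:
 assumes c: "0 < (c::real)" and "u \<in> face_cone k n (X :: nat => real ^ 'd)"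
 shows "c *\<^sub>R u \<in> face_cone k n X"
proof -
 obtain l where l: "u = (\<Sum>i<n. l i *\<^sub>R X i)" "\<forall>i<n. k \<le> i \<longrightarrow> 0 \<le> l i" "(\<Sum>i<n. l i) = 0"
  using assms(2) unfolding face_cone_def by blast
 have "c *\<^sub>R u = (\<Sum>i<n. (c * l i) *\<^sub>R X i)" by (simp add: l(1) scaleR_sum_right)
 moreover have "(\<Sum>i<n. c * l i) = 0" using l(3) by (simp add: sum_distrib_left[symmetric])
 ultimately show ?thesis unfolding face_cone_def using l(2) c by (intro CollectI exI[of _ "\<lambda>i. c * l i"]) auto
qed

lemma face_cone_linear:
 assumes f: "linear f" and "u \<in> face_cone k n (X :: nat => real ^ 'd)"
 shows "f u \<in> face_cone k n (\<lambda>i. f (X i))"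
 using assms(2) unfolding face_cone_def
 by (auto simp: linear_sum[OF f] linear_scale[OF f])

text \<open>Rotation invariance removes the dependence on the direction, and a cone ignores its
  length. For the last axis the target is \<open>last_unit n\<close>.\<close>

lemma prob_cone:
 assumes u: "u \<noteq> 0"
 shows "(\<integral>\<^sup>+ X. indicator (face_cone k n X) u \<partial>Om) = ennreal (qq n n)"
proof -
 let ?e = "axis (g p) 1 :: real ^ 'd"
 obtain h where h: "orthogonal_transformation h" "h u = norm u *\<^sub>R ?e"
  by (rule orthogonal_transformation_exists[of u "norm u *\<^sub>R ?e"]) (simp add: norm_axis_1)
 have lin: "linear h" "inj h" "surj h" using h(1)
  by (simp_all add: orthogonal_transformation_linear orthogonal_transformation_inj orthogonal_transformation_surj)
 obtain h' where h': "linear h'" "h' \<circ> h = id"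
  using linear_injective_left_inverse[OF lin(1,2)] by blast
 have hh: "h' (h x) = x" for x using h'(2) by (simp add: fun_eq_iff)
 have nu: "0 < norm u" using u by simp
 let ?T = "\<lambda>X. \<lambda>i\<in>{..<n}. h (X i)"
 note hm = orthogonal_measurable[OF h(1)]
 have Tm: "?T \<in> Om \<rightarrow>\<^sub>M Om"
 proof (rule measurable_restrict)
  fix i assume "i \<in> {..<n}"
  then have "(\<lambda>X. X i) \<in> Om \<rightarrow>\<^sub>M mu" by (rule measurable_component_singleton)
  then show "(\<lambda>X. h (X i)) \<in> Om \<rightarrow>\<^sub>M mu" by (rule measurable_compose[OF _ hm])
 qed
 have Td: "distr Om Om ?T = Om"
  unfolding distr_PiM_map[OF finite_lessThan prob_mu hm] mu_orthogonal[OF h(1)] ..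
 have restr: "face_cone k n (\<lambda>i\<in>{..<n}. Y i) = face_cone k n Y" for Y :: "nat => real ^ 'd"
 proof -
  have "(\<Sum>i<n. l i *\<^sub>R (\<lambda>i\<in>{..<n}. Y i) i) = (\<Sum>i<n. l i *\<^sub>R Y i)" for l by (intro sum.cong) auto
  then show ?thesis unfolding face_cone_def by simp
 qed
 have iff: "u \<in> face_cone k n X \<longleftrightarrow> ?e \<in> face_cone k n (?T X)" for X
 proof
  assume "u \<in> face_cone k n X"
  then have "h u \<in> face_cone k n (\<lambda>i. h (X i))" by (rule face_cone_linear[OF lin(1)])
  then have "(1 / norm u) *\<^sub>R h u \<in> face_cone k n (\<lambda>i. h (X i))" using nu by (intro face_cone_scale) auto
  then show "?e \<in> face_cone k n (?T X)" using nu by (simp add: restr h(2))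
 next
  assume "?e \<in> face_cone k n (?T X)"
  then have "norm u *\<^sub>R ?e \<in> face_cone k n (\<lambda>i. h (X i))" using nu face_cone_scale by (simp only: restr)
  then have "h' (h u) \<in> face_cone k n (\<lambda>i. h' (h (X i)))" unfolding h(2)[symmetric] by (rule face_cone_linear[OF h'(1)])
  then show "u \<in> face_cone k n X" by (simp add: hh)
 qed
 have row: "feas {..<n} k n A (cone_row ?e) \<longleftrightarrow> feas {..<n} k n A (last_unit n)" for A
 proof (rule feas_cong)
  fix j assume j: "j < n"
  show "cone_row ?e j = last_unit n j"
  proof (cases j)
   case (Suc i)
   then have "i < Suc p" using j n by simp
   then show ?thesis using Suc g_inj[of i p] by (auto simp: cone_row_def last_unit_def n axis_def)
  qed (simp add: cone_row_def last_unit_def n)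
 qed simp
 let ?P = "\<lambda>A. feas {..<n} k n A (last_unit n)"
 let ?S = "{X \<in> space Om. ?P (rows n vv X)}"
 have Sm: "?S \<in> sets Om" by (rule pr_sets) (intro borel_feas finite_lessThan)
 have "(\<integral>\<^sup>+ X. indicator (face_cone k n X) u \<partial>Om) = (\<integral>\<^sup>+ X. indicator ?S (?T X) \<partial>Om)"
 proof (rule nn_integral_cong)
  fix X assume "X \<in> space Om"
  then have "?T X \<in> space Om" by (rule measurable_space[OF Tm])
  then show "indicator (face_cone k n X) u = (indicator ?S (?T X) :: ennreal)"
   using iff[of X] face_cone_feas[of ?e "?T X"] row by (simp add: indicator_def)
 qed
 also have "\<dots> = (\<integral>\<^sup>+ X. indicator ?S X \<partial>distr Om Om ?T)"
  by (rule nn_integral_distr[symmetric, OF Tm]) (use Sm in simp)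
 also have "\<dots> = emeasure Om ?S" unfolding Td by (rule nn_integral_indicator[OF Sm])
 also have "\<dots> = ennreal (qq n n)" by (simp add: qq_def pr_def Om.emeasure_eq_measure)
 finally show ?thesis .
qed

text \<open>Fubini for the volume of the cone in the unit ball: every nonzero direction is covered
  with the same probability, which is therefore the mean of the volume ratio.\<close>

lemma expected_angle:
 "(\<integral>X. internal_angle (convex hull (X ` {..<k})) (convex hull (X ` {..<n})) \<partial>Om) = qq n n"
proof -
 let ?B = "ball 0 1 :: (real ^ 'd) set"
 let ?V = "measure lebesgue ?B"
 have V: "0 < ?V" using content_ball_pos[of 1 "0 :: real ^ 'd"] by simp
 have Vf: "emeasure lborel ?B < \<infinity>" by (rule emeasure_lborel_ball_finite)
 have VV: "emeasure lborel ?B = ennreal ?V"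
  using Vf by (simp add: emeasure_eq_ennreal_measure)
 have meas: "(\<lambda>(X, u). indicator (face_cone k n X) u * indicator ?B u :: ennreal) \<in> borel_measurable (Om \<Otimes>\<^sub>M lborel)"
 proof -
  have s: "sets (Om \<Otimes>\<^sub>M (lborel :: (real ^ 'd) measure)) = sets (Om \<Otimes>\<^sub>M borel)" by (intro sets_pair_measure_cong) auto
  have "(\<lambda>z. indicator ?B (snd z) :: ennreal) \<in> borel_measurable (Om \<Otimes>\<^sub>M borel)"
   by (rule measurable_compose[OF measurable_snd borel_measurable_indicator]) simp
  then have "(\<lambda>z. (case z of (X, u) => indicator (face_cone k n X) u) * indicator ?B (snd z) :: ennreal) \<in> borel_measurable (Om \<Otimes>\<^sub>M borel)"
   by (intro borel_measurable_times_ennreal face_cone_measurable)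
  then show ?thesis unfolding measurable_cong_sets[OF s refl] by (simp add: case_prod_beta')
 qed
 define N where "N X = (\<integral>\<^sup>+ u. indicator (face_cone k n X) u * indicator ?B u \<partial>lborel)" for X
 have Nm: "N \<in> borel_measurable Om"
  unfolding N_def[abs_def] by (rule lborel.borel_measurable_nn_integral[OF meas])
 have cone_sets: "face_cone k n X \<in> sets borel" if X: "X \<in> space Om" for X
 proof -
  have "(\<lambda>u. indicator (face_cone k n X) u :: ennreal) \<in> borel_measurable borel"
   using measurable_compose[OF measurable_Pair1'[OF X] face_cone_measurable] by simp
  then show ?thesis by (simp add: borel_measurable_indicator_iff)
 qed
 have NX: "N X = ennreal (measure lebesgue (?B \<inter> face_cone k n X))" if X: "X \<in> space Om" for X
 proof -
  have BC: "?B \<inter> face_cone k n X \<in> sets borel" using cone_sets[OF X] by auto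
  have "N X = (\<integral>\<^sup>+ u. indicator (?B \<inter> face_cone k n X) u \<partial>lborel)"
   unfolding N_def by (intro nn_integral_cong) (auto simp: indicator_def)
  also have "\<dots> = emeasure lborel (?B \<inter> face_cone k n X)" using BC by simp
  also have "\<dots> = ennreal (measure lborel (?B \<inter> face_cone k n X))"
  proof (rule emeasure_eq_ennreal_measure)
   have "emeasure lborel (?B \<inter> face_cone k n X) \<le> emeasure lborel ?B" by (rule emeasure_mono) auto
   then show "emeasure lborel (?B \<inter> face_cone k n X) \<noteq> \<top>" using Vf by (auto simp: top_unique)
  qed
  finally show ?thesis using BC by simp
 qed
 interpret pO: pair_sigma_finite Om "lborel :: (real ^ 'd) measure"
  by (intro pair_sigma_finite.intro lborel.sigma_finite_measure_axioms prob_space_imp_sigma_finite Om.prob_space_axioms)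
 have "(\<integral>\<^sup>+ X. N X \<partial>Om) = (\<integral>\<^sup>+ u. (\<integral>\<^sup>+ X. indicator (face_cone k n X) u * indicator ?B u \<partial>Om) \<partial>lborel)"
  unfolding N_def by (rule pO.Fubini'[symmetric, OF meas])
 also have "\<dots> = (\<integral>\<^sup>+ u. ennreal (qq n n) * indicator ?B u \<partial>lborel)"
 proof (rule nn_integral_cong_AE)
  have "AE u in lborel. u \<noteq> (0 :: real ^ 'd)" by (rule AE_lborel_singleton)
  then show "AE u in lborel. (\<integral>\<^sup>+ X. indicator (face_cone k n X) u * indicator ?B u \<partial>Om) = ennreal (qq n n) * indicator ?B (u :: real ^ 'd)"
  proof eventually_elim
   fix u :: "real ^ 'd" assume u: "u \<noteq> 0"
   show "(\<integral>\<^sup>+ X. indicator (face_cone k n X) u * indicator ?B u \<partial>Om) = ennreal (qq n n) * indicator ?B u"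
    by (cases "u \<in> ?B") (simp_all add: prob_cone[OF u])
  qed
 qed
 also have "\<dots> = ennreal (qq n n) * ennreal ?V"
 proof -
  have "(\<integral>\<^sup>+ u. ennreal (qq n n) * indicator ?B u \<partial>lborel) = ennreal (qq n n) * (\<integral>\<^sup>+ u. indicator ?B u \<partial>lborel)"
   by (rule nn_integral_cmult, rule borel_measurable_indicator) simp
  also have "(\<integral>\<^sup>+ u. indicator ?B u \<partial>lborel) = emeasure lborel ?B" by (rule nn_integral_indicator) simp
  finally show ?thesis unfolding VV .
 qed
 finally have I: "(\<integral>\<^sup>+ X. N X \<partial>Om) = ennreal (qq n n) * ennreal ?V" .
 have q0: "0 \<le> qq n n" by (simp add: qq_def pr_def)
 have "(\<integral>X. internal_angle (convex hull (X ` {..<k})) (convex hull (X ` {..<n})) \<partial>Om) =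
  (\<integral>X. enn2real (N X) / ?V \<partial>Om)"
  by (intro Bochner_Integration.integral_cong refl) (simp add: internal_angle_cone[OF kn] NX)
 also have "\<dots> = (\<integral>X. enn2real (N X) \<partial>Om) / ?V" by simp
 also have "(\<integral>X. enn2real (N X) \<partial>Om) = enn2real (\<integral>\<^sup>+ X. ennreal (enn2real (N X)) \<partial>Om)"
  using Nm by (intro integral_eq_nn_integral) auto
 also have "(\<integral>\<^sup>+ X. ennreal (enn2real (N X)) \<partial>Om) = (\<integral>\<^sup>+ X. N X \<partial>Om)"
  by (intro nn_integral_cong) (simp add: NX)
 also have "enn2real (\<integral>\<^sup>+ X. N X \<partial>Om) = qq n n * ?V"
  unfolding I using q0 V by (simp add: ennreal_mult[symmetric])
 finally show ?thesis using V by simp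
qed

end

theorem theorem1p1:
  fixes n k :: nat and \<alpha> :: real
  assumes "n \<ge> 3" and "CARD('d::finite) = n - 1"
    and "1 \<le> k" and "k \<le> n"
    and "\<alpha> \<ge> real n - 3"
  shows "complex_of_real (bold_J TYPE('d) n k ((\<alpha> - real n + 1) / 2)) =
    of_nat (n choose k) *
    (LBINT x = ereal (- (pi / 2)) .. ereal (pi / 2).
       complex_of_real (beta_const 1 (\<alpha> * real n / 2) * (cos x) powr (\<alpha> * real n + 1)) *
       (1 / 2 + \<i> * complex_of_real
          (LBINT y = ereal 0 .. ereal x. beta_const 1 ((\<alpha> - 1) / 2) * (cos y) powr (- \<alpha> - 1)))
       ^ (n - k))"
proof -
 define p where "p = n - 2"
 have np: "1 \<le> p" "n = Suc (Suc p)" using assms(1) by (auto simp: p_def)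
 obtain g :: "nat => 'd" where g: "bij_betw g {..<CARD('d)} UNIV"
  using ex_bij_betw_nat_finite[of "UNIV :: 'd set"] by (auto simp: atLeast0LessThan)
 interpret beta_simplex g n k p \<alpha> "(\<alpha> - real (Suc p)) / 2"
  by unfold_locales (use g np assms in auto)
 interpret K: kernel \<alpha> by unfold_locales (use assms in simp)
 have b: "(\<alpha> - real n + 1) / 2 = (\<alpha> - real (Suc p)) / 2" using np(2) by simp
 have al: "0 \<le> \<alpha>" using assms by simp
 have "cr (bold_J TYPE('d) n k ((\<alpha> - real n + 1) / 2)) = of_nat (n choose k) * cr (qq n n)"
  unfolding bold_J_def b mu_def[symmetric] expected_angle by simp
 also have "cr (qq n n) = cr (beta_const 1 (\<alpha> * real n / 2)) *
  (LBINT x:hpi. cr (cos x powr (\<alpha> * real n + 1)) * K.gg x ^ (n - k))"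
  by (rule qq_formula[OF al]) (use assms in auto)
 also have "\<dots> = (LBINT x:hpi. cr (beta_const 1 (\<alpha> * real n / 2) * cos x powr (\<alpha> * real n + 1)) * K.gg x ^ (n - k))"
  by (simp add: mult.assoc)
 also have "\<dots> = (LBINT x = ereal (- (pi / 2)) .. ereal (pi / 2).
    cr (beta_const 1 (\<alpha> * real n / 2) * (cos x) powr (\<alpha> * real n + 1)) * K.gg x ^ (n - k))"
  by (simp add: interval_lebesgue_integral_le_eq)
 finally show ?thesis unfolding K.gg_def K.gi_def K.cc_def .
qed

end
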